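(* Let $K_0$ be a $p$-adic field and let $f(x)=(f_1(x),\dots,f_r(x))$ be a tuple of polynomials in $m$ variables $x=(x_1,\dots,x_m)$ with coefficients in $\mathcal{O}_{K_0}$. For every finite field extension $K$ of $K_0$, write $-\lambda_K(f)$ (resp. $-\tilde{\lambda}_K(f)$) for the largest real part over all poles in $s$ of $P_{f,K}(q_K^{-s})$ (resp. $\tilde{P}_{f,K}(q_K^{-s})$), with the convention $\lambda_K(f)=+\infty$ (resp. $\tilde{\lambda}_K(f)=+\infty$) if there are no poles. Then for any such $K$ and any finite field extension $L\geq K$, \[ \lambda_L(f)\leq \lambda_K(f) \quad\text{and}\quad \tilde{\lambda}_L(f)\leq \tilde{\lambda}_K(f). \]
   Context: For a non-Archimedean local field $K$ of characteristic zero (here a finite extension of $\mathbb{Q}_p$), $\mathcal{O}_K$ denotes its valuation ring, $\pi\in K$ a uniformizer, and $q_K$ the cardinality of its residue field. For $f=(f_1,\dots,f_r)$ with coefficients in $\mathcal{O}_K$ and $n\in\mathbb{N}$ define $\tilde{N}_{n,K}(f)=\#\{\xi\in(\mathcal{O}_K/(\pi^n))^m \mid f(\xi)=0\}$ and $N_{n,K}(f)=\#\{\xi\in(\mathcal{O}_K/(\pi^n))^m \mid \exists y\in\mathcal{O}_K^m\,(f(y)=0 \wedge \xi = y+(\pi^n)^m)\}$. The Poincaré series is $\tilde{P}_{f,K}(T)=\sum_{n\ge 0}\tilde{N}_{n,K}(f)\,q_K^{-nm}T^n$ and the Serre-Poincaré series is $P_{f,K}(T)=\sum_{n\ge 0}N_{n,K}(f)\,q_K^{-n(m+1)}T^n$.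 Both are rational in $T$, so $P_{f,K}(q_K^{-s})$ and $\tilde{P}_{f,K}(q_K^{-s})$ are meromorphic in $s$. *)

theory Defs
  imports "HOL-Library.Poly_Mapping" "HOL-Computational_Algebra.Computational_Algebra"
    "HOL-Complex_Analysis.Complex_Analysis"
begin

text \<open>A field K (of characteristic zero) equipped with a normalized discrete valuation
  v (only its values on nonzero elements matter).\<close>

definition val_ball :: "('k::field \<Rightarrow> int) \<Rightarrow> int \<Rightarrow> 'k set" where
  "val_ball v N = {x. x = 0 \<or> N \<le> v x}"

text \<open>valuation ring O_K; and pi^n O_K is val_ball v n\<close>
definition val_ring :: "('k::field \<Rightarrow> int) \<Rightarrow> 'k set" where
  "val_ring v = val_ball v 0"

definition residue_rel :: "('k::field \<Rightarrow> int) \<Rightarrow> ('k \<times> 'k) set" where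
  "residue_rel v = {(x, y). x \<in> val_ring v \<and> y \<in> val_ring v \<and> x - y \<in> val_ball v 1}"

definition residue_card :: "('k::field \<Rightarrow> int) \<Rightarrow> nat" where
  "residue_card v = card (val_ring v // residue_rel v)"

text \<open>Non-Archimedean local field of characteristic zero (= finite extension of Q_p):
  a char-0 field, complete w.r.t. a normalized discrete valuation with finite residue field.\<close>
definition local_field_char0 :: "('k::field_char_0 \<Rightarrow> int) \<Rightarrow> bool" where
  "local_field_char0 v \<longleftrightarrow>
     (\<forall>x y. x \<noteq> 0 \<longrightarrow> y \<noteq> 0 \<longrightarrow> v (x * y) = v x + v y) \<and>
     (\<forall>x y. x \<noteq> 0 \<longrightarrow> y \<noteq> 0 \<longrightarrow> x + y \<noteq> 0 \<longrightarrow> min (v x) (v y) \<le> v (x + y)) \<and>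
     (\<forall>k. \<exists>x. x \<noteq> 0 \<and> v x = k) \<and>
     (\<forall>X :: nat \<Rightarrow> 'k. (\<forall>N. \<exists>M. \<forall>i\<ge>M. \<forall>j\<ge>M. X i - X j \<in> val_ball v N) \<longrightarrow>
        (\<exists>l. \<forall>N. \<exists>M. \<forall>i\<ge>M. X i - l \<in> val_ball v N)) \<and>
     finite (val_ring v // residue_rel v)"

definition finite_ext :: "('k::field_char_0 \<Rightarrow> int) \<Rightarrow> ('l::field_char_0 \<Rightarrow> int) \<Rightarrow> ('k \<Rightarrow> 'l) \<Rightarrow> bool" where
  "finite_ext vK vL \<iota> \<longleftrightarrow>
     (\<forall>x y. \<iota> (x + y) = \<iota> x + \<iota> y) \<and> (\<forall>x y. \<iota> (x * y) = \<iota> x * \<iota> y) \<and> \<iota> 1 = 1 \<and>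
     (\<exists>B. finite B \<and> (\<forall>y. \<exists>c. y = (\<Sum>b\<in>B. \<iota> (c b) * b))) \<and>
     (\<exists>e::int. e > 0 \<and> (\<forall>x. x \<noteq> 0 \<longrightarrow> vL (\<iota> x) = e * vK x))"

type_synonym 'a mpoly = "(nat \<Rightarrow>\<^sub>0 nat) \<Rightarrow>\<^sub>0 'a"

definition mpeval :: "'a::comm_semiring_1 mpoly \<Rightarrow> (nat \<Rightarrow> 'a) \<Rightarrow> 'a" where
  "mpeval p x = (\<Sum>\<alpha>\<in>Poly_Mapping.keys p. Poly_Mapping.lookup p \<alpha> * (\<Prod>i\<in>Poly_Mapping.keys \<alpha>. x i ^ Poly_Mapping.lookup \<alpha> i))"

definition integral_poly :: "('k::field \<Rightarrow> int) \<Rightarrow> nat \<Rightarrow> 'k mpoly \<Rightarrow> bool" where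
  "integral_poly v m p \<longleftrightarrow> (\<forall>\<alpha>\<in>Poly_Mapping.keys p. Poly_Mapping.keys \<alpha> \<subseteq> {..<m}) \<and> (\<forall>\<alpha>. Poly_Mapping.lookup p \<alpha> \<in> val_ring v)"

definition base_change :: "('k \<Rightarrow> 'l) \<Rightarrow> 'k::zero mpoly \<Rightarrow> 'l::zero mpoly" where
  "base_change \<iota> p = Poly_Mapping.map \<iota> p"

definition cong_rel :: "('k::field \<Rightarrow> int) \<Rightarrow> nat \<Rightarrow> nat \<Rightarrow> ((nat \<Rightarrow> 'k) \<times> (nat \<Rightarrow> 'k)) set" where
  "cong_rel v m n = {(x, y). \<forall>i<m. x i - y i \<in> val_ball v (int n)}"

definition int_points :: "('k::field \<Rightarrow> int) \<Rightarrow> nat \<Rightarrow> (nat \<Rightarrow> 'k) set" where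
  "int_points v m = PiE {..<m} (\<lambda>_. val_ring v)"

text \<open>tilde N_n: solutions of f = 0 in (O/pi^n)^m\<close>
definition Ntilde :: "('k::field_char_0 \<Rightarrow> int) \<Rightarrow> nat \<Rightarrow> 'k mpoly list \<Rightarrow> nat \<Rightarrow> nat" where
  "Ntilde v m fs n = card ({x \<in> int_points v m. \<forall>f\<in>set fs. mpeval f x \<in> val_ball v (int n)}
                            // cong_rel v m n)"

text \<open>N_n: points of (O/pi^n)^m that lift to a solution in O^m\<close>
definition Nlift :: "('k::field_char_0 \<Rightarrow> int) \<Rightarrow> nat \<Rightarrow> 'k mpoly list \<Rightarrow> nat \<Rightarrow> nat" where
  "Nlift v m fs n = card ({x \<in> int_points v m. \<forall>f\<in>set fs. mpeval f x = 0} // cong_rel v m n)"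

definition poincare_tilde :: "('k::field_char_0 \<Rightarrow> int) \<Rightarrow> nat \<Rightarrow> 'k mpoly list \<Rightarrow> complex fps" where
  "poincare_tilde v m fs =
     Abs_fps (\<lambda>n. of_nat (Ntilde v m fs n) / of_nat (residue_card v) ^ (n * m))"

definition serre_poincare :: "('k::field_char_0 \<Rightarrow> int) \<Rightarrow> nat \<Rightarrow> 'k mpoly list \<Rightarrow> complex fps" where
  "serre_poincare v m fs =
     Abs_fps (\<lambda>n. of_nat (Nlift v m fs n) / of_nat (residue_card v) ^ (n * (m + 1)))"

text \<open>For a rational power series P(T) = a(T)/b(T) (b(0) \<noteq> 0), the meromorphic function
  s \<mapsto> P(q^{-s}).\<close>
definition rat_fps_at_qs :: "complex fps \<Rightarrow> nat \<Rightarrow> complex \<Rightarrow> complex" where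
  "rat_fps_at_qs P q =
     (let (a, b) = (SOME (a, b). poly b 0 \<noteq> 0 \<and> P = fps_of_poly a / fps_of_poly b)
      in (\<lambda>s. poly a (of_nat q powr (- s)) / poly b (of_nat q powr (- s))))"

definition pole_lambda :: "(complex \<Rightarrow> complex) \<Rightarrow> ereal" where
  "pole_lambda F = (if {s. is_pole F s} = {} then \<infinity>
                    else - (SUP s\<in>{s. is_pole F s}. ereal (Re s)))"

definition lambda_serre :: "('k::field_char_0 \<Rightarrow> int) \<Rightarrow> nat \<Rightarrow> 'k mpoly list \<Rightarrow> ereal" where
  "lambda_serre v m fs = pole_lambda (rat_fps_at_qs (serre_poincare v m fs) (residue_card v))"

definition lambda_tilde :: "('k::field_char_0 \<Rightarrow> int) \<Rightarrow> nat \<Rightarrow> 'k mpoly list \<Rightarrow> ereal" where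
  "lambda_tilde v m fs = pole_lambda (rat_fps_at_qs (poincare_tilde v m fs) (residue_card v))"

end

theory Submission imports Defs
begin

text \<open>
  Both counting functions are point counts of families of sets definable over K together with the
  ordered group of integers. Such sets admit a cell decomposition, obtained from Hensel's lemma by
  induction on the degree. The centres of the cells are taken from a maximal ring of definable
  functions, which by its maximality is closed under gluing and inversion.
  Summing the volumes of the cells expresses the normalized counts by Presburger-constructible
  functions, so the two series are rational.

  The same decomposition over L bounds the number of solutions modulo \<open>\<pi>\<close>-powers over L from
  below by the size of the polydisc around each point that is cut out by the distances to the
  centres. Sorting the solutions over K by these distances gives
  \<open>N\<^sub>n(K) \<le> C (e n + 1)^m N\<^sub>e\<^sub>n(L) powr H\<close> with \<open>q\<^sub>K powr (1/e) = q\<^sub>L powr H\<close>, where e is the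
  ramification index. Hence a disc of convergence for L yields the corresponding disc for K, and
  the largest real part of a pole is a logarithm of the radius of convergence.
\<close>

section \<open>Complete discretely valued fields\<close>

text \<open>The obstacle is cancellation. A field-valued function is accessible only through balls
  that contain its value, at a scale given by an integer variable. The sum of two such functions may
  cancel to unbounded depth, so definable functions are not visibly closed under addition. This is
  why a ring is taken from Zorn's lemma: a glued function, a quotient or a root lies in a maximal
  ring as soon as adjoining it still gives a ring of definable functions. Where a sum has to be
  evaluated directly, the position of the point relative to the centres bounds the depth of
  cancellation by a constant depending on the degree and the required precision. The cells over K
  and over L cannot be matched one by one, since ramification and residue degree change all of them.
  The comparison therefore uses only the decomposition over L and measures the embedded K-points
  against its centres. It is one-sided and loses a polynomial factor in n, which does not affect a
  radius of convergence.\<close>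

locale local_field =
  fixes v :: "'k::field_char_0 \<Rightarrow> int"
  assumes local_field: "local_field_char0 v"
begin

abbreviation B :: "int \<Rightarrow> 'k set" where "B \<equiv> val_ball v"

lemma v_mult: "x \<noteq> 0 \<Longrightarrow> y \<noteq> 0 \<Longrightarrow> v (x * y) = v x + v y"
  using local_field by (simp add: local_field_char0_def)

lemma v_add: "x \<noteq> 0 \<Longrightarrow> y \<noteq> 0 \<Longrightarrow> x + y \<noteq> 0 \<Longrightarrow> min (v x) (v y) \<le> v (x + y)"
  using local_field by (simp add: local_field_char0_def)

lemma v_surj: "\<exists>x. x \<noteq> 0 \<and> v x = k"
  using local_field by (simp add: local_field_char0_def)

lemma v_complete:
  fixes X :: "nat \<Rightarrow> 'k"
  assumes "\<And>N. \<exists>M. \<forall>i\<ge>M. \<forall>j\<ge>M. X i - X j \<in> B N"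
  obtains l where "\<And>N. \<exists>M. \<forall>i\<ge>M. X i - l \<in> B N"
proof -
  have h: "\<forall>X :: nat \<Rightarrow> 'k. (\<forall>N. \<exists>M. \<forall>i\<ge>M. \<forall>j\<ge>M. X i - X j \<in> B N) \<longrightarrow>
      (\<exists>l. \<forall>N. \<exists>M. \<forall>i\<ge>M. X i - l \<in> B N)"
    using local_field[unfolded local_field_char0_def] by (elim conjE) assumption
  have "\<exists>l. \<forall>N. \<exists>M. \<forall>i\<ge>M. X i - l \<in> B N"
    by (rule h[THEN spec, of X, THEN mp]) (rule allI, rule assms)
  then show ?thesis using that by metis
qed

lemma finite_residues: "finite (val_ring v // residue_rel v)"
  using local_field by (simp add: local_field_char0_def)

lemma v_one [simp]: "v 1 = 0"
  using v_mult[of 1 1] by simp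

lemma v_minus [simp]: "v (- x) = v x"
proof (cases "x = 0")
  case False
  have "v (-1) + v (-1) = v 1"
    using v_mult[of "-1" "-1"] by simp
  then have "v (-1) = 0" by simp
  then show ?thesis using v_mult[of "-1" x] False by simp
qed simp

lemma v_power: "x \<noteq> 0 \<Longrightarrow> v (x ^ n) = int n * v x"
  by (induction n) (auto simp: v_mult algebra_simps)

lemma v_inverse: "x \<noteq> 0 \<Longrightarrow> v (inverse x) = - v x"
  using v_mult[of x "inverse x"] by simp

lemma v_divide: "x \<noteq> 0 \<Longrightarrow> y \<noteq> 0 \<Longrightarrow> v (x / y) = v x - v y"
  using v_mult[of x "inverse y"] v_inverse by (simp add: divide_inverse)

lemma v_power_int: "x \<noteq> 0 \<Longrightarrow> v (x powi n) = n * v x"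
  by (auto simp: power_int_def v_power v_inverse)

lemma B_iff: "x \<noteq> 0 \<Longrightarrow> x \<in> B z \<longleftrightarrow> z \<le> v x"
  by (simp add: val_ball_def)

lemma B_zero [simp, intro]: "0 \<in> B z"
  by (simp add: val_ball_def)

lemma B_minus_iff [simp]: "- x \<in> B z \<longleftrightarrow> x \<in> B z"
  by (simp add: val_ball_def)

lemma B_minus_commute: "x - y \<in> B z \<longleftrightarrow> y - x \<in> B z"
  using B_minus_iff[of "x - y"] by simp

lemma B_add: "x \<in> B z \<Longrightarrow> y \<in> B z \<Longrightarrow> x + y \<in> B z"
  using v_add[of x y] by (cases "x = 0"; cases "y = 0"; cases "x + y = 0") (auto simp: val_ball_def)

lemma B_diff: "x \<in> B z \<Longrightarrow> y \<in> B z \<Longrightarrow> x - y \<in> B z"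
  using B_add[of x z "- y"] by simp

lemma B_mono: "x \<in> B z \<Longrightarrow> y \<le> z \<Longrightarrow> x \<in> B y"
  unfolding val_ball_def by auto

lemma B_mult: "x \<in> B a \<Longrightarrow> y \<in> B b \<Longrightarrow> x * y \<in> B (a + b)"
  using v_mult[of x y] by (cases "x = 0"; cases "y = 0") (auto simp: val_ball_def)

lemma B_mult': "x \<in> B a \<Longrightarrow> y \<in> B b \<Longrightarrow> c \<le> a + b \<Longrightarrow> x * y \<in> B c"
  using B_mult B_mono by blast

lemma B_sum: "(\<And>i. i \<in> A \<Longrightarrow> f i \<in> B z) \<Longrightarrow> sum f A \<in> B z"
  by (induction A rule: infinite_finite_induct) (auto intro: B_add)

lemma B_one [simp]: "1 \<in> B 0"
  by (simp add: val_ball_def)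

lemma B_of_nat [simp]: "of_nat n \<in> B 0"
  by (induction n) (auto intro: B_add)

lemma B_power: "x \<in> B z \<Longrightarrow> x ^ n \<in> B (int n * z)"
proof (induction n)
  case (Suc n)
  then show ?case using B_mult[of x z "x ^ n" "int n * z"] by (simp add: algebra_simps)
qed simp

lemma B_eq_iff: "x - y \<in> B z \<Longrightarrow> x \<in> B z \<longleftrightarrow> y \<in> B z"
  using B_diff[of x z "x - y"] B_add[of "x - y" z y] by auto

lemma B_trans: "x - y \<in> B z \<Longrightarrow> y - w \<in> B z \<Longrightarrow> x - w \<in> B z"
  using B_add[of "x - y" z "y - w"] by simp

lemma B_all_zero: "(\<And>z. x \<in> B z) \<Longrightarrow> x = 0"
  using B_iff[of x "v x + 1"] by (cases "x = 0") auto

lemma B_ex: "\<exists>N::nat. x \<in> B (- int N)"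
proof (cases "x = 0")
  case False
  then show ?thesis by (intro exI[of _ "nat (- v x)"]) (auto simp: B_iff)
qed auto

lemma v_eqI: "x \<in> B r \<Longrightarrow> x \<notin> B (r + 1) \<Longrightarrow> x \<noteq> 0 \<and> v x = r"
  by (auto simp: val_ball_def)

lemma v_close: "x \<noteq> 0 \<Longrightarrow> x - y \<in> B (v x + 1) \<Longrightarrow> y \<noteq> 0 \<and> v y = v x"
proof -
  assume x: "x \<noteq> 0" "x - y \<in> B (v x + 1)"
  then have "x - y \<in> B (v x)" by (auto elim: B_mono)
  then have "y \<in> B (v x)" using B_eq_iff[of x y "v x"] x by (simp add: B_iff)
  moreover have "y \<notin> B (v x + 1)" using B_eq_iff[OF x(2)] x by (simp add: B_iff)
  ultimately show ?thesis by (rule v_eqI)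
qed

definition unif :: 'k where "unif = (SOME p. p \<noteq> 0 \<and> v p = 1)"

lemma unif: "unif \<noteq> 0" "v unif = 1"
  using someI_ex[OF v_surj[of 1]] by (auto simp: unif_def)

definition pw :: "int \<Rightarrow> 'k" where "pw z = unif powi z"

lemma pw_nz [simp]: "pw z \<noteq> 0"
  by (simp add: pw_def unif)

lemma v_pw [simp]: "v (pw z) = z"
  by (simp add: pw_def v_power_int unif)

lemma pw_0 [simp]: "pw 0 = 1"
  by (simp add: pw_def)

lemma pw_add: "pw (a + b) = pw a * pw b"
  by (simp add: pw_def power_int_add unif)

lemma pw_minus: "pw (- a) = inverse (pw a)"
  by (simp add: pw_def power_int_minus)

lemma pw_diff: "pw (a - b) = pw a / pw b"
  by (simp add: pw_def power_int_diff unif)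

lemma pw_power: "pw a ^ n = pw (int n * a)"
  by (induction n) (auto simp: pw_add algebra_simps)

lemma B_pw [simp]: "pw a \<in> B z \<longleftrightarrow> z \<le> a"
  by (simp add: B_iff)

lemma B_times_pw: "x * pw a \<in> B z \<longleftrightarrow> x \<in> B (z - a)"
  by (cases "x = 0") (auto simp: B_iff v_mult)

lemma B_mult_left: "y \<noteq> 0 \<Longrightarrow> x * y \<in> B z \<longleftrightarrow> x \<in> B (z - v y)"
  by (cases "x = 0") (auto simp: B_iff v_mult)

lemma B_divide: "y \<noteq> 0 \<Longrightarrow> x / y \<in> B z \<longleftrightarrow> x \<in> B (z + v y)"
  by (cases "x = 0") (auto simp: B_iff v_divide)

section \<open>Taylor expansion, and discs on which one Taylor coefficient dominates\<close>

definition T :: "'k \<Rightarrow> 'k poly \<Rightarrow> 'k poly" where "T c p = pcompose p [:c, 1:]"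

lemma poly_T: "poly (T c p) s = poly p (c + s)"
  by (simp add: T_def poly_pcompose)

lemma coeff_T_0: "coeff (T c p) 0 = poly p c"
  using poly_T[of c p 0] by (simp add: poly_0_coeff_0)

lemma degree_T [simp]: "degree (T c p) = degree p"
  by (simp add: T_def degree_pcompose)

lemma T_0 [simp]: "T c 0 = 0"
  by (simp add: T_def)

lemma T_T: "T c (T d p) = T (c + d) p"
proof -
  have "poly (T c (T d p)) = poly (T (c + d) p)"
    by (auto simp: poly_T algebra_simps)
  then show ?thesis by (simp add: poly_eq_poly_eq_iff)
qed

lemma pderiv_T: "pderiv (T c p) = T c (pderiv p)"
  by (simp add: T_def pderiv_pcompose pderiv_pCons)

lemma T_expand:
  assumes "degree p \<le> d"
  shows "T c p = (\<Sum>i\<le>d. smult (coeff p i) ([:c, 1:] ^ i))"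
proof -
  have "poly (T c p) x = poly (\<Sum>i\<le>d. smult (coeff p i) ([:c, 1:] ^ i)) x" for x
  proof -
    have "poly (T c p) x = poly (\<Sum>i\<le>d. monom (coeff p i) i) (c + x)"
      using poly_as_sum_of_monoms'[OF assms] by (simp add: poly_T)
    also have "\<dots> = poly (\<Sum>i\<le>d. smult (coeff p i) ([:c, 1:] ^ i)) x"
      by (simp add: poly_sum poly_monom poly_power add.commute)
    finally show ?thesis .
  qed
  then show ?thesis using poly_eq_poly_eq_iff by blast
qed

text \<open>The hypothesis bounds the Gauss norm of \<open>p\<close> on the disc \<open>B r\<close>.
  This norm does not depend on which point of the disc serves as centre, because binomial
  coefficients are integral.\<close>

lemma coeff_T_bound:
  assumes p: "\<And>i. coeff p i \<in> B (w - int i * r)" and u: "u \<in> B r"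
  shows "coeff (T u p) k \<in> B (w - int k * r)"
proof -
  have "coeff (T u p) k = (\<Sum>i\<le>degree p. coeff p i * coeff ([:u, 1:] ^ i) k)"
    by (simp add: T_expand[OF order_refl] coeff_sum)
  also have "\<dots> \<in> B (w - int k * r)"
  proof (rule B_sum)
    fix i
    show "coeff p i * coeff ([:u, 1:] ^ i) k \<in> B (w - int k * r)"
    proof (cases "k \<le> i")
      case True
      have "coeff ([:u, 1:] ^ i) k = of_nat (i choose k) * u ^ (i - k)"
        using True by (simp add: coeff_linear_poly_power)
      also have "\<dots> \<in> B (0 + int (i - k) * r)"
        using u by (intro B_mult B_of_nat B_power)
      finally show ?thesis
        using p[of i] True by (elim B_mult') (auto simp: algebra_simps of_nat_diff)
    next
      case False
      then have "coeff ([:u, 1:] ^ i) k = 0"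
        by (intro coeff_eq_0) (simp add: degree_linear_power)
      then show ?thesis by simp
    qed
  qed
  finally show ?thesis .
qed

lemma poly_T_B:
  assumes "\<And>k. coeff p k \<in> B (w - int k * r)" "u \<in> B r"
  shows "poly p u \<in> B w"
  using coeff_T_bound[of p w r u 0] assms by (simp add: coeff_T_0)

text \<open>On the disc \<open>t + B \<rho>\<close> the linear Taylor term outweighs every higher
  one by N powers of the uniformizer. \<open>stab\<close> is the same dominance for the constant
  term; for positive N the valuation of the value is then constant on the disc. A larger
  \<open>\<rho>\<close> means a smaller disc.\<close>

definition lin :: "'k poly \<Rightarrow> 'k \<Rightarrow> int \<Rightarrow> int \<Rightarrow> bool" where
  "lin p t \<rho> N \<longleftrightarrow> coeff (T t p) 1 \<noteq> 0 \<and>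
     (\<forall>k\<ge>2. coeff (T t p) k \<in> B (v (coeff (T t p) 1) + N - (int k - 1) * \<rho>))"

definition stab :: "'k poly \<Rightarrow> 'k \<Rightarrow> int \<Rightarrow> int \<Rightarrow> bool" where
  "stab p t \<rho> N \<longleftrightarrow> poly p t \<noteq> 0 \<and>
     (\<forall>k\<ge>1. coeff (T t p) k \<in> B (v (poly p t) + N - int k * \<rho>))"

lemma stab_mono: "stab p t \<rho> N \<Longrightarrow> \<rho> \<le> \<rho>' \<Longrightarrow> N' \<le> N \<Longrightarrow> stab p t \<rho>' N'"
  unfolding stab_def by (auto elim!: B_mono intro!: add_mono diff_mono mult_left_mono)

lemma stab_diff:
  assumes "stab p t \<rho> N" "s - t \<in> B \<rho>"
  shows "poly p s - poly p t \<in> B (v (poly p t) + N)"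
proof -
  let ?q = "T t p - [:poly p t:]"
  have "coeff ?q k \<in> B (v (poly p t) + N - int k * \<rho>)" for k
    using assms(1) by (cases k) (auto simp: stab_def coeff_T_0)
  then have "poly ?q (s - t) \<in> B (v (poly p t) + N)"
    by (rule poly_T_B) (use assms in auto)
  then show ?thesis by (simp add: poly_T)
qed

text \<open>Dominance on a small disc still controls the coefficients at a centre farther away:
  enlarging the disc from \<open>r + M\<close> to \<open>r\<close> costs at most M per degree, hence
  \<open>d * M\<close> altogether. This converts distance from the centres into a bound on
  cancellation in the expansion at a centre.\<close>

lemma stab_coeff_bound:
  assumes "stab p t (r + int M) N" "0 \<le> N" "t - c \<in> B r" "degree p \<le> d"
  shows "coeff (T c p) k \<in> B (v (poly p t) - int (d * M) - int k * r)"
proof -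
  have "coeff (T t p) i \<in> B ((v (poly p t) - int (d * M)) - int i * r)" for i
  proof (cases "i \<le> d")
    case True
    have "i * M \<le> d * M" using True by simp
    then have *: "int i * int M \<le> int (d * M)" by (metis of_nat_le_iff of_nat_mult)
    show ?thesis
    proof (cases "i = 0")
      case True
      then show ?thesis using assms(1) * by (simp add: coeff_T_0 B_iff stab_def)
    next
      case False
      then have "coeff (T t p) i \<in> B (v (poly p t) + N - int i * (r + int M))"
        using assms(1) by (simp add: stab_def)
      then show ?thesis by (rule B_mono) (use * \<open>0 \<le> N\<close> in \<open>auto simp: algebra_simps\<close>)
    qed
  next
    case False
    then have "coeff (T t p) i = 0" using assms(4) by (intro coeff_eq_0) simp
    then show ?thesis by simp
  qed
  from coeff_T_bound[OF this, of "c - t" k] assms(3)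
  show ?thesis by (simp add: T_T B_minus_commute)
qed

lemma B_power_diff:
  assumes "a \<in> B \<rho>" "b \<in> B \<rho>" "a - b \<in> B w"
  shows "a ^ k - b ^ k \<in> B (w + (int k - 1) * \<rho>)"
proof (cases k)
  case (Suc n)
  have "a ^ Suc n - b ^ Suc n = (a - b) * (\<Sum>i\<le>n. a ^ i * b ^ (n - i))"
    by (subst power_diff_sumr2) (simp add: lessThan_Suc_atMost mult.commute)
  also have "\<dots> \<in> B (w + int n * \<rho>)"
  proof (intro B_mult B_sum assms)
    fix i assume "i \<in> {..n}"
    then show "a ^ i * b ^ (n - i) \<in> B (int n * \<rho>)"
      using B_mult[OF B_power[OF assms(1), of i] B_power[OF assms(2), of "n - i"]]
      by (simp add: of_nat_diff algebra_simps)
  qed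
  finally show ?thesis using Suc by simp
qed simp

text \<open>In powers about \<open>t\<close>, factoring \<open>s - y\<close> out of the difference
  of k-th powers gains \<open>(k - 1) * \<rho>\<close>, exactly what dominance of the linear term
  charges for the k-th coefficient.\<close>

lemma lin_diff:
  assumes lin: "lin p t \<rho> N" and y: "y - t \<in> B \<rho>" and s: "s - t \<in> B \<rho>" and ys: "s - y \<in> B w"
  shows "poly p s - poly p y - coeff (T t p) 1 * (s - y) \<in> B (v (coeff (T t p) 1) + w + N)"
proof -
  define q where "q = T t p"
  define d where "d = Suc (degree p)"
  have dq: "degree q \<le> d" by (simp add: q_def d_def)
  have pe: "poly p x = (\<Sum>k\<le>d. coeff q k * (x - t) ^ k)" for x
  proof -
    have "poly p x = poly q (x - t)" by (simp add: q_def poly_T)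
    also have "\<dots> = (\<Sum>k\<le>d. coeff q k * (x - t) ^ k)"
      using poly_as_sum_of_monoms'[OF dq] by (metis (no_types, lifting) poly_sum poly_monom sum.cong)
    finally show ?thesis .
  qed
  have "poly p s - poly p y = (\<Sum>k\<le>d. coeff q k * ((s - t) ^ k - (y - t) ^ k))"
    by (simp add: pe sum_subtractf right_diff_distrib)
  also have "\<dots> = coeff q 1 * (s - y) + (\<Sum>k\<in>{..d} - {1}. coeff q k * ((s - t) ^ k - (y - t) ^ k))"
    by (subst sum.remove[of _ 1]) (auto simp: d_def)
  finally have "poly p s - poly p y - coeff q 1 * (s - y) =
    (\<Sum>k\<in>{..d} - {1}. coeff q k * ((s - t) ^ k - (y - t) ^ k))" by simp
  also have "\<dots> \<in> B (v (coeff q 1) + w + N)"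
  proof (rule B_sum)
    fix k assume k: "k \<in> {..d} - {1}"
    show "coeff q k * ((s - t) ^ k - (y - t) ^ k) \<in> B (v (coeff q 1) + w + N)"
    proof (cases "k = 0")
      case False
      then have "k \<ge> 2" using k by auto
      then have "coeff q k \<in> B (v (coeff q 1) + N - (int k - 1) * \<rho>)"
        using lin by (auto simp: lin_def q_def)
      moreover have "(s - t) ^ k - (y - t) ^ k \<in> B (w + (int k - 1) * \<rho>)"
        using y s ys by (intro B_power_diff) auto
      ultimately show ?thesis by (rule B_mult') simp
    qed simp
  qed
  finally show ?thesis by (simp add: q_def)
qed

lemma lin_mono: "lin p t \<rho> N \<Longrightarrow> \<rho> \<le> \<rho>' \<Longrightarrow> N' \<le> N \<Longrightarrow> lin p t \<rho>' N'"
  unfolding lin_def by (auto elim!: B_mono intro!: add_mono diff_mono mult_left_mono)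

text \<open>Newton iteration with the derivative frozen at \<open>t\<close>: as N is positive,
  \<open>\<phi>\<close> contracts distances in the disc by a power of the uniformizer, and the
  assumption on the value at \<open>t\<close> keeps the iterates inside. Completeness gives a fixed
  point, which is a root.\<close>

lemma Hensel:
  assumes lin: "lin p t \<rho> N" and N: "1 \<le> N" and a0: "poly p t \<in> B (v (coeff (T t p) 1) + \<rho>)"
  obtains y where "poly p y = 0" "y - t \<in> B \<rho>"
proof -
  define a where "a = coeff (T t p) 1"
  have a: "a \<noteq> 0" using lin by (simp add: lin_def a_def)
  define \<phi> where "\<phi> s = s - poly p s / a" for s
  define X where "X n = (\<phi> ^^ n) t" for n
  have step: "\<phi> s - \<phi> s' \<in> B (w + 1)"
    if "s - t \<in> B \<rho>" "s' - t \<in> B \<rho>" "s - s' \<in> B w" for s s' w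
  proof -
    have "(poly p s - poly p s' - a * (s - s')) / a \<in> B (w + 1)"
      using lin_diff[OF lin that(2,1,3)] N a by (auto simp: a_def B_divide elim: B_mono)
    also have "(poly p s - poly p s' - a * (s - s')) / a = - (\<phi> s - \<phi> s')"
      using a by (simp add: \<phi>_def field_simps)
    finally show ?thesis by (subst (asm) B_minus_iff)
  qed
  have \<phi>t: "\<phi> t - t \<in> B \<rho>"
    using a0 a by (simp add: \<phi>_def B_divide a_def add.commute)
  have XB: "X n - t \<in> B \<rho>" for n
  proof (induction n)
    case (Suc n)
    have "\<phi> (X n) - \<phi> t \<in> B \<rho>"
      using step[OF Suc _ Suc] by (auto intro: B_mono)
    then have "\<phi> (X n) - t \<in> B \<rho>" using \<phi>t by (rule B_trans)
    then show ?case by (simp add: X_def)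
  qed (simp add: X_def)
  have XS: "X (Suc n) - X n \<in> B (\<rho> + int n)" for n
  proof (induction n)
    case 0
    then show ?case using \<phi>t by (simp add: X_def)
  next
    case (Suc n)
    from step[OF XB XB Suc] show ?case by (simp add: X_def algebra_simps)
  qed
  have XC: "X (n + k) - X n \<in> B (\<rho> + int n)" for n k
  proof (induction k)
    case (Suc k)
    have "X (Suc (n + k)) - X (n + k) \<in> B (\<rho> + int n)"
      using XS[of "n + k"] by (rule B_mono) simp
    then have "X (Suc (n + k)) - X n \<in> B (\<rho> + int n)" using Suc by (rule B_trans)
    then show ?case by simp
  qed simp
  have XC': "X i - X n \<in> B (\<rho> + int n)" if "n \<le> i" for i n
    using XC[of n "i - n"] that by simp
  have "\<exists>M. \<forall>i\<ge>M. \<forall>j\<ge>M. X i - X j \<in> B K" for K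
  proof (intro exI allI impI)
    fix i j assume ij: "nat (K - \<rho>) \<le> i" "nat (K - \<rho>) \<le> j"
    have "X i - X (nat (K - \<rho>)) \<in> B K" "X (nat (K - \<rho>)) - X j \<in> B K"
      using XC'[OF ij(1)] XC'[OF ij(2)] by (auto simp: B_minus_commute elim: B_mono)
    then show "X i - X j \<in> B K" by (rule B_trans)
  qed
  then obtain y where y: "\<And>K. \<exists>M. \<forall>i\<ge>M. X i - y \<in> B K"
    using v_complete by metis
  have yt: "y - t \<in> B \<rho>"
  proof -
    obtain M where "X M - y \<in> B \<rho>" using y[of \<rho>] by auto
    then show ?thesis using XB[of M] B_trans B_minus_commute by blast
  qed
  have "poly p y / a \<in> B K" for K
  proof -
    obtain M where M: "\<And>i. i \<ge> M \<Longrightarrow> X i - y \<in> B K" using y[of K] by auto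
    have "\<phi> (X M) - \<phi> y \<in> B K" using step[OF XB yt M[of M]] by (auto intro: B_mono)
    then have "X (Suc M) - \<phi> y \<in> B K" by (simp add: X_def)
    moreover have "y - X (Suc M) \<in> B K" using M[of "Suc M"] by (subst B_minus_commute) simp
    ultimately have "y - \<phi> y \<in> B K" using B_trans by blast
    then show ?thesis by (simp add: \<phi>_def)
  qed
  then have "poly p y / a = 0" by (rule B_all_zero)
  then show ?thesis using that[of y] yt a by simp
qed

text \<open>Existence of a root in the disc becomes a single ball condition at \<open>t\<close>;
  this is what makes it definable in \<open>D_Rt\<close>.\<close>

lemma lin_root_iff:
  assumes "lin p t \<rho> N" "1 \<le> N"
  shows "(\<exists>y. poly p y = 0 \<and> y - t \<in> B \<rho>) \<longleftrightarrow> poly p t \<in> B (v (coeff (T t p) 1) + \<rho>)"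
proof
  assume "\<exists>y. poly p y = 0 \<and> y - t \<in> B \<rho>"
  then obtain y where y: "poly p y = 0" "y - t \<in> B \<rho>" by blast
  have a: "coeff (T t p) 1 \<noteq> 0" using assms by (simp add: lin_def)
  have "poly p t - poly p y - coeff (T t p) 1 * (t - y) \<in> B (v (coeff (T t p) 1) + \<rho> + N)"
    by (rule lin_diff[OF assms(1)]) (use y in \<open>auto simp: B_minus_commute\<close>)
  then have "poly p t - coeff (T t p) 1 * (t - y) \<in> B (v (coeff (T t p) 1) + \<rho>)"
    using y assms(2) by (auto elim: B_mono)
  moreover have "coeff (T t p) 1 * (t - y) \<in> B (v (coeff (T t p) 1) + \<rho>)"
    using y a by (intro B_mult) (auto simp: B_iff B_minus_commute)
  ultimately show "poly p t \<in> B (v (coeff (T t p) 1) + \<rho>)" using B_eq_iff by blast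
next
  assume "poly p t \<in> B (v (coeff (T t p) 1) + \<rho>)"
  then show "\<exists>y. poly p y = 0 \<and> y - t \<in> B \<rho>" using Hensel[OF assms] by blast
qed

lemma lin_root_unique:
  assumes "lin p t \<rho> N" "1 \<le> N" "poly p y = 0" "y - t \<in> B \<rho>" "poly p y' = 0" "y' - t \<in> B \<rho>"
  shows "y = y'"
proof (rule ccontr)
  assume "y \<noteq> y'"
  have a: "coeff (T t p) 1 \<noteq> 0" using assms by (simp add: lin_def)
  have "poly p y' - poly p y - coeff (T t p) 1 * (y' - y)
      \<in> B (v (coeff (T t p) 1) + v (y' - y) + N)"
    by (rule lin_diff[OF assms(1)]) (use assms \<open>y \<noteq> y'\<close> in \<open>auto simp: B_iff\<close>)
  then have "coeff (T t p) 1 * (y' - y) \<in> B (v (coeff (T t p) 1) + v (y' - y) + N)"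
    using assms by simp
  then show False using a \<open>y \<noteq> y'\<close> assms(2) by (simp add: B_iff v_mult)
qed

lemma coeff_T_1: "coeff (T t p) 1 = poly (pderiv p) t"
  using coeff_pderiv[of "T t p" 0] by (simp add: pderiv_T coeff_T_0)

text \<open>Integrating the Taylor series of the derivative divides the k-th coefficient by k. In
  characteristic zero this costs at most V digits for k up to the degree, and the hypothesis keeps V
  digits in reserve.\<close>

lemma lin_of_stab_pderiv:
  assumes st: "stab (pderiv p) t \<rho> (N + int V)" and d: "degree p \<le> d"
    and V: "\<And>k. 0 < k \<Longrightarrow> k \<le> d \<Longrightarrow> v (of_nat k) \<le> int V"
  shows "lin p t \<rho> N"
  unfolding lin_def coeff_T_1
proof (intro conjI allI impI)
  show "poly (pderiv p) t \<noteq> 0" using st by (simp add: stab_def)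
  fix k :: nat assume k: "2 \<le> k"
  show "coeff (T t p) k \<in> B (v (poly (pderiv p) t) + N - (int k - 1) * \<rho>)"
  proof (cases "k \<le> d")
    case True
    obtain j where j: "k = Suc j" "j \<ge> 1" using k by (cases k) auto
    have "of_nat k * coeff (T t p) k \<in> B (v (poly (pderiv p) t) + (N + int V) - int j * \<rho>)"
      using st j coeff_pderiv[of "T t p" j] by (auto simp: stab_def pderiv_T)
    then have "coeff (T t p) k \<in> B (v (poly (pderiv p) t) + (N + int V) - int j * \<rho> - v (of_nat k))"
      using B_mult_left[of "of_nat k" "coeff (T t p) k"] k by (simp add: mult.commute)
    then show ?thesis by (rule B_mono) (use V[of k] True j in auto)
  next
    case False
    then show ?thesis using d by (simp add: coeff_eq_0)
  qed
qed

lemma ex_val_bound: "\<exists>V::nat. \<forall>k. 0 < k \<longrightarrow> k \<le> d \<longrightarrow> v (of_nat k) \<le> int V"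
proof -
  have "finite ((\<lambda>k. nat (v (of_nat k))) ` {0<..d})" by simp
  then obtain V where "\<forall>x\<in>(\<lambda>k. nat (v (of_nat k))) ` {0<..d}. x \<le> V"
    using finite_nat_set_iff_bounded_le by blast
  then show ?thesis by (intro exI[of _ V]) (fastforce simp: nat_le_iff)
qed

text \<open>A point is far from every root in the field of a polynomial and its
  derivatives only if the polynomial has nearly constant value around it. Roots outside the field
  need not be considered, because a nearby one would produce a root in the field by Hensel.\<close>

lemma stab_away_from_roots:
  "\<exists>M\<ge>1. \<forall>p t r. degree p \<le> d \<longrightarrow> p \<noteq> 0 \<longrightarrow>
     (\<forall>i c. (pderiv ^^ i) p \<noteq> 0 \<longrightarrow> poly ((pderiv ^^ i) p) c = 0 \<longrightarrow> t - c \<notin> B (r + 1)) \<longrightarrow>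
     stab p t (r + int M) (int N)"
proof (induction d arbitrary: N)
  case 0
  have "stab p t \<rho> n" if p: "degree p \<le> 0" "p \<noteq> 0" for p t \<rho> n
  proof -
    obtain c where "p = [:c:]" using p degree_eq_zeroE by blast
    then show ?thesis using p by (auto simp: stab_def T_def coeff_pCons split: nat.splits)
  qed
  then show ?case by blast
next
  case (Suc d)
  obtain V where V: "\<And>k. 0 < k \<Longrightarrow> k \<le> Suc d \<Longrightarrow> v (of_nat k) \<le> int V"
    using ex_val_bound by blast
  obtain M1 where M1: "M1 \<ge> 1" "\<And>p t r. degree p \<le> d \<Longrightarrow> p \<noteq> 0 \<Longrightarrow>
     (\<forall>i c. (pderiv ^^ i) p \<noteq> 0 \<longrightarrow> poly ((pderiv ^^ i) p) c = 0 \<longrightarrow> t - c \<notin> B (r + 1)) \<Longrightarrow>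
     stab p t (r + int M1) (int (N + 1 + V))" using Suc[of "N + 1 + V"] by blast
  show ?case
  proof (intro exI[of _ "M1 + N"] conjI allI impI)
    show "1 \<le> M1 + N" using M1 by simp
    fix p t r assume d: "degree p \<le> Suc d" and p: "p \<noteq> 0"
      and away: "\<forall>i c. (pderiv ^^ i) p \<noteq> 0 \<longrightarrow> poly ((pderiv ^^ i) p) c = 0 \<longrightarrow> t - c \<notin> B (r + 1)"
    show "stab p t (r + int (M1 + N)) (int N)"
    proof (cases "degree p = 0")
      case True
      then obtain c where "p = [:c:]" using degree_eq_zeroE by blast
      then show ?thesis using p by (auto simp: stab_def T_def coeff_pCons split: nat.splits)
    next
      case False
      let ?\<rho> = "r + int M1"
      have nz: "pderiv p \<noteq> 0" using False by (simp add: pderiv_eq_0_iff)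
      have st: "stab (pderiv p) t ?\<rho> (int (N + 1) + int V)"
      proof -
        have "stab (pderiv p) t ?\<rho> (int (N + 1 + V))"
        proof (rule M1(2)[OF _ nz], goal_cases)
          case 1
          then show ?case using d by (simp add: degree_pderiv)
        next
          case 2
          then show ?case using away[rule_format, of "Suc i" for i] by (simp add: funpow_Suc_right del: funpow.simps)
        qed
        then show ?thesis by (simp add: ac_simps)
      qed
      have lin: "lin p t ?\<rho> (int (N + 1))" by (rule lin_of_stab_pderiv[OF st d V])
      let ?a = "coeff (T t p) 1"
      have a0: "poly p t \<notin> B (v ?a + ?\<rho>)"
      proof
        assume "poly p t \<in> B (v ?a + ?\<rho>)"
        then obtain y where y: "poly p y = 0" "y - t \<in> B ?\<rho>"
          using Hensel[OF lin] by auto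
        have "t - y \<notin> B (r + 1)" using away[rule_format, of 0 y] p y by simp
        moreover have "t - y \<in> B (r + 1)"
          using y(2) M1(1) by (auto simp: B_minus_commute elim: B_mono)
        ultimately show False by blast
      qed
      have pt: "poly p t \<noteq> 0" using a0 by auto
      \<comment> \<open>Without a root in the disc the constant term beats the linear one and with
        it all higher ones. Shrinking the disc by N more powers gains at least N in every
        nonconstant term, which is the required margin.\<close>
      then have va: "v (poly p t) < v ?a + ?\<rho>" using a0 by (simp add: B_iff)
      show ?thesis unfolding stab_def
      proof (intro conjI allI impI pt)
        fix k :: nat assume k: "1 \<le> k"
        show "coeff (T t p) k \<in> B (v (poly p t) + int N - int k * (r + int (M1 + N)))"
        proof (cases "k = 1")
          case True
          have "?a \<noteq> 0" using lin by (simp add: lin_def)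
          then show ?thesis using True va by (simp add: B_iff)
        next
          case False
          then have "coeff (T t p) k \<in> B (v ?a + int (N + 1) - (int k - 1) * ?\<rho>)"
            using k lin by (auto simp: lin_def)
          moreover have "int N * 1 \<le> int N * int k" using k by (intro mult_left_mono) auto
          ultimately show ?thesis
            by (elim B_mono) (use va in \<open>auto simp: algebra_simps\<close>)
        qed
      qed
    qed
  qed
qed

end

section \<open>Residue representatives and definable functions\<close>

context local_field
begin

abbreviation qq :: nat where "qq \<equiv> residue_card v"

lemma residue_rel_iff: "(x, y) \<in> residue_rel v \<longleftrightarrow> x \<in> B 0 \<and> y \<in> B 0 \<and> x - y \<in> B 1"
  by (simp add: residue_rel_def val_ring_def)

lemma equiv_residue_rel: "equiv (val_ring v) (residue_rel v)"
proof (rule equivI)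
  show "residue_rel v \<subseteq> val_ring v \<times> val_ring v"
    by (auto simp: residue_rel_def)
  show "refl_on (val_ring v) (residue_rel v)"
    by (auto simp: refl_on_def residue_rel_iff val_ring_def)
  show "sym (residue_rel v)"
    by (auto simp: sym_def residue_rel_iff B_minus_commute)
  show "trans (residue_rel v)"
    unfolding trans_def residue_rel_iff using B_trans by blast
qed

lemma ex_digits:
  "\<exists>Dg. finite Dg \<and> Dg \<subseteq> B 0 \<and> card Dg = qq \<and> (\<forall>x\<in>B 0. \<exists>!d\<in>Dg. x - d \<in> B 1)"
proof -
  let ?Q = "val_ring v // residue_rel v"
  define pick where "pick X = (SOME x. x \<in> X)" for X :: "'k set"
  have pick: "pick X \<in> X" if X: "X \<in> ?Q" for X
    using in_quotient_imp_non_empty[OF equiv_residue_rel X] by (auto simp: pick_def some_in_eq)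
  have sub: "X \<subseteq> B 0" if X: "X \<in> ?Q" for X
    using in_quotient_imp_subset[OF equiv_residue_rel X] by (simp add: val_ring_def)
  have inj: "X = Y" if "X \<in> ?Q" "Y \<in> ?Q" "pick X - pick Y \<in> B 1" for X Y
    using quotient_eqI[OF equiv_residue_rel that(1,2) pick[OF that(1)] pick[OF that(2)]]
      that pick sub by (auto simp: residue_rel_iff)
  show ?thesis
  proof (intro exI[of _ "pick ` ?Q"] conjI ballI)
    show "finite (pick ` ?Q)" using finite_residues by simp
    show "pick ` ?Q \<subseteq> B 0" using pick sub by blast
    have "inj_on pick ?Q" by (intro inj_onI inj) auto
    then show "card (pick ` ?Q) = qq" by (simp add: card_image residue_card_def)
    fix x assume x: "x \<in> B 0"
    then have X: "residue_rel v `` {x} \<in> ?Q" by (intro quotientI) (simp add: val_ring_def)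
    show "\<exists>!d\<in>pick ` ?Q. x - d \<in> B 1"
    proof (rule ex1I[of _ "pick (residue_rel v `` {x})"])
      show "pick (residue_rel v `` {x}) \<in> pick ` ?Q \<and> x - pick (residue_rel v `` {x}) \<in> B 1"
        using pick[OF X] X by (auto simp: residue_rel_iff)
      fix d assume "d \<in> pick ` ?Q \<and> x - d \<in> B 1"
      then obtain Y where Y: "Y \<in> ?Q" "d = pick Y" "x - pick Y \<in> B 1" by auto
      have "pick (residue_rel v `` {x}) - x \<in> B 1"
        using pick[OF X] by (auto simp: residue_rel_iff B_minus_commute)
      then have "pick (residue_rel v `` {x}) - pick Y \<in> B 1" using Y(3) B_trans by blast
      then show "d = pick (residue_rel v `` {x})" using inj[OF X Y(1)] Y(2) by simp
    qed
  qed
qed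

definition digits :: "'k set" where
  "digits = (SOME Dg. finite Dg \<and> Dg \<subseteq> B 0 \<and> card Dg = qq \<and> (\<forall>x\<in>B 0. \<exists>!d\<in>Dg. x - d \<in> B 1))"

lemma digits:
  "finite digits" "digits \<subseteq> B 0" "card digits = qq" "\<And>x. x \<in> B 0 \<Longrightarrow> \<exists>!d\<in>digits. x - d \<in> B 1"
  using someI_ex[OF ex_digits] unfolding digits_def by simp_all

lemma qq_ge_2: "2 \<le> qq"
proof -
  obtain a where a: "a \<in> digits" "0 - a \<in> B 1" using digits(4)[of 0] by auto
  obtain b where b: "b \<in> digits" "1 - b \<in> B 1" using digits(4)[of 1] by auto
  have "a \<noteq> b" using a b B_diff[of "1 - b" 1 "0 - a"] by (auto simp: B_iff)
  then have "card {a, b} = 2" by simp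
  moreover have "card {a, b} \<le> card digits" using a b digits(1) by (intro card_mono) auto
  ultimately show ?thesis using digits(3) by simp
qed

text \<open>Truncated digit expansions, representing the valuation ring modulo the n-th power of its
  maximal ideal. A fixed finite system turns statements about leading digits into finite
  disjunctions.\<close>

primrec E :: "nat \<Rightarrow> 'k set" where
  "E 0 = {0}"
| "E (Suc n) = (\<lambda>(e, d). e + pw (int n) * d) ` (E n \<times> digits)"

lemma E_sub: "E n \<subseteq> B 0"
proof (induction n)
  case (Suc n)
  have "e + pw (int n) * d \<in> B 0" if "e \<in> E n" "d \<in> digits" for e d
    using that Suc digits(2) by (intro B_add B_mult'[of _ "int n" _ 0]) auto
  then show ?case by auto
qed simp

lemma ex_rep: "x \<in> B 0 \<Longrightarrow> \<exists>e\<in>E n. x - e \<in> B (int n)"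
proof (induction n)
  case (Suc n)
  then obtain e where e: "e \<in> E n" "x - e \<in> B (int n)" by blast
  then have "(x - e) / pw (int n) \<in> B 0" by (simp add: B_divide)
  then obtain d where d: "d \<in> digits" "(x - e) / pw (int n) - d \<in> B 1" using digits(4) by blast
  have "((x - e) / pw (int n) - d) * pw (int n) \<in> B (1 + int n)"
    using d(2) by (simp add: B_times_pw)
  moreover have "((x - e) / pw (int n) - d) * pw (int n) = x - (e + pw (int n) * d)"
    by (simp add: field_simps)
  ultimately have "x - (e + pw (int n) * d) \<in> B (int (Suc n))" by simp
  moreover have "e + pw (int n) * d \<in> E (Suc n)" using e(1) d(1) by auto
  ultimately show ?case by blast
qed simp

text \<open>Uniqueness at level n is a hypothesis because the lemma serves inside the inductive
  proof of \<open>E_unique\<close> as well as afterwards.\<close>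

lemma E_inj:
  "e \<in> E n \<Longrightarrow> d \<in> digits \<Longrightarrow> e' \<in> E n \<Longrightarrow> d' \<in> digits \<Longrightarrow>
     (e + pw (int n) * d) - (e' + pw (int n) * d') \<in> B (int (Suc n)) \<Longrightarrow>
     (\<And>a b. a \<in> E n \<Longrightarrow> b \<in> E n \<Longrightarrow> a - b \<in> B (int n) \<Longrightarrow> a = b) \<Longrightarrow> e = e' \<and> d = d'"
proof -
  assume e: "e \<in> E n" "e' \<in> E n" and d: "d \<in> digits" "d' \<in> digits"
    and eq: "(e + pw (int n) * d) - (e' + pw (int n) * d') \<in> B (int (Suc n))"
    and IH: "\<And>a b. a \<in> E n \<Longrightarrow> b \<in> E n \<Longrightarrow> a - b \<in> B (int n) \<Longrightarrow> a = b"
  have d0: "d - d' \<in> B 0" using d digits(2) by (auto intro: B_diff)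
  then have "pw (int n) * (d - d') \<in> B (int n)" by (intro B_mult'[of _ "int n" _ 0]) auto
  moreover have "(e + pw (int n) * d) - (e' + pw (int n) * d') \<in> B (int n)"
    using eq by (rule B_mono) simp
  ultimately have "(e + pw (int n) * d) - (e' + pw (int n) * d') - pw (int n) * (d - d') \<in> B (int n)"
    by (rule B_diff[rotated])
  then have "e - e' \<in> B (int n)" by (simp add: algebra_simps)
  then have ee: "e = e'" using IH e by blast
  then have "(d - d') * pw (int n) \<in> B (int (Suc n))" using eq by (simp add: algebra_simps)
  then have "d - d' \<in> B 1" by (simp add: B_times_pw)
  then have "d = d'" using digits(4)[of d] d digits(2) B_zero[of 1] by (metis diff_self subsetD)
  with ee show ?thesis by simp
qed

lemma E_unique: "a \<in> E n \<Longrightarrow> b \<in> E n \<Longrightarrow> a - b \<in> B (int n) \<Longrightarrow> a = b"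
proof (induction n arbitrary: a b)
  case (Suc n)
  from Suc.prems obtain e d e' d' where
    "e \<in> E n" "d \<in> digits" "a = e + pw (int n) * d" "e' \<in> E n" "d' \<in> digits" "b = e' + pw (int n) * d'"
    by auto
  then show ?case using E_inj[of e n d e' d'] Suc by auto
qed simp

lemma finite_E [simp]: "finite (E n)"
  by (induction n) (auto simp: digits(1))

lemma card_E: "card (E n) = qq ^ n"
proof (induction n)
  case (Suc n)
  have "inj_on (\<lambda>(e, d). e + pw (int n) * d) (E n \<times> digits)"
  proof (rule inj_onI, clarsimp)
    fix e d e' d'
    assume "e \<in> E n" "d \<in> digits" "e' \<in> E n" "d' \<in> digits"
      "e + pw (int n) * d = e' + pw (int n) * d'"
    then show "e = e' \<and> d = d'" using E_inj[of e n d e' d'] E_unique by auto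
  qed
  then show ?case using Suc by (simp add: card_image card_cartesian_product digits(3))
qed simp

definition rep :: "nat \<Rightarrow> 'k \<Rightarrow> 'k" where "rep n x = (THE e. e \<in> E n \<and> x - e \<in> B (int n))"

lemma rep:
  assumes "x \<in> B 0"
  shows "rep n x \<in> E n" "x - rep n x \<in> B (int n)"
proof -
  obtain e where e: "e \<in> E n" "x - e \<in> B (int n)" using ex_rep[OF assms] by blast
  have "rep n x = e" unfolding rep_def
  proof (rule the_equality)
    fix e' assume e': "e' \<in> E n \<and> x - e' \<in> B (int n)"
    then have "e' - e \<in> B (int n)" using e(2) B_trans B_minus_commute by blast
    then show "e' = e" using E_unique e e' by blast
  qed (use e in simp)
  then show "rep n x \<in> E n" "x - rep n x \<in> B (int n)" using e by auto
qed

lemma rep_eqI: "x \<in> B 0 \<Longrightarrow> e \<in> E n \<Longrightarrow> x - e \<in> B (int n) \<Longrightarrow> rep n x = e"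
  using rep[of x n] E_unique[of "rep n x" n e] B_trans[of "rep n x" x "int n" e] by (simp add: B_minus_commute)

lemma rep_E [simp]: "e \<in> E n \<Longrightarrow> rep n e = e"
  using E_sub by (intro rep_eqI) auto

lemma rep_eq_iff:
  assumes "x \<in> B 0" "y \<in> B 0"
  shows "rep n x = rep n y \<longleftrightarrow> x - y \<in> B (int n)"
proof
  assume "rep n x = rep n y"
  then show "x - y \<in> B (int n)" using rep(2)[OF assms(1)] rep(2)[OF assms(2)]
    by (metis B_minus_commute B_trans)
next
  assume "x - y \<in> B (int n)"
  then have "x - rep n y \<in> B (int n)" using rep(2)[OF assms(2)] B_trans by blast
  then show "rep n x = rep n y" using assms rep by (intro rep_eqI)
qed

end

text \<open>Predicates in a parameter \<open>x\<close> and an environment \<open>z\<close> of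
  integer variables, closed under first-order logic over the ordered group of integers. Variables
  are de Bruijn indices: a quantifier pushes its value to the front with \<open>case_nat\<close>,
  and renaming by an arbitrary \<open>\<sigma>\<close> covers weakening and permutation.\<close>

locale int_structure =
  fixes D :: "('x \<Rightarrow> (nat \<Rightarrow> int) \<Rightarrow> bool) set"
  assumes D_not: "P \<in> D \<Longrightarrow> (\<lambda>x z. \<not> P x z) \<in> D"
    and D_conj: "P \<in> D \<Longrightarrow> Q \<in> D \<Longrightarrow> (\<lambda>x z. P x z \<and> Q x z) \<in> D"
    and D_ex_push: "P \<in> D \<Longrightarrow> (\<lambda>x z. \<exists>k. P x (case_nat k z)) \<in> D"
    and D_ren: "P \<in> D \<Longrightarrow> (\<lambda>x z. P x (\<lambda>i. z (\<sigma> i))) \<in> D"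
    and D_atom_le: "(\<lambda>x z. z i \<le> z j) \<in> D"
    and D_atom_add: "(\<lambda>x z. z i = z j + z k) \<in> D"
    and D_atom_const: "(\<lambda>x z. z i = c) \<in> D"
begin

lemma D_disj: "P \<in> D \<Longrightarrow> Q \<in> D \<Longrightarrow> (\<lambda>x z. P x z \<or> Q x z) \<in> D"
  using D_not[OF D_conj[OF D_not D_not, of P Q]] by simp

lemma D_imp: "P \<in> D \<Longrightarrow> Q \<in> D \<Longrightarrow> (\<lambda>x z. P x z \<longrightarrow> Q x z) \<in> D"
  unfolding imp_conv_disj by (intro D_disj D_not)

lemma D_True: "(\<lambda>x z. True) \<in> D"
  using D_disj[OF D_not D_atom_const, OF D_atom_const, of 0 0 0 0] by simp

lemma D_bool: "(\<lambda>x z. b) \<in> D"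
  using D_True D_not[OF D_True] by (cases b) auto

lemma D_ex:
  assumes "(\<lambda>x z. P x (\<lambda>i. z (Suc i)) (z 0)) \<in> D"
  shows "(\<lambda>x z. \<exists>k. P x z k) \<in> D"
  using D_ex_push[OF assms] by simp

lemma D_all:
  assumes "(\<lambda>x z. P x (\<lambda>i. z (Suc i)) (z 0)) \<in> D"
  shows "(\<lambda>x z. \<forall>k. P x z k) \<in> D"
  using D_not[OF D_ex[of "\<lambda>x z k. \<not> P x z k", OF D_not[OF assms]]] by simp

lemma D_bex: "finite A \<Longrightarrow> (\<And>a. a \<in> A \<Longrightarrow> (\<lambda>x z. P a x z) \<in> D) \<Longrightarrow> (\<lambda>x z. \<exists>a\<in>A. P a x z) \<in> D"
  by (induction A rule: finite_induct) (auto intro: D_bool D_disj)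

lemma D_ball: "finite A \<Longrightarrow> (\<And>a. a \<in> A \<Longrightarrow> (\<lambda>x z. P a x z) \<in> D) \<Longrightarrow> (\<lambda>x z. \<forall>a\<in>A. P a x z) \<in> D"
  by (induction A rule: finite_induct) (auto intro: D_bool D_conj)

text \<open>A term is any integer-valued function with definable graph, the value being variable 0.
  Substituting it then amounts to an existential quantifier over its value.\<close>

definition tm :: "('x \<Rightarrow> (nat \<Rightarrow> int) \<Rightarrow> int) \<Rightarrow> bool" where
  "tm F \<longleftrightarrow> (\<lambda>x z. z 0 = F x (\<lambda>i. z (Suc i))) \<in> D"

lemma tm_ren: "tm F \<Longrightarrow> tm (\<lambda>x z. F x (\<lambda>i. z (\<sigma> i)))"
  unfolding tm_def using D_ren[of "\<lambda>x z. z 0 = F x (\<lambda>i. z (Suc i))" "case_nat 0 (\<lambda>i. Suc (\<sigma> i))"]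
  by simp

lemma D_eq_var: "(\<lambda>x z. z i = z j) \<in> D"
  using D_conj[OF D_atom_le[of i j] D_atom_le[of j i]] by (simp add: order_eq_iff)

lemma tm_var: "tm (\<lambda>x z. z i)"
  unfolding tm_def by (rule D_eq_var)

lemma tm_const: "tm (\<lambda>x z. c)"
  unfolding tm_def by (rule D_atom_const)

lemma D_subst:
  assumes "P \<in> D" "tm F"
  shows "(\<lambda>x z. P x (case_nat (F x z) (\<lambda>i. z (\<sigma> i)))) \<in> D"
proof -
  have "(\<lambda>x z. \<exists>k. k = F x z \<and> P x (case_nat k (\<lambda>i. z (\<sigma> i)))) \<in> D"
  proof (rule D_ex, rule D_conj)
    show "(\<lambda>x z. z 0 = F x (\<lambda>i. z (Suc i))) \<in> D" using assms(2) by (simp add: tm_def)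
    have "(\<lambda>x z. P x (\<lambda>i. z (case_nat 0 (\<lambda>i. Suc (\<sigma> i)) i))) \<in> D" by (rule D_ren[OF assms(1)])
    moreover have "(\<lambda>i. z (case_nat 0 (\<lambda>i. Suc (\<sigma> i)) i)) = case_nat (z 0) (\<lambda>i. z (Suc (\<sigma> i)))"
      for z :: "nat \<Rightarrow> int" by (rule ext) (simp split: nat.split)
    ultimately show "(\<lambda>x z. P x (case_nat (z 0) (\<lambda>i. z (Suc (\<sigma> i))))) \<in> D" by simp
  qed
  then show ?thesis by simp
qed

lemma D_subst1:
  assumes "(\<lambda>x z. P x (z 0)) \<in> D" "tm F"
  shows "(\<lambda>x z. P x (F x z)) \<in> D"
  using D_subst[OF assms, of id] by simp

lemma D_subst2:
  assumes "(\<lambda>x z. P x (z 0) (z 1)) \<in> D" "tm F" "tm G"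
  shows "(\<lambda>x z. P x (F x z) (G x z)) \<in> D"
proof -
  have "(\<lambda>x z. P x (F x (\<lambda>i. z (Suc i))) (z 0)) \<in> D"
    using D_subst[OF assms(1) tm_ren[OF assms(2), of Suc], of "\<lambda>_. 0"] by simp
  from D_subst[OF this assms(3), of id] show ?thesis by simp
qed

lemma tm_comp2:
  assumes "tm (\<lambda>x z. f x (z 0) (z 1))" "tm F" "tm G"
  shows "tm (\<lambda>x z. f x (F x z) (G x z))"
proof -
  have "(\<lambda>x z. z 2 = f x (z 0) (z 1)) \<in> D"
    using D_ren[OF assms(1)[unfolded tm_def], of "case_nat 2 (case_nat 0 (\<lambda>_. 1))"] by simp
  then have "(\<lambda>x z. z 1 = f x (F x (\<lambda>i. z (Suc (Suc i)))) (z 0)) \<in> D"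
    using D_subst[of "\<lambda>x z. z (Suc (Suc 0)) = f x (z 0) (z 1)", OF _ tm_ren[OF assms(2), of "\<lambda>i. Suc (Suc i)"], of id]
    by (simp add: numeral_2_eq_2)
  from D_subst[OF this tm_ren[OF assms(3), of Suc], of id] show ?thesis
    by (simp add: tm_def)
qed

lemma tm_add: "tm F \<Longrightarrow> tm G \<Longrightarrow> tm (\<lambda>x z. F x z + G x z)"
proof (rule tm_comp2[of "\<lambda>x. (+)"])
  show "tm (\<lambda>x z. z 0 + z 1)" unfolding tm_def by (rule D_atom_add)
qed

lemma tm_diff: "tm F \<Longrightarrow> tm G \<Longrightarrow> tm (\<lambda>x z. F x z - G x z)"
proof (rule tm_comp2[of "\<lambda>x. (-)"])
  have "(\<lambda>x z. z (Suc 0) = z 0 + z 2) \<in> D" by (rule D_atom_add)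
  moreover have "(a = b - c) \<longleftrightarrow> (b = a + c)" for a b c :: int by auto
  ultimately show "tm (\<lambda>x z. z 0 - z 1)" unfolding tm_def by (simp add: numeral_2_eq_2)
qed

lemma tm_mult_nat: "tm F \<Longrightarrow> tm (\<lambda>x z. int n * F x z)"
proof (induction n)
  case (Suc n)
  then have "tm (\<lambda>x z. F x z + int n * F x z)" by (intro tm_add) auto
  then show ?case by (simp add: algebra_simps)
qed (simp add: tm_const)

lemmas tm_intros = tm_var tm_const tm_add tm_diff tm_mult_nat

lemma D_le: "tm F \<Longrightarrow> tm G \<Longrightarrow> (\<lambda>x z. F x z \<le> G x z) \<in> D"
  using D_subst2[of "\<lambda>x. (\<le>)" F G] D_atom_le by blast

lemma D_eq: "tm F \<Longrightarrow> tm G \<Longrightarrow> (\<lambda>x z. F x z = G x z) \<in> D"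
  using D_subst2[of "\<lambda>x. (=)" F G] D_eq_var by blast

end

section \<open>Definable functions with values in the field\<close>

locale field_structure = local_field v + int_structure D
  for v :: "'k::field_char_0 \<Rightarrow> int" and D :: "('x \<Rightarrow> (nat \<Rightarrow> int) \<Rightarrow> bool) set"
begin

text \<open>For integral \<open>a\<close> the test asks whether \<open>h x\<close> has valuation at
  least the scale; for other \<open>a\<close> it prescribes the valuation and finitely many leading
  digits. Such information behaves well under products and quotients, but it does not control the
  cancellation in a sum.\<close>

definition def_fn :: "('x \<Rightarrow> 'k) \<Rightarrow> bool" where
  "def_fn h \<longleftrightarrow> (\<forall>a. (\<lambda>x z. h x - a * pw (z 0) \<in> B (z 0)) \<in> D)"

lemma D_fn_ball:
  assumes "def_fn h" "tm F"
  shows "(\<lambda>x z. h x - a * pw (F x z) \<in> B (F x z)) \<in> D"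
  using assms D_subst1[of "\<lambda>x k. h x - a * pw k \<in> B k" F] by (auto simp: def_fn_def)

lemma D_fn_ball_shift:
  assumes "def_fn h" "tm F"
  shows "(\<lambda>x z. h x - a * pw (F x z) \<in> B (F x z + c)) \<in> D"
proof -
  have "(\<lambda>x z. h x - (a * pw (- c)) * pw (F x z + c) \<in> B (F x z + c)) \<in> D"
    by (intro D_fn_ball tm_add tm_const assms)
  moreover have "(a * pw (- c)) * pw (F x z + c) = a * pw (F x z)" for x z
    by (simp add: pw_add pw_minus)
  ultimately show ?thesis by simp
qed

lemma D_fn_B:
  assumes "def_fn h" "tm F"
  shows "(\<lambda>x z. h x \<in> B (F x z)) \<in> D"
  using D_fn_ball[OF assms, of 0] by simp

lemma D_fn_zero:
  assumes "def_fn h"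
  shows "(\<lambda>x z. h x = 0) \<in> D"
proof -
  have "(\<lambda>x z. \<forall>k. h x \<in> B k) \<in> D"
    by (intro D_all D_fn_B assms tm_intros)
  moreover have "(\<forall>k. h x \<in> B k) \<longleftrightarrow> h x = 0" for x
    using B_all_zero by auto
  ultimately show ?thesis by simp
qed

lemma def_const: "def_fn (\<lambda>x. c)"
  unfolding def_fn_def
proof
  fix a
  show "(\<lambda>x z. c - a * pw (z 0) \<in> B (z 0)) \<in> D"
  proof (cases "a \<in> B 0")
    case True
    then have eq: "c - a * pw k \<in> B k \<longleftrightarrow> c \<in> B k" for k
      by (intro B_eq_iff[of "c - a * pw k" c]) (simp add: B_times_pw)
    show ?thesis
    proof (cases "c = 0")
      case True
      then show ?thesis using eq by (simp add: D_bool)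
    next
      case False
      then show ?thesis unfolding eq by (simp add: B_iff) (intro D_le tm_intros)
    qed
  next
    case False
    \<comment> \<open>For non-integral \<open>a\<close> the ball avoids 0 and all its points have
      the same valuation, so it can contain the constant at one scale only.\<close>
    have k: "c \<noteq> 0 \<and> k = v c - v a" if "c - a * pw k \<in> B k" for k
    proof -
      have a: "a \<noteq> 0" using False by auto
      have va: "v a < 0" using False a by (simp add: B_iff)
      have "a * pw k - c \<in> B (v (a * pw k) + 1)"
        using that va a by (auto simp: B_minus_commute v_mult elim: B_mono)
      with v_close[OF _ this] a show ?thesis by (simp add: v_mult)
    qed
    have eq: "c - a * pw k \<in> B k \<longleftrightarrow> k = v c - v a \<and> c - a * pw (v c - v a) \<in> B (v c - v a)" for k
    proof (cases "k = v c - v a")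
      case True
      then show ?thesis by (simp only: simp_thms)
    next
      case False
      then have "c - a * pw k \<notin> B k" using k[of k] by blast
      with False show ?thesis by (simp only: simp_thms)
    qed
    show ?thesis by (subst eq) (intro D_conj D_atom_const D_bool)
  qed
qed

lemma def_if:
  assumes "(\<lambda>x z. A x) \<in> D" "def_fn h" "def_fn h'"
  shows "def_fn (\<lambda>x. if A x then h x else h' x)"
  unfolding def_fn_def
proof
  fix a
  have "(\<lambda>x z. A x \<and> h x - a * pw (z 0) \<in> B (z 0) \<or> \<not> A x \<and> h' x - a * pw (z 0) \<in> B (z 0)) \<in> D"
    by (intro D_disj D_conj D_not assms D_fn_ball tm_intros)
  moreover have "(A x \<and> h x - a * pw k \<in> B k \<or> \<not> A x \<and> h' x - a * pw k \<in> B k) \<longleftrightarrow>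
    (if A x then h x else h' x) - a * pw k \<in> B k" for x k by simp
  ultimately show "(\<lambda>x z. (if A x then h x else h' x) - a * pw (z 0) \<in> B (z 0)) \<in> D" by simp
qed

text \<open>If \<open>a\<close> lies in \<open>B (- N)\<close>, only the first N digits of the
  denominator matter. Writing it as \<open>\<eta> * pw w\<close> to relative precision N, with
  \<open>\<eta>\<close> from the finite set \<open>E N\<close>, turns the test for the quotient into
  one for the numerator at the scale \<open>k + w\<close>.\<close>

lemma def_divide:
  assumes p: "def_fn p" and g: "def_fn g"
  shows "def_fn (\<lambda>x. p x / g x)"
  unfolding def_fn_def
proof
  fix a
  obtain N where N: "a \<in> B (- int N)" using B_ex by blast
  have key: "p x / g x - a * pw k \<in> B k \<longleftrightarrow> p x - (a * \<eta>) * pw (k + w) \<in> B (k + w)"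
    if "g x \<noteq> 0" "v (g x) = w" "g x - \<eta> * pw w \<in> B (w + int N)" for x k w \<eta>
  proof -
    have "p x / g x - a * pw k = (p x - a * pw k * g x) / g x"
      using that(1) by (simp add: field_simps)
    then have "p x / g x - a * pw k \<in> B k \<longleftrightarrow> p x - a * pw k * g x \<in> B (k + w)"
      using that by (simp add: B_divide)
    also have "\<dots> \<longleftrightarrow> p x - (a * \<eta>) * pw (k + w) \<in> B (k + w)"
    proof (rule B_eq_iff)
      have "(a * pw k) * (g x - \<eta> * pw w) \<in> B (k + w)"
        by (rule B_mult'[of _ "k - int N" _ "w + int N"]) (use N that(3) in \<open>simp_all add: B_times_pw\<close>)
      moreover have "(a * pw k) * (g x - \<eta> * pw w) =
          - ((p x - a * pw k * g x) - (p x - (a * \<eta>) * pw (k + w)))"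
        by (simp add: algebra_simps pw_add)
      ultimately show "(p x - a * pw k * g x) - (p x - (a * \<eta>) * pw (k + w)) \<in> B (k + w)"
        by (metis B_minus_iff)
    qed
    finally show ?thesis .
  qed
  have "(\<lambda>x z. g x = 0 \<and> 0 - a * pw (z 0) \<in> B (z 0) \<or>
     (\<exists>w. g x \<in> B w \<and> \<not> g x \<in> B (w + 1) \<and>
       (\<exists>\<eta>\<in>E N. g x - \<eta> * pw w \<in> B (w + int N) \<and> p x - (a * \<eta>) * pw (z 0 + w) \<in> B (z 0 + w)))) \<in> D"
    by (intro D_disj D_conj D_ex D_bex D_not D_fn_zero D_fn_B D_fn_ball D_fn_ball_shift
        def_const p g finite_E tm_intros)
  moreover have "(g x = 0 \<and> 0 - a * pw k \<in> B k \<or>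
     (\<exists>w. g x \<in> B w \<and> \<not> g x \<in> B (w + 1) \<and>
       (\<exists>\<eta>\<in>E N. g x - \<eta> * pw w \<in> B (w + int N) \<and> p x - (a * \<eta>) * pw (k + w) \<in> B (k + w))))
     \<longleftrightarrow> p x / g x - a * pw k \<in> B k" (is "?L \<longleftrightarrow> ?R") for x k
  proof
    assume ?L
    then show ?R using key v_eqI by auto
  next
    assume R: ?R
    show ?L
    proof (cases "g x = 0")
      case False
      define w where "w = v (g x)"
      have "g x / pw w \<in> B 0" using False by (simp add: B_divide w_def) (simp add: B_iff)
      then obtain \<eta> where \<eta>: "\<eta> \<in> E N" "g x / pw w - \<eta> \<in> B (int N)" using ex_rep by blast
      then have "(g x / pw w - \<eta>) * pw w \<in> B (w + int N)" by (simp add: B_times_pw)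
      then have \<eta>': "g x - \<eta> * pw w \<in> B (w + int N)" by (simp add: algebra_simps)
      show ?thesis using key[OF False w_def[symmetric] \<eta>'] R \<eta> \<eta>' False
        by (intro disjI2 exI[of _ w]) (auto simp: B_iff w_def)
    qed (use R in simp)
  qed
  ultimately show "(\<lambda>x z. p x / g x - a * pw (z 0) \<in> B (z 0)) \<in> D" by simp
qed

section \<open>Maximal rings of definable functions\<close>

definition def_ring :: "('x \<Rightarrow> 'k) set \<Rightarrow> bool" where
  "def_ring R \<longleftrightarrow> (\<forall>h\<in>R. def_fn h) \<and> (\<forall>c. (\<lambda>x. c) \<in> R) \<and>
     (\<forall>h\<in>R. \<forall>h'\<in>R. (\<lambda>x. h x + h' x) \<in> R \<and> (\<lambda>x. h x * h' x) \<in> R)"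

definition max_ring :: "('x \<Rightarrow> 'k) set \<Rightarrow> bool" where
  "max_ring R \<longleftrightarrow> def_ring R \<and> (\<forall>R'. def_ring R' \<longrightarrow> R \<subseteq> R' \<longrightarrow> R' = R)"

lemma ex_max_ring:
  assumes "def_ring R0"
  shows "\<exists>R. max_ring R \<and> R0 \<subseteq> R"
proof -
  let ?A = "{R. def_ring R \<and> R0 \<subseteq> R}"
  have "\<exists>M\<in>?A. \<forall>X\<in>?A. M \<subseteq> X \<longrightarrow> X = M"
  proof (rule subset_Zorn_nonempty)
    show "?A \<noteq> {}" using assms by auto
    fix C assume C: "C \<noteq> {}" "subset.chain ?A C"
    then have sub: "R \<in> C \<Longrightarrow> def_ring R \<and> R0 \<subseteq> R" for R by (auto simp: subset.chain_def)
    have two: "\<exists>S\<in>C. h \<in> S \<and> h' \<in> S" if "h \<in> \<Union>C" "h' \<in> \<Union>C" for h h'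
    proof -
      from that obtain S S' where S: "S \<in> C" "h \<in> S" "S' \<in> C" "h' \<in> S'" by blast
      then have "S \<subseteq> S' \<or> S' \<subseteq> S" using C(2) unfolding subset.chain_def by blast
      then show ?thesis using S by blast
    qed
    have "def_ring (\<Union>C)" unfolding def_ring_def
    proof (intro conjI ballI allI)
      fix h assume "h \<in> \<Union>C"
      then show "def_fn h" using sub by (auto simp: def_ring_def)
    next
      fix c show "(\<lambda>x. c) \<in> \<Union>C" using C(1) sub by (fastforce simp: def_ring_def)
    next
      fix h h' assume "h \<in> \<Union>C" "h' \<in> \<Union>C"
      then obtain S where "S \<in> C" "h \<in> S" "h' \<in> S" using two by blast
      moreover from this have "(\<lambda>x. h x + h' x) \<in> S" "(\<lambda>x. h x * h' x) \<in> S"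
        using sub[of S] by (simp_all add: def_ring_def)
      ultimately show "(\<lambda>x. h x + h' x) \<in> \<Union>C" "(\<lambda>x. h x * h' x) \<in> \<Union>C"
        by blast+
    qed
    then show "\<Union>C \<in> ?A" using C(1) sub by blast
  qed
  then obtain M where M: "def_ring M" "R0 \<subseteq> M" "\<And>X. def_ring X \<Longrightarrow> R0 \<subseteq> X \<Longrightarrow> M \<subseteq> X \<Longrightarrow> X = M" by auto
  then have "max_ring M" unfolding max_ring_def by (meson subset_trans)
  then show ?thesis using M(2) by blast
qed

lemma def_ring_consts: "def_ring (range (\<lambda>c x. c))"
  by (auto simp: def_ring_def def_const)

end

locale ring_structure = field_structure v D
  for v :: "'k::field_char_0 \<Rightarrow> int" and D :: "('x \<Rightarrow> (nat \<Rightarrow> int) \<Rightarrow> bool) set" +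
  fixes R :: "('x \<Rightarrow> 'k) set"
  assumes max_ring: "max_ring R"
begin

lemma R_def: "h \<in> R \<Longrightarrow> def_fn h"
  and R_const [intro]: "(\<lambda>x. c) \<in> R"
  and R_add [intro]: "h \<in> R \<Longrightarrow> h' \<in> R \<Longrightarrow> (\<lambda>x. h x + h' x) \<in> R"
  and R_mult [intro]: "h \<in> R \<Longrightarrow> h' \<in> R \<Longrightarrow> (\<lambda>x. h x * h' x) \<in> R"
  using max_ring by (auto simp: max_ring_def def_ring_def)

lemma R_uminus: "h \<in> R \<Longrightarrow> (\<lambda>x. - h x) \<in> R"
  using R_mult[OF R_const, of h "-1"] by simp

lemma R_diff [intro]: "h \<in> R \<Longrightarrow> h' \<in> R \<Longrightarrow> (\<lambda>x. h x - h' x) \<in> R"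
  using R_add[OF _ R_uminus, of h h'] by simp

lemma R_power [intro]: "h \<in> R \<Longrightarrow> (\<lambda>x. h x ^ n) \<in> R"
  by (induction n) auto

lemma R_sum: "(\<And>i. i \<in> A \<Longrightarrow> (\<lambda>x. f i x) \<in> R) \<Longrightarrow> (\<lambda>x. \<Sum>i\<in>A. f i x) \<in> R"
  by (induction A rule: infinite_finite_induct) auto

lemma R_maximal:
  assumes "R \<subseteq> S" "\<And>h. h \<in> S \<Longrightarrow> def_fn h"
    "\<And>h h'. h \<in> S \<Longrightarrow> h' \<in> S \<Longrightarrow> (\<lambda>x. h x + h' x) \<in> S"
    "\<And>h h'. h \<in> S \<Longrightarrow> h' \<in> S \<Longrightarrow> (\<lambda>x. h x * h' x) \<in> S"
    "h \<in> S"
  shows "h \<in> R"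
proof -
  have "def_ring S" using assms(1-4) R_const by (fastforce simp: def_ring_def)
  then show ?thesis using max_ring assms(1,5) by (auto simp: max_ring_def)
qed

text \<open>Functions glued along the fixed condition \<open>A\<close> add and multiply piecewise,
  so they form a ring; each is definable by cases, and maximality puts them into
  \<open>R\<close>.\<close>

lemma R_if:
  assumes A: "(\<lambda>x z. A x) \<in> D" and "h \<in> R" "h' \<in> R"
  shows "(\<lambda>x. if A x then h x else h' x) \<in> R"
proof (rule R_maximal[of "(\<lambda>(h, h') x. if A x then h x else h' x) ` (R \<times> R)"])
  show "R \<subseteq> (\<lambda>(h, h') x. if A x then h x else h' x) ` (R \<times> R)"
  proof
    fix h assume "h \<in> R"
    then show "h \<in> (\<lambda>(h, h') x. if A x then h x else h' x) ` (R \<times> R)"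
      by (intro image_eqI[of _ _ "(h, h)"]) auto
  qed
  show "def_fn h" if "h \<in> (\<lambda>(h, h') x. if A x then h x else h' x) ` (R \<times> R)" for h
    using that by clarify (intro def_if A R_def)
next
  fix f g assume "f \<in> (\<lambda>(h, h') x. if A x then h x else h' x) ` (R \<times> R)"
    "g \<in> (\<lambda>(h, h') x. if A x then h x else h' x) ` (R \<times> R)"
  then obtain a b c d where *: "a \<in> R" "b \<in> R" "c \<in> R" "d \<in> R"
    "f = (\<lambda>x. if A x then a x else b x)" "g = (\<lambda>x. if A x then c x else d x)" by auto
  show "(\<lambda>x. f x + g x) \<in> (\<lambda>(h, h') x. if A x then h x else h' x) ` (R \<times> R)"
    by (rule image_eqI[of _ _ "(\<lambda>x. a x + c x, \<lambda>x. b x + d x)"]) (use * in auto)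
  show "(\<lambda>x. f x * g x) \<in> (\<lambda>(h, h') x. if A x then h x else h' x) ` (R \<times> R)"
    by (rule image_eqI[of _ _ "(\<lambda>x. a x * c x, \<lambda>x. b x * d x)"]) (use * in auto)
qed (use assms in auto)

text \<open>The ring S localizes at \<open>g\<close>: fractions over powers of \<open>g\<close>
  where \<open>g\<close> does not vanish, and an independent element of \<open>R\<close> on the zero
  set. The independent part is what lets S contain \<open>R\<close> itself and also the value 0
  produced by division by zero.\<close>

lemma R_divide:
  assumes "p \<in> R" "g \<in> R"
  shows "(\<lambda>x. p x / g x) \<in> R"
proof -
  define S where "S = {\<lambda>x. if g x = 0 then b x else a x / g x ^ n | a b n. a \<in> R \<and> b \<in> R}"
  have S_I: "(\<lambda>x. if g x = 0 then b x else a x / g x ^ n) \<in> S" if "a \<in> R" "b \<in> R" for a b n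
    using that by (auto simp: S_def)
  show ?thesis
  proof (rule R_maximal[of S])
    show "R \<subseteq> S"
    proof
      fix h assume "h \<in> R"
      then have "(\<lambda>x. if g x = 0 then h x else h x / g x ^ 0) \<in> S" by (intro S_I)
      moreover have "(\<lambda>x. if g x = 0 then h x else h x / g x ^ 0) = h" by auto
      ultimately show "h \<in> S" by simp
    qed
    show "def_fn h" if "h \<in> S" for h
    proof -
      from that obtain a b n where ab: "a \<in> R" "b \<in> R" "h = (\<lambda>x. if g x = 0 then b x else a x / g x ^ n)"
        unfolding S_def by (elim CollectE exE conjE) rule
      have "def_fn (\<lambda>x. g x ^ n)" by (rule R_def[OF R_power[OF assms(2)]])
      from def_if[OF D_fn_zero[OF R_def[OF assms(2)]] R_def[OF ab(2)] def_divide[OF R_def[OF ab(1)] this]]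
      show ?thesis unfolding ab(3) .
    qed
    have "(\<lambda>x. if g x = 0 then 0 else p x / g x ^ 1) \<in> S" by (rule S_I[of p "\<lambda>x. 0" 1, OF assms(1) R_const])
    moreover have "(\<lambda>x. if g x = 0 then 0 else p x / g x ^ 1) = (\<lambda>x. p x / g x)" by auto
    ultimately show "(\<lambda>x. p x / g x) \<in> S" by simp
  next
    fix f f' assume "f \<in> S" "f' \<in> S"
    then obtain a b n a' b' n' where *: "a \<in> R" "b \<in> R" "a' \<in> R" "b' \<in> R"
      "f = (\<lambda>x. if g x = 0 then b x else a x / g x ^ n)"
      "f' = (\<lambda>x. if g x = 0 then b' x else a' x / g x ^ n')" unfolding S_def by blast
    have "(\<lambda>x. if g x = 0 then b x + b' x else (a x * g x ^ n' + a' x * g x ^ n) / g x ^ (n + n')) \<in> S"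
      using * assms(2) by (intro S_I R_add R_mult R_power)
    also have "(\<lambda>x. if g x = 0 then b x + b' x else (a x * g x ^ n' + a' x * g x ^ n) / g x ^ (n + n'))
       = (\<lambda>x. f x + f' x)" using * by (auto simp: power_add field_simps)
    finally show "(\<lambda>x. f x + f' x) \<in> S" .
    have "(\<lambda>x. if g x = 0 then b x * b' x else (a x * a' x) / g x ^ (n + n')) \<in> S"
      using * by (intro S_I R_mult)
    also have "(\<lambda>x. if g x = 0 then b x * b' x else (a x * a' x) / g x ^ (n + n'))
       = (\<lambda>x. f x * f' x)" using * by (auto simp: power_add)
    finally show "(\<lambda>x. f x * f' x) \<in> S" .
  qed
qed

text \<open>The sum is determined modulo the target radius by finitely many leading digits of its terms,
  because the cancellation is bounded by L.\<close>

lemma D_bounded_sum: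
  assumes b: "\<And>k. k \<le> d \<Longrightarrow> b k \<in> R" and \<xi>: "\<xi> \<in> B 0"
  shows "(\<lambda>x z. (\<forall>k\<le>d. b k x \<in> B (z 1 - int L - int k * z 0)) \<and>
     (\<Sum>k\<le>d. b k x * (\<xi> * pw (z 0)) ^ k) - a * pw (z 1) \<in> B (z 1)) \<in> D"
proof -
  let ?C = "{\<beta> \<in> PiE {..d} (\<lambda>_. E L). (\<Sum>k\<le>d. \<beta> k * \<xi> ^ k) * pw (- int L) - a \<in> B 0}"
  let ?P = "\<lambda>x r w. \<exists>\<beta>\<in>?C. \<forall>k\<in>{..d}. b k x - \<beta> k * pw (w - int L - int k * r) \<in> B (w - int L - int k * r + int L)"
  have "(\<lambda>x z. ?P x (z 0) (z 1)) \<in> D"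
    by (intro D_bex D_ball D_fn_ball_shift R_def b tm_intros finite_subset[of ?C "PiE {..d} (\<lambda>_. E L)"])
       (auto intro: finite_PiE)
  moreover have "?P x r w \<longleftrightarrow> (\<forall>k\<le>d. b k x \<in> B (w - int L - int k * r)) \<and>
     (\<Sum>k\<le>d. b k x * (\<xi> * pw r) ^ k) - a * pw w \<in> B w" for x r w
  proof -
    have eq: "((\<Sum>k\<le>d. b k x * (\<xi> * pw r) ^ k) - a * pw w \<in> B w) \<longleftrightarrow>
       (\<Sum>k\<le>d. \<beta> k * \<xi> ^ k) * pw (- int L) - a \<in> B 0"
      if \<beta>: "\<And>k. k \<le> d \<Longrightarrow> b k x - \<beta> k * pw (w - int L - int k * r) \<in> B (w - int k * r)" for \<beta>
    proof -
      have "(\<Sum>k\<le>d. b k x * (\<xi> * pw r) ^ k) - (\<Sum>k\<le>d. \<beta> k * \<xi> ^ k) * pw (w - int L) =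
         (\<Sum>k\<le>d. (b k x - \<beta> k * pw (w - int L - int k * r)) * (\<xi> * pw r) ^ k)"
      proof -
        have "\<beta> k * pw (w - int L - int k * r) * (\<xi> * pw r) ^ k = \<beta> k * \<xi> ^ k * pw (w - int L)" for k
        proof -
          have "pw (w - int L - int k * r) * pw r ^ k = pw (w - int L)"
            by (simp add: pw_power flip: pw_add)
          then show ?thesis by (simp add: power_mult_distrib algebra_simps)
        qed
        then have "(\<Sum>k\<le>d. \<beta> k * pw (w - int L - int k * r) * (\<xi> * pw r) ^ k) =
            (\<Sum>k\<le>d. \<beta> k * \<xi> ^ k) * pw (w - int L)" unfolding sum_distrib_right by (intro sum.cong refl)
        then show ?thesis by (simp add: left_diff_distrib sum_subtractf)
      qed
      also have "\<dots> \<in> B w"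
      proof (rule B_sum)
        fix k assume "k \<in> {..d}"
        have "(\<xi> * pw r) ^ k \<in> B (int k * r)"
          using \<xi> by (intro B_power) (simp add: B_times_pw B_mono)
        then show "(b k x - \<beta> k * pw (w - int L - int k * r)) * (\<xi> * pw r) ^ k \<in> B w"
          using \<beta>[of k] \<open>k \<in> {..d}\<close> by (intro B_mult'[of _ "w - int k * r" _ "int k * r"]) auto
      qed
      finally have "((\<Sum>k\<le>d. b k x * (\<xi> * pw r) ^ k) - a * pw w) -
         ((\<Sum>k\<le>d. \<beta> k * \<xi> ^ k) * pw (w - int L) - a * pw w) \<in> B w" by simp
      then have "((\<Sum>k\<le>d. b k x * (\<xi> * pw r) ^ k) - a * pw w \<in> B w) \<longleftrightarrow>
         (\<Sum>k\<le>d. \<beta> k * \<xi> ^ k) * pw (w - int L) - a * pw w \<in> B w" by (rule B_eq_iff)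
      also have "(\<Sum>k\<le>d. \<beta> k * \<xi> ^ k) * pw (w - int L) - a * pw w =
         ((\<Sum>k\<le>d. \<beta> k * \<xi> ^ k) * pw (- int L) - a) * pw w"
        by (simp add: algebra_simps pw_diff pw_minus divide_inverse)
      finally show ?thesis by (simp add: B_times_pw)
    qed
    show ?thesis
    proof
      assume "?P x r w"
      then obtain \<beta> where \<beta>: "\<beta> \<in> ?C" "\<And>k. k \<le> d \<Longrightarrow>
        b k x - \<beta> k * pw (w - int L - int k * r) \<in> B (w - int k * r)" by auto
      have "b k x \<in> B (w - int L - int k * r)" if k: "k \<le> d" for k
      proof -
        have "\<beta> k \<in> B 0" using \<beta>(1) k E_sub by (auto simp: PiE_iff)
        then have "\<beta> k * pw (w - int L - int k * r) \<in> B (w - int L - int k * r)"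
          by (simp add: B_times_pw)
        moreover have "b k x - \<beta> k * pw (w - int L - int k * r) \<in> B (w - int L - int k * r)"
          using \<beta>(2)[OF k] by (rule B_mono) simp
        ultimately show ?thesis using B_eq_iff by blast
      qed
      then show "(\<forall>k\<le>d. b k x \<in> B (w - int L - int k * r)) \<and>
        (\<Sum>k\<le>d. b k x * (\<xi> * pw r) ^ k) - a * pw w \<in> B w" using eq[OF \<beta>(2)] \<beta>(1) by auto
    next
      assume L: "(\<forall>k\<le>d. b k x \<in> B (w - int L - int k * r)) \<and>
        (\<Sum>k\<le>d. b k x * (\<xi> * pw r) ^ k) - a * pw w \<in> B w"
      define \<beta> where "\<beta> = restrict (\<lambda>k. rep L (b k x / pw (w - int L - int k * r))) {..d}"
      have *: "b k x / pw (w - int L - int k * r) \<in> B 0" if "k \<le> d" for k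
        using L that by (simp add: B_divide)
      have \<beta>: "b k x - \<beta> k * pw (w - int L - int k * r) \<in> B (w - int k * r)" if k: "k \<le> d" for k
      proof -
        have "(b k x / pw (w - int L - int k * r) - \<beta> k) * pw (w - int L - int k * r) \<in> B (w - int k * r)"
          using rep(2)[OF *[OF k], of L] k by (simp add: B_times_pw \<beta>_def)
        then show ?thesis by (simp add: left_diff_distrib)
      qed
      have "\<beta> \<in> PiE {..d} (\<lambda>_. E L)" using rep(1)[OF *] by (auto simp: \<beta>_def)
      then show "?P x r w" using eq[OF \<beta>] \<beta> L by (intro bexI[of _ \<beta>]) auto
    qed
  qed
  ultimately show ?thesis by simp
qed

text \<open>If the target scale is at most \<open>z 1\<close>, the second summand is invisible
  modulo the ball. Otherwise the two scales differ by one of the numbers 1 to L, and for each of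
  these the second summand is a fixed multiple of \<open>pw (z 0)\<close> that can be absorbed into
  \<open>a\<close>.\<close>

lemma D_bounded_add:
  assumes h: "def_fn h" and \<xi>: "\<xi> \<in> B 0"
  shows "(\<lambda>x z. z 0 \<le> z 1 + int L \<and> h x + \<xi> * pw (z 1) - a * pw (z 0) \<in> B (z 0)) \<in> D"
proof -
  have "(\<lambda>x z. z 0 \<le> z 1 \<and> h x - a * pw (z 0) \<in> B (z 0) \<or>
     (\<exists>i\<in>{1..L}. z 0 = z 1 + int i \<and> h x - (a - \<xi> * pw (- int i)) * pw (z 0) \<in> B (z 0))) \<in> D"
    by (intro D_disj D_conj D_bex D_le D_eq D_fn_ball h tm_intros finite_atLeastAtMost)
  moreover have "(w \<le> r \<and> h x - a * pw w \<in> B w \<or>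
     (\<exists>i\<in>{1..L}. w = r + int i \<and> h x - (a - \<xi> * pw (- int i)) * pw w \<in> B w)) \<longleftrightarrow>
     w \<le> r + int L \<and> h x + \<xi> * pw r - a * pw w \<in> B w" (is "?L \<longleftrightarrow> ?R") for x w r
  proof -
    have 1: "h x + \<xi> * pw r - a * pw w \<in> B w \<longleftrightarrow> h x - a * pw w \<in> B w" if "w \<le> r"
      using \<xi> that by (intro B_eq_iff) (simp add: B_times_pw B_mono)
    have 2: "h x - (a - \<xi> * pw (- int i)) * pw w = h x + \<xi> * pw r - a * pw w" if "w = r + int i" for i
      using that by (simp add: algebra_simps pw_add pw_minus)
    show ?thesis
    proof (cases "w \<le> r")
      case True
      then show ?thesis using 1 by auto
    next
      case False
      then obtain i where i: "w = r + int i" "1 \<le> i"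
        by (intro that[of "nat (w - r)"]) auto
      show ?thesis
      proof
        assume ?L
        then show ?R using False 2 by fastforce
      next
        assume R: ?R
        then have "h x - (a - \<xi> * pw (- int i)) * pw w \<in> B w" unfolding 2[OF i(1)] by blast
        then show ?L using R i by (intro disjI2 bexI[of _ i]) auto
      qed
    qed
  qed
  ultimately show ?thesis by simp
qed

end

section \<open>Preparation of definable sets\<close>

context ring_structure
begin

text \<open>For a unit \<open>\<xi>\<close> the point has distance exactly r from \<open>c\<close>,
  and admissibility says that no other centre is nearer. This is what blocks deep cancellation
  against the centres.\<close>

definition adm :: "('x \<Rightarrow> 'k) set \<Rightarrow> ('x \<Rightarrow> 'k) \<Rightarrow> 'k \<Rightarrow> 'x \<Rightarrow> int \<Rightarrow> bool" where
  "adm C c \<xi> x r \<longleftrightarrow> (\<forall>c'\<in>C. c x + \<xi> * pw r - c' x \<notin> B (r + 1))"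

text \<open>Cell decomposition of the sets \<open>S x\<close>: the truth at \<open>t\<close> depends
  only on a nearest centre, the valuation r of the distance to it and N leading digits of the
  difference. So \<open>S\<close> is known from its values at the arm points
  \<open>c x + \<xi> * pw r\<close> and at the centres, and there it has to be definable. Having 0
  among the centres forces \<open>0 \<le> r\<close> for integral points.\<close>

definition prep :: "('x \<Rightarrow> 'k) set \<Rightarrow> nat \<Rightarrow> ('x \<Rightarrow> 'k \<Rightarrow> (nat \<Rightarrow> int) \<Rightarrow> bool) \<Rightarrow> bool" where
  "prep C N S \<longleftrightarrow> finite C \<and> C \<subseteq> R \<and> (\<lambda>x. 0) \<in> C \<and> 1 \<le> N \<and>
     (\<forall>x t t' z r. (\<forall>c\<in>C. t - c x \<notin> B (r + 1)) \<longrightarrow> t - t' \<in> B (r + int N) \<longrightarrow> S x t z = S x t' z) \<and>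
     (\<forall>c\<in>C. \<forall>\<xi>\<in>B 0 - B 1. (\<lambda>x z. adm C c \<xi> x (z 0) \<and> S x (c x + \<xi> * pw (z 0)) (\<lambda>i. z (Suc i))) \<in> D) \<and>
     (\<forall>c\<in>C. (\<lambda>x z. S x (c x) z) \<in> D)"

lemma prepD:
  assumes "prep C N S"
  shows "finite C" "C \<subseteq> R" "(\<lambda>x. 0) \<in> C" "1 \<le> N"
    "\<And>x t t' z r. (\<And>c. c \<in> C \<Longrightarrow> t - c x \<notin> B (r + 1)) \<Longrightarrow> t - t' \<in> B (r + int N) \<Longrightarrow> S x t z = S x t' z"
    "\<And>c \<xi>. c \<in> C \<Longrightarrow> \<xi> \<in> B 0 - B 1 \<Longrightarrow>
       (\<lambda>x z. adm C c \<xi> x (z 0) \<and> S x (c x + \<xi> * pw (z 0)) (\<lambda>i. z (Suc i))) \<in> D"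
    "\<And>c. c \<in> C \<Longrightarrow> (\<lambda>x z. S x (c x) z) \<in> D"
  using assms unfolding prep_def by blast+

lemma prepI:
  assumes "finite C" "C \<subseteq> R" "(\<lambda>x. 0) \<in> C" "1 \<le> N"
    and inv: "\<And>x t t' z r. (\<And>c. c \<in> C \<Longrightarrow> t - c x \<notin> B (r + 1)) \<Longrightarrow> t - t' \<in> B (r + int N) \<Longrightarrow> S x t z = S x t' z"
    and arms: "\<And>c \<xi>. c \<in> C \<Longrightarrow> \<xi> \<in> B 0 - B 1 \<Longrightarrow>
       (\<lambda>x z. adm C c \<xi> x (z 0) \<and> S x (c x + \<xi> * pw (z 0)) (\<lambda>i. z (Suc i))) \<in> D"
    and "\<And>c. c \<in> C \<Longrightarrow> (\<lambda>x z. S x (c x) z) \<in> D"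
  shows "prep C N S"
  unfolding prep_def
proof (intro conjI allI impI ballI)
  fix x t t' z r assume "\<forall>c\<in>C. t - c x \<notin> B (r + 1)" "t - t' \<in> B (r + int N)"
  then show "S x t z = S x t' z" by (intro inv) auto
qed (fact assms)+

lemma D_adm:
  assumes "finite C" "C \<subseteq> R" "c \<in> R" "tm F"
  shows "(\<lambda>x z. adm C c \<xi> x (F x z)) \<in> D"
proof -
  have "(\<lambda>x z. \<forall>c'\<in>C. \<not> (c x - c' x) - (- \<xi>) * pw (F x z) \<in> B (F x z + 1)) \<in> D"
    using assms by (intro D_ball D_not D_fn_ball_shift R_def R_diff) auto
  moreover have "(c x - c' x) - (- \<xi>) * pw k = c x + \<xi> * pw k - c' x" for c' x k by simp
  ultimately show ?thesis by (simp only: adm_def)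
qed

lemma nearest:
  assumes "finite C" "C \<noteq> {}" "\<And>c. c \<in> C \<Longrightarrow> t \<noteq> c x"
  obtains c r where "c \<in> C" "t - c x \<in> B r" "\<And>c'. c' \<in> C \<Longrightarrow> t - c' x \<notin> B (r + 1)"
proof -
  define r where "r = Max ((\<lambda>c. v (t - c x)) ` C)"
  have "r \<in> (\<lambda>c. v (t - c x)) ` C" unfolding r_def using assms by (intro Max_in) auto
  then obtain c where c: "c \<in> C" "v (t - c x) = r" by auto
  have "t - c' x \<notin> B (r + 1)" if "c' \<in> C" for c'
  proof -
    have "v (t - c' x) \<le> r" unfolding r_def using assms that by (intro Max_ge) auto
    then show ?thesis using assms(3)[OF that] by (simp add: B_iff)
  qed
  moreover have "t - c x \<in> B r" using c assms(3)[OF c(1)] by (simp add: B_iff)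
  ultimately show ?thesis using that c by blast
qed

lemma arm_point:
  assumes "u \<in> B r" "u \<notin> B (r + 1)" "1 \<le> N"
  obtains \<xi> where "\<xi> \<in> E N - B 1" "u - \<xi> * pw r \<in> B (r + int N)"
proof -
  have "u / pw r \<in> B 0" using assms by (simp add: B_divide)
  then obtain \<xi> where \<xi>: "\<xi> \<in> E N" "u / pw r - \<xi> \<in> B (int N)" using ex_rep by blast
  then have "(u / pw r - \<xi>) * pw r \<in> B (r + int N)" by (simp add: B_times_pw)
  then have 1: "u - \<xi> * pw r \<in> B (r + int N)" by (simp add: left_diff_distrib)
  have "\<xi> \<notin> B 1"
  proof
    assume "\<xi> \<in> B 1"
    then have "\<xi> * pw r \<in> B (r + 1)" by (simp add: B_times_pw)
    moreover have "u - \<xi> * pw r \<in> B (r + 1)" using 1 by (rule B_mono) (use assms in simp)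
    ultimately show False using assms(2) B_eq_iff by blast
  qed
  then show ?thesis using that \<xi> 1 by blast
qed

lemma adm_of_near:
  assumes "\<And>c'. c' \<in> C \<Longrightarrow> t - c' x \<notin> B (r + 1)" "t - c x - \<xi> * pw r \<in> B (r + int N)" "1 \<le> N"
  shows "adm C c \<xi> x r"
  unfolding adm_def
proof
  fix c' assume "c' \<in> C"
  have "t - c x - \<xi> * pw r \<in> B (r + 1)" using assms(2) by (rule B_mono) (use assms(3) in simp)
  then have "(t - c' x) - (c x + \<xi> * pw r - c' x) \<in> B (r + 1)" by (simp add: algebra_simps)
  then show "c x + \<xi> * pw r - c' x \<notin> B (r + 1)" using assms(1)[OF \<open>c' \<in> C\<close>] B_eq_iff by blast
qed

lemma ex_arm:
  assumes "finite C" "C \<noteq> {}" "1 \<le> N" "\<And>c. c \<in> C \<Longrightarrow> t \<noteq> c x"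
  obtains c \<xi> r where "c \<in> C" "\<xi> \<in> E N - B 1" "t - c x - \<xi> * pw r \<in> B (r + int N)"
    "adm C c \<xi> x r" "t - c x \<in> B r" "\<And>c'. c' \<in> C \<Longrightarrow> t - c' x \<notin> B (r + 1)"
proof -
  obtain c r where c: "c \<in> C" "t - c x \<in> B r" "\<And>c'. c' \<in> C \<Longrightarrow> t - c' x \<notin> B (r + 1)"
    by (rule nearest[of C t x]) (use assms in auto)
  obtain \<xi> where \<xi>: "\<xi> \<in> E N - B 1" "t - c x - \<xi> * pw r \<in> B (r + int N)"
    using arm_point[OF c(2) c(3)[OF c(1)] assms(3)] by blast
  have "adm C c \<xi> x r" by (rule adm_of_near[of C t x r c \<xi> N]) (use c(3) \<xi>(2) assms(3) in auto)
  then show ?thesis using that[of c \<xi> r] c \<xi> by blast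
qed

lemma prep_arm_eq:
  assumes "prep C N S" "adm C c \<xi> x r" "t - c x - \<xi> * pw r \<in> B (r + int N)"
  shows "S x (c x + \<xi> * pw r) z = S x t z"
proof (rule prepD(5)[OF assms(1)])
  show "c x + \<xi> * pw r - c' x \<notin> B (r + 1)" if "c' \<in> C" for c'
    using assms(2) that by (simp add: adm_def)
  have "(c x + \<xi> * pw r) - t = - (t - c x - \<xi> * pw r)" by simp
  then show "c x + \<xi> * pw r - t \<in> B (r + int N)" using assms(3) by (metis B_minus_iff)
qed

text \<open>Every point is a centre or lies in the disc around an arm point of a nearest centre,
  with \<open>\<xi>\<close> in the finite set \<open>E N\<close>. A prepared set is thus described
  by finitely many families of discs, each indexed by one integer.\<close>

lemma prep_char:
  assumes "prep C N S"
  shows "S x t z \<longleftrightarrow> (\<exists>c\<in>C. t = c x \<and> S x (c x) z) \<or>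
    (\<exists>c\<in>C. \<exists>\<xi>\<in>E N - B 1. \<exists>r. t - c x - \<xi> * pw r \<in> B (r + int N) \<and>
       adm C c \<xi> x r \<and> S x (c x + \<xi> * pw r) z)" (is "_ \<longleftrightarrow> ?A \<or> ?B")
proof
  assume S: "S x t z"
  show "?A \<or> ?B"
  proof (cases "\<exists>c\<in>C. t = c x")
    case False
    obtain c \<xi> r where *: "c \<in> C" "\<xi> \<in> E N - B 1" "t - c x - \<xi> * pw r \<in> B (r + int N)" "adm C c \<xi> x r"
      by (rule ex_arm[of C N t x]) (use prepD(1,3,4)[OF assms] False in auto)
    then show ?thesis using prep_arm_eq[OF assms *(4,3), of z] S by blast
  qed (use S in auto)
next
  assume "?A \<or> ?B"
  then show "S x t z" using prep_arm_eq[OF assms] by blast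
qed

text \<open>By the cell description, substituting \<open>y\<close> into a prepared set involves
  \<open>y\<close> only through its differences with the centres. The guard \<open>G\<close> allows
  these differences to be controlled on part of the parameters only, as happens for arm
  points.\<close>

lemma D_pull:
  assumes S: "prep C N S" and G: "G \<in> D"
    and y: "\<And>c a. c \<in> C \<Longrightarrow>
      (\<lambda>x z. G x (\<lambda>i. z (Suc i)) \<and> y x (\<lambda>i. z (Suc i)) - c x - a * pw (z 0) \<in> B (z 0)) \<in> D"
  shows "(\<lambda>x z. G x z \<and> S x (y x z) z) \<in> D"
proof -
  have 1: "(\<lambda>x z. \<forall>k. G x z \<and> y x z - c x \<in> B k) \<in> D" if "c \<in> C" for c
    using y[OF that, of 0] by (intro D_all) simp
  have 2: "(\<lambda>x z. G x (\<lambda>i. z (Suc i)) \<and> y x (\<lambda>i. z (Suc i)) - c x - \<xi> * pw (z 0) \<in> B (z 0 + int N)) \<in> D"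
    if c: "c \<in> C" for c \<xi>
  proof -
    have "(\<lambda>x z. G x (\<lambda>i. z (Suc i)) \<and> y x (\<lambda>i. z (Suc i)) - c x - (\<xi> * pw (- int N)) * pw (z 0 + int N)
        \<in> B (z 0 + int N)) \<in> D"
      using D_subst[OF y[OF c, of "\<xi> * pw (- int N)"] tm_add[OF tm_var tm_const], of 0 "int N" Suc] by simp
    moreover have "(\<xi> * pw (- int N)) * pw (k + int N) = \<xi> * pw k" for k
      by (simp add: pw_add pw_minus)
    ultimately show ?thesis by simp
  qed
  have "(\<lambda>x z. (\<exists>c\<in>C. (\<forall>k. G x z \<and> y x z - c x \<in> B k) \<and> S x (c x) z) \<or>
    (\<exists>c\<in>C. \<exists>\<xi>\<in>E N - B 1. \<exists>r. (G x z \<and> y x z - c x - \<xi> * pw r \<in> B (r + int N)) \<and>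
       adm C c \<xi> x r \<and> S x (c x + \<xi> * pw r) z)) \<in> D"
  proof (rule D_disj)
    show "(\<lambda>x z. \<exists>c\<in>C. (\<forall>k. G x z \<and> y x z - c x \<in> B k) \<and> S x (c x) z) \<in> D"
      by (intro D_bex D_conj[OF 1] prepD(1,7)[OF S])
    show "(\<lambda>x z. \<exists>c\<in>C. \<exists>\<xi>\<in>E N - B 1. \<exists>r. (G x z \<and> y x z - c x - \<xi> * pw r \<in> B (r + int N)) \<and>
       adm C c \<xi> x r \<and> S x (c x + \<xi> * pw r) z) \<in> D"
      by (intro D_bex D_ex D_conj[OF 2] prepD(1)[OF S] prepD(6)[OF S]) (use E_sub in auto)
  qed
  moreover have "G x z \<and> S x (y x z) z \<longleftrightarrow> (\<exists>c\<in>C. (\<forall>k. G x z \<and> y x z - c x \<in> B k) \<and> S x (c x) z) \<or>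
    (\<exists>c\<in>C. \<exists>\<xi>\<in>E N - B 1. \<exists>r. (G x z \<and> y x z - c x - \<xi> * pw r \<in> B (r + int N)) \<and>
       adm C c \<xi> x r \<and> S x (c x + \<xi> * pw r) z)" for x z
  proof -
    have "y x z = c x \<longleftrightarrow> (\<forall>k. y x z - c x \<in> B k)" for c
      using B_all_zero[of "y x z - c x"] by auto
    then show ?thesis unfolding prep_char[OF S, of x "y x z" z] by blast
  qed
  ultimately show ?thesis by simp
qed

lemma prep_ren:
  assumes "prep C N S"
  shows "prep C N (\<lambda>x t z. S x t (\<lambda>i. z (\<sigma> i)))"
proof -
  have "(\<lambda>x z. adm C c \<xi> x (z 0) \<and> S x (c x + \<xi> * pw (z 0)) (\<lambda>i. z (Suc (\<sigma> i)))) \<in> D"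
    if "c \<in> C" "\<xi> \<in> B 0 - B 1" for c \<xi>
    using D_ren[OF prepD(6)[OF assms that], of "case_nat 0 (\<lambda>i. Suc (\<sigma> i))"] by simp
  moreover have "(\<lambda>x z. S x (c x) (\<lambda>i. z (\<sigma> i))) \<in> D" if "c \<in> C" for c
    using D_ren[OF prepD(7)[OF assms that], of \<sigma>] by simp
  ultimately show ?thesis unfolding prep_def
    using prepD(1-4)[OF assms] prepD(5)[OF assms] by blast
qed

text \<open>An admissible point has valuation at most r relative to every centre, so the ball test
  can succeed only for \<open>w \<le> r + L\<close>. In this range the sum is definable by
  \<open>D_bounded_add\<close>.\<close>

lemma D_arm_ball:
  assumes c: "c \<in> R" "c' \<in> C" "finite C" "C \<subseteq> R" and \<xi>: "\<xi> \<in> B 0"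
  shows "(\<lambda>x z. adm C c \<xi> x (z 1) \<and> c x + \<xi> * pw (z 1) - c' x - a * pw (z 0) \<in> B (z 0)) \<in> D"
proof -
  obtain L where L: "a \<in> B (- int L)" using B_ex by blast
  have "(\<lambda>x z. adm C c \<xi> x (z 1) \<and> z 0 \<le> z 1 + int L \<and>
     (c x - c' x) + \<xi> * pw (z 1) - a * pw (z 0) \<in> B (z 0)) \<in> D"
    using c \<xi> by (intro D_conj D_adm D_bounded_add R_def R_diff tm_intros) auto
  moreover have "adm C c \<xi> x r \<and> w \<le> r + int L \<and> (c x - c' x) + \<xi> * pw r - a * pw w \<in> B w \<longleftrightarrow>
    adm C c \<xi> x r \<and> c x + \<xi> * pw r - c' x - a * pw w \<in> B w" for x r w
  proof -
    have "w \<le> r + int L" if "adm C c \<xi> x r" "c x + \<xi> * pw r - c' x - a * pw w \<in> B w"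
    proof (rule ccontr)
      assume w: "\<not> w \<le> r + int L"
      then have "c x + \<xi> * pw r - c' x - a * pw w \<in> B (r + 1)" using that(2) by (auto elim: B_mono)
      moreover have "a * pw w \<in> B (r + 1)" using L w by (simp add: B_times_pw) (erule B_mono, simp)
      ultimately have "c x + \<xi> * pw r - c' x \<in> B (r + 1)" using B_eq_iff by blast
      then show False using that(1) c(2) by (auto simp: adm_def)
    qed
    moreover have "(c x - c' x) + \<xi> * pw r = c x + \<xi> * pw r - c' x" by simp
    ultimately show ?thesis by metis
  qed
  ultimately show ?thesis by simp
qed

text \<open>The old set is pulled back along the new arm points, whose distances to the old centres
  are controlled by admissibility. This lets two prepared sets share one decomposition.\<close>

lemma prep_refine:
  assumes S: "prep C N S" and C': "finite C'" "C \<subseteq> C'" "C' \<subseteq> R" "N \<le> N'"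
  shows "prep C' N' S"
proof -
  note p = prepD[OF S]
  have inv: "S x t z = S x t' z" if "\<And>c. c \<in> C' \<Longrightarrow> t - c x \<notin> B (r + 1)" "t - t' \<in> B (r + int N')" for x t t' z r
  proof (rule p(5))
    show "t - t' \<in> B (r + int N)" using that(2) by (rule B_mono) (use C' in simp)
  qed (use that C' in auto)
  have arms: "(\<lambda>x z. adm C' c' \<xi> x (z 0) \<and> S x (c' x + \<xi> * pw (z 0)) (\<lambda>i. z (Suc i))) \<in> D"
    if c': "c' \<in> C'" and \<xi>: "\<xi> \<in> B 0 - B 1" for c' \<xi>
  proof (rule D_pull[OF prep_ren[OF S]])
    show "(\<lambda>x z. adm C' c' \<xi> x (z 0)) \<in> D" using C' c' by (intro D_adm tm_var) auto
    fix c a assume "c \<in> C"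
    then have "(\<lambda>x z. adm C' c' \<xi> x (z 1) \<and> c' x + \<xi> * pw (z 1) - c x - a * pw (z 0) \<in> B (z 0)) \<in> D"
      using c' C' \<xi> by (intro D_arm_ball) auto
    then show "(\<lambda>x z. adm C' c' \<xi> x (z (Suc 0)) \<and> c' x + \<xi> * pw (z (Suc 0)) - c x - a * pw (z 0) \<in> B (z 0)) \<in> D"
      by simp
  qed
  have cent: "(\<lambda>x z. S x (c' x) z) \<in> D" if c': "c' \<in> C'" for c'
  proof -
    have "(\<lambda>x z. True \<and> S x (c' x) z) \<in> D"
    proof (rule D_pull[OF S D_True])
      fix c a assume "c \<in> C"
      then have "(\<lambda>x z. (c' x - c x) - a * pw (z 0) \<in> B (z 0)) \<in> D"
        using c' C' p by (intro D_fn_ball R_def R_diff tm_intros) auto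
      then show "(\<lambda>x z. True \<and> c' x - c x - a * pw (z 0) \<in> B (z 0)) \<in> D" by simp
    qed
    then show ?thesis by simp
  qed
  show ?thesis
  proof (rule prepI)
    show "S x t z = S x t' z" if "\<And>c. c \<in> C' \<Longrightarrow> t - c x \<notin> B (r + 1)" "t - t' \<in> B (r + int N')" for x t t' z r
      by (rule inv[OF that])
  qed (use C' p(1-4) arms cent in auto)
qed

section \<open>Closure of prepared sets under logic, and projection\<close>

definition prepared :: "('x \<Rightarrow> 'k \<Rightarrow> (nat \<Rightarrow> int) \<Rightarrow> bool) \<Rightarrow> bool" where
  "prepared S \<longleftrightarrow> (\<exists>C N. prep C N S)"

lemma prepared_D:
  assumes "P \<in> D"
  shows "prepared (\<lambda>x t z. P x z)"
  unfolding prepared_def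
proof (intro exI)
  show "prep {\<lambda>x. 0} 1 (\<lambda>x t z. P x z)"
    unfolding prep_def using assms D_ren[OF assms, of Suc] by (auto intro!: D_conj D_adm tm_var R_const)
qed

lemma prepared_not: "prepared S \<Longrightarrow> prepared (\<lambda>x t z. \<not> S x t z)"
proof -
  assume "prepared S"
  then obtain C N where p: "prep C N S" by (auto simp: prepared_def)
  have "(\<lambda>x z. adm C c \<xi> x (z 0) \<and> \<not> S x (c x + \<xi> * pw (z 0)) (\<lambda>i. z (Suc i))) \<in> D"
    if "c \<in> C" "\<xi> \<in> B 0 - B 1" for c \<xi>
  proof -
    have "(\<lambda>x z. adm C c \<xi> x (z 0) \<and> \<not> (adm C c \<xi> x (z 0) \<and> S x (c x + \<xi> * pw (z 0)) (\<lambda>i. z (Suc i)))) \<in> D"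
      using that prepD(1,2)[OF p] by (intro D_conj[OF D_adm D_not] prepD(6)[OF p] tm_var) auto
    then show ?thesis by (elim back_subst[of "\<lambda>P. P \<in> D"]) (intro ext, auto)
  qed
  then have "prep C N (\<lambda>x t z. \<not> S x t z)"
    by (intro prepI prepD(1-4)[OF p] D_not[OF prepD(7)[OF p]] arg_cong[of _ _ Not] prepD(5)[OF p]) auto
  then show ?thesis by (auto simp: prepared_def)
qed

lemma prepared_common:
  assumes "prepared S" "prepared S'"
  obtains C N where "prep C N S" "prep C N S'"
proof -
  from assms obtain C N C' N' where p: "prep C N S" "prep C' N' S'" by (auto simp: prepared_def)
  have "prep (C \<union> C') (max N N') S" "prep (C \<union> C') (max N N') S'"
    using prepD(1-4)[OF p(1)] prepD(1-4)[OF p(2)]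
    by (auto intro!: prep_refine[OF p(1)] prep_refine[OF p(2)])
  then show ?thesis using that by blast
qed

lemma prepared_conj: "prepared S \<Longrightarrow> prepared S' \<Longrightarrow> prepared (\<lambda>x t z. S x t z \<and> S' x t z)"
proof -
  assume "prepared S" "prepared S'"
  then obtain C N where p: "prep C N S" "prep C N S'" using prepared_common by blast
  have "(\<lambda>x z. adm C c \<xi> x (z 0) \<and> S x (c x + \<xi> * pw (z 0)) (\<lambda>i. z (Suc i)) \<and> S' x (c x + \<xi> * pw (z 0)) (\<lambda>i. z (Suc i))) \<in> D"
    if "c \<in> C" "\<xi> \<in> B 0 - B 1" for c \<xi>
    using D_conj[OF prepD(6)[OF p(1) that] prepD(6)[OF p(2) that]]
    by (elim back_subst[of "\<lambda>P. P \<in> D"]) (intro ext, auto)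
  moreover have "S x t z \<and> S' x t z \<longleftrightarrow> S x t' z \<and> S' x t' z"
    if "\<forall>c\<in>C. t - c x \<notin> B (r + 1)" "t - t' \<in> B (r + int N)" for x t t' z r
    using prepD(5)[OF p(1), of t x r t' z] prepD(5)[OF p(2), of t x r t' z] that by blast
  ultimately have "prep C N (\<lambda>x t z. S x t z \<and> S' x t z)" unfolding prep_def
    using prepD(1-4)[OF p(1)] D_conj[OF prepD(7)[OF p(1)] prepD(7)[OF p(2)]] by blast
  then show ?thesis by (auto simp: prepared_def)
qed

lemma prepared_ex: "prepared S \<Longrightarrow> prepared (\<lambda>x t z. \<exists>k. S x t (case_nat k z))"
proof -
  assume "prepared S"
  then obtain C N where p: "prep C N S" by (auto simp: prepared_def)
  \<comment> \<open>The arm radius occupies variable 0, but after the quantifier is moved outwards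
    the quantified value does; the renaming exchanges the two.\<close>
  let ?\<rho> = "case_nat 1 (case_nat 0 (\<lambda>i. Suc (Suc i)))"
  have "(\<lambda>x z. adm C c \<xi> x (z 0) \<and> (\<exists>k. S x (c x + \<xi> * pw (z 0)) (case_nat k (\<lambda>i. z (Suc i))))) \<in> D"
    if "c \<in> C" "\<xi> \<in> B 0 - B 1" for c \<xi>
  proof -
    have "(\<lambda>x z. \<exists>k. adm C c \<xi> x (z 0) \<and> S x (c x + \<xi> * pw (z 0)) (case_nat k (\<lambda>i. z (Suc i)))) \<in> D"
    proof (rule D_ex)
      have "(\<lambda>i. z (?\<rho> (Suc i))) = case_nat (z 0) (\<lambda>i. z (Suc (Suc i)))" for z :: "nat \<Rightarrow> int"
        by (rule ext) (simp split: nat.split)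
      then show "(\<lambda>x z. adm C c \<xi> x (z (Suc 0)) \<and>
          S x (c x + \<xi> * pw (z (Suc 0))) (case_nat (z 0) (\<lambda>i. z (Suc (Suc i))))) \<in> D"
        using D_ren[OF prepD(6)[OF p that], of ?\<rho>] by simp
    qed
    then show ?thesis by simp
  qed
  moreover have "(\<exists>k. S x t (case_nat k z)) = (\<exists>k. S x t' (case_nat k z))"
    if "\<forall>c\<in>C. t - c x \<notin> B (r + 1)" "t - t' \<in> B (r + int N)" for x t t' z r
    using prepD(5)[OF p, of t x r t'] that by blast
  ultimately have "prep C N (\<lambda>x t z. \<exists>k. S x t (case_nat k z))" unfolding prep_def
    using prepD(1-4)[OF p] D_ex_push[OF prepD(7)[OF p]] by blast
  then show ?thesis by (auto simp: prepared_def)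
qed

lemma prepared_ren: "prepared S \<Longrightarrow> prepared (\<lambda>x t z. S x t (\<lambda>i. z (\<sigma> i)))"
  using prep_ren unfolding prepared_def by blast

text \<open>A cell that meets the set contains its arm point, so the field quantifier reduces to
  finitely many centres and digits and one integer quantifier.\<close>

lemma D_project:
  assumes "prepared S"
  shows "(\<lambda>x z. \<exists>t. S x t z) \<in> D"
proof -
  obtain C N where p: "prep C N S" using assms by (auto simp: prepared_def)
  have "(\<lambda>x z. (\<exists>c\<in>C. S x (c x) z) \<or>
    (\<exists>c\<in>C. \<exists>\<xi>\<in>E N - B 1. \<exists>r. adm C c \<xi> x r \<and> S x (c x + \<xi> * pw r) z)) \<in> D"
    by (intro D_disj D_bex D_ex prepD(1)[OF p] prepD(6)[OF p] prepD(7)[OF p]) (use E_sub in auto)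
  moreover have "(\<exists>t. S x t z) \<longleftrightarrow> (\<exists>c\<in>C. S x (c x) z) \<or>
    (\<exists>c\<in>C. \<exists>\<xi>\<in>E N - B 1. \<exists>r. adm C c \<xi> x r \<and> S x (c x + \<xi> * pw r) z)" for x z
    using prep_char[OF p, of x _ z] by blast
  ultimately show ?thesis by simp
qed

section \<open>Polynomials with coefficients in the ring of definable functions\<close>

definition RP :: "nat \<Rightarrow> ('x \<Rightarrow> 'k poly) \<Rightarrow> bool" where
  "RP d p \<longleftrightarrow> (\<forall>x. degree (p x) \<le> d) \<and> (\<forall>k. (\<lambda>x. coeff (p x) k) \<in> R)"

lemma poly_sum_le: "degree (p :: 'k poly) \<le> d \<Longrightarrow> poly p t = (\<Sum>i\<le>d. coeff p i * t ^ i)"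
  using poly_as_sum_of_monoms'[of p d] by (metis (no_types, lifting) poly_sum poly_monom sum.cong)

lemma RP_eval:
  assumes "RP d p" "c \<in> R"
  shows "(\<lambda>x. poly (p x) (c x)) \<in> R"
proof -
  have "(\<lambda>x. \<Sum>i\<le>d. coeff (p x) i * c x ^ i) \<in> R"
    using assms by (intro R_sum R_mult R_power) (auto simp: RP_def)
  moreover have "(\<Sum>i\<le>d. coeff (p x) i * c x ^ i) = poly (p x) (c x)" for x
    using assms by (subst poly_sum_le[of "p x" d]) (auto simp: RP_def)
  ultimately show ?thesis by simp
qed

lemma RP_pderiv: "RP d p \<Longrightarrow> RP (d - 1) (\<lambda>x. pderiv (p x))"
  by (auto simp: RP_def degree_pderiv coeff_pderiv diff_le_mono intro!: R_mult R_const)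

lemma RP_T:
  assumes "RP d p" "c \<in> R"
  shows "RP d (\<lambda>x. T (c x) (p x))"
  unfolding RP_def
proof (intro conjI allI)
  fix k
  have c: "(\<lambda>x. coeff ([:c x, 1:] ^ i) k) \<in> R" for i
  proof (cases "k \<le> i")
    case True
    then show ?thesis by (simp add: coeff_linear_poly_power) (intro R_mult R_const R_power assms)
  next
    case False
    then show ?thesis by (simp add: coeff_eq_0 degree_linear_power R_const)
  qed
  have "(\<lambda>x. \<Sum>i\<le>d. coeff (p x) i * coeff ([:c x, 1:] ^ i) k) \<in> R"
    using assms by (intro R_sum R_mult c) (auto simp: RP_def)
  moreover have "coeff (T (c x) (p x)) k = (\<Sum>i\<le>d. coeff (p x) i * coeff ([:c x, 1:] ^ i) k)" for x
    using assms by (subst T_expand[of _ d]) (auto simp: RP_def coeff_sum)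
  ultimately show "(\<lambda>x. coeff (T (c x) (p x)) k) \<in> R" by simp
qed (use assms in \<open>auto simp: RP_def\<close>)

text \<open>Roots of the derivatives of all orders are included because
  \<open>stab_away_from_roots\<close> descends through the derivatives; only roots in the field
  itself have to be hit.\<close>

definition covers :: "('x \<Rightarrow> 'k) set \<Rightarrow> ('x \<Rightarrow> 'k poly) \<Rightarrow> bool" where
  "covers C p \<longleftrightarrow> (\<forall>x i y. p x \<noteq> 0 \<longrightarrow> (pderiv ^^ i) (p x) \<noteq> 0 \<longrightarrow> poly ((pderiv ^^ i) (p x)) y = 0 \<longrightarrow>
     (\<exists>c\<in>C. y = c x))"

lemma ex_prep_const:
  "\<exists>M\<ge>1. \<forall>p C x t r. RP d p \<longrightarrow> covers C p \<longrightarrow> p x \<noteq> 0 \<longrightarrow> (\<forall>c\<in>C. t - c x \<notin> B (r + 1)) \<longrightarrow>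
     stab (p x) t (r + int M) (int N)"
proof -
  obtain M where M: "M \<ge> 1" "\<And>p t r. degree p \<le> d \<Longrightarrow> p \<noteq> 0 \<Longrightarrow>
     (\<forall>i c. (pderiv ^^ i) p \<noteq> 0 \<longrightarrow> poly ((pderiv ^^ i) p) c = 0 \<longrightarrow> t - c \<notin> B (r + 1)) \<Longrightarrow>
     stab p t (r + int M) (int N)" using stab_away_from_roots[of d N] by blast
  show ?thesis
  proof (intro exI[of _ M] conjI allI impI)
    fix p C x t r assume "RP d p" "covers C p" "p x \<noteq> 0" "\<forall>c\<in>C. t - c x \<notin> B (r + 1)"
    note * = this
    show "stab (p x) t (r + int M) (int N)"
    proof (rule M(2))
      show "degree (p x) \<le> d" using *(1) by (simp add: RP_def)
      show "\<forall>i c. (pderiv ^^ i) (p x) \<noteq> 0 \<longrightarrow> poly ((pderiv ^^ i) (p x)) c = 0 \<longrightarrow> t - c \<notin> B (r + 1)"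
        using *(2-4) unfolding covers_def by metis
    qed fact
  qed (rule M(1))
qed

text \<open>Away from the covering centres the polynomial is stable on discs of relative size M,
  which gives the invariance. On an arm the same stability bounds the Taylor coefficients at the
  centre, so the value is a sum with cancellation at most \<open>d * M + N0\<close> and
  \<open>D_bounded_sum\<close> applies.\<close>

lemma prep_poly:
  assumes p: "RP d p" and C: "finite C" "C \<subseteq> R" "(\<lambda>x. 0) \<in> C" "covers C p"
  shows "\<exists>N. prep C N (\<lambda>x t z. poly (p x) t - a * pw (z 0) \<in> B (z 0))"
proof -
  obtain N1 where N1: "a \<in> B (- int N1)" using B_ex by blast
  define N0 where "N0 = Suc N1"
  have N0: "a \<in> B (- int N0)" using N1 by (rule B_mono) (simp add: N0_def)
  obtain M where M: "M \<ge> 1" "\<And>x t r. p x \<noteq> 0 \<Longrightarrow> (\<forall>c\<in>C. t - c x \<notin> B (r + 1)) \<Longrightarrow>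
     stab (p x) t (r + int M) (int N0)" using ex_prep_const[of d N0] p C(4) by blast
  let ?S = "\<lambda>x t z. poly (p x) t - a * pw (z 0) \<in> B (z 0 :: int)"
  have inv: "poly (p x) t - a * pw k \<in> B k \<longleftrightarrow> poly (p x) t' - a * pw k \<in> B k"
    if t: "\<forall>c\<in>C. t - c x \<notin> B (r + 1)" and tt: "t - t' \<in> B (r + int M)" for x t t' r k
  proof (cases "p x = 0")
    case False
    note st = M(2)[OF False t]
    then have nz: "poly (p x) t \<noteq> 0" by (simp add: stab_def)
    have d: "poly (p x) t - poly (p x) t' \<in> B (v (poly (p x) t) + int N0)"
      using stab_diff[OF st, of t'] tt by (simp add: B_minus_commute)
    have v': "poly (p x) t' \<noteq> 0" "v (poly (p x) t') = v (poly (p x) t)"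
      using v_close[OF nz B_mono[OF d]] by (auto simp: N0_def)
    \<comment> \<open>Since \<open>a * pw k\<close> has valuation at least \<open>k - N0\<close>,
      the test can succeed only up to this scale. Beyond it both tests fail, and below it the two
      values are close enough.\<close>
    have key: "k \<le> v A + int N0" if "A - a * pw k \<in> B k" "A \<noteq> 0" for A
    proof -
      have "a * pw k \<in> B (k - int N0)" using N0 by (simp add: B_times_pw)
      moreover have "A - a * pw k \<in> B (k - int N0)" using that(1) by (rule B_mono) simp
      ultimately have "A \<in> B (k - int N0)" using B_eq_iff by blast
      then show ?thesis using that(2) by (simp add: B_iff)
    qed
    show ?thesis
    proof (cases "k \<le> v (poly (p x) t) + int N0")
      case True
      then have "(poly (p x) t - a * pw k) - (poly (p x) t' - a * pw k) \<in> B k"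
        using d by (auto elim: B_mono)
      then show ?thesis by (rule B_eq_iff)
    next
      case False
      then show ?thesis using key[of "poly (p x) t"] key[of "poly (p x) t'"] nz v' by auto
    qed
  qed simp
  have arms: "(\<lambda>x z. adm C c \<xi> x (z 0) \<and> poly (p x) (c x + \<xi> * pw (z 0)) - a * pw (z (Suc 0)) \<in> B (z (Suc 0))) \<in> D"
    if c: "c \<in> C" and \<xi>: "\<xi> \<in> B 0 - B 1" for c \<xi>
  proof -
    let ?b = "\<lambda>k x. coeff (T (c x) (p x)) k"
    let ?L = "d * M + N0"
    have "RP d (\<lambda>x. T (c x) (p x))" using p c C by (intro RP_T) auto
    then have b: "?b k \<in> R" for k by (simp add: RP_def)
    have "(\<lambda>x z. adm C c \<xi> x (z 0) \<and> (\<forall>k\<le>d. ?b k x \<in> B (z 1 - int ?L - int k * z 0)) \<and>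
       (\<Sum>k\<le>d. ?b k x * (\<xi> * pw (z 0)) ^ k) - a * pw (z 1) \<in> B (z 1)) \<in> D"
      using c C \<xi> by (intro D_conj[OF D_adm D_bounded_sum] b tm_var) auto
    moreover have "adm C c \<xi> x r \<and> (\<forall>k\<le>d. ?b k x \<in> B (w - int ?L - int k * r)) \<and>
       (\<Sum>k\<le>d. ?b k x * (\<xi> * pw r) ^ k) - a * pw w \<in> B w \<longleftrightarrow>
       adm C c \<xi> x r \<and> poly (p x) (c x + \<xi> * pw r) - a * pw w \<in> B w" for x r w
    proof -
      have eq: "(\<Sum>k\<le>d. ?b k x * (\<xi> * pw r) ^ k) = poly (p x) (c x + \<xi> * pw r)"
        using poly_sum_le[of "T (c x) (p x)" d "\<xi> * pw r"] p by (simp add: poly_T RP_def)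
      have "?b k x \<in> B (w - int ?L - int k * r)"
        if a: "adm C c \<xi> x r" and t: "poly (p x) (c x + \<xi> * pw r) - a * pw w \<in> B w" for k
      proof (cases "p x = 0")
        case False
        let ?t = "c x + \<xi> * pw r"
        have st: "stab (p x) ?t (r + int M) (int N0)"
          using a by (intro M(2) False) (auto simp: adm_def)
        then have nz: "poly (p x) ?t \<noteq> 0" by (simp add: stab_def)
        have "a * pw w \<in> B (w - int N0)" using N0 by (simp add: B_times_pw)
        moreover have "poly (p x) ?t - a * pw w \<in> B (w - int N0)" using t by (rule B_mono) simp
        ultimately have "poly (p x) ?t \<in> B (w - int N0)" using B_eq_iff by blast
        then have "w - int N0 \<le> v (poly (p x) ?t)" using nz by (simp add: B_iff)
        moreover have "?b k x \<in> B (v (poly (p x) ?t) - int (d * M) - int k * r)"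
          using p \<xi> by (intro stab_coeff_bound[OF st]) (auto simp: RP_def B_times_pw)
        ultimately show ?thesis by (elim B_mono) simp
      qed simp
      then show ?thesis using eq by auto
    qed
    ultimately show ?thesis by simp
  qed
  have "(\<lambda>x z. poly (p x) (c x) - a * pw (z 0) \<in> B (z 0)) \<in> D" if "c \<in> C" for c
    using that C p by (intro D_fn_ball R_def RP_eval tm_var) auto
  then have "prep C M ?S" unfolding prep_def using C M(1) inv arms by blast
  then show ?thesis by blast
qed

end

section \<open>Roots of polynomials over the ring of definable functions\<close>

context local_field
begin

lemma ball_iff_of_close:
  assumes a: "a \<in> B (- int N)" and N: "1 \<le> N" and A: "A \<noteq> 0" and AA: "A - A' \<in> B (v A + int N)"
  shows "A - a * pw k \<in> B k \<longleftrightarrow> A' - a * pw k \<in> B k"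
proof -
  have A': "A' \<noteq> 0" "v A' = v A" using v_close[OF A B_mono[OF AA]] N by auto
  have key: "k \<le> v X + int N" if "X - a * pw k \<in> B k" "X \<noteq> 0" for X
  proof -
    have "a * pw k \<in> B (k - int N)" using a by (simp add: B_times_pw)
    moreover have "X - a * pw k \<in> B (k - int N)" using that(1) by (rule B_mono) simp
    ultimately have "X \<in> B (k - int N)" using B_eq_iff by blast
    then show ?thesis using that(2) by (simp add: B_iff)
  qed
  show ?thesis
  proof (cases "k \<le> v A + int N")
    case True
    then have "(A - a * pw k) - (A' - a * pw k) \<in> B k" using AA by (auto elim: B_mono)
    then show ?thesis by (rule B_eq_iff)
  next
    case False
    then show ?thesis using key[of A] key[of A'] A A' by auto
  qed
qed

text \<open>One Newton step from \<open>s\<close> finds \<open>Y - s\<close> to relative precision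
  N. The gain is that the step is a quotient of polynomial values, hence in the ring when
  \<open>s\<close> is, whereas the root \<open>Y\<close> is not yet known to be there.\<close>

lemma Newton_step_close:
  assumes lin: "lin p t \<rho> N" and Y: "poly p Y = 0" "Y - t \<in> B \<rho>" and s: "s - t \<in> B \<rho>"
    and st: "stab (pderiv p) t \<rho> N" and N: "1 \<le> N" and ne: "Y \<noteq> s"
  shows "(Y - s) - (- poly p s / poly (pderiv p) s) \<in> B (v (Y - s) + N)"
proof -
  define A where "A = coeff (T t p) 1"
  define A' where "A' = poly (pderiv p) s"
  have A: "A \<noteq> 0" using lin by (simp add: lin_def A_def)
  have d: "A' - A \<in> B (v A + N)"
    using stab_diff[OF st s] by (simp only: A'_def A_def coeff_T_1)
  then have "A' - A \<in> B (v A + 1)" by (rule B_mono) (use N in simp)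
  then have "A - A' \<in> B (v A + 1)" by (subst B_minus_commute)
  then have A': "A' \<noteq> 0" "v A' = v A" using v_close[OF A, of A'] by auto
  have vv: "v (s - Y) = v (Y - s)" using v_minus[of "s - Y"] by simp
  have "poly p s - poly p Y - A * (s - Y) \<in> B (v A + v (s - Y) + N)"
    unfolding A_def by (rule lin_diff[OF lin Y(2) s]) (use ne in \<open>simp add: B_iff\<close>)
  then have "poly p s - A * (s - Y) \<in> B (v A + v (Y - s) + N)" using Y(1) vv by simp
  moreover have "(A' - A) * (s - Y) \<in> B (v A + v (Y - s) + N)"
    using d by (rule B_mult'[of _ _ _ "v (Y - s)"]) (use ne vv in \<open>auto simp: B_iff\<close>)
  ultimately have "(poly p s - A * (s - Y)) - (A' - A) * (s - Y) \<in> B (v A + v (Y - s) + N)"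
    by (rule B_diff)
  then have "((poly p s - A * (s - Y)) - (A' - A) * (s - Y)) / A' \<in> B (v (Y - s) + N)"
    using A' by (simp add: B_divide algebra_simps)
  also have "((poly p s - A * (s - Y)) - (A' - A) * (s - Y)) / A' = (Y - s) - (- poly p s / A')"
    using A' by (simp add: field_simps)
  finally show ?thesis by (simp add: A'_def)
qed

end

context ring_structure
begin

lemma RP_mono: "RP d p \<Longrightarrow> d \<le> d' \<Longrightarrow> RP d' p"
  unfolding RP_def using order_trans by blast

lemma RP_add: "RP d p \<Longrightarrow> RP d q \<Longrightarrow> RP d (\<lambda>x. p x + q x)"
  unfolding RP_def by (auto intro: degree_add_le)

lemma RP_diff: "RP d p \<Longrightarrow> RP d q \<Longrightarrow> RP d (\<lambda>x. p x - q x)"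
  unfolding RP_def by (auto intro: degree_diff_le)

lemma RP_mult:
  assumes "RP m p" "RP n q"
  shows "RP (m + n) (\<lambda>x. p x * q x)"
  unfolding RP_def
proof (intro conjI allI)
  show "degree (p x * q x) \<le> m + n" for x
    using assms by (intro order_trans[OF degree_mult_le] add_mono) (auto simp: RP_def)
  show "(\<lambda>x. coeff (p x * q x) k) \<in> R" for k
    unfolding coeff_mult using assms by (intro R_sum R_mult) (auto simp: RP_def)
qed

lemma RP_monom: "a \<in> R \<Longrightarrow> RP n (\<lambda>x. monom (a x) n)"
  unfolding RP_def
proof (intro conjI allI)
  fix k assume "a \<in> R"
  then show "(\<lambda>x. coeff (monom (a x) n) k) \<in> R" by (cases "n = k") (auto simp: R_const)
qed (simp add: degree_monom_le)

lemma RP_sum: "(\<And>i. i \<in> A \<Longrightarrow> RP n (f i)) \<Longrightarrow> RP n (\<lambda>x. \<Sum>i\<in>A. f i x)"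
proof (induction A rule: infinite_finite_induct)
  case (insert a A)
  then show ?case by (simp add: RP_add)
qed (auto simp: RP_def R_const)

lemma RP_const: "a \<in> R \<Longrightarrow> RP n (\<lambda>x. [:a x:])"
  using RP_mono[OF RP_monom[of a 0]] by (simp add: monom_0)

lemma RP_smult: "a \<in> R \<Longrightarrow> RP n p \<Longrightarrow> RP n (\<lambda>x. smult (a x) (p x))"
  using RP_mult[OF RP_const[of a 0], of n p] by simp

lemma RP_higher_pderiv: "RP d p \<Longrightarrow> RP (d - i) (\<lambda>x. (pderiv ^^ i) (p x))"
proof (induction i)
  case (Suc i)
  then show ?case using RP_pderiv[of "d - i"] by simp
qed simp

definition secs :: "('x \<Rightarrow> 'k) set \<Rightarrow> ('x \<Rightarrow> 'k poly) \<Rightarrow> bool" where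
  "secs C p \<longleftrightarrow> finite C \<and> C \<subseteq> R \<and> (\<forall>x y. p x \<noteq> 0 \<longrightarrow> poly (p x) y = 0 \<longrightarrow> (\<exists>c\<in>C. y = c x))"

lemma ex_covers:
  assumes IH: "\<And>n q. n \<le> d \<Longrightarrow> RP n q \<Longrightarrow> \<exists>C. secs C q" and p: "RP d p"
  shows "\<exists>C. finite C \<and> C \<subseteq> R \<and> (\<lambda>x. 0) \<in> C \<and> covers C p"
proof -
  have "\<forall>i. \<exists>C. secs C (\<lambda>x. (pderiv ^^ i) (p x))"
    using IH[OF _ RP_higher_pderiv[OF p]] by auto
  then obtain C where C: "\<And>i. secs (C i) (\<lambda>x. (pderiv ^^ i) (p x))" by metis
  have big: "(pderiv ^^ i) (p x) = 0" if "d < i" for i x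
  proof -
    define j where "j = i - 1"
    have j: "i = Suc j" "d \<le> j" using that by (auto simp: j_def)
    have "degree ((pderiv ^^ j) (p x)) = 0" using RP_higher_pderiv[OF p, of j] j(2) by (simp add: RP_def)
    then show ?thesis using j(1) by (simp add: pderiv_eq_0_iff)
  qed
  show ?thesis
  proof (intro exI conjI)
    show "covers (insert (\<lambda>x. 0) (\<Union>i\<le>d. C i)) p"
      unfolding covers_def
    proof (intro allI impI)
      fix x i y assume "p x \<noteq> 0" "(pderiv ^^ i) (p x) \<noteq> 0" "poly ((pderiv ^^ i) (p x)) y = 0"
      moreover then have "i \<le> d" using big not_le by blast
      ultimately show "\<exists>c\<in>insert (\<lambda>x. 0) (\<Union>i\<le>d. C i). y = c x"
        using C[of i] unfolding secs_def by blast
    qed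
  qed (use C in \<open>auto simp: secs_def R_const\<close>)
qed

end

text \<open>Induction step on the degree for finding root functions in \<open>R\<close>:
  \<open>C1\<close> covers the derivative, and polynomials of degree below \<open>d\<close> already
  have covering centres. The coefficient \<open>lc\<close> may vanish for some parameters.\<close>

locale root_step = ring_structure v D R
  for v :: "'k::field_char_0 \<Rightarrow> int" and D :: "('x \<Rightarrow> (nat \<Rightarrow> int) \<Rightarrow> bool) set" and R +
  fixes d :: nat and p :: "'x \<Rightarrow> 'k poly" and C1 :: "('x \<Rightarrow> 'k) set"
  assumes d_pos: "1 \<le> d" and RP_p: "RP d p"
    and C1: "finite C1" "C1 \<subseteq> R" "(\<lambda>x. 0) \<in> C1" "covers C1 (\<lambda>x. pderiv (p x))"
    and lower_covers: "\<And>g. RP (d - 1) g \<Longrightarrow> \<exists>C. finite C \<and> C \<subseteq> R \<and> (\<lambda>x. 0) \<in> C \<and> covers C g"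
begin

abbreviation lc :: "'x \<Rightarrow> 'k" where "lc x \<equiv> coeff (p x) d"

lemma degree_p: "degree (p x) \<le> d" and coeff_p: "(\<lambda>x. coeff (p x) k) \<in> R"
  using RP_p by (auto simp: RP_def)

lemma pderiv_nz: "lc x \<noteq> 0 \<Longrightarrow> pderiv (p x) \<noteq> 0"
  using d_pos le_degree[of "p x" d] by (auto simp: pderiv_eq_0_iff)

definition V :: nat where "V = (SOME V. \<forall>k. 0 < k \<longrightarrow> k \<le> d \<longrightarrow> v (of_nat k) \<le> int V)"

lemma V: "0 < k \<Longrightarrow> k \<le> d \<Longrightarrow> v (of_nat k) \<le> int V"
  using someI_ex[OF ex_val_bound[of d]] unfolding V_def by blast

lemma ex_MM:
  "\<exists>M\<ge>1. \<forall>x t r. lc x \<noteq> 0 \<longrightarrow> (\<forall>c\<in>C1. t - c x \<notin> B (r + 1)) \<longrightarrow>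
     stab (pderiv (p x)) t (r + int M) (int (N + V))"
proof -
  have "RP (d - 1) (\<lambda>x. pderiv (p x))" by (rule RP_pderiv[OF RP_p])
  then show ?thesis using ex_prep_const[of "d - 1" "N + V"] C1(4) pderiv_nz by metis
qed

text \<open>Relative size of the discs, away from the centres of the derivative, on which
  \<open>p x\<close> is linear to precision N. The additional V in the stability of the derivative
  pays for the integration in \<open>lin_of_stab_pderiv\<close>.\<close>

definition MM :: "nat \<Rightarrow> nat" where
  "MM N = (SOME M. M \<ge> 1 \<and> (\<forall>x t r. lc x \<noteq> 0 \<longrightarrow> (\<forall>c\<in>C1. t - c x \<notin> B (r + 1)) \<longrightarrow>
     stab (pderiv (p x)) t (r + int M) (int (N + V))))"

lemma MM: "MM N \<ge> 1"
  "lc x \<noteq> 0 \<Longrightarrow> \<forall>c\<in>C1. t - c x \<notin> B (r + 1) \<Longrightarrow>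
     stab (pderiv (p x)) t (r + int (MM N)) (int N + int V)"
  using someI_ex[OF ex_MM[of N]] unfolding MM_def by auto

lemma lin_p:
  assumes "lc x \<noteq> 0" "\<forall>c\<in>C1. t - c x \<notin> B (r + 1)" "MM N \<le> m"
  shows "lin (p x) t (r + int m) (int N)"
  using lin_mono[OF lin_of_stab_pderiv[OF MM(2)[OF assms(1,2)] degree_p V]] assms(3) by simp

definition Rt :: "('x \<Rightarrow> 'k) \<Rightarrow> 'k \<Rightarrow> nat \<Rightarrow> 'x \<Rightarrow> int \<Rightarrow> bool" where
  "Rt c \<xi> m x r \<longleftrightarrow> lc x \<noteq> 0 \<and> adm C1 c \<xi> x r \<and>
     (\<exists>y. poly (p x) y = 0 \<and> y - (c x + \<xi> * pw r) \<in> B (r + int m))"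

text \<open>By Hensel a root near the arm point exists exactly when the value there lies in a ball
  whose radius is the valuation of the derivative plus \<open>r + m\<close>. That valuation w is
  read off from the prepared sets of the derivative (\<open>?Q\<close>), and the value is tested as
  a sum with bounded cancellation (\<open>?U\<close>).\<close>

lemma D_Rt:
  assumes c: "c \<in> C1" and \<xi>: "\<xi> \<in> B 0 - B 1" and m: "MM 1 \<le> m"
  shows "(\<lambda>x z. Rt c \<xi> m x (z 0)) \<in> D"
proof -
  \<comment> \<open>Three losses add up: m from the size of the disc, \<open>d * MM 1\<close> from
    recentring at the centre, and V from dividing the coefficients of the derivative by k.\<close>
  define L where "L = m + d * MM 1 + V"
  let ?b = "\<lambda>k x. coeff (T (c x) (p x)) k"
  let ?t = "\<lambda>x r. c x + \<xi> * pw r"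
  let ?Q = "\<lambda>x r w. adm C1 c \<xi> x r \<and> poly (pderiv (p x)) (?t x r) \<in> B w"
  let ?U = "\<lambda>x r w. (\<forall>k\<le>d. ?b k x \<in> B (w - int L - int k * r)) \<and> (\<Sum>k\<le>d. ?b k x * (\<xi> * pw r) ^ k) \<in> B w"
  have cR: "c \<in> R" using c C1 by blast
  have b: "?b k \<in> R" for k using RP_T[OF RP_p cR] by (simp add: RP_def)
  have Q: "(\<lambda>x z. ?Q x (z 0) (z 1)) \<in> D"
  proof -
    obtain N where "prep C1 N (\<lambda>x t z. poly (pderiv (p x)) t - 0 * pw (z 0) \<in> B (z 0))"
      using prep_poly[OF RP_pderiv[OF RP_p] C1] by blast
    from prepD(6)[OF this c \<xi>] show ?thesis by simp
  qed
  have U: "(\<lambda>x z. ?U x (z 0) (z 1)) \<in> D"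
    using D_bounded_sum[of d ?b \<xi> L 0] b \<xi> by simp
  have Q1: "(\<lambda>x z. ?Q x (z (Suc 0)) (z 0)) \<in> D"
    by (rule D_subst2[OF Q]) (intro tm_intros)+
  have Q2: "(\<lambda>x z. ?Q x (z (Suc 0)) (z 0 + 1)) \<in> D"
    by (rule D_subst2[OF Q]) (intro tm_intros)+
  have U1: "(\<lambda>x z. ?U x (z (Suc 0)) (z 0 + z (Suc 0) + int m)) \<in> D"
    by (rule D_subst2[OF U]) (intro tm_intros)+
  have "(\<lambda>x z. \<not> lc x = 0 \<and> (\<exists>w. ?Q x (z 0) w \<and> \<not> ?Q x (z 0) (w + 1) \<and> ?U x (z 0) (w + z 0 + int m))) \<in> D"
    by (rule D_conj[OF D_not[OF D_fn_zero[OF R_def[OF coeff_p]]]], rule D_ex)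
       (rule D_conj[OF Q1 D_conj[OF D_not[OF Q2] U1]])
  moreover have "Rt c \<xi> m x r \<longleftrightarrow> \<not> lc x = 0 \<and> (\<exists>w. ?Q x r w \<and> \<not> ?Q x r (w + 1) \<and> ?U x r (w + r + int m))"
    for x r
  proof (cases "lc x \<noteq> 0 \<and> adm C1 c \<xi> x r")
    case True
    then have away: "\<forall>c'\<in>C1. ?t x r - c' x \<notin> B (r + 1)" by (auto simp: adm_def)
    note lin = lin_p[OF conjunct1[OF True] away m]
    note st = MM(2)[OF conjunct1[OF True] away, of 1]
    let ?w = "v (poly (pderiv (p x)) (?t x r))"
    have nz: "poly (pderiv (p x)) (?t x r) \<noteq> 0" using st by (simp add: stab_def)
    have eq: "(\<Sum>k\<le>d. ?b k x * (\<xi> * pw r) ^ k) = poly (p x) (?t x r)"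
      using poly_sum_le[of "T (c x) (p x)" d "\<xi> * pw r"] degree_p by (simp add: poly_T)
    have b1: "?b k x \<in> B (?w + r - int (d * MM 1) - int V - int k * r)" if k: "1 \<le> k" "k \<le> d" for k
    proof -
      obtain j where j: "k = Suc j" using k by (cases k) auto
      have "coeff (T (c x) (pderiv (p x))) j \<in> B (?w - int ((d - 1) * MM 1) - int j * r)"
        by (rule stab_coeff_bound[OF st])
           (use \<xi> degree_p[of x] in \<open>auto simp: B_times_pw degree_pderiv diff_le_mono\<close>)
      then have "?b k x * of_nat k \<in> B (?w - int ((d - 1) * MM 1) - int j * r)"
        using coeff_pderiv[of "T (c x) (p x)" j] j by (simp add: pderiv_T mult.commute)
      then have "?b k x \<in> B (?w - int ((d - 1) * MM 1) - int j * r - v (of_nat k))"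
        using k by (subst (asm) B_mult_left) auto
      moreover have "int ((d - 1) * MM 1) \<le> int (d * MM 1)"
        by (rule of_nat_mono, rule mult_right_mono) auto
      ultimately show ?thesis using V[of k] k j by (elim B_mono) (auto simp: algebra_simps)
    qed
    have iL: "int L = int m + int (d * MM 1) + int V" by (simp add: L_def)
    have bd: "?b k x \<in> B (?w + r + int m - int L - int k * r)"
      if t: "poly (p x) (?t x r) \<in> B (?w + r + int m)" and k: "k \<le> d" for k
    proof (cases "k = 0")
      case False
      then show ?thesis using b1[of k] k by (simp add: L_def algebra_simps)
    next
      case True
      \<comment> \<open>The constant coefficient is not controlled by the derivative; it is
        recovered as the value at the arm point minus the terms already bounded.\<close>
      have e: "poly (p x) (?t x r) = (\<Sum>k\<in>{..d} - {0}. ?b k x * (\<xi> * pw r) ^ k) + ?b 0 x"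
        unfolding eq[symmetric] by (subst sum.remove[of _ 0]) auto
      have s1: "(\<Sum>k\<in>{..d} - {0}. ?b k x * (\<xi> * pw r) ^ k) \<in> B (?w + r + int m - int L)"
      proof (rule B_sum)
        fix k assume "k \<in> {..d} - {0}"
        then have "?b k x \<in> B (?w + r - int (d * MM 1) - int V - int k * r)" by (intro b1) auto
        moreover have "(\<xi> * pw r) ^ k \<in> B (int k * r)"
          using \<xi> by (intro B_power) (simp add: B_times_pw)
        ultimately show "?b k x * (\<xi> * pw r) ^ k \<in> B (?w + r + int m - int L)"
          by (rule B_mult') (use iL in linarith)
      qed
      have s2: "poly (p x) (?t x r) \<in> B (?w + r + int m - int L)" using t by (rule B_mono) simp
      have "?b 0 x \<in> B (?w + r + int m - int L)" using B_diff[OF s2 s1] e by simp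
      then show ?thesis using True by simp
    qed
    have root: "Rt c \<xi> m x r \<longleftrightarrow> poly (p x) (?t x r) \<in> B (?w + r + int m)"
      using lin_root_iff[OF lin] True by (simp add: Rt_def coeff_T_1[simplified] add.assoc)
    show ?thesis
    proof
      assume "Rt c \<xi> m x r"
      then have t: "poly (p x) (?t x r) \<in> B (?w + r + int m)" using root by simp
      have "?U x r (?w + r + int m)" using bd[OF t] t eq by auto
      then show "\<not> lc x = 0 \<and> (\<exists>w. ?Q x r w \<and> \<not> ?Q x r (w + 1) \<and> ?U x r (w + r + int m))"
        using True nz by (intro conjI exI[of _ ?w]) (auto simp: B_iff)
    next
      assume "\<not> lc x = 0 \<and> (\<exists>w. ?Q x r w \<and> \<not> ?Q x r (w + 1) \<and> ?U x r (w + r + int m))"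
      then obtain w where w: "?Q x r w" "\<not> ?Q x r (w + 1)" "?U x r (w + r + int m)" by blast
      then have "?w = w" using v_eqI[of _ w] by blast
      then show "Rt c \<xi> m x r" unfolding root using w(3) eq by simp
    qed
  qed (auto simp: Rt_def)
  ultimately show ?thesis by simp
qed

lemma Rt_away:
  assumes "adm C1 c \<xi> x r" "y - (c x + \<xi> * pw r) \<in> B (r + 1)" "c' \<in> C1"
  shows "y - c' x \<notin> B (r + 1)"
proof -
  have "c x + \<xi> * pw r - c' x \<notin> B (r + 1)" using assms by (simp add: adm_def)
  moreover have "(y - c' x) - (c x + \<xi> * pw r - c' x) \<in> B (r + 1)"
    using assms(2) by (simp add: algebra_simps)
  ultimately show ?thesis using B_eq_iff by blast
qed

lemma Rt_unique:
  assumes "lc x \<noteq> 0" "adm C1 c \<xi> x r" "MM 1 \<le> m"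
    "poly (p x) y = 0" "y - (c x + \<xi> * pw r) \<in> B (r + int m)"
    "poly (p x) y' = 0" "y' - (c x + \<xi> * pw r) \<in> B (r + int m)"
  shows "y = y'"
proof (rule lin_root_unique)
  show "lin (p x) (c x + \<xi> * pw r) (r + int m) (int 1)"
    using assms by (intro lin_p) (auto simp: adm_def)
qed (use assms in auto)

end

text \<open>\<open>P\<close> selects at most one radius for each parameter, and \<open>y\<close> is
  the root in the disc of that arm, with default value 0 where nothing is selected. Because this
  root is unique, conditions on \<open>y\<close> can be rephrased as existence of a root in a
  smaller disc.\<close>

locale root_section = root_step v D R d p C1
  for v :: "'k::field_char_0 \<Rightarrow> int" and D :: "('x \<Rightarrow> (nat \<Rightarrow> int) \<Rightarrow> bool) set" and R d p C1 +
  fixes c :: "'x \<Rightarrow> 'k" and \<xi> :: 'k and P :: "'x \<Rightarrow> int \<Rightarrow> bool" and y :: "'x \<Rightarrow> 'k"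
  assumes c: "c \<in> C1" and \<xi>: "\<xi> \<in> B 0 - B 1"
    and DP: "(\<lambda>x z. P x (z 0)) \<in> D"
    and P_lc: "P x r \<Longrightarrow> lc x \<noteq> 0" and P_adm: "P x r \<Longrightarrow> adm C1 c \<xi> x r"
    and P_unique: "P x r \<Longrightarrow> P x r' \<Longrightarrow> r = r'"
    and P_root: "P x r \<Longrightarrow> poly (p x) (y x) = 0"
    and P_near: "P x r \<Longrightarrow> y x - (c x + \<xi> * pw r) \<in> B (r + int (MM 1))"
    and y_else: "(\<And>r. \<not> P x r) \<Longrightarrow> y x = 0"
begin

text \<open>Refine \<open>\<xi>\<close> to L digits \<open>\<xi>'\<close> of the root. If
  \<open>c'\<close> is close to the refined arm point, the Newton step \<open>h\<close> from
  \<open>c'\<close> has the same leading digits as \<open>y - c'\<close>. If not,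
  \<open>y - c'\<close> is not small, and the arm point may replace \<open>y\<close> in a sum with
  bounded cancellation.\<close>

lemma def_y_diff:
  assumes c': "c' \<in> R"
  shows "def_fn (\<lambda>x. y x - c' x)"
  unfolding def_fn_def
proof
  fix a
  obtain N1 where "a \<in> B (- int N1)" using B_ex by blast
  then have N: "a \<in> B (- int (Suc N1))" by (rule B_mono) simp
  define N where "N = Suc N1"
  note N = N[folded N_def]
  define Ma where "Ma = max (MM N) (MM 1)"
  \<comment> \<open>\<open>Ma\<close> separates near from far \<open>c'\<close>. In the far case
    \<open>y - c'\<close> has valuation below \<open>r + Ma\<close>, so N further digits of the root
    settle the ball test.\<close>
  define L where "L = Ma + N"
  define h where "h x = - poly (p x) (c' x) / poly (pderiv (p x)) (c' x)" for x
  have hR: "h \<in> R" unfolding h_def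
    using RP_eval[OF RP_p c'] RP_eval[OF RP_pderiv[OF RP_p] c'] by (intro R_divide R_uminus)
  have cR: "c \<in> R" using c C1 by blast
  let ?X = "{\<xi>'\<in>E L. \<xi>' - \<xi> \<in> B (int (MM 1))}"
  have X: "\<xi>' \<in> B 0 - B 1" if "\<xi>' \<in> ?X" for \<xi>'
  proof -
    have "\<xi>' - \<xi> \<in> B 1" using that MM(1)[of 1] by (auto elim: B_mono)
    then have "\<xi>' \<in> B 1 \<longleftrightarrow> \<xi> \<in> B 1" by (rule B_eq_iff)
    then show ?thesis using that \<xi> E_sub by blast
  qed
  have L: "MM 1 \<le> L" "Ma \<le> L" "1 \<le> L" "1 \<le> Ma" using MM(1)[of 1] by (auto simp: L_def Ma_def)
  let ?near = "\<lambda>x \<xi>' r. (c' x - c x) - \<xi>' * pw r \<in> B (r + int Ma)"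
  let ?W = "\<lambda>x r k \<xi>'. Rt c \<xi>' L x r \<and> (?near x \<xi>' r \<and> h x - a * pw k \<in> B k \<or>
     \<not> ?near x \<xi>' r \<and> k \<le> r + int L \<and> (c x - c' x) + \<xi>' * pw r - a * pw k \<in> B k)"
  have W: "(\<lambda>x z. ?W x (z 0) (z (Suc 0)) \<xi>') \<in> D" if \<xi>': "\<xi>' \<in> ?X" for \<xi>'
  proof -
    have Rt: "(\<lambda>x z. Rt c \<xi>' L x (z 0)) \<in> D" by (rule D_Rt[OF c X[OF \<xi>'] L(1)])
    have near: "(\<lambda>x z. ?near x \<xi>' (z 0)) \<in> D"
      by (intro D_fn_ball_shift R_def R_diff c' cR tm_var)
    have h: "(\<lambda>x z. h x - a * pw (z (Suc 0)) \<in> B (z (Suc 0))) \<in> D"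
      by (intro D_fn_ball R_def hR tm_var)
    have "(\<lambda>x z. z 0 \<le> z 1 + int L \<and> (c x - c' x) + \<xi>' * pw (z 1) - a * pw (z 0) \<in> B (z 0)) \<in> D"
      using X[OF \<xi>'] by (intro D_bounded_add R_def R_diff c' cR) auto
    from D_subst2[OF this tm_var[of "Suc 0"] tm_var[of 0]]
    have "(\<lambda>x z. z (Suc 0) \<le> z 0 + int L \<and> (c x - c' x) + \<xi>' * pw (z 0) - a * pw (z (Suc 0)) \<in> B (z (Suc 0))) \<in> D" .
    from D_conj[OF Rt D_disj[OF D_conj[OF near h] D_conj[OF D_not[OF near] this]]] show ?thesis .
  qed
  have "(\<lambda>x z. \<exists>r. P x r \<and> (\<exists>\<xi>'\<in>?X. ?W x r (z 0) \<xi>')) \<in> D"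
    by (rule D_ex, rule D_conj[OF DP], rule D_bex[OF _ W]) simp_all
  moreover have "(\<lambda>x z. \<not> (\<exists>r. P x r) \<and> (0 - c' x) - a * pw (z 0) \<in> B (z 0)) \<in> D"
    by (rule D_conj[OF D_not[OF D_ex[OF DP]]]) (intro D_fn_ball R_def R_diff R_const tm_var c')
  ultimately have "(\<lambda>x z. \<not> (\<exists>r. P x r) \<and> (0 - c' x) - a * pw (z 0) \<in> B (z 0) \<or>
     (\<exists>r. P x r \<and> (\<exists>\<xi>'\<in>?X. ?W x r (z 0) \<xi>'))) \<in> D" by (intro D_disj)
  moreover have "(\<not> (\<exists>r. P x r) \<and> (0 - c' x) - a * pw k \<in> B k \<or> (\<exists>r. P x r \<and> (\<exists>\<xi>'\<in>?X. ?W x r k \<xi>')))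
     \<longleftrightarrow> (y x - c' x) - a * pw k \<in> B k" for x k
  proof (cases "\<exists>r. P x r")
    case False
    then show ?thesis using y_else[of x] by auto
  next
    case True
    then obtain r where r: "P x r" by blast
    note root = P_root[OF r] and near = P_near[OF r]
    have near1: "y x - (c x + \<xi> * pw r) \<in> B (r + 1)"
      using near by (rule B_mono) (use MM(1)[of 1] in simp)
    have W: "?W x r k \<xi>' \<longleftrightarrow> (y x - c' x) - a * pw k \<in> B k"
      if \<xi>': "\<xi>' \<in> ?X" and Rt: "Rt c \<xi>' L x r" for \<xi>'
    proof -
      let ?t = "c x + \<xi>' * pw r"
      have tt: "?t - (c x + \<xi> * pw r) \<in> B (r + int (MM 1))"
      proof -
        have "?t - (c x + \<xi> * pw r) = (\<xi>' - \<xi>) * pw r" by (simp add: algebra_simps)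
        then show ?thesis using \<xi>' by (simp add: B_times_pw)
      qed
      obtain y' where y': "poly (p x) y' = 0" "y' - ?t \<in> B (r + int L)" using Rt by (auto simp: Rt_def)
      have "y' - ?t \<in> B (r + int (MM 1))" using y'(2) by (rule B_mono) (use L in simp)
      then have "y' - (c x + \<xi> * pw r) \<in> B (r + int (MM 1))" using tt by (rule B_trans)
      then have "y' = y x"
        by (rule Rt_unique[OF P_lc[OF r] P_adm[OF r] order_refl y'(1) _ root near])
      then have yt: "y x - ?t \<in> B (r + int L)" using y' by simp
      then have yt': "y x - ?t \<in> B (r + int Ma)" by (rule B_mono) (use L in simp)
      have adm': "adm C1 c \<xi>' x r" using Rt by (simp add: Rt_def)
      show ?thesis
      proof (cases "?near x \<xi>' r")
        case True
        then have s: "c' x - ?t \<in> B (r + int Ma)" by (simp add: algebra_simps)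
        have away: "\<forall>c''\<in>C1. ?t - c'' x \<notin> B (r + 1)" using adm' by (simp add: adm_def)
        have lin: "lin (p x) ?t (r + int Ma) (int N)"
          by (rule lin_p[OF P_lc[OF r] away]) (simp_all add: Ma_def)
        have st: "stab (pderiv (p x)) ?t (r + int Ma) (int N)"
          by (rule stab_mono[OF MM(2)[OF P_lc[OF r] away, of N]]) (simp_all add: Ma_def)
        have "(y x - c' x) - a * pw k \<in> B k \<longleftrightarrow> h x - a * pw k \<in> B k"
        proof (cases "y x = c' x")
          case True
          then show ?thesis using root by (simp add: h_def)
        next
          case False
          have "(y x - c' x) - h x \<in> B (v (y x - c' x) + int N)"
            unfolding h_def using Newton_step_close[OF lin root yt' s st _ False] by (simp add: N_def)
          then show ?thesis using False by (intro ball_iff_of_close[OF N]) (auto simp: N_def)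
        qed
        then show ?thesis using True Rt by blast
      next
        case False
        have yc: "y x - c' x \<notin> B (r + int Ma)"
        proof
          assume "y x - c' x \<in> B (r + int Ma)"
          then have "(y x - ?t) - (y x - c' x) \<in> B (r + int Ma)" by (rule B_diff[OF yt'])
          also have "(y x - ?t) - (y x - c' x) = (c' x - c x) - \<xi>' * pw r" by (simp add: algebra_simps)
          finally show False using False by blast
        qed
        have "k \<le> r + int L" if t: "(y x - c' x) - a * pw k \<in> B k"
        proof (rule ccontr)
          assume k: "\<not> k \<le> r + int L"
          have "a * pw k \<in> B (k - int N)" using N by (simp add: B_times_pw)
          moreover have "(y x - c' x) - a * pw k \<in> B (k - int N)" using t by (rule B_mono) simp
          ultimately have "y x - c' x \<in> B (k - int N)" using B_eq_iff by blast
          then have "y x - c' x \<in> B (r + int Ma)" by (rule B_mono) (use k in \<open>simp add: L_def\<close>)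
          then show False using yc by blast
        qed
        moreover have "(c x - c' x) + \<xi>' * pw r - a * pw k \<in> B k \<longleftrightarrow> (y x - c' x) - a * pw k \<in> B k"
          if "k \<le> r + int L"
        proof (rule B_eq_iff)
          have "?t - y x \<in> B k" using yt that by (subst B_minus_commute) (rule B_mono)
          then show "((c x - c' x) + \<xi>' * pw r - a * pw k) - ((y x - c' x) - a * pw k) \<in> B k"
            by (simp add: algebra_simps)
        qed
        ultimately show ?thesis using False Rt by blast
      qed
    qed
    have "y x - c x - \<xi> * pw r \<in> B (r + 1)" using near1 by (simp add: algebra_simps)
    moreover have "\<xi> * pw r \<in> B r" "\<xi> * pw r \<notin> B (r + 1)" using \<xi> by (auto simp: B_times_pw)
    ultimately have yc: "y x - c x \<in> B r" "y x - c x \<notin> B (r + 1)"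
      using B_eq_iff[of "y x - c x" "\<xi> * pw r" "r + 1"] B_eq_iff[OF B_mono, of "y x - c x" "\<xi> * pw r" "r + 1" r]
      by auto
    obtain \<xi>' where \<xi>': "\<xi>' \<in> E L - B 1" "y x - c x - \<xi>' * pw r \<in> B (r + int L)"
      using arm_point[OF yc L(3)] by blast
    have "\<xi>' * pw r - \<xi> * pw r \<in> B (r + int (MM 1))"
    proof -
      have "(y x - (c x + \<xi> * pw r)) - (y x - c x - \<xi>' * pw r) \<in> B (r + int (MM 1))"
        by (rule B_diff[OF near B_mono[OF \<xi>'(2)]]) (use L in simp)
      then show ?thesis by (simp add: algebra_simps)
    qed
    then have "\<xi>' - \<xi> \<in> B (int (MM 1))" by (simp add: B_times_pw flip: left_diff_distrib)
    then have inX: "\<xi>' \<in> ?X" using \<xi>' by simp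
    have "adm C1 c \<xi>' x r"
      by (rule adm_of_near[of _ "y x" _ _ _ _ L]) (use Rt_away[OF P_adm[OF r] near1] \<xi>' L in auto)
    then have "Rt c \<xi>' L x r"
      unfolding Rt_def using P_lc[OF r] root \<xi>'(2) by (auto simp: algebra_simps)
    then have "(\<exists>\<xi>'\<in>?X. ?W x r k \<xi>') \<longleftrightarrow> (y x - c' x) - a * pw k \<in> B k"
      using W inX by blast
    moreover have "(\<exists>r. P x r \<and> (\<exists>\<xi>'\<in>?X. ?W x r k \<xi>')) \<longleftrightarrow> (\<exists>\<xi>'\<in>?X. ?W x r k \<xi>')"
      using r P_unique by blast
    ultimately show ?thesis using True by blast
  qed
  ultimately show "(\<lambda>x z. y x - c' x - a * pw (z 0) \<in> B (z 0)) \<in> D" by simp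
qed

text \<open>The degree below \<open>d\<close> matters: such a polynomial has covering centres by
  induction, and \<open>def_y_diff\<close> controls the distances from \<open>y\<close> to
  them.\<close>

lemma def_poly_y:
  assumes g: "RP (d - 1) g"
  shows "def_fn (\<lambda>x. poly (g x) (y x))"
  unfolding def_fn_def
proof
  fix a
  obtain C where C: "finite C" "C \<subseteq> R" "(\<lambda>x. 0) \<in> C" "covers C g" using lower_covers[OF g] by blast
  obtain N where p: "prep C N (\<lambda>x t z. poly (g x) t - a * pw (z 0) \<in> B (z 0))"
    using prep_poly[OF g C] by blast
  have "(\<lambda>x z. True \<and> poly (g x) (y x) - a * pw (z 0) \<in> B (z 0)) \<in> D"
  proof (rule D_pull[OF p D_True])
    fix c' b assume "c' \<in> C"
    then have "(\<lambda>x z. y x - c' x - b * pw (z 0) \<in> B (z 0)) \<in> D"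
      using C by (intro D_fn_ball def_y_diff tm_var) auto
    then show "(\<lambda>x z. True \<and> y x - c' x - b * pw (z 0) \<in> B (z 0)) \<in> D" by simp
  qed
  then show "(\<lambda>x z. poly (g x) (y x) - a * pw (z 0) \<in> B (z 0)) \<in> D" by simp
qed

text \<open>Dividing by \<open>lc\<close> where a radius is selected and taking X^d elsewhere gives
  a polynomial that is monic and vanishes at \<open>y\<close> for every parameter, so reduction
  modulo it needs no case distinction.\<close>

definition monic :: "'x \<Rightarrow> 'k poly" where
  "monic x = monom 1 d + (\<Sum>k<d. monom (if \<exists>r. P x r then coeff (p x) k / lc x else 0) k)"

lemma RP_monic: "RP d monic"
  unfolding monic_def
proof (intro RP_add RP_sum RP_monom R_const)
  fix k assume "k \<in> {..<d}"
  have "(\<lambda>x z. \<exists>r. P x r) \<in> D" by (intro D_ex DP)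
  then have "(\<lambda>x. if \<exists>r. P x r then coeff (p x) k / lc x else 0) \<in> R"
    by (intro R_if R_divide coeff_p R_const)
  then have "RP k (\<lambda>x. monom (if \<exists>r. P x r then coeff (p x) k / lc x else 0) k)" by (rule RP_monom)
  then show "RP d (\<lambda>x. monom (if \<exists>r. P x r then coeff (p x) k / lc x else 0) k)"
    by (rule RP_mono) (use \<open>k \<in> {..<d}\<close> in simp)
qed

lemma coeff_monic: "coeff (monic x) d = 1"
  by (simp add: monic_def coeff_sum)

lemma poly_monic: "poly (monic x) (y x) = 0"
proof (cases "\<exists>r. P x r")
  case True
  then have lc: "lc x \<noteq> 0" and root: "poly (p x) (y x) = 0" using P_lc P_root by blast+
  have "(\<Sum>k\<le>d. coeff (p x) k * y x ^ k) = 0"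
    using poly_sum_le[OF degree_p] root by simp
  then have "(\<Sum>k<d. coeff (p x) k * y x ^ k) = - lc x * y x ^ d"
    by (simp add: lessThan_Suc_atMost[symmetric] eq_neg_iff_add_eq_0)
  moreover have "poly (monic x) (y x) = y x ^ d + (\<Sum>k<d. coeff (p x) k * y x ^ k) / lc x"
    using True by (simp add: monic_def poly_monom poly_sum sum_divide_distrib)
  ultimately show ?thesis using lc by simp
next
  case False
  then show ?thesis using y_else[of x] d_pos by (simp add: monic_def poly_monom poly_sum)
qed

lemma reduce:
  "RP n G \<Longrightarrow> \<exists>g. RP (d - 1) g \<and> (\<forall>x. poly (G x) (y x) = poly (g x) (y x))"
proof (induction n arbitrary: G)
  case 0
  then show ?case using RP_mono by blast
next
  case (Suc n)
  show ?case
  proof (cases "Suc n \<le> d - 1")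
    case True
    then show ?thesis using Suc.prems RP_mono by blast
  next
    case False
    then have d: "d \<le> Suc n" by simp
    define G' where "G' x = G x - smult (coeff (G x) (Suc n)) (monom 1 (Suc n - d) * monic x)" for x
    have "RP (Suc n) G'" unfolding G'_def
    proof (intro RP_diff Suc.prems RP_smult)
      show "(\<lambda>x. coeff (G x) (Suc n)) \<in> R" using Suc.prems by (simp add: RP_def)
      show "RP (Suc n) (\<lambda>x. monom 1 (Suc n - d) * monic x)"
        using RP_mult[OF RP_monom[OF R_const] RP_monic, of "Suc n - d" 1] d by simp
    qed
    moreover have "coeff (G' x) (Suc n) = 0" for x
      using d coeff_monic by (simp add: G'_def coeff_monom_mult)
    ultimately have "RP n G'" unfolding RP_def
      by (metis Suc_n_not_le_n coeff_0 degree_0 eq_zero_or_degree_less le_SucE less_Suc_eq_le zero_le leading_coeff_0_iff)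
    from Suc.IH[OF this] obtain g where g: "RP (d - 1) g" "\<And>x. poly (G' x) (y x) = poly (g x) (y x)" by blast
    have "poly (G' x) (y x) = poly (G x) (y x)" for x
      by (simp add: G'_def poly_monic)
    then show ?thesis using g by auto
  qed
qed

text \<open>Reduction modulo \<open>monic\<close> shows that the ring generated by \<open>y\<close>
  over \<open>R\<close> consists of polynomials in \<open>y\<close> of degree below
  \<open>d\<close>. All of these are definable, so maximality puts \<open>y\<close> into
  \<open>R\<close>.\<close>

lemma y_in_R: "y \<in> R"
proof -
  define S where "S = {\<lambda>x. poly (g x) (y x) | g. RP (d - 1) g}"
  have S_I: "(\<lambda>x. poly (G x) (y x)) \<in> S" if "RP n G" for n G
  proof -
    from reduce[OF that] obtain g where "RP (d - 1) g" "\<And>x. poly (G x) (y x) = poly (g x) (y x)" by blast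
    then show ?thesis by (auto simp: S_def)
  qed
  show ?thesis
  proof (rule R_maximal[of S])
    show "R \<subseteq> S"
    proof
      fix h assume "h \<in> R"
      then have "(\<lambda>x. poly [:h x:] (y x)) \<in> S" by (intro S_I RP_const)
      then show "h \<in> S" by simp
    qed
    show "def_fn h" if "h \<in> S" for h
      using that def_poly_y by (auto simp: S_def)
    have "RP 1 (\<lambda>x. monom 1 1)" by (intro RP_monom R_const)
    from S_I[OF this] show "y \<in> S" by (simp add: poly_monom)
  next
    fix h h' assume "h \<in> S" "h' \<in> S"
    then obtain g g' where g: "RP (d - 1) g" "RP (d - 1) g'"
      "h = (\<lambda>x. poly (g x) (y x))" "h' = (\<lambda>x. poly (g' x) (y x))" by (auto simp: S_def)
    show "(\<lambda>x. h x + h' x) \<in> S" using S_I[OF RP_add[OF g(1,2)]] g by simp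
    show "(\<lambda>x. h x * h' x) \<in> S" using S_I[OF RP_mult[OF g(1,2)]] g by simp
  qed
qed

end

context root_step
begin

text \<open>A root in the disc of an arm determines the radius as the valuation of its distance to
  the centre, so there are no more radii than roots.\<close>

lemma finite_Rt:
  assumes "c \<in> C1" "\<xi> \<in> B 0 - B 1" "1 \<le> m"
  shows "finite {r. Rt c \<xi> m x r}" "card {r. Rt c \<xi> m x r} \<le> d"
proof -
  have "finite {r. Rt c \<xi> m x r} \<and> card {r. Rt c \<xi> m x r} \<le> d"
  proof (cases "lc x = 0")
    case False
    then have nz: "p x \<noteq> 0" by auto
    have sub: "{r. Rt c \<xi> m x r} \<subseteq> (\<lambda>y. v (y - c x)) ` {y. poly (p x) y = 0}"
    proof
      fix r assume "r \<in> {r. Rt c \<xi> m x r}"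
      then obtain y where y: "poly (p x) y = 0" "y - (c x + \<xi> * pw r) \<in> B (r + int m)"
        by (auto simp: Rt_def)
      have "(y - c x) - \<xi> * pw r \<in> B (r + 1)" using y(2) assms(3) by (auto simp: algebra_simps elim: B_mono)
      moreover have "\<xi> * pw r \<in> B r" "\<xi> * pw r \<notin> B (r + 1)" using assms by (auto simp: B_times_pw)
      ultimately have "y - c x \<in> B r" "y - c x \<notin> B (r + 1)"
        using B_eq_iff[of "y - c x" "\<xi> * pw r" "r + 1"] B_eq_iff[OF B_mono, of "y - c x" "\<xi> * pw r" "r + 1" r]
        by auto
      then have "v (y - c x) = r" using v_eqI by blast
      then show "r \<in> (\<lambda>y. v (y - c x)) ` {y. poly (p x) y = 0}" using y(1) by auto
    qed
    have fin: "finite {y. poly (p x) y = 0}" using nz by (rule poly_roots_finite)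
    have "card {r. Rt c \<xi> m x r} \<le> card ((\<lambda>y. v (y - c x)) ` {y. poly (p x) y = 0})"
      using sub fin by (intro card_mono) auto
    also have "\<dots> \<le> card {y. poly (p x) y = 0}" using fin by (rule card_image_le)
    also have "\<dots> \<le> degree (p x)" using nz by (rule card_poly_roots_bound)
    also have "\<dots> \<le> d" by (rule degree_p)
    finally show ?thesis using finite_subset[OF sub] fin by auto
  qed (simp add: Rt_def)
  then show "finite {r. Rt c \<xi> m x r}" "card {r. Rt c \<xi> m x r} \<le> d" by auto
qed

lemma ex_section:
  assumes c: "c \<in> C1" and \<xi>: "\<xi> \<in> B 0 - B 1" and DP: "(\<lambda>x z. P x (z 0)) \<in> D"
    and P: "\<And>x r. P x r \<Longrightarrow> Rt c \<xi> (MM 1) x r" and unique: "\<And>x r r'. P x r \<Longrightarrow> P x r' \<Longrightarrow> r = r'"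
  shows "\<exists>y\<in>R. \<forall>x r. P x r \<longrightarrow> (\<forall>y'. poly (p x) y' = 0 \<longrightarrow>
    y' - (c x + \<xi> * pw r) \<in> B (r + int (MM 1)) \<longrightarrow> y' = y x)"
proof -
  have "\<exists>s. (\<forall>r. P x r \<longrightarrow> poly (p x) s = 0 \<and> s - (c x + \<xi> * pw r) \<in> B (r + int (MM 1))) \<and>
     ((\<forall>r. \<not> P x r) \<longrightarrow> s = 0)" for x
  proof (cases "\<exists>r. P x r")
    case True
    then obtain r where "P x r" by blast
    then show ?thesis using P[of x r] unique unfolding Rt_def by blast
  qed auto
  then obtain y where y: "\<And>x r. P x r \<Longrightarrow> poly (p x) (y x) = 0"
    "\<And>x r. P x r \<Longrightarrow> y x - (c x + \<xi> * pw r) \<in> B (r + int (MM 1))"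
    "\<And>x. (\<And>r. \<not> P x r) \<Longrightarrow> y x = 0" by metis
  interpret root_section v D R d p C1 c \<xi> P y
    by unfold_locales (use c \<xi> DP P unique y in \<open>auto simp: Rt_def\<close>)
  show ?thesis
  proof (intro bexI[OF _ y_in_R] allI impI)
    fix x r y' assume r: "P x r" and "poly (p x) y' = 0" "y' - (c x + \<xi> * pw r) \<in> B (r + int (MM 1))"
    then show "y' = y x" using Rt_unique[OF P_lc[OF r] P_adm[OF r] order_refl] y(1,2)[OF r] by blast
  qed
qed

definition hits :: "('x \<Rightarrow> 'k) set \<Rightarrow> ('x \<Rightarrow> 'k) \<Rightarrow> 'k \<Rightarrow> 'x \<Rightarrow> int \<Rightarrow> bool" where
  "hits C c \<xi> x r \<longleftrightarrow> (\<forall>y'. poly (p x) y' = 0 \<longrightarrow>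
     y' - (c x + \<xi> * pw r) \<in> B (r + int (MM 1)) \<longrightarrow> (\<exists>y\<in>C. y' = y x))"

lemma hits_mono: "hits C c \<xi> x r \<Longrightarrow> C \<subseteq> C' \<Longrightarrow> hits C' c \<xi> x r"
  unfolding hits_def by blast

text \<open>The radii at which roots occur form a finite set of integers of bounded size. Its
  minimum is definable, so one section at a time can be split off.\<close>

lemma ex_sections:
  assumes c: "c \<in> C1" and \<xi>: "\<xi> \<in> B 0 - B 1"
  shows "(\<lambda>x z. P x (z 0)) \<in> D \<Longrightarrow> (\<And>x r. P x r \<Longrightarrow> Rt c \<xi> (MM 1) x r) \<Longrightarrow>
    (\<And>x. card {r. P x r} \<le> n) \<Longrightarrow>
    \<exists>C. finite C \<and> C \<subseteq> R \<and> (\<forall>x r. P x r \<longrightarrow> hits C c \<xi> x r)"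
proof (induction n arbitrary: P)
  case (0 P)
  have fin: "finite {r. P x r}" for x
    by (rule finite_subset[OF _ finite_Rt(1)[OF c \<xi> MM(1)]]) (use 0(2) in auto)
  have "{r. P x r} = {}" for x using 0(3)[of x] fin[of x] by simp
  then have "\<not> P x r" for x r by blast
  then show ?case by (intro exI[of _ "{}"]) auto
next
  case (Suc n P)
  have fin: "finite {r. P x r}" for x
    by (rule finite_subset[OF _ finite_Rt(1)[OF c \<xi> MM(1)]]) (use Suc.prems(2) in auto)
  define P1 where "P1 x r \<longleftrightarrow> P x r \<and> (\<forall>k. P x k \<longrightarrow> r \<le> k)" for x r
  have DP: "tm F \<Longrightarrow> (\<lambda>x z. P x (F x z)) \<in> D" for F by (rule D_subst1[OF Suc.prems(1)])
  have DP1: "(\<lambda>x z. P1 x (z 0)) \<in> D"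
    unfolding P1_def by (intro D_conj D_all D_imp DP D_le tm_var)
  have "\<exists>y\<in>R. \<forall>x r. P1 x r \<longrightarrow> (\<forall>y'. poly (p x) y' = 0 \<longrightarrow>
    y' - (c x + \<xi> * pw r) \<in> B (r + int (MM 1)) \<longrightarrow> y' = y x)"
  proof (rule ex_section[OF c \<xi> DP1])
    show "Rt c \<xi> (MM 1) x r" if "P1 x r" for x r
      using that by (intro Suc.prems(2)) (simp add: P1_def)
  qed (auto simp: P1_def intro: order_antisym)
  then obtain y where y: "y \<in> R" "\<And>x r y'. P1 x r \<Longrightarrow> poly (p x) y' = 0 \<Longrightarrow>
    y' - (c x + \<xi> * pw r) \<in> B (r + int (MM 1)) \<Longrightarrow> y' = y x" by blast
  have "\<exists>C. finite C \<and> C \<subseteq> R \<and> (\<forall>x r. P x r \<and> \<not> P1 x r \<longrightarrow> hits C c \<xi> x r)"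
  proof (rule Suc.IH[of "\<lambda>x r. P x r \<and> \<not> P1 x r"])
    show "(\<lambda>x z. P x (z 0) \<and> \<not> P1 x (z 0)) \<in> D" by (intro D_conj D_not DP1 Suc.prems(1))
    show "card {r. P x r \<and> \<not> P1 x r} \<le> n" for x
    proof (cases "{r. P x r} = {}")
      case False
      have "Min {r. P x r} \<in> {r. P x r}" using fin False by (rule Min_in)
      moreover have "P1 x (Min {r. P x r})" using Min_in[OF fin False] fin by (auto simp: P1_def)
      ultimately have "{r. P x r \<and> \<not> P1 x r} \<subset> {r. P x r}" by blast
      then have "card {r. P x r \<and> \<not> P1 x r} < card {r. P x r}" by (rule psubset_card_mono[OF fin])
      then show ?thesis using Suc.prems(3)[of x] by simp
    qed simp
    show "Rt c \<xi> (MM 1) x r" if "P x r \<and> \<not> P1 x r" for x r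
      using that by (intro Suc.prems(2)) simp
  qed
  then obtain C where C: "finite C" "C \<subseteq> R" "\<And>x r. P x r \<Longrightarrow> \<not> P1 x r \<Longrightarrow> hits C c \<xi> x r" by blast
  show ?case
  proof (intro exI[of _ "insert y C"] conjI allI impI)
    fix x r assume P: "P x r"
    show "hits (insert y C) c \<xi> x r"
    proof (cases "P1 x r")
      case True
      then show ?thesis using y(2)[of x r] by (auto simp: hits_def)
    next
      case False
      then show ?thesis using C(3)[OF P] by (auto intro: hits_mono)
    qed
  qed (use y C in auto)
qed

lemma ex_secs_lc:
  "\<exists>C. finite C \<and> C \<subseteq> R \<and> (\<forall>x y. lc x \<noteq> 0 \<longrightarrow> poly (p x) y = 0 \<longrightarrow> (\<exists>c\<in>C. y = c x))"
proof -
  have ex: "\<exists>C. finite C \<and> C \<subseteq> R \<and> (\<forall>x r. Rt c \<xi> (MM 1) x r \<longrightarrow> hits C c \<xi> x r)"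
    if "c \<in> C1" "\<xi> \<in> B 0 - B 1" for c \<xi>
    by (rule ex_sections[where n = d, OF that D_Rt[OF that order_refl]]) (auto intro: finite_Rt[OF that MM(1)])
  define F where "F c \<xi> = (SOME C. finite C \<and> C \<subseteq> R \<and> (\<forall>x r. Rt c \<xi> (MM 1) x r \<longrightarrow> hits C c \<xi> x r))" for c \<xi>
  have F: "finite (F c \<xi>) \<and> F c \<xi> \<subseteq> R \<and> (\<forall>x r. Rt c \<xi> (MM 1) x r \<longrightarrow> hits (F c \<xi>) c \<xi> x r)"
    if "c \<in> C1" "\<xi> \<in> B 0 - B 1" for c \<xi>
    using someI_ex[OF ex[OF that]] unfolding F_def .
  have E: "E (MM 1) - B 1 \<subseteq> B 0 - B 1" using E_sub by blast
  show ?thesis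
  proof (intro exI[of _ "C1 \<union> (\<Union>c\<in>C1. \<Union>\<xi>\<in>E (MM 1) - B 1. F c \<xi>)"] conjI allI impI)
    show "finite (C1 \<union> (\<Union>c\<in>C1. \<Union>\<xi>\<in>E (MM 1) - B 1. F c \<xi>))"       by (intro finite_UnI finite_UN_I finite_Diff finite_E C1(1)) (use F E in blast)
    show "C1 \<union> (\<Union>c\<in>C1. \<Union>\<xi>\<in>E (MM 1) - B 1. F c \<xi>) \<subseteq> R" using C1(2) F E by blast
    fix x y assume lc: "lc x \<noteq> 0" and y: "poly (p x) y = 0"
    show "\<exists>c\<in>C1 \<union> (\<Union>c\<in>C1. \<Union>\<xi>\<in>E (MM 1) - B 1. F c \<xi>). y = c x"
    proof (cases "\<exists>c\<in>C1. y = c x")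
      case False
      obtain c \<xi> r where *: "c \<in> C1" "\<xi> \<in> E (MM 1) - B 1" "y - c x - \<xi> * pw r \<in> B (r + int (MM 1))" "adm C1 c \<xi> x r"
        by (rule ex_arm[of C1 "MM 1" y x]) (use C1 MM(1) False in auto)
      have near: "y - (c x + \<xi> * pw r) \<in> B (r + int (MM 1))" using *(3) by (simp add: algebra_simps)
      then have "Rt c \<xi> (MM 1) x r" using lc y *(4) by (auto simp: Rt_def)
      then have "hits (F c \<xi>) c \<xi> x r" using F[of c \<xi>] * E by blast
      then have "\<exists>s\<in>F c \<xi>. y = s x" using y near unfolding hits_def by blast
      then show ?thesis using *(1,2) by blast
    qed blast
  qed
qed

end

context ring_structure
begin

lemma ex_secs: "RP d p \<Longrightarrow> \<exists>C. secs C p"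
proof (induction d arbitrary: p rule: less_induct)
  case (less d)
  show ?case
  proof (cases "d = 0")
    case True
    have "poly (p x) y \<noteq> 0" if "p x \<noteq> 0" for x y
    proof -
      have "degree (p x) = 0" using less.prems True by (simp add: RP_def)
      then obtain a where "p x = [:a:]" by (rule degree_eq_zeroE)
      then show ?thesis using that by auto
    qed
    then show ?thesis by (intro exI[of _ "{}"]) (auto simp: secs_def)
  next
    case False
    have cov: "\<exists>C. finite C \<and> C \<subseteq> R \<and> (\<lambda>x. 0) \<in> C \<and> covers C g" if "RP (d - 1) g" for g
    proof (rule ex_covers[OF _ that])
      show "\<exists>C. secs C q" if "n \<le> d - 1" "RP n q" for n q
        using less.IH[of n q] that False by auto
    qed
    obtain C1 where C1: "finite C1" "C1 \<subseteq> R" "(\<lambda>x. 0) \<in> C1" "covers C1 (\<lambda>x. pderiv (p x))"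
      using cov[OF RP_pderiv[OF less.prems]] by blast
    interpret root_step v D R d p C1
      by unfold_locales (use False less.prems C1 cov in auto)
    obtain C where C: "finite C" "C \<subseteq> R" "\<And>x y. lc x \<noteq> 0 \<Longrightarrow> poly (p x) y = 0 \<Longrightarrow> \<exists>c\<in>C. y = c x"
      using ex_secs_lc by blast
    \<comment> \<open>Where \<open>lc\<close> vanishes, \<open>p\<close> agrees with
      \<open>q\<close>, whose degree is smaller for every parameter. The root functions of
      \<open>q\<close> and those found for nonzero \<open>lc\<close> together serve all
      parameters.\<close>
    define q where "q x = p x - monom (lc x) d" for x
    have "RP d q" unfolding q_def by (intro RP_diff RP_monom less.prems coeff_p)
    moreover have "coeff (q x) d = 0" for x by (simp add: q_def)
    moreover have "degree (q x) \<noteq> d" for x using \<open>\<And>x. coeff (q x) d = 0\<close>[of x] False by (metis degree_0 leading_coeff_0_iff)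
    ultimately have "RP (d - 1) q" unfolding RP_def using False by (metis One_nat_def Suc_pred le_SucE not_gr0)
    then obtain C0 where C0: "secs C0 q" using less.IH[of "d - 1"] False by auto
    have "secs (C \<union> C0) p" unfolding secs_def
    proof (intro conjI allI impI)
      fix x y assume *: "p x \<noteq> 0" "poly (p x) y = 0"
      show "\<exists>c\<in>C \<union> C0. y = c x"
      proof (cases "lc x = 0")
        case True
        then have "q x = p x" by (simp add: q_def)
        then show ?thesis using C0 * unfolding secs_def by (metis UnI2)
      qed (use C(3) * in blast)
    qed (use C C0 in \<open>auto simp: secs_def\<close>)
    then show ?thesis by blast
  qed
qed

lemma prepared_poly:
  assumes "RP d p"
  shows "prepared (\<lambda>x t z. poly (p x) t - a * pw (z 0) \<in> B (z 0))"
proof -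
  obtain C where "finite C" "C \<subseteq> R" "(\<lambda>x. 0) \<in> C" "covers C p"
    using ex_covers[OF _ assms] ex_secs by blast
  then show ?thesis using prep_poly[OF assms, of C a] by (auto simp: prepared_def)
qed

end

section \<open>Presburger arithmetic and constructible functions\<close>

text \<open>Linear terms with floor division by positive constants. Floor division expresses
  congruences, and it is also what solving an inequality for the eliminated variable
  produces.\<close>

inductive_set TT :: "((nat \<Rightarrow> int) \<Rightarrow> int) set" where
  TT_var: "(\<lambda>z. z i) \<in> TT"
| TT_const: "(\<lambda>z. c) \<in> TT"
| TT_add: "F \<in> TT \<Longrightarrow> G \<in> TT \<Longrightarrow> (\<lambda>z. F z + G z) \<in> TT"
| TT_mult: "F \<in> TT \<Longrightarrow> (\<lambda>z. c * F z) \<in> TT"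
| TT_div: "F \<in> TT \<Longrightarrow> 0 < n \<Longrightarrow> (\<lambda>z. F z div n) \<in> TT"

inductive_set QQ :: "((nat \<Rightarrow> int) \<Rightarrow> bool) set" where
  QQ_ge: "F \<in> TT \<Longrightarrow> (\<lambda>z. 0 \<le> F z) \<in> QQ"
| QQ_not: "P \<in> QQ \<Longrightarrow> (\<lambda>z. \<not> P z) \<in> QQ"
| QQ_conj: "P \<in> QQ \<Longrightarrow> Q \<in> QQ \<Longrightarrow> (\<lambda>z. P z \<and> Q z) \<in> QQ"

lemma TT_minus: "F \<in> TT \<Longrightarrow> (\<lambda>z. - F z) \<in> TT"
  using TT_mult[of F "-1"] by simp

lemma TT_diff: "F \<in> TT \<Longrightarrow> G \<in> TT \<Longrightarrow> (\<lambda>z. F z - G z) \<in> TT"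
  using TT_add[OF _ TT_minus, of F G] by simp

lemma TT_subst: "F \<in> TT \<Longrightarrow> (\<And>i. S i \<in> TT) \<Longrightarrow> (\<lambda>z. F (\<lambda>i. S i z)) \<in> TT"
  by (induction rule: TT.induct) (auto intro: TT.intros)

lemma QQ_subst:
  assumes P: "P \<in> QQ" and S: "\<And>i. S i \<in> TT"
  shows "(\<lambda>z. P (\<lambda>i. S i z)) \<in> QQ"
  using P
proof (induction rule: QQ.induct)
  case (QQ_ge F)
  show ?case by (rule QQ.QQ_ge[OF TT_subst[OF QQ_ge S]])
next
  case (QQ_not P)
  show ?case by (rule QQ.QQ_not[OF QQ_not.IH])
next
  case (QQ_conj P Q)
  show ?case by (rule QQ.QQ_conj[OF QQ_conj.IH])
qed

lemma case_nat_subst: "(\<lambda>i. case_nat F (\<lambda>j z. z j) i z) = case_nat (F z) (z :: nat \<Rightarrow> int)"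
  by (rule ext) (simp split: nat.split)

lemma TT_case_nat: "F \<in> TT \<Longrightarrow> case_nat F (\<lambda>j z. z j) i \<in> TT"
  by (cases i) (auto intro: TT_var)

lemma TT_push: "F \<in> TT \<Longrightarrow> G \<in> TT \<Longrightarrow> (\<lambda>z. F (case_nat (G z) z)) \<in> TT"
  using TT_subst[of F "case_nat G (\<lambda>j z. z j)"] TT_case_nat by (simp add: case_nat_subst)

lemma QQ_push: "P \<in> QQ \<Longrightarrow> G \<in> TT \<Longrightarrow> (\<lambda>z. P (case_nat (G z) z)) \<in> QQ"
  using QQ_subst[of P "case_nat G (\<lambda>j z. z j)"] TT_case_nat by (simp add: case_nat_subst)

lemma QQ_disj: "P \<in> QQ \<Longrightarrow> Q \<in> QQ \<Longrightarrow> (\<lambda>z. P z \<or> Q z) \<in> QQ"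
  using QQ_not[OF QQ_conj[OF QQ_not QQ_not, of P Q]] by simp

lemma QQ_le: "F \<in> TT \<Longrightarrow> G \<in> TT \<Longrightarrow> (\<lambda>z. F z \<le> G z) \<in> QQ"
  using QQ_ge[OF TT_diff, of G F] by simp

lemma QQ_eq: "F \<in> TT \<Longrightarrow> G \<in> TT \<Longrightarrow> (\<lambda>z. F z = G z) \<in> QQ"
  using QQ_conj[OF QQ_le QQ_le, of F G G F] by (simp add: order_eq_iff)

lemma QQ_False: "(\<lambda>z. False) \<in> QQ"
  using QQ_ge[OF TT_const, of "-1"] by simp

lemma QQ_bex: "finite A \<Longrightarrow> (\<And>a. a \<in> A \<Longrightarrow> (\<lambda>z. P a z) \<in> QQ) \<Longrightarrow> (\<lambda>z. \<exists>a\<in>A. P a z) \<in> QQ"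
  by (induction A rule: finite_induct) (auto intro: QQ_False QQ_disj)

text \<open>Variable 0 runs through an arithmetic progression of step \<open>d\<close>, along which
  a term is affine with slope \<open>s\<close> in spite of its floor divisions.\<close>

definition quasi :: "int \<Rightarrow> int \<Rightarrow> ((nat \<Rightarrow> int) \<Rightarrow> int) \<Rightarrow> bool" where
  "quasi d s F \<longleftrightarrow> (\<forall>k z j. F (case_nat (k + d * j) z) = F (case_nat k z) + s * j)"

lemma quasi_mult: "quasi d s F \<Longrightarrow> quasi (d * m) (s * m) F"
  unfolding quasi_def by (simp add: mult.assoc)

lemma TT_quasi: "F \<in> TT \<Longrightarrow> \<exists>d>0. \<exists>s. quasi d s F"
proof (induction rule: TT.induct)
  case (TT_var i)
  have "quasi 1 (if i = 0 then 1 else 0) (\<lambda>z. z i)"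
    by (cases i) (auto simp: quasi_def)
  then show ?case by (metis zero_less_one)
next
  case (TT_const c)
  have "quasi 1 0 (\<lambda>z. c)" by (simp add: quasi_def)
  then show ?case by (metis zero_less_one)
next
  case (TT_add F G)
  then obtain d s d' s' where *: "d > 0" "quasi d s F" "d' > 0" "quasi d' s' G" by blast
  have "quasi (d * d') (s * d' + s' * d) (\<lambda>z. F z + G z)"
    unfolding quasi_def
  proof (intro allI)
    fix k z j
    have "F (case_nat (k + d * (d' * j)) z) = F (case_nat k z) + s * (d' * j)"
      "G (case_nat (k + d' * (d * j)) z) = G (case_nat k z) + s' * (d * j)"
      using *(2,4) unfolding quasi_def by blast+
    then show "F (case_nat (k + d * d' * j) z) + G (case_nat (k + d * d' * j) z) =
       F (case_nat k z) + G (case_nat k z) + (s * d' + s' * d) * j"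
      by (simp add: algebra_simps)
  qed
  then show ?case using * by (metis mult_pos_pos)
next
  case (TT_mult F c)
  then obtain d s where *: "d > 0" "quasi d s F" by blast
  then have "quasi d (c * s) (\<lambda>z. c * F z)" by (auto simp: quasi_def algebra_simps)
  then show ?case using * by blast
next
  case (TT_div F n)
  then obtain d s where *: "d > 0" "quasi d s F" by blast
  have "quasi (d * n) s (\<lambda>z. F z div n)"
    unfolding quasi_def
  proof (intro allI)
    fix k z j
    have "F (case_nat (k + d * (n * j)) z) = F (case_nat k z) + s * (n * j)"
      using *(2) unfolding quasi_def by blast
    then have "F (case_nat (k + d * n * j) z) = F (case_nat k z) + (s * j) * n"
      by (simp add: algebra_simps)
    then show "F (case_nat (k + d * n * j) z) div n = F (case_nat k z) div n + s * j"
      using TT_div(2) by simp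
  qed
  then show ?case using * TT_div(2) by (metis mult_pos_pos)
qed

lemma le_div_iff_mult_le:
  fixes a b s :: int
  assumes "0 < s"
  shows "a \<le> b div s \<longleftrightarrow> a * s \<le> b"
proof
  assume "a \<le> b div s"
  then have "a * s \<le> b div s * s" using assms by (intro mult_right_mono) auto
  also have "\<dots> \<le> b" using pos_mod_sign[OF assms, of b] by (simp flip: minus_mod_eq_div_mult)
  finally show "a * s \<le> b" .
next
  assume "a * s \<le> b"
  then have "a * s div s \<le> b div s" using assms by (intro zdiv_mono1)
  then show "a \<le> b div s" using assms by simp
qed

text \<open>An inequality that is linear in k describes a half-line; the sign of \<open>s\<close>
  determines its direction, which \<open>b\<close> records.\<close>

lemma threshold:
  fixes s :: int
  assumes "F \<in> TT" "s \<noteq> 0"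
  shows "\<exists>\<beta>\<in>TT. \<exists>b. \<forall>z k. 0 \<le> F z + s * k \<longleftrightarrow> (b \<longleftrightarrow> \<beta> z \<le> k)"
proof (cases "s > 0")
  case True
  have "0 \<le> F z + s * k \<longleftrightarrow> - (F z div s) \<le> k" for z k
  proof -
    have "0 \<le> F z + s * k \<longleftrightarrow> (- k) * s \<le> F z" by (auto simp: algebra_simps)
    also have "\<dots> \<longleftrightarrow> - k \<le> F z div s" using True by (simp only: le_div_iff_mult_le)
    finally show ?thesis by auto
  qed
  then show ?thesis using assms True by (intro bexI[of _ "\<lambda>z. - (F z div s)"] exI[of _ True]) (auto intro: TT_minus TT_div)
next
  case False
  then have s: "0 < - s" using assms by simp
  have "0 \<le> F z + s * k \<longleftrightarrow> \<not> F z div (- s) + 1 \<le> k" for z k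
  proof -
    have "0 \<le> F z + s * k \<longleftrightarrow> k * (- s) \<le> F z" by (auto simp: algebra_simps)
    also have "\<dots> \<longleftrightarrow> k \<le> F z div (- s)" using s by (simp only: le_div_iff_mult_le)
    finally show ?thesis by auto
  qed
  then show ?thesis using assms s
    by (intro bexI[of _ "\<lambda>z. F z div (- s) + 1"] exI[of _ False]) (auto intro!: TT_add TT_div TT_const)
qed

text \<open>On the residue class of j modulo d the truth of \<open>P\<close> depends only on the
  position of k relative to finitely many breakpoints, which are terms in the remaining
  variables.\<close>

definition pat :: "((nat \<Rightarrow> int) \<Rightarrow> bool) \<Rightarrow> int \<Rightarrow> int \<Rightarrow> ((nat \<Rightarrow> int) \<Rightarrow> int) set \<Rightarrow> bool" where
  "pat P d j Bk \<longleftrightarrow> finite Bk \<and> Bk \<subseteq> TT \<and> (\<forall>z k k'. (\<forall>\<beta>\<in>Bk. \<beta> z \<le> k \<longleftrightarrow> \<beta> z \<le> k') \<longrightarrow>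
     P (case_nat (j + d * k) z) = P (case_nat (j + d * k') z))"

lemma pat_conj: "pat P d j Bk \<Longrightarrow> pat Q d j Bk' \<Longrightarrow> pat (\<lambda>z. P z \<and> Q z) d j (Bk \<union> Bk')"
proof -
  assume p: "pat P d j Bk" "pat Q d j Bk'"
  have "(P (case_nat (j + d * k) z) \<and> Q (case_nat (j + d * k) z)) =
      (P (case_nat (j + d * k') z) \<and> Q (case_nat (j + d * k') z))"
    if "\<forall>\<beta>\<in>Bk \<union> Bk'. \<beta> z \<le> k \<longleftrightarrow> \<beta> z \<le> k'" for z k k'
  proof -
    have "P (case_nat (j + d * k) z) = P (case_nat (j + d * k') z)"
      using p(1) that unfolding pat_def by blast
    moreover have "Q (case_nat (j + d * k) z) = Q (case_nat (j + d * k') z)"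
      using p(2) that unfolding pat_def by blast
    ultimately show ?thesis by simp
  qed
  then show ?thesis using p by (simp add: pat_def)
qed

text \<open>Admitting every multiple \<open>d * m\<close> of the step makes the statement inductive:
  both parts of a conjunction can be read along a common step. The same device recurs in
  \<open>NF_QQ\<close> and \<open>NF_CC\<close>.\<close>

lemma QQ_pattern: "P \<in> QQ \<Longrightarrow> \<exists>d>0. \<forall>m>0. \<forall>j. \<exists>Bk. pat P (d * m) j Bk"
proof (induction rule: QQ.induct)
  case (QQ_ge F)
  obtain d s where d: "d > 0" "quasi d s F" using TT_quasi[OF QQ_ge] by blast
  show ?case
  proof (intro exI[of _ d] conjI allI impI d(1))
    fix m j :: int
    have eq: "F (case_nat (j + (d * m) * k) z) = F (case_nat j z) + (s * m) * k" for k z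
      using quasi_mult[OF d(2), of m] unfolding quasi_def by blast
    have Fj: "(\<lambda>z. F (case_nat j z)) \<in> TT" using TT_push[OF QQ_ge TT_const] .
    show "\<exists>Bk. pat (\<lambda>z. 0 \<le> F z) (d * m) j Bk"
    proof (cases "s * m = 0")
      case True
      then show ?thesis by (intro exI[of _ "{}"]) (simp only: pat_def eq, simp)
    next
      case False
      obtain \<beta> b where "\<beta> \<in> TT" "\<And>z k. 0 \<le> F (case_nat j z) + (s * m) * k \<longleftrightarrow> (b \<longleftrightarrow> \<beta> z \<le> k)"
        using threshold[OF Fj False] by blast
      then show ?thesis by (intro exI[of _ "{\<beta>}"]) (simp only: pat_def eq, simp)
    qed
  qed
next
  case (QQ_not P)
  then show ?case by (simp add: pat_def)
next
  case (QQ_conj P Q)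
  obtain d where d: "d > 0" "\<And>m j. m > 0 \<Longrightarrow> \<exists>Bk. pat P (d * m) j Bk" using QQ_conj.IH(1) by blast
  obtain d' where d': "d' > 0" "\<And>m j. m > 0 \<Longrightarrow> \<exists>Bk. pat Q (d' * m) j Bk" using QQ_conj.IH(2) by blast
  have "\<exists>Bk. pat (\<lambda>z. P z \<and> Q z) (d * d' * m) j Bk" if m: "m > 0" for m j
  proof -
    obtain Bk where "pat P (d * (d' * m)) j Bk" using d(2)[of "d' * m" j] m d'(1) by auto
    moreover obtain Bk' where "pat Q (d' * (d * m)) j Bk'" using d'(2)[of "d * m" j] m d(1) by auto
    moreover have "d * (d' * m) = d * d' * m" "d' * (d * m) = d * d' * m" by simp_all
    ultimately show ?thesis using pat_conj by metis
  qed
  then show ?case using d(1) d'(1) by (metis mult_pos_pos)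
qed

text \<open>Quantifier elimination: a witness can be moved, within its residue class, to a breakpoint,
  to just below a breakpoint, or to 0.\<close>

lemma QQ_ex:
  assumes P: "P \<in> QQ"
  shows "(\<lambda>z. \<exists>k. P (case_nat k z)) \<in> QQ"
proof -
  obtain d where d: "d > 0" "\<And>m j. m > 0 \<Longrightarrow> \<exists>Bk. pat P (d * m) j Bk"
    using QQ_pattern[OF P] by blast
  have "\<exists>Bk. pat P d j Bk" for j using d(2)[of 1 j] by simp
  then obtain Bk where pat: "\<And>j. pat P d j (Bk j)" by metis
  then have Bk: "\<And>j. finite (Bk j)" "\<And>j. Bk j \<subseteq> TT" by (auto simp: pat_def)
  have Bk3: "P (case_nat (j + d * k) z) = P (case_nat (j + d * k') z)" if "\<forall>\<beta>\<in>Bk j. \<beta> z \<le> k \<longleftrightarrow> \<beta> z \<le> k'" for j z k k'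
    using pat[of j] that unfolding pat_def by blast
  define Cd where "Cd j = insert (\<lambda>z. 0) (Bk j \<union> (\<lambda>\<beta> z. \<beta> z - 1) ` Bk j)" for j
  have Cd: "finite (Cd j)" "Cd j \<subseteq> TT" for j
    using Bk(1,2)[of j] by (auto simp: Cd_def intro!: TT_const TT_diff)
  have "(\<lambda>z. \<exists>j\<in>{0..<d}. \<exists>\<tau>\<in>Cd j. P (case_nat (j + d * \<tau> z) z)) \<in> QQ"
  proof (intro QQ_bex Cd finite_atLeastLessThan_int)
    fix j \<tau> assume "\<tau> \<in> Cd j"
    then have "(\<lambda>z. j + d * \<tau> z) \<in> TT" using Cd(2) by (intro TT_add TT_const TT_mult) auto
    then show "(\<lambda>z. P (case_nat (j + d * \<tau> z) z)) \<in> QQ" by (rule QQ_push[OF P])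
  qed
  moreover have "(\<exists>k. P (case_nat k z)) \<longleftrightarrow> (\<exists>j\<in>{0..<d}. \<exists>\<tau>\<in>Cd j. P (case_nat (j + d * \<tau> z) z))" for z
  proof
    assume "\<exists>k. P (case_nat k z)"
    then obtain k0 where k0: "P (case_nat k0 z)" by blast
    define j k where "j = k0 mod d" and "k = k0 div d"
    have jk: "P (case_nat (j + d * k) z)" and j: "j \<in> {0..<d}" using k0 d(1) by (simp_all add: j_def k_def)
    have "\<exists>\<tau>\<in>Cd j. \<forall>\<beta>\<in>Bk j. \<beta> z \<le> k \<longleftrightarrow> \<beta> z \<le> \<tau> z"
    proof (cases "\<exists>\<beta>\<in>Bk j. \<beta> z \<le> k")
      case True
      define S where "S = {\<beta>\<in>Bk j. \<beta> z \<le> k}"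
      have S: "finite ((\<lambda>\<beta>. \<beta> z) ` S)" "(\<lambda>\<beta>. \<beta> z) ` S \<noteq> {}" using True Bk(1) by (auto simp: S_def)
      obtain \<tau> where \<tau>: "Max ((\<lambda>\<beta>. \<beta> z) ` S) = \<tau> z" "\<tau> \<in> S" by (rule imageE[OF Max_in[OF S]])
      have "\<beta> z \<le> \<tau> z" if "\<beta> \<in> S" for \<beta> using \<tau>(1)[symmetric] S(1) that by simp
      then have "\<forall>\<beta>\<in>Bk j. \<beta> z \<le> k \<longleftrightarrow> \<beta> z \<le> \<tau> z" using \<tau>(2) by (auto simp: S_def)
      moreover have "\<tau> \<in> Cd j" using \<tau>(2) by (simp add: S_def Cd_def)
      ultimately show ?thesis by blast
    next
      case False
      show ?thesis
      proof (cases "Bk j = {}")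
        case True
        then show ?thesis by (auto simp: Cd_def)
      next
        case ne: False
        then have S: "finite ((\<lambda>\<beta>. \<beta> z) ` Bk j)" "(\<lambda>\<beta>. \<beta> z) ` Bk j \<noteq> {}" using Bk(1) by auto
        obtain \<beta>0 where \<beta>0: "Min ((\<lambda>\<beta>. \<beta> z) ` Bk j) = \<beta>0 z" "\<beta>0 \<in> Bk j" by (rule imageE[OF Min_in[OF S]])
        have "\<beta>0 z \<le> \<beta> z" if "\<beta> \<in> Bk j" for \<beta> using \<beta>0(1)[symmetric] S(1) that by simp
        then have "\<forall>\<beta>\<in>Bk j. \<beta> z \<le> k \<longleftrightarrow> \<beta> z \<le> \<beta>0 z - 1" using False by fastforce
        moreover have "(\<lambda>z. \<beta>0 z - 1) \<in> Cd j" using \<beta>0(2) by (auto simp: Cd_def)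
        ultimately show ?thesis by (intro bexI[of _ "\<lambda>z. \<beta>0 z - 1"])
      qed
    qed
    then obtain \<tau> where "\<tau> \<in> Cd j" "\<forall>\<beta>\<in>Bk j. \<beta> z \<le> k \<longleftrightarrow> \<beta> z \<le> \<tau> z" by blast
    then show "\<exists>j\<in>{0..<d}. \<exists>\<tau>\<in>Cd j. P (case_nat (j + d * \<tau> z) z)" using Bk3[of j z k "\<tau> z"] jk j by blast
  qed blast
  ultimately show ?thesis by simp
qed

lemma QQ_structure: "int_structure {\<lambda>(x :: 'x) z. Q z | Q. Q \<in> QQ}"
proof
  fix P :: "'x \<Rightarrow> (nat \<Rightarrow> int) \<Rightarrow> bool" and \<sigma> :: "nat \<Rightarrow> nat"
  assume "P \<in> {\<lambda>(x :: 'x) z. Q z | Q. Q \<in> QQ}"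
  then obtain Q where Q: "Q \<in> QQ" "P = (\<lambda>x z. Q z)" by blast
  show "(\<lambda>x z. \<not> P x z) \<in> {\<lambda>(x :: 'x) z. Q z | Q. Q \<in> QQ}" using Q QQ_not by auto
  show "(\<lambda>x z. \<exists>k. P x (case_nat k z)) \<in> {\<lambda>(x :: 'x) z. Q z | Q. Q \<in> QQ}" using Q QQ_ex by auto
  show "(\<lambda>x z. P x (\<lambda>i. z (\<sigma> i))) \<in> {\<lambda>(x :: 'x) z. Q z | Q. Q \<in> QQ}"
    using Q QQ_subst[of Q "\<lambda>i z. z (\<sigma> i)"] TT_var by auto
next
  fix P P' :: "'x \<Rightarrow> (nat \<Rightarrow> int) \<Rightarrow> bool"
  assume "P \<in> {\<lambda>(x :: 'x) z. Q z | Q. Q \<in> QQ}" "P' \<in> {\<lambda>(x :: 'x) z. Q z | Q. Q \<in> QQ}"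
  then show "(\<lambda>x z. P x z \<and> P' x z) \<in> {\<lambda>(x :: 'x) z. Q z | Q. Q \<in> QQ}" using QQ_conj by auto
next
  fix i j k :: nat and c :: int
  show "(\<lambda>x z. z i \<le> z j) \<in> {\<lambda>(x :: 'x) z. Q z | Q. Q \<in> QQ}" using QQ_le[OF TT_var TT_var] by auto
  show "(\<lambda>x z. z i = z j + z k) \<in> {\<lambda>(x :: 'x) z. Q z | Q. Q \<in> QQ}"
    using QQ_eq[OF TT_var TT_add[OF TT_var TT_var]] by auto
  show "(\<lambda>x z. z i = c) \<in> {\<lambda>(x :: 'x) z. Q z | Q. Q \<in> QQ}" using QQ_eq[OF TT_var TT_const] by auto
qed

section \<open>Constructible functions and their normal form in one variable\<close>

inductive_set CC :: "((nat \<Rightarrow> int) \<Rightarrow> real) set" where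
  CC_ind: "Q \<in> QQ \<Longrightarrow> (\<lambda>z. of_bool (Q z)) \<in> CC"
| CC_term: "F \<in> TT \<Longrightarrow> (\<lambda>z. of_int (F z)) \<in> CC"
| CC_exp: "F \<in> TT \<Longrightarrow> 0 < \<theta> \<Longrightarrow> (\<lambda>z. \<theta> powi F z) \<in> CC"
| CC_const: "(\<lambda>z. c) \<in> CC"
| CC_add: "F \<in> CC \<Longrightarrow> G \<in> CC \<Longrightarrow> (\<lambda>z. F z + G z) \<in> CC"
| CC_mult: "F \<in> CC \<Longrightarrow> G \<in> CC \<Longrightarrow> (\<lambda>z. F z * G z) \<in> CC"

lemma CC_diff: "F \<in> CC \<Longrightarrow> G \<in> CC \<Longrightarrow> (\<lambda>z. F z - G z) \<in> CC"
  using CC_add[OF _ CC_mult[OF CC_const], of F G "-1"] by simp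

lemma CC_power: "F \<in> CC \<Longrightarrow> (\<lambda>z. F z ^ n) \<in> CC"
  by (induction n) (auto intro: CC_const CC_mult)

lemma CC_sum: "(\<And>i. i \<in> A \<Longrightarrow> (\<lambda>z. F i z) \<in> CC) \<Longrightarrow> (\<lambda>z. \<Sum>i\<in>A. F i z) \<in> CC"
  by (induction A rule: infinite_finite_induct) (auto intro: CC_const CC_add)

type_synonym nf_term = "((nat \<Rightarrow> int) \<Rightarrow> real) \<times> nat \<times> real \<times> ((nat \<Rightarrow> int) \<Rightarrow> int)"

fun nf_val :: "nf_term \<Rightarrow> (nat \<Rightarrow> int) \<Rightarrow> int \<Rightarrow> real" where
  "nf_val (g, e, \<Theta>, \<beta>) z k = g z * of_int k ^ e * \<Theta> powi k * of_bool (\<beta> z \<le> k)"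

fun nf_ok :: "nf_term \<Rightarrow> bool" where
  "nf_ok (g, e, \<Theta>, \<beta>) \<longleftrightarrow> g \<in> CC \<and> 0 < \<Theta> \<and> \<beta> \<in> TT"

text \<open>Along each residue class a constructible function is an exponential polynomial in k
  whose terms are switched on at thresholds. The restriction to \<open>0 \<le> k\<close> fits power
  series and lets the threshold 0 stand for no condition.\<close>

definition NF :: "int \<Rightarrow> int \<Rightarrow> ((nat \<Rightarrow> int) \<Rightarrow> real) \<Rightarrow> bool" where
  "NF d j F \<longleftrightarrow> (\<exists>xs. list_all nf_ok xs \<and>
     (\<forall>z. \<forall>k\<ge>0. F (case_nat (j + d * k) z) = (\<Sum>x\<leftarrow>xs. nf_val x z k)))"

lemma NF_I: "list_all nf_ok xs \<Longrightarrow> (\<And>z k. 0 \<le> k \<Longrightarrow> F (case_nat (j + d * k) z) = (\<Sum>x\<leftarrow>xs. nf_val x z k)) \<Longrightarrow> NF d j F"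
  unfolding NF_def by blast

lemma NF_add: "NF d j F \<Longrightarrow> NF d j G \<Longrightarrow> NF d j (\<lambda>z. F z + G z)"
proof -
  assume "NF d j F" "NF d j G"
  then obtain xs ys where "list_all nf_ok xs" "\<And>z k. k \<ge> 0 \<Longrightarrow> F (case_nat (j + d * k) z) = (\<Sum>x\<leftarrow>xs. nf_val x z k)"
    "list_all nf_ok ys" "\<And>z k. k \<ge> 0 \<Longrightarrow> G (case_nat (j + d * k) z) = (\<Sum>x\<leftarrow>ys. nf_val x z k)"
    unfolding NF_def by blast
  then show ?thesis by (intro NF_I[of "xs @ ys"]) auto
qed

text \<open>Two threshold indicators multiply to the indicator of the larger threshold; deciding
  which one is larger produces the two terms.\<close>

fun nf_prod :: "nf_term \<Rightarrow> nf_term \<Rightarrow> nf_term list" where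
  "nf_prod (g, e, \<Theta>, \<beta>) (g', e', \<Theta>', \<beta>') =
     [(\<lambda>z. g z * g' z * of_bool (\<beta>' z \<le> \<beta> z), e + e', \<Theta> * \<Theta>', \<beta>),
      (\<lambda>z. g z * g' z * of_bool (\<not> \<beta>' z \<le> \<beta> z), e + e', \<Theta> * \<Theta>', \<beta>')]"

lemma nf_prod_val: "(\<Sum>w\<leftarrow>nf_prod x y. nf_val w z k) = nf_val x z k * nf_val y z k"
  by (cases x; cases y) (auto simp: power_add power_int_mult_distrib)

lemma nf_prod_ok: "nf_ok x \<Longrightarrow> nf_ok y \<Longrightarrow> list_all nf_ok (nf_prod x y)"
  by (cases x; cases y) (auto intro!: CC_mult CC_ind QQ_le QQ_not)

lemma NF_mult: "NF d j F \<Longrightarrow> NF d j G \<Longrightarrow> NF d j (\<lambda>z. F z * G z)"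
proof -
  assume "NF d j F" "NF d j G"
  then obtain xs ys where *: "list_all nf_ok xs" "\<And>z k. k \<ge> 0 \<Longrightarrow> F (case_nat (j + d * k) z) = (\<Sum>x\<leftarrow>xs. nf_val x z k)"
    "list_all nf_ok ys" "\<And>z k. k \<ge> 0 \<Longrightarrow> G (case_nat (j + d * k) z) = (\<Sum>x\<leftarrow>ys. nf_val x z k)"
    unfolding NF_def by blast
  have 1: "(\<Sum>w\<leftarrow>concat (map (nf_prod x) ys). nf_val w z k) = nf_val x z k * (\<Sum>y\<leftarrow>ys. nf_val y z k)" for x ys z k
    by (induction ys) (auto simp: nf_prod_val distrib_left)
  have 2: "(\<Sum>w\<leftarrow>concat (map (\<lambda>x. concat (map (nf_prod x) ys)) xs). nf_val w z k) =
      (\<Sum>x\<leftarrow>xs. nf_val x z k) * (\<Sum>y\<leftarrow>ys. nf_val y z k)" for xs z k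
    by (induction xs) (auto simp: 1 distrib_right)
  show ?thesis
  proof (rule NF_I)
    show "list_all nf_ok (concat (map (\<lambda>x. concat (map (nf_prod x) ys)) xs))"
      using *(1,3) nf_prod_ok by (fastforce simp: list_all_iff)
  qed (simp only: 2 *)
qed

lemma NF_threshold:
  assumes F: "F \<in> TT" and eq: "\<And>k z. F (case_nat (j + d * k) z) = F (case_nat j z) + s * k"
  shows "NF d j (\<lambda>z. of_bool (0 \<le> F z))"
proof (cases "s = 0")
  case True
  then show ?thesis using F
    by (intro NF_I[of "[(\<lambda>z. of_bool (0 \<le> F (case_nat j z)), 0, 1, \<lambda>z. 0)]"])
       (auto simp: eq intro!: CC_ind QQ_ge TT_push TT_const)
next
  case False
  obtain \<beta> b where \<beta>: "\<beta> \<in> TT" "\<And>z k. 0 \<le> F (case_nat j z) + s * k \<longleftrightarrow> (b \<longleftrightarrow> \<beta> z \<le> k)"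
    using threshold[OF TT_push[OF F TT_const] False] by blast
  show ?thesis
  proof (cases b)
    case True
    then show ?thesis using \<beta> by (intro NF_I[of "[(\<lambda>z. 1, 0, 1, \<beta>)]"]) (auto simp: eq intro: CC_const)
  next
    case False
    then show ?thesis using \<beta>
      by (intro NF_I[of "[(\<lambda>z. 1, 0, 1, \<lambda>z. 0), (\<lambda>z. -1, 0, 1, \<beta>)]"]) (auto simp: eq intro: CC_const TT_const)
  qed
qed

lemma NF_const: "NF d j (\<lambda>z. c)"
  by (intro NF_I[of "[(\<lambda>z. c, 0, 1, \<lambda>z. 0)]"]) (auto intro: CC_const TT_const)

lemma NF_QQ: "Q \<in> QQ \<Longrightarrow> \<exists>d>0. \<forall>m>0. \<forall>j. NF (d * m) j (\<lambda>z. of_bool (Q z))"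
proof (induction rule: QQ.induct)
  case (QQ_ge F)
  obtain d s where d: "d > 0" "quasi d s F" using TT_quasi[OF QQ_ge] by blast
  show ?case
  proof (intro exI[of _ d] conjI allI impI d(1))
    fix m j
    show "NF (d * m) j (\<lambda>z. of_bool (0 \<le> F z))"
      using quasi_mult[OF d(2), of m] by (intro NF_threshold[OF QQ_ge]) (auto simp: quasi_def)
  qed
next
  case (QQ_not P)
  then obtain d where d: "d > 0" "\<And>m j. m > 0 \<Longrightarrow> NF (d * m) j (\<lambda>z. of_bool (P z))" by blast
  have "NF (d * m) j (\<lambda>z. of_bool (\<not> P z))" if "m > 0" for m j
  proof -
    have "NF (d * m) j (\<lambda>z. 1 + (- 1) * of_bool (P z))" by (intro NF_add NF_mult NF_const d that)
    then show ?thesis by (simp add: of_bool_not_iff)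
  qed
  then show ?case using d(1) by blast
next
  case (QQ_conj P Q)
  obtain d where d: "d > 0" "\<And>m j. m > 0 \<Longrightarrow> NF (d * m) j (\<lambda>z. of_bool (P z))" using QQ_conj.IH(1) by blast
  obtain d' where d': "d' > 0" "\<And>m j. m > 0 \<Longrightarrow> NF (d' * m) j (\<lambda>z. of_bool (Q z))" using QQ_conj.IH(2) by blast
  have "NF (d * d' * m) j (\<lambda>z. of_bool (P z \<and> Q z))" if "m > 0" for m j
  proof -
    have "NF (d * (d' * m)) j (\<lambda>z. of_bool (P z))" "NF (d' * (d * m)) j (\<lambda>z. of_bool (Q z))"
      using d d' that by auto
    then have "NF (d * d' * m) j (\<lambda>z. of_bool (P z))" "NF (d * d' * m) j (\<lambda>z. of_bool (Q z))"
      by (simp_all add: mult_ac)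
    then show ?thesis unfolding of_bool_conj by (rule NF_mult)
  qed
  then show ?case using d(1) d'(1) by (metis mult_pos_pos)
qed

lemma NF_CC: "F \<in> CC \<Longrightarrow> \<exists>d>0. \<forall>m>0. \<forall>j. NF (d * m) j F"
proof (induction rule: CC.induct)
  case (CC_ind Q)
  then show ?case by (rule NF_QQ)
next
  case (CC_term F)
  obtain d s where d: "d > 0" "quasi d s F" using TT_quasi[OF CC_term] by blast
  show ?case
  proof (intro exI[of _ d] conjI allI impI d(1))
    fix m j
    have eq: "F (case_nat (j + d * m * k) z) = F (case_nat j z) + (s * m) * k" for k z
      using quasi_mult[OF d(2), of m] unfolding quasi_def by blast
    show "NF (d * m) j (\<lambda>z. of_int (F z))"
      by (intro NF_I[of "[(\<lambda>z. of_int (F (case_nat j z)), 0, 1, \<lambda>z. 0), (\<lambda>z. of_int (s * m), 1, 1, \<lambda>z. 0)]"])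
         (auto simp: eq intro!: CC.CC_term CC_const TT_push TT_const CC_term)
  qed
next
  case (CC_exp F \<theta>)
  obtain d s where d: "d > 0" "quasi d s F" using TT_quasi[OF CC_exp(1)] by blast
  show ?case
  proof (intro exI[of _ d] conjI allI impI d(1))
    fix m j
    have eq: "F (case_nat (j + d * m * k) z) = F (case_nat j z) + (s * m) * k" for k z
      using quasi_mult[OF d(2), of m] unfolding quasi_def by blast
    show "NF (d * m) j (\<lambda>z. \<theta> powi F z)"
      by (intro NF_I[of "[(\<lambda>z. \<theta> powi (F (case_nat j z)), 0, \<theta> powi (s * m), \<lambda>z. 0)]"])
         (use CC_exp in \<open>auto simp: eq power_int_add power_int_mult zero_less_power_int intro!: CC.CC_exp TT_push TT_const\<close>)
  qed
next
  case (CC_const c)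
  then show ?case using NF_const by (metis zero_less_one)
next
  case (CC_add F G)
  obtain d where d: "d > 0" "\<And>m j. m > 0 \<Longrightarrow> NF (d * m) j F" using CC_add.IH(1) by blast
  obtain d' where d': "d' > 0" "\<And>m j. m > 0 \<Longrightarrow> NF (d' * m) j G" using CC_add.IH(2) by blast
  have "NF (d * d' * m) j (\<lambda>z. F z + G z)" if "m > 0" for m j
  proof -
    have "NF (d * (d' * m)) j F" "NF (d' * (d * m)) j G" using d d' that by auto
    then have "NF (d * d' * m) j F" "NF (d * d' * m) j G" by (simp_all add: mult_ac)
    then show ?thesis by (rule NF_add)
  qed
  then show ?case using d(1) d'(1) by (metis mult_pos_pos)
next
  case (CC_mult F G)
  obtain d where d: "d > 0" "\<And>m j. m > 0 \<Longrightarrow> NF (d * m) j F" using CC_mult.IH(1) by blast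
  obtain d' where d': "d' > 0" "\<And>m j. m > 0 \<Longrightarrow> NF (d' * m) j G" using CC_mult.IH(2) by blast
  have "NF (d * d' * m) j (\<lambda>z. F z * G z)" if "m > 0" for m j
  proof -
    have "NF (d * (d' * m)) j F" "NF (d' * (d * m)) j G" using d d' that by auto
    then have "NF (d * d' * m) j F" "NF (d * d' * m) j G" by (simp_all add: mult_ac)
    then show ?thesis by (rule NF_mult)
  qed
  then show ?case using d(1) d'(1) by (metis mult_pos_pos)
qed

section \<open>Summation of exponential polynomials\<close>

definition psum :: "nat \<Rightarrow> real \<Rightarrow> nat \<Rightarrow> real" where
  "psum e \<Theta> n = (\<Sum>k<n. of_nat k ^ e * \<Theta> ^ k)"

text \<open>Upper summation bounds will be terms in the remaining variables, cut off at 0, so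
  constructibility is required after every such substitution.\<close>

definition CCP :: "(nat \<Rightarrow> real) \<Rightarrow> bool" where
  "CCP f \<longleftrightarrow> (\<forall>\<beta>\<in>TT. (\<lambda>z. f (nat (\<beta> z))) \<in> CC)"

lemma CCP_add: "CCP f \<Longrightarrow> CCP g \<Longrightarrow> CCP (\<lambda>n. f n + g n)"
  and CCP_scale: "CCP f \<Longrightarrow> CCP (\<lambda>n. c * f n)"
  and CCP_const: "CCP (\<lambda>n. c)"
  by (auto simp: CCP_def intro: CC_add CC_mult CC_const)

lemma CCP_diff: "CCP f \<Longrightarrow> CCP g \<Longrightarrow> CCP (\<lambda>n. f n - g n)"
  using CCP_add[OF _ CCP_scale, of f g "-1"] by simp

lemma CCP_sum: "(\<And>i. i \<in> A \<Longrightarrow> CCP (f i)) \<Longrightarrow> CCP (\<lambda>n. \<Sum>i\<in>A. f i n)"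
  by (induction A rule: infinite_finite_induct) (auto intro: CCP_const CCP_add)

lemma CCP_monomial:
  assumes "0 < \<Theta>"
  shows "CCP (\<lambda>n. of_nat n ^ e * \<Theta> ^ n)"
  unfolding CCP_def
proof
  fix \<beta> assume \<beta>: "\<beta> \<in> TT"
  have "(\<lambda>z. of_bool (0 \<le> \<beta> z) * (of_int (\<beta> z) ^ e * \<Theta> powi (\<beta> z)) + of_bool (\<not> 0 \<le> \<beta> z) * (0 ^ e)) \<in> CC"
    using \<beta> assms by (intro CC_add CC_mult CC_ind CC_power CC_term CC_exp CC_const QQ_ge QQ_not)
  also have "(\<lambda>z. of_bool (0 \<le> \<beta> z) * (of_int (\<beta> z) ^ e * \<Theta> powi (\<beta> z)) + of_bool (\<not> 0 \<le> \<beta> z) * (0 ^ e)) =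
     (\<lambda>z. of_nat (nat (\<beta> z)) ^ e * \<Theta> ^ nat (\<beta> z))"
    by (rule ext) (auto simp: power_int_def)
  finally show "(\<lambda>z. of_nat (nat (\<beta> z)) ^ e * \<Theta> ^ nat (\<beta> z)) \<in> CC" .
qed

text \<open>Telescoping of the differences of \<open>k ^ e * \<Theta> ^ k\<close>, with the power of
  k + 1 expanded by the binomial theorem.\<close>

lemma psum_rec:
  "of_nat n ^ e * \<Theta> ^ n - 0 ^ e = \<Theta> * (\<Sum>l\<le>e. of_nat (e choose l) * psum l \<Theta> n) - psum e \<Theta> n"
proof (induction n)
  case (Suc n)
  have "of_nat (Suc n) ^ e = (\<Sum>l\<le>e. of_nat (e choose l) * (of_nat n :: real) ^ l)"
    using binomial_ring[of "of_nat n :: real" 1 e] by (simp add: add.commute)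
  then have "of_nat (Suc n) ^ e * \<Theta> ^ Suc n = \<Theta> * (\<Sum>l\<le>e. of_nat (e choose l) * (of_nat n ^ l * \<Theta> ^ n))"
    by (simp add: sum_distrib_right sum_distrib_left mult_ac)
  moreover have "\<Theta> * (\<Sum>l\<le>e. of_nat (e choose l) * psum l \<Theta> (Suc n)) =
    \<Theta> * (\<Sum>l\<le>e. of_nat (e choose l) * psum l \<Theta> n) + \<Theta> * (\<Sum>l\<le>e. of_nat (e choose l) * (of_nat n ^ l * \<Theta> ^ n))"
    by (simp add: psum_def distrib_left sum.distrib)
  moreover have "psum e \<Theta> (Suc n) = psum e \<Theta> n + of_nat n ^ e * \<Theta> ^ n" by (simp add: psum_def)
  ultimately show ?case using Suc by linarith
qed (simp add: psum_def)

text \<open>The recurrence is solved for its top term, which carries the coefficient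
  \<open>\<Theta> - 1\<close>. For ratio 1 this coefficient vanishes, and the recurrence with
  exponent \<open>Suc e\<close> determines the sum with exponent e instead.\<close>

lemma CCP_psum:
  assumes \<Theta>: "0 < \<Theta>"
  shows "CCP (psum e \<Theta>)"
proof (induction e rule: less_induct)
  case (less e)
  show ?case
  proof (cases "\<Theta> = 1")
    case False
    have "(\<Sum>l\<le>e. of_nat (e choose l) * psum l \<Theta> n) = (\<Sum>l<e. of_nat (e choose l) * psum l \<Theta> n) + psum e \<Theta> n" for n
      by (simp add: lessThan_Suc_atMost[symmetric])
    then have "psum e \<Theta> n = 1 / (\<Theta> - 1) * ((of_nat n ^ e * \<Theta> ^ n - 0 ^ e) - \<Theta> * (\<Sum>l<e. of_nat (e choose l) * psum l \<Theta> n))" for n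
      using psum_rec[of n e \<Theta>] False by (simp add: field_simps)
    moreover have "CCP (\<lambda>n. 1 / (\<Theta> - 1) * ((of_nat n ^ e * \<Theta> ^ n - 0 ^ e) - \<Theta> * (\<Sum>l<e. of_nat (e choose l) * psum l \<Theta> n)))"
      by (intro CCP_scale CCP_diff CCP_monomial CCP_const CCP_sum less \<Theta>) auto
    ultimately show ?thesis by presburger
  next
    case True
    have "(\<Sum>l\<le>Suc e. of_nat (Suc e choose l) * psum l 1 n) =
      (\<Sum>l<e. of_nat (Suc e choose l) * psum l 1 n) + of_nat (Suc e) * psum e 1 n + psum (Suc e) 1 n" for n
    proof -
      have "{..Suc e} = insert (Suc e) (insert e {..<e})" by auto
      then show ?thesis by (simp add: algebra_simps)
    qed
    then have "psum e \<Theta> n = 1 / of_nat (Suc e) * (of_nat n ^ Suc e * 1 ^ n - (\<Sum>l<e. of_nat (Suc e choose l) * psum l 1 n))" for n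
      using psum_rec[of n "Suc e" 1] True by (simp add: field_simps del: of_nat_Suc binomial_Suc_Suc)
    moreover have "CCP (\<lambda>n. 1 / of_nat (Suc e) * (of_nat n ^ Suc e * 1 ^ n - (\<Sum>l<e. of_nat (Suc e choose l) * psum l 1 n)))"
      using less True by (intro CCP_scale CCP_diff CCP_monomial CCP_sum) auto
    ultimately show ?thesis by presburger
  qed
qed

lemma power_times_geometric_tendsto_0:
  assumes "0 < x" "x < (1::real)"
  shows "(\<lambda>k. of_nat k ^ e * x ^ k) \<longlonglongrightarrow> 0"
proof (cases "e = 0")
  case True
  then show ?thesis using LIMSEQ_power_zero[of x] assms by simp
next
  case False
  define y where "y = root e x"
  have y: "0 < y" "y < 1" "y ^ e = x" using assms False by (simp_all add: y_def)
  have "(\<lambda>k. of_nat k * y ^ k) \<longlonglongrightarrow> 0" using powser_times_n_limit_0[of y] y by simp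
  then have "(\<lambda>k. (of_nat k * y ^ k) ^ e) \<longlonglongrightarrow> 0 ^ e" by (rule tendsto_power)
  moreover have "(of_nat k * y ^ k) ^ e = of_nat k ^ e * x ^ k" for k
    by (simp add: power_mult_distrib flip: y(3)) (simp add: mult.commute flip: power_mult)
  ultimately show ?thesis using False by (simp add: zero_power)
qed

lemma summable_power_times_geometric:
  assumes "0 < x" "x < (1::real)"
  shows "summable (\<lambda>k. of_nat k ^ e * x ^ k)"
proof -
  define y where "y = sqrt x"
  have y: "0 < y" "y < 1" "y * y = x" using assms by (simp_all add: y_def)
  have "(\<lambda>k. of_nat k ^ e * y ^ k) \<longlonglongrightarrow> 0" using y by (intro power_times_geometric_tendsto_0)
  then have "eventually (\<lambda>k. \<bar>of_nat k ^ e * y ^ k\<bar> < 1) sequentially"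
    by (auto simp: tendsto_iff dist_real_def elim!: allE[of _ 1])
  then have "eventually (\<lambda>k. norm (of_nat k ^ e * x ^ k) \<le> y ^ k) sequentially"
  proof eventually_elim
    case (elim k)
    have "norm (of_nat k ^ e * x ^ k) = \<bar>of_nat k ^ e * y ^ k\<bar> * y ^ k"
      using y by (simp add: abs_mult power_mult_distrib flip: y(3))
    also have "\<dots> \<le> 1 * y ^ k" using elim y by (intro mult_right_mono) auto
    finally show ?case by simp
  qed
  moreover have "summable (\<lambda>k. y ^ k)" using y by (intro summable_geometric) auto
  ultimately show ?thesis by (rule summable_comparison_test_ev)
qed

text \<open>Linear independence of the growth rates of exponential polynomials that do not decay.\<close>

lemma no_growth:
  fixes G :: "nat \<times> real \<Rightarrow> real"
  assumes fin: "finite A" and pos: "\<And>e \<Theta>. (e, \<Theta>) \<in> A \<Longrightarrow> 0 < \<Theta>"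
    and lim: "(\<lambda>k. \<Sum>(e, \<Theta>)\<in>A. G (e, \<Theta>) * (of_nat k ^ e * \<Theta> ^ k)) \<longlonglongrightarrow> 0"
    and mem: "(e0, \<Theta>0) \<in> A" "1 \<le> \<Theta>0"
  shows "G (e0, \<Theta>0) = 0"
proof (rule ccontr)
  assume "G (e0, \<Theta>0) \<noteq> 0"
  define A' where "A' = {(e, \<Theta>) \<in> A. 1 \<le> \<Theta> \<and> G (e, \<Theta>) \<noteq> 0}"
  have "A' \<subseteq> A" by (auto simp: A'_def)
  then have A': "finite A'" "A' \<noteq> {}" using finite_subset[OF _ fin] mem \<open>G (e0, \<Theta>0) \<noteq> 0\<close> by (auto simp: A'_def)
  \<comment> \<open>The dominant term has the largest base and, for that base, the largest exponent
    of k. After division by its growth only its coefficient survives in the limit.\<close>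
  define \<Theta>m where "\<Theta>m = Max (snd ` A')"
  have "\<Theta>m \<in> snd ` A'" unfolding \<Theta>m_def using A' by (intro Max_in) auto
  then obtain e1 where e1: "(e1, \<Theta>m) \<in> A'" by auto
  define em where "em = Max {e. (e, \<Theta>m) \<in> A'}"
  have fe: "finite {e. (e, \<Theta>m) \<in> A'}"
    by (rule finite_subset[of _ "fst ` A'"]) (use A' in force)+
  have "em \<in> {e. (e, \<Theta>m) \<in> A'}" unfolding em_def by (rule Max_in) (use fe e1 in auto)
  then have m: "(em, \<Theta>m) \<in> A" "1 \<le> \<Theta>m" "G (em, \<Theta>m) \<noteq> 0" by (auto simp: A'_def)
  have max: "\<Theta> < \<Theta>m \<or> \<Theta> = \<Theta>m \<and> e < em" if "(e, \<Theta>) \<in> A" "G (e, \<Theta>) \<noteq> 0" "(e, \<Theta>) \<noteq> (em, \<Theta>m)" for e \<Theta>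
  proof (cases "1 \<le> \<Theta>")
    case True
    then have in': "(e, \<Theta>) \<in> A'" using that by (simp add: A'_def)
    then have "\<Theta> \<le> \<Theta>m" unfolding \<Theta>m_def using A' by (intro Max_ge) force+
    moreover have "e \<le> em" if "\<Theta> = \<Theta>m" unfolding em_def using in' fe that by (intro Max_ge) auto
    ultimately show ?thesis using that by force
  qed (use m in auto)
  define h where "h e \<Theta> k = (of_nat k ^ e * \<Theta> ^ k) / (of_nat k ^ em * \<Theta>m ^ k)" for e and \<Theta> :: real and k :: nat
  have h: "(\<lambda>k. G (e, \<Theta>) * h e \<Theta> k) \<longlonglongrightarrow> (if (e, \<Theta>) = (em, \<Theta>m) then G (em, \<Theta>m) else 0)" if eA: "(e, \<Theta>) \<in> A" for e \<Theta>
  proof (cases "(e, \<Theta>) = (em, \<Theta>m)")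
    case True
    have "eventually (\<lambda>k. h em \<Theta>m k = 1) sequentially"
      using eventually_gt_at_top[of 0] by eventually_elim (use m in \<open>simp add: h_def\<close>)
    then have "h em \<Theta>m \<longlonglongrightarrow> 1" by (rule tendsto_eventually)
    then show ?thesis using True tendsto_mult_left[of "h em \<Theta>m" 1 sequentially "G (em, \<Theta>m)"] by simp
  next
    case ne: False
    show ?thesis
    proof (cases "G (e, \<Theta>) = 0")
      case False
      have "h e \<Theta> \<longlonglongrightarrow> 0"
      proof (cases "\<Theta> < \<Theta>m")
        case True
        have "(\<lambda>k. of_nat k ^ e * (\<Theta> / \<Theta>m) ^ k) \<longlonglongrightarrow> 0"
          using True pos[OF eA] m by (intro power_times_geometric_tendsto_0) auto
        then show ?thesis
        proof (rule Lim_null_comparison[rotated])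
          show "eventually (\<lambda>k. norm (h e \<Theta> k) \<le> of_nat k ^ e * (\<Theta> / \<Theta>m) ^ k) sequentially"
            using eventually_gt_at_top[of 0]
          proof eventually_elim
            case (elim k)
            have "norm (h e \<Theta> k) = (of_nat k ^ e * (\<Theta> / \<Theta>m) ^ k) / of_nat k ^ em"
              using pos[OF eA] m by (simp add: h_def power_divide abs_mult)
            also have "\<dots> \<le> (of_nat k ^ e * (\<Theta> / \<Theta>m) ^ k) / 1"
              using elim pos[OF eA] m by (intro divide_left_mono) auto
            finally show ?case by simp
          qed
        qed
      next
        case not_less: False
        then have eq: "\<Theta> = \<Theta>m" "e < em" using max[OF eA False ne] by auto
        have "(\<lambda>k. inverse (real k)) \<longlonglongrightarrow> 0" by (rule lim_inverse_n)
        then show ?thesis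
        proof (rule Lim_null_comparison[rotated])
          show "eventually (\<lambda>k. norm (h e \<Theta> k) \<le> inverse (real k)) sequentially"
            using eventually_gt_at_top[of 0]
          proof eventually_elim
            case (elim k)
            obtain i where i: "em = Suc (e + i)" using eq(2) less_iff_Suc_add by auto
            have "norm (h e \<Theta> k) = inverse (real k) * inverse (real k ^ i)"
              using elim m eq(1) by (simp add: h_def i power_add field_simps)
            also have "\<dots> \<le> inverse (real k) * 1"
              using elim by (intro mult_left_mono) (auto simp: field_simps)
            finally show ?case by simp
          qed
        qed
      qed
      then show ?thesis using ne tendsto_mult_left[of "h e \<Theta>" 0 sequentially "G (e, \<Theta>)"] by auto
    qed (use ne in auto)
  qed
  have "(\<lambda>k. \<Sum>(e, \<Theta>)\<in>A. G (e, \<Theta>) * h e \<Theta> k) \<longlonglongrightarrow> (\<Sum>(e, \<Theta>)\<in>A. if (e, \<Theta>) = (em, \<Theta>m) then G (em, \<Theta>m) else 0)"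
    using h by (intro tendsto_sum) auto
  also have "(\<Sum>(e, \<Theta>)\<in>A. if (e, \<Theta>) = (em, \<Theta>m) then G (em, \<Theta>m) else 0) = (\<Sum>t\<in>A. if t = (em, \<Theta>m) then G (em, \<Theta>m) else 0)"
    by (simp add: case_prod_unfold prod_eq_iff)
  also have "\<dots> = G (em, \<Theta>m)" using fin m(1) by simp
  finally have l1: "(\<lambda>k. \<Sum>(e, \<Theta>)\<in>A. G (e, \<Theta>) * h e \<Theta> k) \<longlonglongrightarrow> G (em, \<Theta>m)" .
  have "(\<lambda>k. \<Sum>(e, \<Theta>)\<in>A. G (e, \<Theta>) * h e \<Theta> k) \<longlonglongrightarrow> 0"
  proof (rule Lim_null_comparison)
    show "(\<lambda>k. norm (\<Sum>(e, \<Theta>)\<in>A. G (e, \<Theta>) * (of_nat k ^ e * \<Theta> ^ k))) \<longlonglongrightarrow> 0"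
      using lim by (rule tendsto_norm_zero)
    show "eventually (\<lambda>k. norm (\<Sum>(e, \<Theta>)\<in>A. G (e, \<Theta>) * h e \<Theta> k) \<le>
        norm (\<Sum>(e, \<Theta>)\<in>A. G (e, \<Theta>) * (of_nat k ^ e * \<Theta> ^ k))) sequentially"
      using eventually_gt_at_top[of 0]
    proof eventually_elim
      case (elim k)
      have ge1: "1 \<le> real k ^ em * \<Theta>m ^ k"
        using elim m by (intro mult_ge1_I one_le_power) auto
      have "(\<Sum>(e, \<Theta>)\<in>A. G (e, \<Theta>) * h e \<Theta> k) =
         (\<Sum>(e, \<Theta>)\<in>A. G (e, \<Theta>) * (of_nat k ^ e * \<Theta> ^ k)) / (real k ^ em * \<Theta>m ^ k)"
        by (simp add: h_def sum_divide_distrib case_prod_unfold)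
      also have "norm \<dots> \<le> norm (\<Sum>(e, \<Theta>)\<in>A. G (e, \<Theta>) * (of_nat k ^ e * \<Theta> ^ k)) / 1"
        unfolding norm_divide using ge1 by (intro divide_left_mono) (auto intro: order_trans)
      finally show ?case by simp
    qed
  qed
  then have "G (em, \<Theta>m) = 0" using LIMSEQ_unique[OF l1] by simp
  then show False using m(3) by simp
qed


lemma sum_list_group:
  fixes g :: "'a \<Rightarrow> real"
  shows "(\<Sum>x\<leftarrow>xs. g x * h (key x)) = (\<Sum>t\<in>key ` set xs. (\<Sum>x\<leftarrow>filter (\<lambda>x. key x = t) xs. g x) * h t)"
proof (induction xs)
  case (Cons a xs)
  have "(\<Sum>t\<in>key ` set (a # xs). (\<Sum>x\<leftarrow>filter (\<lambda>x. key x = t) (a # xs). g x) * h t) =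
     (\<Sum>t\<in>insert (key a) (key ` set xs). (if t = key a then g a * h t else 0) + (\<Sum>x\<leftarrow>filter (\<lambda>x. key x = t) xs. g x) * h t)"
    by (intro sum.cong) (auto simp: algebra_simps)
  also have "\<dots> = g a * h (key a) + (\<Sum>t\<in>insert (key a) (key ` set xs). (\<Sum>x\<leftarrow>filter (\<lambda>x. key x = t) xs. g x) * h t)"
    by (subst sum.distrib) simp
  also have "(\<Sum>t\<in>insert (key a) (key ` set xs). (\<Sum>x\<leftarrow>filter (\<lambda>x. key x = t) xs. g x) * h t) =
     (\<Sum>t\<in>key ` set xs. (\<Sum>x\<leftarrow>filter (\<lambda>x. key x = t) xs. g x) * h t)"
  proof (cases "key a \<in> key ` set xs")
    case False
    then have "filter (\<lambda>x. key x = key a) xs = []" by (auto simp: filter_empty_conv image_iff)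
    then show ?thesis using False by simp
  qed (simp add: insert_absorb)
  finally show ?case using Cons by simp
qed simp

definition total :: "nat \<Rightarrow> real \<Rightarrow> real" where
  "total e \<Theta> = (if \<Theta> < 1 then (suminf (\<lambda>k. of_nat k ^ e * \<Theta> ^ k)) else 0)"

text \<open>The coefficients of the terms that do not decay cancel, so their infinite tails may be dropped
  and only the finite initial segments contribute.\<close>

lemma sums_exp_poly:
  fixes xs :: "(real \<times> nat \<times> real \<times> nat) list"
  assumes pos: "\<And>g e \<Theta> b. (g, e, \<Theta>, b) \<in> set xs \<Longrightarrow> 0 < \<Theta>"
    and f: "\<And>k. f k = (\<Sum>(g, e, \<Theta>, b)\<leftarrow>xs. g * (of_nat k ^ e * \<Theta> ^ k * of_bool (b \<le> k)))"
    and s: "f sums s"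
  shows "s = (\<Sum>(g, e, \<Theta>, b)\<leftarrow>xs. g * (total e \<Theta> - psum e \<Theta> b))"
proof -
  define key where "key = (\<lambda>(g :: real, e :: nat, \<Theta> :: real, b :: nat). (e, \<Theta>))"
  define A where "A = key ` set xs"
  define G where "G t = (\<Sum>x\<leftarrow>filter (\<lambda>x. key x = t) xs. fst x)" for t
  have group: "(\<Sum>(g, e, \<Theta>, b)\<leftarrow>xs. g * h e \<Theta>) = (\<Sum>(e, \<Theta>)\<in>A. G (e, \<Theta>) * h e \<Theta>)" for h
  proof -
    have "(\<Sum>(g, e, \<Theta>, b)\<leftarrow>xs. g * h e \<Theta>) = (\<Sum>x\<leftarrow>xs. fst x * (case key x of (e, \<Theta>) \<Rightarrow> h e \<Theta>))"
      by (intro arg_cong[of _ _ sum_list] map_cong refl) (auto simp: key_def)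
    also have "\<dots> = (\<Sum>t\<in>A. G t * (case t of (e, \<Theta>) \<Rightarrow> h e \<Theta>))"
      unfolding A_def G_def by (rule sum_list_group)
    also have "\<dots> = (\<Sum>(e, \<Theta>)\<in>A. G (e, \<Theta>) * h e \<Theta>)" by (intro sum.cong) auto
    finally show ?thesis .
  qed
  have Apos: "0 < \<Theta>" if "(e, \<Theta>) \<in> A" for e \<Theta> using that pos by (auto simp: A_def key_def)
  have fin: "finite A" by (simp add: A_def)
  \<comment> \<open>The sum of all thresholds serves as a common upper bound for them.\<close>
  define K where "K = (\<Sum>(g, e, \<Theta>, b)\<leftarrow>xs. b)"
  have K: "b \<le> K" if "(g, e, \<Theta>, b) \<in> set xs" for g e \<Theta> b
  proof -
    have "b \<in> set (map (\<lambda>(g, e, \<Theta>, b). b) xs)" using that by force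
    then show ?thesis unfolding K_def by (rule member_le_sum_list) auto
  qed
  have large: "f k = (\<Sum>(e, \<Theta>)\<in>A. G (e, \<Theta>) * (of_nat k ^ e * \<Theta> ^ k))" if "K \<le> k" for k
  proof -
    have "f k = (\<Sum>(g, e, \<Theta>, b)\<leftarrow>xs. g * (of_nat k ^ e * \<Theta> ^ k))"
      unfolding f using K that by (intro arg_cong[of _ _ sum_list] map_cong refl) force
    then show ?thesis using group[of "\<lambda>e \<Theta>. of_nat k ^ e * \<Theta> ^ k"] by simp
  qed
  have "f \<longlonglongrightarrow> 0" using s by (intro summable_LIMSEQ_zero) (auto simp: sums_iff)
  moreover have "eventually (\<lambda>k. f k = (\<Sum>(e, \<Theta>)\<in>A. G (e, \<Theta>) * (of_nat k ^ e * \<Theta> ^ k))) sequentially"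
    using eventually_ge_at_top[of K] by eventually_elim (rule large)
  ultimately have lim: "(\<lambda>k. \<Sum>(e, \<Theta>)\<in>A. G (e, \<Theta>) * (of_nat k ^ e * \<Theta> ^ k)) \<longlonglongrightarrow> 0"
    by (rule Lim_transform_eventually)
  have G0: "G (e, \<Theta>) = 0" if "(e, \<Theta>) \<in> A" "1 \<le> \<Theta>" for e \<Theta>
    by (rule no_growth[OF fin Apos lim that])
  have psum_lim: "(\<lambda>n. G (e, \<Theta>) * psum e \<Theta> n) \<longlonglongrightarrow> G (e, \<Theta>) * total e \<Theta>" if "(e, \<Theta>) \<in> A" for e \<Theta>
  proof (cases "\<Theta> < 1")
    case True
    then have "summable (\<lambda>k. of_nat k ^ e * \<Theta> ^ k)" using Apos[OF that] by (intro summable_power_times_geometric)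
    then have "psum e \<Theta> \<longlonglongrightarrow> total e \<Theta>"
      using True by (simp add: total_def psum_def[abs_def] summable_LIMSEQ)
    then show ?thesis by (rule tendsto_mult_left)
  qed (use G0[OF that] in auto)
  have part: "(\<Sum>k<n. f k) = (\<Sum>(e, \<Theta>)\<in>A. G (e, \<Theta>) * psum e \<Theta> n) - (\<Sum>(g, e, \<Theta>, b)\<leftarrow>xs. g * psum e \<Theta> b)"
    if n: "K \<le> n" for n
  proof -
    have one: "(\<Sum>k<n. of_nat k ^ e * \<Theta> ^ k * of_bool (b \<le> k)) = psum e \<Theta> n - psum e \<Theta> b" if "b \<le> n" for e \<Theta> b
    proof -
      have "psum e \<Theta> n = psum e \<Theta> b + (\<Sum>k=b..<n. of_nat k ^ e * \<Theta> ^ k)"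
        unfolding psum_def lessThan_atLeast0 by (rule sum.atLeastLessThan_concat[symmetric]) (use that in auto)
      moreover have "(\<Sum>k<n. of_nat k ^ e * \<Theta> ^ k * of_bool (b \<le> k)) = (\<Sum>k=b..<n. of_nat k ^ e * \<Theta> ^ k)"
        by (rule sum.mono_neutral_cong_right) auto
      ultimately show ?thesis by simp
    qed
    have swap: "(\<Sum>k<n. \<Sum>x\<leftarrow>ys. F x k) = (\<Sum>x\<leftarrow>ys. \<Sum>k<n. F x k)" for ys and F :: "real \<times> nat \<times> real \<times> nat \<Rightarrow> nat \<Rightarrow> real"
      by (induction ys) (auto simp: sum.distrib)
    have "(\<Sum>k<n. f k) = (\<Sum>x\<leftarrow>xs. \<Sum>k<n. (case x of (g, e, \<Theta>, b) \<Rightarrow> g * (of_nat k ^ e * \<Theta> ^ k * of_bool (b \<le> k))))"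
      unfolding f by (rule swap)
    also have "\<dots> = (\<Sum>(g, e, \<Theta>, b)\<leftarrow>xs. g * psum e \<Theta> n - g * psum e \<Theta> b)"
    proof (intro arg_cong[of _ _ sum_list] map_cong refl)
      fix x assume x: "x \<in> set xs"
      obtain g e \<Theta> b where xx: "x = (g, e, \<Theta>, b)" by (cases x)
      have "b \<le> n" using K[of g e \<Theta> b] x n xx by simp
      then show "(\<Sum>k<n. (case x of (g, e, \<Theta>, b) \<Rightarrow> g * (of_nat k ^ e * \<Theta> ^ k * of_bool (b \<le> k)))) =
         (case x of (g, e, \<Theta>, b) \<Rightarrow> g * psum e \<Theta> n - g * psum e \<Theta> b)"
        by (simp only: xx prod.case sum_distrib_left[symmetric] one[OF \<open>b \<le> n\<close>] right_diff_distrib)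
    qed
    also have "\<dots> = (\<Sum>(g, e, \<Theta>, b)\<leftarrow>xs. g * psum e \<Theta> n) - (\<Sum>(g, e, \<Theta>, b)\<leftarrow>xs. g * psum e \<Theta> b)"
      by (simp add: case_prod_unfold sum_list_subtractf)
    also have "(\<Sum>(g, e, \<Theta>, b)\<leftarrow>xs. g * psum e \<Theta> n) = (\<Sum>(e, \<Theta>)\<in>A. G (e, \<Theta>) * psum e \<Theta> n)"
      by (rule group)
    finally show ?thesis .
  qed
  have "(\<lambda>n. (\<Sum>(e, \<Theta>)\<in>A. G (e, \<Theta>) * psum e \<Theta> n) - (\<Sum>(g, e, \<Theta>, b)\<leftarrow>xs. g * psum e \<Theta> b))
     \<longlonglongrightarrow> (\<Sum>(e, \<Theta>)\<in>A. G (e, \<Theta>) * total e \<Theta>) - (\<Sum>(g, e, \<Theta>, b)\<leftarrow>xs. g * psum e \<Theta> b)"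
    using psum_lim by (intro tendsto_diff tendsto_sum tendsto_const) auto
  moreover have "eventually (\<lambda>n. (\<Sum>(e, \<Theta>)\<in>A. G (e, \<Theta>) * psum e \<Theta> n) - (\<Sum>(g, e, \<Theta>, b)\<leftarrow>xs. g * psum e \<Theta> b) = (\<Sum>k<n. f k)) sequentially"
    using eventually_ge_at_top[of K] by eventually_elim (simp add: part)
  ultimately have "(\<lambda>n. \<Sum>k<n. f k) \<longlonglongrightarrow> (\<Sum>(e, \<Theta>)\<in>A. G (e, \<Theta>) * total e \<Theta>) - (\<Sum>(g, e, \<Theta>, b)\<leftarrow>xs. g * psum e \<Theta> b)"
    by (rule Lim_transform_eventually)
  then have "s = (\<Sum>(e, \<Theta>)\<in>A. G (e, \<Theta>) * total e \<Theta>) - (\<Sum>(g, e, \<Theta>, b)\<leftarrow>xs. g * psum e \<Theta> b)"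
    using s unfolding sums_def by (rule LIMSEQ_unique[rotated])
  also have "(\<Sum>(e, \<Theta>)\<in>A. G (e, \<Theta>) * total e \<Theta>) = (\<Sum>(g, e, \<Theta>, b)\<leftarrow>xs. g * total e \<Theta>)"
    by (rule group[symmetric])
  finally show ?thesis by (simp add: case_prod_unfold sum_list_subtractf right_diff_distrib)
qed

lemma suminf_residues:
  fixes f :: "nat \<Rightarrow> real"
  assumes "summable f" "\<And>k. 0 \<le> f k" "0 < d"
  shows "\<And>j. summable (\<lambda>k. f (j + d * k))" "(suminf (\<lambda>k. f k)) = (\<Sum>j<d. suminf (\<lambda>k. f (j + d * k)))"
proof -
  show sub: "summable (\<lambda>k. f (j + d * k))" for j
  proof -
    have "strict_mono (\<lambda>k. j + d * k)" using assms(3) by (auto simp: strict_mono_def)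
    then show ?thesis using summable_reindex[of f "\<lambda>k. j + d * k"] assms strict_mono_imp_inj_on by (auto simp: o_def)
  qed
  have "(\<lambda>n. sum f {n * d..<n * d + d}) sums (suminf (\<lambda>k. f k))"
    by (rule sums_group) (use assms summable_sums in auto)
  moreover have "sum f {n * d..<n * d + d} = (\<Sum>j<d. f (j + d * n))" for n
    using sum.shift_bounds_nat_ivl[of f 0 "n * d" d] by (simp add: lessThan_atLeast0 add.commute mult.commute)
  ultimately have "(\<lambda>n. \<Sum>j<d. f (j + d * n)) sums (suminf (\<lambda>k. f k))" by simp
  moreover have "(\<lambda>n. \<Sum>j<d. f (j + d * n)) sums (\<Sum>j<d. suminf (\<lambda>k. f (j + d * k)))"
    using sub by (intro sums_sum summable_sums)
  ultimately show "(suminf (\<lambda>k. f k)) = (\<Sum>j<d. suminf (\<lambda>k. f (j + d * k)))" by (rule sums_unique2)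
qed

lemma CC_sum_list: "(\<And>x. x \<in> set xs \<Longrightarrow> (\<lambda>z. F x z) \<in> CC) \<Longrightarrow> (\<lambda>z. \<Sum>x\<leftarrow>xs. F x z) \<in> CC"
  by (induction xs) (auto intro: CC_const CC_add)

text \<open>Nonnegativity permits splitting the series by residue classes, and on each class
  \<open>sums_exp_poly\<close> evaluates it. The other variables enter the answer only through
  coefficients and thresholds, so it is again constructible.\<close>

lemma CC_suminf:
  assumes F: "F \<in> CC" and nonneg: "\<And>z. 0 \<le> F z"
    and summable: "\<And>z. summable (\<lambda>k. F (case_nat (int k) z))"
  shows "(\<lambda>z. suminf (\<lambda>k. F (case_nat (int k) z))) \<in> CC"
proof -
  obtain d where d: "d > 0" "\<And>m j. m > 0 \<Longrightarrow> NF (d * m) j F" using NF_CC[OF F] by blast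
  have "NF d j F" for j using d(2)[of 1 j] by simp
  then have "\<forall>j. \<exists>xs. list_all nf_ok xs \<and> (\<forall>z. \<forall>k\<ge>0. F (case_nat (j + d * k) z) = (\<Sum>x\<leftarrow>xs. nf_val x z k))"
    by (simp add: NF_def)
  then obtain xs where xs: "\<And>j. list_all nf_ok (xs j)"
    "\<And>j z k. 0 \<le> k \<Longrightarrow> F (case_nat (j + d * k) z) = (\<Sum>x\<leftarrow>xs j. nf_val x z k)" by metis
  define W where "W j z = (\<Sum>(g, e, \<Theta>, \<beta>)\<leftarrow>xs j. g z * (total e \<Theta> - psum e \<Theta> (nat (\<beta> z))))" for j z
  have "(\<lambda>z. W j z) \<in> CC" for j
    unfolding W_def
  proof (rule CC_sum_list)
    fix x assume x: "x \<in> set (xs j)"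
    obtain g e \<Theta> \<beta> where [simp]: "x = (g, e, \<Theta>, \<beta>)" by (cases x)
    have ok: "g \<in> CC" "0 < \<Theta>" "\<beta> \<in> TT" using xs(1)[of j] x by (auto simp: list_all_iff)
    have "(\<lambda>z. psum e \<Theta> (nat (\<beta> z))) \<in> CC" using CCP_psum[OF ok(2)] ok(3) by (simp add: CCP_def)
    then show "(\<lambda>z. case x of (g, e, \<Theta>, \<beta>) \<Rightarrow> g z * (total e \<Theta> - psum e \<Theta> (nat (\<beta> z)))) \<in> CC"
      using ok by (simp) (intro CC_mult CC_diff CC_const)
  qed
  then have "(\<lambda>z. \<Sum>j<nat d. W (int j) z) \<in> CC" by (intro CC_sum)
  moreover have "(suminf (\<lambda>k. F (case_nat (int k) z))) = (\<Sum>j<nat d. W (int j) z)" for z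
  proof -
    have nd: "0 < nat d" using d by simp
    note sr = suminf_residues[where f = "\<lambda>k. F (case_nat (int k) z)", OF summable nonneg nd]
    have "(suminf (\<lambda>k. F (case_nat (int (j + nat d * k)) z))) = W (int j) z" for j
    proof -
      let ?ys = "map (\<lambda>(g, e, \<Theta>, \<beta>). (g z, e, \<Theta>, nat (\<beta> z))) (xs (int j))"
      have "(suminf (\<lambda>k. F (case_nat (int (j + nat d * k)) z))) = (\<Sum>(g, e, \<Theta>, b)\<leftarrow>?ys. g * (total e \<Theta> - psum e \<Theta> b))"
      proof (rule sums_exp_poly)
        show "(\<lambda>k. F (case_nat (int (j + nat d * k)) z)) sums (suminf (\<lambda>k. F (case_nat (int (j + nat d * k)) z)))"
          using sr(1)[of j] by (rule summable_sums)
        show "0 < \<Theta>" if "(g, e, \<Theta>, b) \<in> set ?ys" for g e \<Theta> b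
          using that xs(1)[of "int j"] by (auto simp: list_all_iff)
        fix k
        have "F (case_nat (int (j + nat d * k)) z) = (\<Sum>x\<leftarrow>xs (int j). nf_val x z (int k))"
          using xs(2)[of "int k" "int j" z] d by simp
        also have "\<dots> = (\<Sum>(g, e, \<Theta>, b)\<leftarrow>?ys. g * (of_nat k ^ e * \<Theta> ^ k * of_bool (b \<le> k)))"
          unfolding map_map by (intro arg_cong[of _ _ sum_list] map_cong refl) (auto simp: nat_le_iff)
        finally show "F (case_nat (int (j + nat d * k)) z) = (\<Sum>(g, e, \<Theta>, b)\<leftarrow>?ys. g * (of_nat k ^ e * \<Theta> ^ k * of_bool (b \<le> k)))" .
      qed
      also have "\<dots> = W (int j) z" unfolding W_def map_map by (intro arg_cong[of _ _ sum_list] map_cong refl) auto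
      finally show ?thesis .
    qed
    then show ?thesis using sr(2) by simp
  qed
  ultimately show ?thesis by simp
qed

section \<open>Rational power series\<close>

definition rational :: "complex fps \<Rightarrow> bool" where
  "rational f \<longleftrightarrow> (\<exists>a b. poly b 0 \<noteq> 0 \<and> f * fps_of_poly b = fps_of_poly a)"

lemma rational_poly: "rational (fps_of_poly a)"
  unfolding rational_def by (intro exI[of _ a] exI[of _ 1]) simp

lemma rational_add: "rational f \<Longrightarrow> rational g \<Longrightarrow> rational (f + g)"
proof -
  assume "rational f" "rational g"
  then obtain a b a' b' where *: "poly b 0 \<noteq> 0" "f * fps_of_poly b = fps_of_poly a" "poly b' 0 \<noteq> 0" "g * fps_of_poly b' = fps_of_poly a'"
    unfolding rational_def by blast
  have "(f + g) * fps_of_poly (b * b') = (f * fps_of_poly b) * fps_of_poly b' + (g * fps_of_poly b') * fps_of_poly b"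
    by (simp add: fps_of_poly_mult algebra_simps)
  also have "\<dots> = fps_of_poly (a * b' + a' * b)" by (simp add: * fps_of_poly_mult fps_of_poly_add)
  finally show ?thesis unfolding rational_def using * by (intro exI[of _ "a * b' + a' * b"] exI[of _ "b * b'"]) simp
qed

lemma rational_mult: "rational f \<Longrightarrow> rational g \<Longrightarrow> rational (f * g)"
proof -
  assume "rational f" "rational g"
  then obtain a b a' b' where *: "poly b 0 \<noteq> 0" "f * fps_of_poly b = fps_of_poly a" "poly b' 0 \<noteq> 0" "g * fps_of_poly b' = fps_of_poly a'"
    unfolding rational_def by blast
  have "(f * g) * fps_of_poly (b * b') = (f * fps_of_poly b) * (g * fps_of_poly b')"
    by (simp add: fps_of_poly_mult algebra_simps)
  also have "\<dots> = fps_of_poly (a * a')" by (simp add: * fps_of_poly_mult)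
  finally show ?thesis unfolding rational_def using * by (intro exI[of _ "a * a'"] exI[of _ "b * b'"]) simp
qed

lemma rational_const: "rational (fps_const c)"
  using rational_poly[of "[:c:]"] by (simp add: fps_of_poly_const)

lemma rational_diff: "rational f \<Longrightarrow> rational g \<Longrightarrow> rational (f - g)"
proof -
  assume "rational f" "rational g"
  then have "rational (f + fps_const (- 1) * g)" by (intro rational_add rational_mult rational_const)
  also have "f + fps_const (- 1) * g = f - g" by (rule fps_ext) simp
  finally show ?thesis .
qed

lemma rational_sum: "(\<And>i. i \<in> A \<Longrightarrow> rational (f i)) \<Longrightarrow> rational (\<Sum>i\<in>A. f i)"
  using rational_poly[of 0] by (induction A rule: infinite_finite_induct) (auto intro: rational_add)

lemma rational_sum_list: "(\<And>x. x \<in> set xs \<Longrightarrow> rational (f x)) \<Longrightarrow> rational (\<Sum>x\<leftarrow>xs. f x)"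
  using rational_poly[of 0] by (induction xs) (auto intro: rational_add)

lemma rational_X: "rational (fps_X ^ n)"
  using rational_poly[of "monom 1 n"] by (simp add: fps_of_poly_monom')

lemma fps_deriv_of_poly: "fps_deriv (fps_of_poly a) = fps_of_poly (pderiv a)"
  by (rule fps_ext) (simp add: coeff_pderiv)

lemma rational_deriv: "rational f \<Longrightarrow> rational (fps_deriv f)"
proof -
  assume "rational f"
  then obtain a b where *: "poly b 0 \<noteq> 0" "f * fps_of_poly b = fps_of_poly a"
    unfolding rational_def by blast
  have "fps_deriv (f * fps_of_poly b) = fps_of_poly (pderiv a)" by (simp add: * fps_deriv_of_poly)
  then have "fps_deriv f * fps_of_poly b = fps_of_poly (pderiv a) - f * fps_of_poly (pderiv b)"
    by (simp add: fps_deriv_of_poly algebra_simps)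
  then have "fps_deriv f * fps_of_poly b * fps_of_poly b = (fps_of_poly (pderiv a) - f * fps_of_poly (pderiv b)) * fps_of_poly b"
    by simp
  also have "\<dots> = fps_of_poly (pderiv a) * fps_of_poly b - (f * fps_of_poly b) * fps_of_poly (pderiv b)"
    by (simp add: algebra_simps)
  also have "\<dots> = fps_of_poly (pderiv a * b - a * pderiv b)"
    by (simp add: * fps_of_poly_mult fps_of_poly_diff)
  finally have "fps_deriv f * fps_of_poly (b * b) = fps_of_poly (pderiv a * b - a * pderiv b)"
    by (simp add: fps_of_poly_mult mult.assoc)
  then show ?thesis unfolding rational_def using * by (intro exI[of _ "pderiv a * b - a * pderiv b"] exI[of _ "b * b"]) simp
qed

definition spaced :: "nat \<Rightarrow> nat \<Rightarrow> complex \<Rightarrow> complex fps" where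
  "spaced d e \<theta> = Abs_fps (\<lambda>n. if d dvd n then of_nat (n div d) ^ e * \<theta> ^ (n div d) else 0)"

text \<open>Induction from the geometric series: the operator X d/dX multiplies the coefficient of
  X^n by n, which raises the exponent e by one up to the factor \<open>d\<close>.\<close>

lemma rational_spaced:
  assumes d: "0 < d"
  shows "rational (spaced d e \<theta>)"
proof (induction e)
  case 0
  have "spaced d 0 \<theta> * (1 - fps_const \<theta> * fps_X ^ d) = 1"
  proof (rule fps_ext)
    fix n
    have "(spaced d 0 \<theta> * (1 - fps_const \<theta> * fps_X ^ d)) $ n =
       spaced d 0 \<theta> $ n - \<theta> * (spaced d 0 \<theta> * fps_X ^ d) $ n"
      by (simp add: algebra_simps)
    also have "\<dots> = 1 $ n"
    proof (cases "n < d")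
      case True
      then show ?thesis using d by (auto simp: spaced_def fps_X_power_mult_right_nth dest: dvd_imp_le)
    next
      case False
      then obtain i where "n = d + i" using le_Suc_ex not_less by blast
      then show ?thesis using d by (auto simp: spaced_def fps_X_power_mult_right_nth)
    qed
    finally show "(spaced d 0 \<theta> * (1 - fps_const \<theta> * fps_X ^ d)) $ n = 1 $ n" .
  qed
  moreover have "fps_of_poly (1 - monom \<theta> d) = 1 - fps_const \<theta> * fps_X ^ d"
    by (simp add: fps_of_poly_diff fps_of_poly_monom)
  ultimately have "spaced d 0 \<theta> * fps_of_poly (1 - monom \<theta> d) = fps_of_poly 1"
    by (simp only: fps_of_poly_1)
  then show ?case unfolding rational_def using d
    by (intro exI[of _ 1] exI[of _ "1 - monom \<theta> d"]) (simp add: poly_monom zero_power)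
next
  case (Suc e)
  have "spaced d (Suc e) \<theta> = fps_const (1 / of_nat d) * (fps_X ^ 1 * fps_deriv (spaced d e \<theta>))"
  proof (rule fps_ext)
    fix n
    have "(fps_const (1 / of_nat d) * (fps_X ^ 1 * fps_deriv (spaced d e \<theta>))) $ n =
       1 / of_nat d * (of_nat n * spaced d e \<theta> $ n)" by (cases n) auto
    also have "\<dots> = spaced d (Suc e) \<theta> $ n"
      using d by (cases "d dvd n") (auto simp: spaced_def)
    finally show "spaced d (Suc e) \<theta> $ n = (fps_const (1 / of_nat d) * (fps_X ^ 1 * fps_deriv (spaced d e \<theta>))) $ n"
      by simp
  qed
  then show ?case using Suc by (simp only:) (intro rational_mult rational_const rational_X rational_deriv)
qed

text \<open>On each residue class the normal form is a combination of spaced series; a threshold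
  removes only finitely many coefficients, that is, a polynomial.\<close>

lemma CC_rational:
  assumes "F \<in> CC"
  shows "rational (Abs_fps (\<lambda>n. complex_of_real (F (case_nat (int n) z))))"
proof -
  obtain d where d: "d > 0" "\<And>m j. m > 0 \<Longrightarrow> NF (d * m) j F" using NF_CC[OF assms] by blast
  have "NF d j F" for j using d(2)[of 1 j] by simp
  then have "\<forall>j. \<exists>xs. list_all nf_ok xs \<and> (\<forall>z. \<forall>k\<ge>0. F (case_nat (j + d * k) z) = (\<Sum>x\<leftarrow>xs. nf_val x z k))"
    by (simp add: NF_def)
  then obtain xs where xs: "\<And>j. list_all nf_ok (xs j)"
    "\<And>j z k. 0 \<le> k \<Longrightarrow> F (case_nat (j + d * k) z) = (\<Sum>x\<leftarrow>xs j. nf_val x z k)" by metis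
  define D where "D = nat d"
  have D: "0 < D" "d = int D" using d(1) by (auto simp: D_def)
  define piece where "piece x = (case x of (g, e, \<Theta>, \<beta>) \<Rightarrow> fps_const (complex_of_real (g z)) *
     (spaced D e (of_real \<Theta>) - (\<Sum>k<nat (\<beta> z). fps_const (of_nat k ^ e * of_real \<Theta> ^ k) * fps_X ^ (D * k))))" for x :: nf_term
  have piece_nth: "piece x $ n = (if D dvd n then complex_of_real (nf_val x z (int (n div D))) else 0)" for x n
  proof -
    obtain g e \<Theta> \<beta> where [simp]: "x = (g, e, \<Theta>, \<beta>)" by (cases x)
    have "(\<Sum>k<nat (\<beta> z). fps_const (of_nat k ^ e * complex_of_real \<Theta> ^ k) * fps_X ^ (D * k)) $ n =
      (\<Sum>k<nat (\<beta> z). if D dvd n \<and> k = n div D then of_nat k ^ e * complex_of_real \<Theta> ^ k else 0)"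
      unfolding fps_sum_nth
    proof (intro sum.cong refl)
      fix k
      have "n = D * k \<longleftrightarrow> D dvd n \<and> k = n div D" using D(1) by auto
      then show "(fps_const (of_nat k ^ e * complex_of_real \<Theta> ^ k) * fps_X ^ (D * k)) $ n =
        (if D dvd n \<and> k = n div D then of_nat k ^ e * complex_of_real \<Theta> ^ k else 0)"
        by (simp add: fps_X_power_nth)
    qed
    also have "\<dots> = (if D dvd n \<and> n div D < nat (\<beta> z) then of_nat (n div D) ^ e * complex_of_real \<Theta> ^ (n div D) else 0)"
      by (cases "D dvd n") (simp_all add: if_distrib cong: if_cong)
    finally have fin: "(\<Sum>k<nat (\<beta> z). fps_const (of_nat k ^ e * complex_of_real \<Theta> ^ k) * fps_X ^ (D * k)) $ n =
       (if D dvd n \<and> n div D < nat (\<beta> z) then of_nat (n div D) ^ e * complex_of_real \<Theta> ^ (n div D) else 0)" .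
    have "n div D < nat (\<beta> z) \<longleftrightarrow> \<not> \<beta> z \<le> int (n div D)" by (simp only: zless_nat_eq_int_zless not_le)
    moreover have "piece x $ n = complex_of_real (g z) * (spaced D e (of_real \<Theta>) $ n -
       (if D dvd n \<and> n div D < nat (\<beta> z) then of_nat (n div D) ^ e * complex_of_real \<Theta> ^ (n div D) else 0))"
      unfolding piece_def by (simp only: prod.case \<open>x = (g, e, \<Theta>, \<beta>)\<close> fps_mult_left_const_nth fps_sub_nth fin)
    ultimately show ?thesis by (simp add: spaced_def)
  qed
  have "Abs_fps (\<lambda>n. complex_of_real (F (case_nat (int n) z))) =
     (\<Sum>j<D. fps_X ^ j * (\<Sum>x\<leftarrow>xs (int j). piece x))"
  proof (rule fps_ext)
    fix n
    have sl: "(\<Sum>x\<leftarrow>ys. piece x) $ i = (if D dvd i then complex_of_real (\<Sum>x\<leftarrow>ys. nf_val x z (int (i div D))) else 0)" for ys i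
      by (induction ys) (auto simp: piece_nth)
    have "(\<Sum>j<D. fps_X ^ j * (\<Sum>x\<leftarrow>xs (int j). piece x)) $ n =
      (\<Sum>j<D. if j = n mod D then complex_of_real (F (case_nat (int n) z)) else 0)"
      unfolding fps_sum_nth
    proof (intro sum.cong refl)
      fix j assume j: "j \<in> {..<D}"
      show "(fps_X ^ j * (\<Sum>x\<leftarrow>xs (int j). piece x)) $ n = (if j = n mod D then complex_of_real (F (case_nat (int n) z)) else 0)"
      proof (cases "j = n mod D")
        case True
        define k where "k = n div D"
        have n: "n = j + D * k" using True by (simp add: k_def)
        then have eq: "int n = int j + d * int k" using D by simp
        have "(fps_X ^ j * (\<Sum>x\<leftarrow>xs (int j). piece x)) $ n = (\<Sum>x\<leftarrow>xs (int j). piece x) $ (D * k)"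
          using n by (simp add: fps_X_power_mult_nth)
        also have "\<dots> = complex_of_real (F (case_nat (int n) z))"
          unfolding sl eq xs(2)[OF of_nat_0_le_iff] using D(1) by simp
        finally show ?thesis using True by simp
      next
        case False
        have "\<not> D dvd (n - j)" if "j \<le> n"
        proof
          assume "D dvd (n - j)"
          then obtain k where "n - j = D * k" by blast
          then have "n = j + D * k" using that by simp
          then show False using False j by simp
        qed
        then show ?thesis using False by (simp add: fps_X_power_mult_nth sl)
      qed
    qed
    also have "\<dots> = complex_of_real (F (case_nat (int n) z))" using D(1) by simp
    finally show "Abs_fps (\<lambda>n. complex_of_real (F (case_nat (int n) z))) $ n =
       (\<Sum>j<D. fps_X ^ j * (\<Sum>x\<leftarrow>xs (int j). piece x)) $ n" by simp
  qed
  moreover have "rational (piece x)" for x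
  proof -
    obtain g e \<Theta> \<beta> where [simp]: "x = (g, e, \<Theta>, \<beta>)" by (cases x)
    show ?thesis unfolding piece_def
      by simp (intro rational_mult rational_const rational_diff rational_spaced D rational_sum rational_X)
  qed
  ultimately show ?thesis by (simp only:) (intro rational_sum rational_mult rational_X rational_sum_list)
qed

section \<open>Volumes of definable sets\<close>

context local_field
begin

lemma card_E_ball:
  assumes u: "u \<in> B 0" and k: "k \<le> l"
  shows "card {e \<in> E l. e - u \<in> B (int k)} = qq ^ (l - k)"
  using k
proof (induction l rule: dec_induct)
  case base
  have "{e \<in> E k. e - u \<in> B (int k)} = {rep k u}"
  proof (intro equalityI subsetI)
    fix e assume "e \<in> {e \<in> E k. e - u \<in> B (int k)}"
    then have "rep k u = e" using rep_eqI[OF u, of e k] B_minus_commute by blast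
    then show "e \<in> {rep k u}" by simp
  next
    fix e assume "e \<in> {rep k u}"
    then show "e \<in> {e \<in> E k. e - u \<in> B (int k)}" using rep[OF u, of k] B_minus_commute by auto
  qed
  then show ?case by simp
next
  case (step l)
  let ?f = "\<lambda>(e, d). e + pw (int l) * d"
  have iff: "e + pw (int l) * d - u \<in> B (int k) \<longleftrightarrow> e - u \<in> B (int k)" if "d \<in> digits" for e d
  proof (rule B_eq_iff)
    have "d \<in> B 0" using that digits(2) by blast
    then have "pw (int l) * d \<in> B (int k)" using step(1) by (intro B_mult'[of _ "int l" _ 0]) auto
    then show "e + pw (int l) * d - u - (e - u) \<in> B (int k)" by simp
  qed
  have "{e \<in> E (Suc l). e - u \<in> B (int k)} = ?f ` ({e \<in> E l. e - u \<in> B (int k)} \<times> digits)"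
    using iff by auto
  moreover have "inj_on ?f ({e \<in> E l. e - u \<in> B (int k)} \<times> digits)"
  proof (rule inj_onI, clarsimp)
    fix e d e' d'
    assume "e \<in> E l" "d \<in> digits" "e' \<in> E l" "d' \<in> digits" "e + pw (int l) * d = e' + pw (int l) * d'"
    then show "e = e' \<and> d = d'" using E_inj[of e l d e' d'] E_unique by auto
  qed
  ultimately show ?case
    using step by (simp add: card_image card_cartesian_product digits(3) Suc_diff_le mult.commute)
qed

lemma card_E_ball_le:
  assumes "k \<le> l"
  shows "card {e \<in> E l. e - u \<in> B (int k)} \<le> qq ^ (l - k)"
proof (cases "{e \<in> E l. e - u \<in> B (int k)} = {}")
  case False
  then obtain e0 where e0: "e0 \<in> E l" "e0 - u \<in> B (int k)" by blast
  have "{e \<in> E l. e - u \<in> B (int k)} \<subseteq> {e \<in> E l. e - e0 \<in> B (int k)}"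
    using e0 B_trans B_minus_commute by blast
  then have "card {e \<in> E l. e - u \<in> B (int k)} \<le> card {e \<in> E l. e - e0 \<in> B (int k)}"
    by (intro card_mono) auto
  also have "\<dots> = qq ^ (l - k)" using e0 E_sub assms by (intro card_E_ball) auto
  finally show ?thesis .
next
  case True
  show ?thesis unfolding True by simp
qed

lemma qq_real: "1 < real qq"
  using qq_ge_2 by simp

end

text \<open>Level m carries the predicates and functions in the first m field coordinates.
  Parameters are infinite sequences, so independence of the later coordinates has to be
  demanded.\<close>

locale level = ring_structure v D R
  for v :: "'k::field_char_0 \<Rightarrow> int" and D :: "((nat \<Rightarrow> 'k) \<Rightarrow> (nat \<Rightarrow> int) \<Rightarrow> bool) set" and R +
  fixes m :: nat
  assumes indep: "P \<in> D \<Longrightarrow> (\<And>i. i < m \<Longrightarrow> x i = y i) \<Longrightarrow> P x z = P y z"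
begin

text \<open>A predicate in one more coordinate counts as definable when it is prepared in that
  coordinate over the present level. Cell decomposition thus holds by construction, and what needs
  proof is closure under logic and definability of polynomials.\<close>

definition next_D :: "((nat \<Rightarrow> 'k) \<Rightarrow> (nat \<Rightarrow> int) \<Rightarrow> bool) set" where
  "next_D = {\<lambda>x z. S x (x m) z | S. prepared S}"

lemma next_D_I: "prepared S \<Longrightarrow> (\<lambda>x z. S x (x m) z) \<in> next_D"
  by (auto simp: next_D_def)

lemma R_indep:
  assumes h: "h \<in> R" and xy: "\<And>i. i < m \<Longrightarrow> x i = y i"
  shows "h x = h y"
proof -
  have "h y - h x \<in> B k" for k
  proof -
    \<comment> \<open>The free constant in the test is chosen so that at scale k it expresses
      closeness to the value at \<open>x0\<close>. This predicate cannot see the later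
      coordinates.\<close>
    have "(\<lambda>x z. h x - (h x0 / pw k) * pw (z 0) \<in> B (z 0)) \<in> D" for x0
      by (intro D_fn_ball R_def h tm_var)
    from indep[where x = x and y = y and z = "\<lambda>_. k", OF this[of x] xy] show ?thesis by simp
  qed
  then have "h y - h x = 0" by (rule B_all_zero)
  then show ?thesis by simp
qed

lemma prepared_indep:
  assumes S: "prepared S" and xy: "\<And>i. i < m \<Longrightarrow> x i = y i"
  shows "S x t z = S y t z"
proof -
  obtain C N where p: "prep C N S" using S by (auto simp: prepared_def)
  have c: "c x = c y" if "c \<in> C" for c
    using that prepD(2)[OF p] R_indep xy by blast
  have 1: "S x (c x) z = S y (c y) z" if "c \<in> C" for c
    using indep[where x = x and y = y and z = z, OF prepD(7)[OF p that] xy] .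
  have 2: "(adm C c \<xi> x r \<and> S x (c x + \<xi> * pw r) z) = (adm C c \<xi> y r \<and> S y (c y + \<xi> * pw r) z)"
    if "c \<in> C" "\<xi> \<in> E N - B 1" for c \<xi> r
  proof -
    have "\<xi> \<in> B 0 - B 1" using that E_sub by blast
    from indep[where x = x and y = y and z = "case_nat r z", OF prepD(6)[OF p that(1) this] xy] show ?thesis by simp
  qed
  show ?thesis
    unfolding prep_char[OF p, of x t z] prep_char[OF p, of y t z]
  proof (intro arg_cong2[of _ _ _ _ "(\<or>)"] bex_cong refl arg_cong[of _ _ Ex] ext)
    fix c assume "c \<in> C"
    then show "(t = c x \<and> S x (c x) z) = (t = c y \<and> S y (c y) z)" using c[of c] 1[of c] by simp
  next
    fix c \<xi> r assume "c \<in> C" "\<xi> \<in> E N - B 1"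
    then show "(t - c x - \<xi> * pw r \<in> B (r + int N) \<and> adm C c \<xi> x r \<and> S x (c x + \<xi> * pw r) z) =
      (t - c y - \<xi> * pw r \<in> B (r + int N) \<and> adm C c \<xi> y r \<and> S y (c y + \<xi> * pw r) z)"
      using c[of c] 2[of c \<xi> r] by simp
  qed
qed

lemma next_indep:
  assumes "P \<in> next_D" and xy: "\<And>i. i < Suc m \<Longrightarrow> x i = y i"
  shows "P x z = P y z"
proof -
  obtain S where S: "prepared S" "P = (\<lambda>x z. S x (x m) z)" using assms by (auto simp: next_D_def)
  then show ?thesis using prepared_indep[OF S(1), of x y "x m" z] xy by simp
qed

lemma next_structure: "int_structure next_D"
proof
  show "P \<in> next_D \<Longrightarrow> (\<lambda>x z. \<not> P x z) \<in> next_D" for P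
    using prepared_not by (auto simp: next_D_def)
  show "P \<in> next_D \<Longrightarrow> Q \<in> next_D \<Longrightarrow> (\<lambda>x z. P x z \<and> Q x z) \<in> next_D" for P Q
    using prepared_conj by (fastforce simp: next_D_def)
  show "P \<in> next_D \<Longrightarrow> (\<lambda>x z. \<exists>k. P x (case_nat k z)) \<in> next_D" for P
    using prepared_ex by (auto simp: next_D_def)
  show "P \<in> next_D \<Longrightarrow> (\<lambda>x z. P x (\<lambda>i. z (\<sigma> i))) \<in> next_D" for P \<sigma>
    using prepared_ren by (auto simp: next_D_def)
  show "(\<lambda>x z. z i \<le> z j) \<in> next_D" for i j
    using next_D_I[OF prepared_D[OF D_atom_le]] .
  show "(\<lambda>x z. z i = z j + z k) \<in> next_D" for i j k
    using next_D_I[OF prepared_D[OF D_atom_add]] .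
  show "(\<lambda>x z. z i = c) \<in> next_D" for i c
    using next_D_I[OF prepared_D[OF D_atom_const]] .
qed

lemma next_field_structure: "field_structure v next_D"
  by (intro field_structure.intro local_field_axioms next_structure)

text \<open>The polynomial functions in the new coordinate over \<open>R\<close> form a ring, and
  they are definable by \<open>prepared_poly\<close>. Any maximal ring above it serves the next
  level.\<close>

lemma ex_next:
  "\<exists>R'. level v next_D R' (Suc m) \<and> R \<subseteq> R' \<and> (\<lambda>x. x m) \<in> R'"
proof -
  interpret nx: field_structure v next_D by (rule next_field_structure)
  define R0 where "R0 = {\<lambda>x. poly (p x) (x m) | d p. RP d p}"
  have I: "(\<lambda>x. poly (p x) (x m)) \<in> R0" if "RP d p" for d p using that by (auto simp: R0_def)
  have "nx.def_ring R0"
    unfolding nx.def_ring_def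
  proof (intro conjI ballI allI)
    fix h assume "h \<in> R0"
    then obtain d p where p: "RP d p" "h = (\<lambda>x. poly (p x) (x m))" by (auto simp: R0_def)
    show "nx.def_fn h"
      unfolding nx.def_fn_def p(2) using next_D_I[OF prepared_poly[OF p(1)]] by simp
  next
    fix c show "(\<lambda>x. c) \<in> R0" using I[OF RP_const[OF R_const, of 0 c]] by simp
  next
    fix h h' assume "h \<in> R0" "h' \<in> R0"
    then obtain d p d' p' where p: "RP d p" "h = (\<lambda>x. poly (p x) (x m))" "RP d' p'" "h' = (\<lambda>x. poly (p' x) (x m))"
      by (auto simp: R0_def)
    have "RP (max d d') (\<lambda>x. p x + p' x)"
      by (intro RP_add RP_mono[OF p(1)] RP_mono[OF p(3)]) auto
    from I[OF this] show "(\<lambda>x. h x + h' x) \<in> R0" using p by simp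
    from I[OF RP_mult[OF p(1,3)]] show "(\<lambda>x. h x * h' x) \<in> R0" using p by simp
  qed
  then obtain R' where R': "nx.max_ring R'" "R0 \<subseteq> R'" using nx.ex_max_ring by blast
  have "level v next_D R' (Suc m)"
    by (intro level.intro ring_structure.intro next_field_structure ring_structure_axioms.intro R'(1) level_axioms.intro next_indep)
  moreover have "h \<in> R'" if "h \<in> R" for h
  proof -
    have "(\<lambda>x. poly [:h x:] (x m)) \<in> R0" by (rule I[OF RP_const[OF that, of 0]])
    then show ?thesis using R'(2) by auto
  qed
  moreover have "(\<lambda>x. x m) \<in> R'"
    using I[OF RP_monom[OF R_const, of 1 1]] R'(2) by (auto simp: poly_monom)
  ultimately show ?thesis by blast
qed

lemma next_project:
  assumes "P \<in> next_D"
  shows "(\<lambda>x z. \<exists>t. P (x(m := t)) z) \<in> D"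
proof -
  obtain S where S: "prepared S" "P = (\<lambda>x z. S x (x m) z)" using assms by (auto simp: next_D_def)
  have "S (x(m := t)) t z = S x t z" for x t z by (rule prepared_indep[OF S(1)]) auto
  then show ?thesis using D_project[OF S(1)] S(2) by simp
qed

end

section \<open>Point counts on finite grids\<close>

context local_field
begin

definition cnt :: "nat \<Rightarrow> nat \<Rightarrow> ((nat \<Rightarrow> 'k) \<Rightarrow> (nat \<Rightarrow> int) \<Rightarrow> bool) \<Rightarrow> (nat \<Rightarrow> int) \<Rightarrow> nat" where
  "cnt m l P z = card {x \<in> PiE {..<m} (\<lambda>_. E l). P x z}"

text \<open>The proportion of grid points of precision l that satisfy \<open>P\<close>. Its limit
  plays the role of Haar volume, with the valuation ring of volume 1.\<close>

definition vol :: "nat \<Rightarrow> nat \<Rightarrow> ((nat \<Rightarrow> 'k) \<Rightarrow> (nat \<Rightarrow> int) \<Rightarrow> bool) \<Rightarrow> (nat \<Rightarrow> int) \<Rightarrow> real" where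
  "vol m l P z = real (cnt m l P z) / real qq ^ (l * m)"

definition has_vol :: "nat \<Rightarrow> ((nat \<Rightarrow> 'k) \<Rightarrow> (nat \<Rightarrow> int) \<Rightarrow> bool) \<Rightarrow> ((nat \<Rightarrow> int) \<Rightarrow> real) \<Rightarrow> bool" where
  "has_vol m P \<phi> \<longleftrightarrow> \<phi> \<in> CC \<and> (\<forall>z. (\<lambda>l. vol m l P z) \<longlonglongrightarrow> \<phi> z)"

lemma finite_PiE_E [simp]: "finite (PiE {..<m :: nat} (\<lambda>_. E l))"
  by (intro finite_PiE) auto

lemma cnt_le: "cnt m l P z \<le> qq ^ (l * m)"
proof -
  have "cnt m l P z \<le> card (PiE {..<m} (\<lambda>_. E l))" unfolding cnt_def by (intro card_mono) auto
  also have "\<dots> = qq ^ (l * m)" by (simp add: card_PiE card_E power_mult)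
  finally show ?thesis .
qed

lemma vol_bounds: "0 \<le> vol m l P z" "vol m l P z \<le> 1"
proof -
  show "0 \<le> vol m l P z" by (simp add: vol_def)
  have "real (cnt m l P z) \<le> real qq ^ (l * m)" using cnt_le[of m l P z] by (metis of_nat_le_iff of_nat_power)
  then show "vol m l P z \<le> 1" using qq_real by (simp add: vol_def divide_le_eq)
qed

lemma cnt_Suc:
  assumes "\<And>x t. S (x(m := t)) t z = S x t z"
  shows "cnt (Suc m) l (\<lambda>x z. S x (x m) z) z = (\<Sum>x\<in>PiE {..<m} (\<lambda>_. E l). card {t \<in> E l. S x t z})"
proof -
  let ?X = "PiE {..<m} (\<lambda>_. E l)"
  have "bij_betw (\<lambda>(x, t). x(m := t)) (SIGMA x:?X. {t \<in> E l. S x t z}) {x \<in> PiE {..<Suc m} (\<lambda>_. E l). S x (x m) z}"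
  proof (rule bij_betw_byWitness[where f' = "\<lambda>y. (restrict y {..<m}, y m)"], goal_cases)
    case 1
    then show ?case by (auto simp: fun_eq_iff PiE_iff extensional_def)
  next
    case 2
    then show ?case by (auto simp: fun_eq_iff PiE_iff extensional_def)
  next
    case 3
    then show ?case using assms by (auto simp: PiE_iff extensional_def less_Suc_eq)
  next
    case 4
    have "(restrict y {..<m}, y m) \<in> (SIGMA x:?X. {t \<in> E l. S x t z})"
      if y: "y \<in> PiE {..<Suc m} (\<lambda>_. E l)" "S y (y m) z" for y
    proof -
      have "(restrict y {..<m})(m := y m) = y" using y(1) by (auto simp: fun_eq_iff PiE_iff extensional_def)
      then have "S (restrict y {..<m}) (y m) z" using assms[of "restrict y {..<m}" "y m"] y(2) by simp
      then show ?thesis using y(1) by (auto simp: PiE_iff)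
    qed
    then show ?case by blast
  qed
  then have "cnt (Suc m) l (\<lambda>x z. S x (x m) z) z = card (SIGMA x:?X. {t \<in> E l. S x t z})"
    unfolding cnt_def by (simp add: bij_betw_same_card)
  then show ?thesis by (simp add: card_SigmaI)
qed

end

context level
begin

text \<open>Ties between equally near centres are broken by an enumeration of the centres, so that the
  cells become disjoint.\<close>

definition cell :: "('a \<Rightarrow> nat) \<Rightarrow> 'a set \<Rightarrow> ('a \<Rightarrow> (nat \<Rightarrow> 'k) \<Rightarrow> 'k) \<Rightarrow> 'a \<Rightarrow> 'k \<Rightarrow> (nat \<Rightarrow> 'k) \<Rightarrow> int \<Rightarrow> bool" where
  "cell ord I c i \<xi> x r \<longleftrightarrow> (\<forall>j\<in>I. c i x + \<xi> * pw r - c j x \<notin> B (r + 1) \<and>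
     (ord j < ord i \<longrightarrow> c i x + \<xi> * pw r - c j x \<notin> B r))"

text \<open>The discs of the cells visible at precision l are disjoint and lie in the fibre, which
  gives the lower bound. A remaining point of the fibre agrees with some centre up to
  \<open>l - N\<close> digits, and each centre accounts for at most \<open>qq ^ N\<close> such grid
  points. The error is therefore independent of l.\<close>

lemma fiber_count:
  fixes ord :: "((nat \<Rightarrow> 'k) \<Rightarrow> 'k) \<Rightarrow> nat"
  assumes p: "prep C N S" and inj: "inj_on ord C" and int: "\<And>t. S x t z \<Longrightarrow> t \<in> B 0" and l: "N \<le> l"
  defines "M \<equiv> (\<Sum>c\<in>C. \<Sum>\<xi>\<in>E N - B 1. \<Sum>r\<in>{r. r + N \<le> l}.
      of_bool (cell ord C (\<lambda>c. c) c \<xi> x (int r) \<and> S x (c x + \<xi> * pw (int r)) z) * qq ^ (l - (r + N)))"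
  shows "M \<le> card {t \<in> E l. S x t z}" "card {t \<in> E l. S x t z} \<le> M + card C * qq ^ N"
proof -
  note pd = prepD[OF p]
  let ?T = "{t \<in> E l. S x t z}"
  let ?J = "{(c, \<xi>, r). c \<in> C \<and> \<xi> \<in> E N - B 1 \<and> r + N \<le> l \<and>
     cell ord C (\<lambda>c. c) c \<xi> x (int r) \<and> S x (c x + \<xi> * pw (int r)) z}"
  define cl where "cl = (\<lambda>(c, \<xi>, r). {t \<in> E l. t - (c x + \<xi> * pw (int r)) \<in> B (int (r + N))})"
  have finR: "finite {r. r + N \<le> l}" by (rule finite_subset[of _ "{..l}"]) auto
  have JS: "?J \<subseteq> C \<times> (E N - B 1) \<times> {r. r + N \<le> l}" by auto
  then have finJ: "finite ?J" using finite_subset[OF JS] pd(1) finR by simp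
  have cell_adm: "adm C c \<xi> x (int r)" if "cell ord C (\<lambda>c. c) c \<xi> x (int r)" for c \<xi> r
    using that by (auto simp: cell_def adm_def)
  have sub: "cl j \<subseteq> ?T" if "j \<in> ?J" for j
  proof
    obtain c \<xi> r where j: "j = (c, \<xi>, r)" by (cases j)
    fix t assume t: "t \<in> cl j"
    have "t - c x - \<xi> * pw (int r) \<in> B (int r + int N)" using t j by (auto simp: cl_def algebra_simps)
    then show "t \<in> ?T" using prep_arm_eq[OF p cell_adm, of c \<xi> r t z] that t j by (auto simp: cl_def)
  qed
  have cardc: "card (cl (c, \<xi>, r)) = qq ^ (l - (r + N))" if "(c, \<xi>, r) \<in> ?J" for c \<xi> r
    unfolding cl_def prod.case by (rule card_E_ball) (use that int in auto)
  have disj: "j = j'" if j: "j \<in> ?J" "j' \<in> ?J" "t \<in> cl j" "t \<in> cl j'" for j j' t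
  proof -
    obtain c \<xi> r where jj: "j = (c, \<xi>, r)" by (cases j)
    obtain c' \<xi>' r' where jj': "j' = (c', \<xi>', r')" by (cases j')
    have N: "1 \<le> N" by (rule pd(4))
    have near: "t - c'' x \<notin> B (int r0 + 1)" "ord c'' < ord c0 \<Longrightarrow> t - c'' x \<notin> B (int r0)" "t - c0 x \<in> B (int r0)"
      if J: "(c0, \<xi>0, r0) \<in> ?J" "t \<in> cl (c0, \<xi>0, r0)" "c'' \<in> C" for c0 \<xi>0 r0 c''
    proof -
      have 1: "t - (c0 x + \<xi>0 * pw (int r0)) \<in> B (int r0 + 1)"
        using J(2) N by (auto simp: cl_def elim: B_mono)
      then have 2: "t - (c0 x + \<xi>0 * pw (int r0)) \<in> B (int r0)" by (rule B_mono) simp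
      have cell: "c0 x + \<xi>0 * pw (int r0) - c'' x \<notin> B (int r0 + 1)"
        "ord c'' < ord c0 \<Longrightarrow> c0 x + \<xi>0 * pw (int r0) - c'' x \<notin> B (int r0)"
        using J(1,3) by (auto simp: cell_def)
      have e: "(t - c'' x) - (c0 x + \<xi>0 * pw (int r0) - c'' x) = t - (c0 x + \<xi>0 * pw (int r0))" by simp
      show "t - c'' x \<notin> B (int r0 + 1)" using B_eq_iff[of "t - c'' x" "c0 x + \<xi>0 * pw (int r0) - c'' x"] 1 cell(1) e by metis
      show "t - c'' x \<notin> B (int r0)" if "ord c'' < ord c0"
        using B_eq_iff[of "t - c'' x" "c0 x + \<xi>0 * pw (int r0) - c'' x"] 2 cell(2)[OF that] e by metis
      have "\<xi>0 * pw (int r0) \<in> B (int r0)" using J(1) E_sub by (auto simp: B_times_pw)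
      from B_add[OF 2 this] show "t - c0 x \<in> B (int r0)" by (simp add: algebra_simps)
    qed
    have c: "c \<in> C" "c' \<in> C" using j jj jj' by auto
    have J: "(c, \<xi>, r) \<in> ?J" "t \<in> cl (c, \<xi>, r)" "(c', \<xi>', r') \<in> ?J" "t \<in> cl (c', \<xi>', r')" using j jj jj' by auto
    have "r = r'"
    proof (rule ccontr)
      assume "r \<noteq> r'"
      then consider "int r + 1 \<le> int r'" | "int r' + 1 \<le> int r" by linarith
      then show False
      proof cases
        case 1
        then have "t - c' x \<in> B (int r + 1)" using near(3)[OF J(3,4) c(2)] B_mono by blast
        then show False using near(1)[OF J(1,2) c(2)] by blast
      next
        case 2
        then have "t - c x \<in> B (int r' + 1)" using near(3)[OF J(1,2) c(1)] B_mono by blast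
        then show False using near(1)[OF J(3,4) c(1)] by blast
      qed
    qed
    moreover have "c = c'"
    proof (rule ccontr)
      assume "c \<noteq> c'"
      then have "ord c \<noteq> ord c'" using inj c by (auto dest: inj_onD)
      then consider "ord c < ord c'" | "ord c' < ord c" by linarith
      then show False
      proof cases
        case 1
        then show False using near(2)[OF J(3,4) c(1)] near(3)[OF J(1,2) c(1)] \<open>r = r'\<close> by simp
      next
        case 2
        then show False using near(2)[OF J(1,2) c(2)] near(3)[OF J(3,4) c(2)] \<open>r = r'\<close> by simp
      qed
    qed
    moreover have "\<xi> = \<xi>'"
    proof -
      have "t - (c x + \<xi> * pw (int r)) \<in> B (int (r + N))" "t - (c x + \<xi>' * pw (int r)) \<in> B (int (r + N))"
        using J(2,4) \<open>r = r'\<close> \<open>c = c'\<close> by (auto simp: cl_def)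
      then have "(t - (c x + \<xi>' * pw (int r))) - (t - (c x + \<xi> * pw (int r))) \<in> B (int (r + N))" by (rule B_diff[rotated])
      then have "(\<xi> - \<xi>') * pw (int r) \<in> B (int (r + N))" by (simp add: algebra_simps)
      then have "\<xi> - \<xi>' \<in> B (int N)" by (simp add: B_times_pw)
      then show ?thesis using E_unique J(1,3) by auto
    qed
    ultimately show ?thesis using jj jj' by simp
  qed
  have "card (\<Union>j\<in>?J. cl j) = (\<Sum>j\<in>?J. card (cl j))"
    by (rule card_UN_disjoint[OF finJ]) (use disj in \<open>auto simp: cl_def\<close>)
  also have "\<dots> = (\<Sum>(c, \<xi>, r)\<in>?J. qq ^ (l - (r + N)))"
    using cardc by (intro sum.cong) auto
  also have "\<dots> = (\<Sum>(c, \<xi>, r)\<in>C \<times> (E N - B 1) \<times> {r. r + N \<le> l}.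
      of_bool (cell ord C (\<lambda>c. c) c \<xi> x (int r) \<and> S x (c x + \<xi> * pw (int r)) z) * qq ^ (l - (r + N)))"
    by (rule sum.mono_neutral_cong_left) (use JS pd(1) finR in auto)
  also have "\<dots> = M"
    unfolding M_def by (simp add: sum.cartesian_product)
  finally have M: "card (\<Union>j\<in>?J. cl j) = M" .
  have UT: "(\<Union>j\<in>?J. cl j) \<subseteq> ?T" using sub by blast
  then show "M \<le> card ?T" unfolding M[symmetric] by (rule card_mono[rotated]) simp
  let ?Z = "\<Union>c\<in>C. {t \<in> E l. t - c x \<in> B (int (l - N))}"
  have "?T \<subseteq> (\<Union>j\<in>?J. cl j) \<union> ?Z"
  proof
    fix t assume t: "t \<in> ?T"
    show "t \<in> (\<Union>j\<in>?J. cl j) \<union> ?Z"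
    proof (cases "t \<in> ?Z")
      case False
      have neq: "t \<noteq> c x" if "c \<in> C" for c using False that t by auto
      obtain c0 r where c0: "c0 \<in> C" "t - c0 x \<in> B r" "\<And>c'. c' \<in> C \<Longrightarrow> t - c' x \<notin> B (r + 1)"
        by (rule nearest[of C t x]) (use pd(1,3) neq in auto)
      let ?near = "{c \<in> C. t - c x \<in> B r}"
      have ne: "?near \<noteq> {}" "finite ?near" using c0 pd(1) by auto
      define c where "c = arg_min_on ord ?near"
      have c: "c \<in> C" "t - c x \<in> B r" using arg_min_if_finite(1)[OF ne(2,1), of ord] by (auto simp: c_def)
      have cmin: "t - c' x \<notin> B r" if "c' \<in> C" "ord c' < ord c" for c'
        using arg_min_if_finite(2)[OF ne(2,1), of ord] that by (auto simp: c_def)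
      obtain \<xi> where \<xi>: "\<xi> \<in> E N - B 1" "t - c x - \<xi> * pw r \<in> B (r + int N)"
        using arm_point[OF c(2) c0(3)[OF c(1)] pd(4)] by blast
      have "t \<in> B 0" using t E_sub by blast
      then have "0 \<le> r"
        using c0(3)[OF pd(3)] B_mono[of t 0 "r + 1"] by (cases "0 \<le> r") auto
      then obtain r' where r': "r = int r'" using nonneg_int_cases by blast
      have rl: "r' + N \<le> l"
      proof (rule ccontr)
        assume "\<not> r' + N \<le> l"
        then have "t - c x \<in> B (int (l - N))" using c(2) r' l by (auto elim!: B_mono)
        then show False using False c(1) t by blast
      qed
      have near1: "t - (c x + \<xi> * pw r) \<in> B (r + 1)" "t - (c x + \<xi> * pw r) \<in> B r"
        using \<xi>(2) pd(4) by (auto simp: algebra_simps elim: B_mono)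
      have cell: "cell ord C (\<lambda>c. c) c \<xi> x r" unfolding cell_def
      proof (intro ballI conjI impI)
        fix c' assume c': "c' \<in> C"
        have e: "(t - c' x) - (c x + \<xi> * pw r - c' x) = t - (c x + \<xi> * pw r)" by simp
        show "c x + \<xi> * pw r - c' x \<notin> B (r + 1)"
          using B_eq_iff[of "t - c' x" "c x + \<xi> * pw r - c' x"] near1(1) c0(3)[OF c'] e by metis
        show "c x + \<xi> * pw r - c' x \<notin> B r" if "ord c' < ord c"
          using B_eq_iff[of "t - c' x" "c x + \<xi> * pw r - c' x"] near1(2) cmin[OF c' that] e by metis
      qed
      then have "adm C c \<xi> x r" by (auto simp: cell_def adm_def)
      from prep_arm_eq[OF p this \<xi>(2), of z] have "S x (c x + \<xi> * pw r) z" using t by blast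
      then have "(c, \<xi>, r') \<in> ?J" using c \<xi>(1) rl cell r' by auto
      moreover have "t \<in> cl (c, \<xi>, r')" using t \<xi>(2) r' by (auto simp: cl_def algebra_simps)
      ultimately show ?thesis by blast
    qed simp
  qed
  then have "card ?T \<le> card ((\<Union>j\<in>?J. cl j) \<union> ?Z)"
    by (intro card_mono finite_UnI finite_UN_I finJ pd(1)) (auto simp: cl_def)
  also have "\<dots> \<le> M + card ?Z" using card_Un_le[of "\<Union>j\<in>?J. cl j" ?Z] M by simp
  also have "card ?Z \<le> (\<Sum>c\<in>C. card {t \<in> E l. t - c x \<in> B (int (l - N))})" by (rule card_UN_le[OF pd(1)])
  also have "\<dots> \<le> (\<Sum>c\<in>C. qq ^ (l - (l - N)))" by (intro sum_mono card_E_ball_le) simp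
  also have "\<dots> = card C * qq ^ N" using l by simp
  finally show "card ?T \<le> M + card C * qq ^ N" by simp
qed

lemma D_cell:
  assumes "finite C" "C \<subseteq> R" "c \<in> C"
  shows "(\<lambda>x z. cell ord C (\<lambda>c. c) c \<xi> x (z 0)) \<in> D"
proof -
  have e: "(c x - c' x) - (- \<xi>) * pw k = c x + \<xi> * pw k - c' x" for c' x k by simp
  have 1: "(\<lambda>x z. \<not> c x + \<xi> * pw (z 0) - c' x \<in> B (z 0 + k)) \<in> D" if "c' \<in> C" for c' k
    using D_not[OF D_fn_ball_shift[OF R_def tm_var, of "\<lambda>x. c x - c' x" "- \<xi>" 0 k]] assms that
    unfolding e by blast
  have "(\<lambda>x z. \<forall>c'\<in>C. (\<not> c x + \<xi> * pw (z 0) - c' x \<in> B (z 0 + 1)) \<and>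
     (ord c' < ord c \<longrightarrow> \<not> c x + \<xi> * pw (z 0) - c' x \<in> B (z 0 + 0))) \<in> D"
    by (intro D_ball D_conj D_imp D_bool 1 assms(1))
  then show ?thesis by (simp add: cell_def)
qed

text \<open>Up to the vanishing error of \<open>fiber_count\<close>, the volume is a sum of weights
  \<open>w r\<close> times volumes of sets of the previous level, with the arm radius as an
  additional integer variable. Summability of the weights permits the limit in l under the sum over
  r, and \<open>CC_suminf\<close> keeps the result constructible.\<close>

lemma next_has_vol:
  assumes IH: "\<And>Q. Q \<in> D \<Longrightarrow> (\<And>x z i. Q x z \<Longrightarrow> i < m \<Longrightarrow> x i \<in> B 0) \<Longrightarrow> \<exists>\<phi>. has_vol m Q \<phi>"
    and P: "P \<in> next_D" and int: "\<And>x z i. P x z \<Longrightarrow> i < Suc m \<Longrightarrow> x i \<in> B 0"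
  shows "\<exists>\<phi>. has_vol (Suc m) P \<phi>"
proof -
  obtain S where S: "prepared S" "P = (\<lambda>x z. S x (x m) z)" using P by (auto simp: next_D_def)
  have Supd: "S (x(m := t)) t z = S x t z" for x t z by (rule prepared_indep[OF S(1)]) auto
  have Sint: "t \<in> B 0" "i < m \<Longrightarrow> x i \<in> B 0" if "S x t z" for x t z i
    using int[of "x(m := t)" z m] int[of "x(m := t)" z i] S(2) Supd that by auto
  obtain C N where p: "prep C N S" using S(1) by (auto simp: prepared_def)
  note pd = prepD[OF p]
  obtain ord :: "((nat \<Rightarrow> 'k) \<Rightarrow> 'k) \<Rightarrow> nat" where inj: "inj_on ord C"
    using finite_imp_inj_to_nat_seg[OF pd(1)] by blast
  let ?I = "C \<times> (E N - B 1)"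
  let ?A = "\<lambda>(c, \<xi>) x z. cell ord C (\<lambda>c. c) c \<xi> x (z 0) \<and> S x (c x + \<xi> * pw (z 0)) (\<lambda>i. z (Suc i))"
  have finI: "finite ?I" using pd(1) by simp
  have AD: "?A i \<in> D" if "i \<in> ?I" for i
  proof -
    obtain c \<xi> where i: "i = (c, \<xi>)" "c \<in> C" "\<xi> \<in> B 0 - B 1" using \<open>i \<in> ?I\<close> E_sub by blast
    have "(\<lambda>x z. cell ord C (\<lambda>c. c) c \<xi> x (z 0) \<and> adm C c \<xi> x (z 0) \<and> S x (c x + \<xi> * pw (z 0)) (\<lambda>i. z (Suc i))) \<in> D"
      by (intro D_conj[OF D_cell] pd i)
    moreover have "(cell ord C (\<lambda>c. c) c \<xi> x r \<and> adm C c \<xi> x r \<and> Y) \<longleftrightarrow> cell ord C (\<lambda>c. c) c \<xi> x r \<and> Y" for x r Y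
      by (auto simp: cell_def adm_def)
    ultimately show ?thesis using i by simp
  qed
  have "\<exists>\<phi>. has_vol m (?A i) \<phi>" if "i \<in> ?I" for i
    using AD[OF that] by (rule IH) (use Sint(2) in \<open>auto split: prod.splits\<close>)
  then have "\<exists>\<phi>. \<forall>i\<in>?I. has_vol m (?A i) (\<phi> i)" by (intro bchoice ballI)
  then obtain \<phi> where \<phi>: "\<And>i. i \<in> ?I \<Longrightarrow> has_vol m (?A i) (\<phi> i)" by blast
  have \<phi>_lim: "(\<lambda>l. vol m l (?A i) z) \<longlonglongrightarrow> \<phi> i z" and \<phi>_CC: "\<phi> i \<in> CC" if "i \<in> ?I" for i z
    using \<phi>[OF that] by (auto simp: has_vol_def)
  have \<phi>_bounds: "0 \<le> \<phi> i z" "\<phi> i z \<le> 1" if "i \<in> ?I" for i z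
    using LIMSEQ_le_const[OF \<phi>_lim[OF that, of z], of 0] LIMSEQ_le_const2[OF \<phi>_lim[OF that, of z], of 1] vol_bounds by auto
  let ?q = "real qq"
  \<comment> \<open>The proportion of the valuation ring occupied by a disc of radius
    \<open>r + N\<close>.\<close>
  define w where "w r = (1 / ?q) ^ (r + N)" for r
  have w: "0 \<le> w r" for r by (simp add: w_def)
  have wsum: "summable w"
    unfolding w_def power_add using qq_real by (intro summable_mult2 summable_geometric) auto
  have volP: "\<bar>vol (Suc m) l P z - (\<Sum>i\<in>?I. suminf (\<lambda>r. of_bool (r + N \<le> l) * w r * vol m l (?A i) (case_nat (int r) z)))\<bar>
      \<le> real (card C) * ?q ^ N / ?q ^ l" if l: "N \<le> l" for l z
  proof -
    let ?X = "PiE {..<m} (\<lambda>_. E l)"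
    define M where "M x = (\<Sum>c\<in>C. \<Sum>\<xi>\<in>E N - B 1. \<Sum>r\<in>{r. r + N \<le> l}.
      of_bool (cell ord C (\<lambda>c. c) c \<xi> x (int r) \<and> S x (c x + \<xi> * pw (int r)) z) * qq ^ (l - (r + N)))" for x
    have fc: "M x \<le> card {t \<in> E l. S x t z}" "card {t \<in> E l. S x t z} \<le> M x + card C * qq ^ N" for x
    proof -
      have int: "\<And>t. S x t z \<Longrightarrow> t \<in> B 0" by (rule Sint(1))
      show "M x \<le> card {t \<in> E l. S x t z}" "card {t \<in> E l. S x t z} \<le> M x + card C * qq ^ N"
        using fiber_count[where S = S and C = C and N = N and ord = ord and l = l and x = x and z = z, OF p inj int l]
        by (simp_all add: M_def)
    qed
    have cntP: "cnt (Suc m) l P z = (\<Sum>x\<in>?X. card {t \<in> E l. S x t z})"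
      unfolding S(2) by (rule cnt_Suc, rule Supd)
    have cX: "real (card ?X) = ?q ^ (l * m)" by (simp add: card_PiE card_E power_mult)
    have lower: "(\<Sum>x\<in>?X. M x) \<le> cnt (Suc m) l P z" unfolding cntP by (intro sum_mono fc)
    have "cnt (Suc m) l P z \<le> (\<Sum>x\<in>?X. M x + card C * qq ^ N)" unfolding cntP by (intro sum_mono fc)
    also have "\<dots> = (\<Sum>x\<in>?X. M x) + card ?X * (card C * qq ^ N)" by (simp add: sum.distrib)
    finally have "real (cnt (Suc m) l P z) \<le> real ((\<Sum>x\<in>?X. M x) + card ?X * (card C * qq ^ N))" by (rule of_nat_mono)
    then have upper: "real (cnt (Suc m) l P z) \<le> real (\<Sum>x\<in>?X. M x) + ?q ^ (l * m) * (real (card C) * ?q ^ N)"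
      by (simp add: cX)
    have finR: "finite {r. r + N \<le> l}" by (rule finite_subset[of _ "{..l}"]) auto
    have "real (\<Sum>x\<in>?X. M x) = (\<Sum>x\<in>?X. \<Sum>(c, \<xi>)\<in>?I. \<Sum>r\<in>{r. r + N \<le> l}. of_bool (?A (c, \<xi>) x (case_nat (int r) z)) * ?q ^ (l - (r + N)))"
      unfolding M_def sum.cartesian_product[symmetric] by simp
    also have "\<dots> = (\<Sum>(c, \<xi>)\<in>?I. \<Sum>x\<in>?X. \<Sum>r\<in>{r. r + N \<le> l}. of_bool (?A (c, \<xi>) x (case_nat (int r) z)) * ?q ^ (l - (r + N)))"
      by (subst sum.swap) (simp add: case_prod_unfold)
    also have "\<dots> = (\<Sum>(c, \<xi>)\<in>?I. \<Sum>r\<in>{r. r + N \<le> l}. \<Sum>x\<in>?X. of_bool (?A (c, \<xi>) x (case_nat (int r) z)) * ?q ^ (l - (r + N)))"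
    proof (intro sum.cong refl)
      fix i assume "i \<in> ?I"
      obtain c \<xi> where i: "i = (c, \<xi>)" by (cases i)
      show "(case i of (c, \<xi>) \<Rightarrow> \<Sum>x\<in>?X. \<Sum>r\<in>{r. r + N \<le> l}. of_bool (?A (c, \<xi>) x (case_nat (int r) z)) * ?q ^ (l - (r + N))) =
        (case i of (c, \<xi>) \<Rightarrow> \<Sum>r\<in>{r. r + N \<le> l}. \<Sum>x\<in>?X. of_bool (?A (c, \<xi>) x (case_nat (int r) z)) * ?q ^ (l - (r + N)))"
        unfolding i prod.case by (rule sum.swap)
    qed
    also have "\<dots> = (\<Sum>i\<in>?I. \<Sum>r\<in>{r. r + N \<le> l}. real (cnt m l (?A i) (case_nat (int r) z)) * ?q ^ (l - (r + N)))"
    proof (intro sum.cong refl)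
      fix i assume "i \<in> ?I"
      obtain c \<xi> where i: "i = (c, \<xi>)" by (cases i)
      have "(\<Sum>x\<in>?X. of_bool (?A (c, \<xi>) x (case_nat (int r) z)) * ?q ^ (l - (r + N))) =
         real (cnt m l (?A i) (case_nat (int r) z)) * ?q ^ (l - (r + N))" for r
      proof -
        have "(\<Sum>x\<in>?X. of_bool (?A (c, \<xi>) x (case_nat (int r) z))) = real (cnt m l (?A i) (case_nat (int r) z))"
          unfolding i cnt_def by (simp add: Int_def flip: sum.inter_filter)
        then show ?thesis by (simp only: sum_distrib_right[symmetric])
      qed
      then show "(case i of (c, \<xi>) \<Rightarrow> \<Sum>r\<in>{r. r + N \<le> l}. \<Sum>x\<in>?X. of_bool (?A (c, \<xi>) x (case_nat (int r) z)) * ?q ^ (l - (r + N)))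
        = (\<Sum>r\<in>{r. r + N \<le> l}. real (cnt m l (?A i) (case_nat (int r) z)) * ?q ^ (l - (r + N)))"
        by (simp only: i prod.case)
    qed
    finally have MM: "real (\<Sum>x\<in>?X. M x) =
       (\<Sum>i\<in>?I. \<Sum>r\<in>{r. r + N \<le> l}. real (cnt m l (?A i) (case_nat (int r) z)) * ?q ^ (l - (r + N)))" .
    have q0: "?q > 0" using qq_real by simp
    have sum_eq: "(\<Sum>i\<in>?I. suminf (\<lambda>r. of_bool (r + N \<le> l) * w r * vol m l (?A i) (case_nat (int r) z))) =
       real (\<Sum>x\<in>?X. M x) / ?q ^ (l * Suc m)"
    proof -
      have "suminf (\<lambda>r. of_bool (r + N \<le> l) * w r * vol m l (?A i) (case_nat (int r) z)) =
        (\<Sum>r\<in>{r. r + N \<le> l}. real (cnt m l (?A i) (case_nat (int r) z)) * ?q ^ (l - (r + N))) / ?q ^ (l * Suc m)" for i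
      proof -
        have "suminf (\<lambda>r. of_bool (r + N \<le> l) * w r * vol m l (?A i) (case_nat (int r) z)) =
          (\<Sum>r\<in>{r. r + N \<le> l}. of_bool (r + N \<le> l) * w r * vol m l (?A i) (case_nat (int r) z))"
          by (rule suminf_finite[OF finR]) auto
        also have "\<dots> = (\<Sum>r\<in>{r. r + N \<le> l}. real (cnt m l (?A i) (case_nat (int r) z)) * ?q ^ (l - (r + N)) / ?q ^ (l * Suc m))"
        proof (intro sum.cong refl)
          fix r assume r: "r \<in> {r. r + N \<le> l}"
          have "?q ^ l = ?q ^ (l - (r + N)) * ?q ^ (r + N)" using r by (simp flip: power_add)
          then show "of_bool (r + N \<le> l) * w r * vol m l (?A i) (case_nat (int r) z) =
             real (cnt m l (?A i) (case_nat (int r) z)) * ?q ^ (l - (r + N)) / ?q ^ (l * Suc m)"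
            using r q0 by (simp add: w_def vol_def power_add power_divide field_simps)
        qed
        finally show ?thesis by (simp add: sum_divide_distrib)
      qed
      then show ?thesis by (simp only: MM sum_divide_distrib)
    qed
    have "\<bar>vol (Suc m) l P z - real (\<Sum>x\<in>?X. M x) / ?q ^ (l * Suc m)\<bar> =
       (real (cnt (Suc m) l P z) - real (\<Sum>x\<in>?X. M x)) / ?q ^ (l * Suc m)"
      using of_nat_mono[OF lower, where 'a = real] q0 by (simp add: vol_def del: of_nat_sum flip: diff_divide_distrib)
    also have "\<dots> \<le> (?q ^ (l * m) * (real (card C) * ?q ^ N)) / ?q ^ (l * Suc m)"
      using upper q0 by (intro divide_right_mono) auto
    also have "\<dots> = real (card C) * ?q ^ N / ?q ^ l" using q0 by (simp add: power_add field_simps)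
    finally show ?thesis unfolding sum_eq .
  qed
  define \<psi> where "\<psi> z = (\<Sum>i\<in>?I. suminf (\<lambda>r. w r * \<phi> i (case_nat (int r) z)))" for z
  have main: "(\<lambda>l. \<Sum>i\<in>?I. suminf (\<lambda>r. of_bool (r + N \<le> l) * w r * vol m l (?A i) (case_nat (int r) z))) \<longlonglongrightarrow> \<psi> z" for z
    unfolding \<psi>_def
  proof (rule tendsto_sum)
    fix i assume i: "i \<in> ?I"
    have "eventually (\<lambda>l. summable (\<lambda>r. norm (of_bool (r + N \<le> l) * w r * vol m l (?A i) (case_nat (int r) z)))) sequentially \<and>
        summable (\<lambda>r. norm (w r * \<phi> i (case_nat (int r) z))) \<and>
        ((\<lambda>l. suminf (\<lambda>r. of_bool (r + N \<le> l) * w r * vol m l (?A i) (case_nat (int r) z))) \<longlonglongrightarrow> suminf (\<lambda>r. w r * \<phi> i (case_nat (int r) z)))"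
    proof (rule tannerys_theorem)
      show "summable w" by (rule wsum)
      show "eventually (\<lambda>(r, l). norm (of_bool (r + N \<le> l) * w r * vol m l (?A i) (case_nat (int r) z)) \<le> w r) (at_top \<times>\<^sub>F sequentially)"
      proof (rule always_eventually, clarify)
        fix r l
        have "of_bool (r + N \<le> l) * w r * vol m l (?A i) (case_nat (int r) z) \<le> 1 * w r * 1"
          using w vol_bounds by (intro mult_mono mult_nonneg_nonneg) auto
        then show "norm (of_bool (r + N \<le> l) * w r * vol m l (?A i) (case_nat (int r) z)) \<le> w r"
          using w[of r] vol_bounds by simp
      qed
      fix r
      have "(\<lambda>l. w r * vol m l (?A i) (case_nat (int r) z)) \<longlonglongrightarrow> w r * \<phi> i (case_nat (int r) z)"
        by (rule tendsto_mult_left[OF \<phi>_lim[OF i]])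
      moreover have "eventually (\<lambda>l. w r * vol m l (?A i) (case_nat (int r) z) =
          of_bool (r + N \<le> l) * w r * vol m l (?A i) (case_nat (int r) z)) sequentially"
        using eventually_ge_at_top[of "r + N"] by eventually_elim simp
      ultimately show "(\<lambda>l. of_bool (r + N \<le> l) * w r * vol m l (?A i) (case_nat (int r) z)) \<longlonglongrightarrow> w r * \<phi> i (case_nat (int r) z)"
        by (rule Lim_transform_eventually)
    qed simp
    then show "(\<lambda>l. suminf (\<lambda>r. of_bool (r + N \<le> l) * w r * vol m l (?A i) (case_nat (int r) z))) \<longlonglongrightarrow> suminf (\<lambda>r. w r * \<phi> i (case_nat (int r) z))"
      by blast
  qed
  have lim: "(\<lambda>l. vol (Suc m) l P z) \<longlonglongrightarrow> \<psi> z" for z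
  proof -
    have "(\<lambda>l. inverse ?q ^ l) \<longlonglongrightarrow> 0" using qq_real by (intro LIMSEQ_power_zero) (simp add: field_simps)
    then have "(\<lambda>l. real (card C) * ?q ^ N * inverse ?q ^ l) \<longlonglongrightarrow> real (card C) * ?q ^ N * 0" by (rule tendsto_mult_left)
    then have "(\<lambda>l. real (card C) * ?q ^ N / ?q ^ l) \<longlonglongrightarrow> 0" by (simp add: divide_inverse power_inverse)
    then have "(\<lambda>l. vol (Suc m) l P z - (\<Sum>i\<in>?I. suminf (\<lambda>r. of_bool (r + N \<le> l) * w r * vol m l (?A i) (case_nat (int r) z)))) \<longlonglongrightarrow> 0"
    proof (rule Lim_null_comparison[rotated])
      show "eventually (\<lambda>l. norm (vol (Suc m) l P z - (\<Sum>i\<in>?I. suminf (\<lambda>r. of_bool (r + N \<le> l) * w r * vol m l (?A i) (case_nat (int r) z))))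
        \<le> real (card C) * ?q ^ N / ?q ^ l) sequentially"
        using eventually_ge_at_top[of N] by eventually_elim (use volP in simp)
    qed
    from tendsto_add[OF this main[of z]] show ?thesis by simp
  qed
  have "\<psi> \<in> CC"
    unfolding \<psi>_def
  proof (rule CC_sum)
    fix i assume i: "i \<in> ?I"
    define F where "F z = (1 / ?q) powi (z 0 + int N) * \<phi> i z" for z
    have FF: "F (case_nat (int r) z) = w r * \<phi> i (case_nat (int r) z)" for r z
      using qq_real by (simp add: F_def w_def power_int_add power_add)
    have "(\<lambda>z. suminf (\<lambda>r. F (case_nat (int r) z))) \<in> CC"
    proof (rule CC_suminf)
      show "F \<in> CC" unfolding F_def
        using qq_real \<phi>_CC[OF i] by (intro CC_mult CC_exp TT_add TT_var TT_const) auto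
      show "0 \<le> F z" for z using \<phi>_bounds[OF i] qq_real by (simp add: F_def)
      show "summable (\<lambda>r. F (case_nat (int r) z))" for z
        unfolding FF
      proof (rule summable_comparison_test[OF _ wsum], intro exI allI impI)
        fix r show "norm (w r * \<phi> i (case_nat (int r) z)) \<le> w r"
          using w[of r] \<phi>_bounds[OF i, of "case_nat (int r) z"] by (simp add: mult_left_le)
      qed
    qed
    then show "(\<lambda>z. suminf (\<lambda>r. w r * \<phi> i (case_nat (int r) z))) \<in> CC" by (simp only: FF)
  qed
  then show ?thesis using lim unfolding has_vol_def by blast
qed

end

section \<open>Lower bounds for the number of residue classes\<close>

context local_field
begin

definition cls :: "nat \<Rightarrow> nat \<Rightarrow> ((nat \<Rightarrow> 'k) \<Rightarrow> (nat \<Rightarrow> int) \<Rightarrow> bool) \<Rightarrow> (nat \<Rightarrow> int) \<Rightarrow> nat" where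
  "cls m l P z = card ((\<lambda>x. restrict (\<lambda>i. rep l (x i)) {..<m}) ` {x. P x z})"

text \<open>Valuation of the distance from \<open>t\<close> to a nearest centre, capped at l because
  finer distances are invisible modulo the l-th power.\<close>

definition rho :: "nat \<Rightarrow> ((nat \<Rightarrow> 'k) \<Rightarrow> 'k) set \<Rightarrow> (nat \<Rightarrow> 'k) \<Rightarrow> 'k \<Rightarrow> nat" where
  "rho l C x t = Max {j. j \<le> l \<and> (\<exists>c\<in>C. t - c x \<in> B (int j))}"

lemma rho_mem:
  assumes "(\<lambda>x. 0) \<in> C" "t \<in> B 0"
  shows "rho l C x t \<le> l" "\<exists>c\<in>C. t - c x \<in> B (int (rho l C x t))"
proof -
  have "rho l C x t \<in> {j. j \<le> l \<and> (\<exists>c\<in>C. t - c x \<in> B (int j))}"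
    unfolding rho_def
  proof (rule Max_in)
    have "\<exists>c\<in>C. t - c x \<in> B (int 0)" using assms by force
    then show "{j. j \<le> l \<and> (\<exists>c\<in>C. t - c x \<in> B (int j))} \<noteq> {}" by blast
  qed simp
  then show "rho l C x t \<le> l" "\<exists>c\<in>C. t - c x \<in> B (int (rho l C x t))" by auto
qed

lemma rho_ge: "j \<le> l \<Longrightarrow> c \<in> C \<Longrightarrow> t - c x \<in> B (int j) \<Longrightarrow> j \<le> rho l C x t"
  unfolding rho_def by (intro Max_ge) auto

lemma rho_mono:
  assumes "C \<subseteq> C'" "(\<lambda>x. 0) \<in> C" "t \<in> B 0"
  shows "rho l C x t \<le> rho l C' x t"
proof -
  obtain c where "c \<in> C" "t - c x \<in> B (int (rho l C x t))" using rho_mem(2)[OF assms(2,3)] by blast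
  then show ?thesis using rho_mem(1)[OF assms(2,3)] assms(1) by (intro rho_ge) auto
qed

definition center_family :: "nat \<Rightarrow> (nat \<Rightarrow> ((nat \<Rightarrow> 'k) \<Rightarrow> 'k) set) \<Rightarrow> bool" where
  "center_family m G \<longleftrightarrow> (\<forall>i<m. finite (G i) \<and> (\<lambda>x. 0) \<in> G i \<and>
     (\<forall>c\<in>G i. \<forall>x y. (\<forall>j<i. x j = y j) \<longrightarrow> c x = c y))"

text \<open>The product counts the residue classes in the polydisc around \<open>x\<close> whose
  radii are the distances to the nearest centres. Up to \<open>\<kappa>\<close>, the set meets at
  least that many classes. Both \<open>\<kappa>\<close> and the centres are uniform in the point,
  the integer variables and the precision.\<close>

definition low_bound :: "nat \<Rightarrow> ((nat \<Rightarrow> 'k) \<Rightarrow> (nat \<Rightarrow> int) \<Rightarrow> bool) \<Rightarrow> real \<Rightarrow> (nat \<Rightarrow> ((nat \<Rightarrow> 'k) \<Rightarrow> 'k) set) \<Rightarrow> bool" where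
  "low_bound m P \<kappa> G \<longleftrightarrow> 0 < \<kappa> \<and> center_family m G \<and>
     (\<forall>x z l. P x z \<longrightarrow> (\<Prod>i<m. real qq ^ (l - rho l (G i) x (x i))) \<le> \<kappa> * real (cls m l P z))"

text \<open>Choose one point over each class of the base and use the classes in its fibre; distinct
  pairs extend to distinct classes.\<close>

lemma cls_fiber:
  assumes S: "\<And>x t. S (x(m := t)) t z = S x t z"
    and int: "\<And>x t i. S x t z \<Longrightarrow> i < m \<Longrightarrow> x i \<in> B 0" "\<And>x t. S x t z \<Longrightarrow> t \<in> B 0"
    and Q: "\<And>x. Q x z' \<Longrightarrow> \<exists>T. (\<forall>t\<in>T. S x t z) \<and> T \<noteq> {} \<and> n \<le> card (rep l ` T)"
  shows "cls m l Q z' * n \<le> cls (Suc m) l (\<lambda>x z. S x (x m) z) z"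
proof -
  let ?R = "\<lambda>m x. restrict (\<lambda>i. rep l (x i)) {..<m :: nat}"
  let ?W = "?R m ` {x. Q x z'}"
  let ?Z = "?R (Suc m) ` {x. S x (x m) z}"
  obtain T where T: "\<And>x. Q x z' \<Longrightarrow> (\<forall>t\<in>T x. S x t z) \<and> T x \<noteq> {} \<and> n \<le> card (rep l ` T x)"
    using Q by metis
  define s where "s w = (SOME x. Q x z' \<and> ?R m x = w)" for w
  have s: "Q (s w) z'" "?R m (s w) = w" if "w \<in> ?W" for w
  proof -
    have "\<exists>x. Q x z' \<and> ?R m x = w" using that by blast
    from someI_ex[OF this] show "Q (s w) z'" "?R m (s w) = w" unfolding s_def by auto
  qed
  have finZ: "finite ?Z"
  proof (rule finite_subset)
    show "?Z \<subseteq> PiE {..<Suc m} (\<lambda>_. E l)"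
    proof clarify
      fix x assume x: "S x (x m) z"
      have "x i \<in> B 0" if "i < Suc m" for i using that int[OF x] by (cases "i = m") auto
      then show "?R (Suc m) x \<in> PiE {..<Suc m} (\<lambda>_. E l)" using rep(1) by auto
    qed
  qed simp
  have inW: "?W \<subseteq> PiE {..<m} (\<lambda>_. E l)"
  proof clarify
    fix x assume "Q x z'"
    then obtain t where "S x t z" using T[of x] by blast
    then show "?R m x \<in> PiE {..<m} (\<lambda>_. E l)" using int(1) rep(1) by auto
  qed
  then have finW: "finite ?W" by (rule finite_subset) simp
  have TE: "rep l ` T (s w) \<subseteq> E l" if "w \<in> ?W" for w
    using T[OF s(1)[OF that]] int(2) rep(1) by blast
  then have finT: "finite (rep l ` T (s w))" if "w \<in> ?W" for w using finite_subset[OF _ finite_E] that by blast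
  have sub: "(\<lambda>(w, e). w(m := e)) ` (SIGMA w:?W. rep l ` T (s w)) \<subseteq> ?Z"
  proof
    fix y assume "y \<in> (\<lambda>(w, e). w(m := e)) ` (SIGMA w:?W. rep l ` T (s w))"
    then obtain p where p: "y = (\<lambda>(w, e). w(m := e)) p" "p \<in> (SIGMA w:?W. rep l ` T (s w))" by (rule imageE)
    from p(2) obtain w e where w: "w \<in> ?W" and e: "e \<in> rep l ` T (s w)" "p = (w, e)" by (rule SigmaE)
    from e(1) obtain t where t: "t \<in> T (s w)" "e = rep l t" by blast
    have y: "y = w(m := rep l t)" by (simp only: p(1) e(2) t(2) prod.case)
    have "S (s w) t z" using T[OF s(1)[OF w]] t(1) by blast
    then have 1: "S ((s w)(m := t)) (((s w)(m := t)) m) z" using S by simp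
    have "?R (Suc m) ((s w)(m := t)) = (?R m (s w))(m := rep l t)"
      by (auto simp: fun_eq_iff restrict_def less_Suc_eq)
    also have "\<dots> = w(m := rep l t)" using s(2)[OF w] by simp
    finally have "y = ?R (Suc m) ((s w)(m := t))" using y by simp
    moreover have "?R (Suc m) ((s w)(m := t)) \<in> ?Z" by (rule imageI) (simp only: mem_Collect_eq 1)
    ultimately show "y \<in> ?Z" by simp
  qed
  have inj: "inj_on (\<lambda>(w, e). w(m := e)) (SIGMA w:?W. rep l ` T (s w))"
  proof (rule inj_onI)
    fix y y' assume yy: "y \<in> (SIGMA w:?W. rep l ` T (s w))" "y' \<in> (SIGMA w:?W. rep l ` T (s w))"
      "(\<lambda>(w, e). w(m := e)) y = (\<lambda>(w, e). w(m := e)) y'"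
    obtain w e where y: "w \<in> ?W" "y = (w, e)" using yy(1) by (rule SigmaE)
    obtain w' e' where y': "w' \<in> ?W" "y' = (w', e')" using yy(2) by (rule SigmaE)
    note w = y(1) y'(1)
    have eq: "w(m := e) = w'(m := e')" using yy(3) by (simp only: y(2) y'(2) prod.case)
    have "w i = w' i" for i
    proof (cases "i = m")
      case True
      have "w \<in> extensional {..<m}" "w' \<in> extensional {..<m}" using subsetD[OF inW w(1)] subsetD[OF inW w(2)] by (simp_all only: PiE_iff)
      then show ?thesis using True by (simp add: extensional_def)
    next
      case False
      then show ?thesis using fun_cong[OF eq, of i] by simp
    qed
    moreover have "e = e'" using fun_cong[OF eq, of m] by simp
    ultimately show "y = y'" using y(2) y'(2) by auto
  qed
  have "cls m l Q z' * n = (\<Sum>w\<in>?W. n)" by (simp add: cls_def)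
  also have "\<dots> \<le> (\<Sum>w\<in>?W. card (rep l ` T (s w)))" using T s(1) by (intro sum_mono) blast
  also have "\<dots> = card (SIGMA w:?W. rep l ` T (s w))" using finW finT by (simp add: card_SigmaI)
  also have "\<dots> = card ((\<lambda>(w, e). w(m := e)) ` (SIGMA w:?W. rep l ` T (s w)))" by (rule card_image[OF inj, symmetric])
  also have "\<dots> \<le> card ?Z" by (rule card_mono[OF finZ sub])
  finally show ?thesis by (simp add: cls_def)
qed

end

context level
begin

text \<open>If the last coordinate is a centre, its factor is 1 and one point in each fibre
  suffices. Otherwise the fibres over all base points with the same arm contain a disc of radius
  \<open>r + N\<close>, which falls short of the disc of radius r only by a factor
  \<open>qq ^ N\<close>.\<close>

lemma next_low_bound:
  assumes IH: "\<And>Q. Q \<in> D \<Longrightarrow> (\<And>x z i. Q x z \<Longrightarrow> i < m \<Longrightarrow> x i \<in> B 0) \<Longrightarrow> \<exists>\<kappa> G. low_bound m Q \<kappa> G"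
    and P: "P \<in> next_D" and int: "\<And>x z i. P x z \<Longrightarrow> i < Suc m \<Longrightarrow> x i \<in> B 0"
  shows "\<exists>\<kappa> G. low_bound (Suc m) P \<kappa> G"
proof -
  obtain S where S: "prepared S" "P = (\<lambda>x z. S x (x m) z)" using P by (auto simp: next_D_def)
  have Supd: "S (x(m := t)) t z = S x t z" for x t z by (rule prepared_indep[OF S(1)]) auto
  have Sint: "t \<in> B 0" "i < m \<Longrightarrow> x i \<in> B 0" if "S x t z" for x t z i
    using int[of "x(m := t)" z m] int[of "x(m := t)" z i] S(2) Supd that by auto
  obtain C N where p: "prep C N S" using S(1) by (auto simp: prepared_def)
  note pd = prepD[OF p]
  let ?I = "C \<times> (E N - B 1)"
  let ?Ac = "\<lambda>c x z. S x (c x) z"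
  let ?A = "\<lambda>i x z. adm C (fst i) (snd i) x (z 0) \<and> S x (fst i x + snd i * pw (z 0)) (\<lambda>i. z (Suc i))"
  have finI: "finite ?I" using pd(1) by simp
  have "\<exists>h. low_bound m (?Ac c) (fst h) (snd h)" if c: "c \<in> C" for c
  proof -
    have "\<exists>\<kappa> G. low_bound m (?Ac c) \<kappa> G" using pd(7)[OF c] by (rule IH) (use Sint(2) in auto)
    then show ?thesis by simp
  qed
  then have "\<exists>h. \<forall>c\<in>C. low_bound m (?Ac c) (fst (h c)) (snd (h c))" by (intro bchoice ballI)
  then obtain h1 where h1: "\<And>c. c \<in> C \<Longrightarrow> low_bound m (?Ac c) (fst (h1 c)) (snd (h1 c))" by blast
  have "\<exists>h. low_bound m (?A i) (fst h) (snd h)" if i: "i \<in> ?I" for i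
  proof -
    have "fst i \<in> C" "snd i \<in> B 0 - B 1" using i E_sub[of N] by auto
    then have "?A i \<in> D" by (rule pd(6))
    then have "\<exists>\<kappa> G. low_bound m (?A i) \<kappa> G" by (rule IH) (use Sint(2) in auto)
    then show ?thesis by simp
  qed
  then have "\<exists>h. \<forall>i\<in>?I. low_bound m (?A i) (fst (h i)) (snd (h i))" by (intro bchoice ballI)
  then obtain h2 where h2: "\<And>i. i \<in> ?I \<Longrightarrow> low_bound m (?A i) (fst (h2 i)) (snd (h2 i))" by blast
  \<comment> \<open>The sums dominate the constant of whichever cell the point lies in; the power of
    \<open>qq\<close> pays for the N digits fixed by an arm.\<close>
  define \<kappa> where "\<kappa> = ((\<Sum>c\<in>C. fst (h1 c)) + (\<Sum>i\<in>?I. fst (h2 i))) * real qq ^ N"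
  define G where "G i = (if i < m then (\<Union>c\<in>C. snd (h1 c) i) \<union> (\<Union>j\<in>?I. snd (h2 j) i) else C)" for i
  have pos1: "0 < fst (h1 c)" if "c \<in> C" for c using h1[OF that] by (simp add: low_bound_def)
  have pos2: "0 < fst (h2 i)" if "i \<in> ?I" for i using h2[OF that] by (simp add: low_bound_def)
  have q1: "1 \<le> real qq ^ N" using qq_real by (intro one_le_power) auto
  have s1: "0 \<le> (\<Sum>i\<in>?I. fst (h2 i))" by (intro sum_nonneg less_imp_le pos2)
  have s2: "0 \<le> (\<Sum>c\<in>C. fst (h1 c))" by (intro sum_nonneg less_imp_le pos1)
  have \<kappa>1: "fst (h1 c) \<le> \<kappa>" if "c \<in> C" for c
  proof -
    have "fst (h1 c) \<le> (\<Sum>c\<in>C. fst (h1 c))" using that pd(1) pos1 by (intro member_le_sum less_imp_le) auto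
    also have "\<dots> \<le> ((\<Sum>c\<in>C. fst (h1 c)) + (\<Sum>i\<in>?I. fst (h2 i))) * 1" using s1 by simp
    also have "\<dots> \<le> \<kappa>" unfolding \<kappa>_def using q1 s1 s2 by (intro mult_left_mono) auto
    finally show ?thesis .
  qed
  have \<kappa>2: "fst (h2 i) * real qq ^ N \<le> \<kappa>" if "i \<in> ?I" for i
  proof -
    have "fst (h2 i) \<le> (\<Sum>i\<in>?I. fst (h2 i))" using that finI pos2 by (intro member_le_sum less_imp_le) auto
    then show ?thesis unfolding \<kappa>_def using s2 q1 by (intro mult_right_mono) auto
  qed
  have cf1: "center_family m (snd (h1 c))" if "c \<in> C" for c using h1[OF that] by (simp add: low_bound_def)
  have cf2: "center_family m (snd (h2 i))" if "i \<in> ?I" for i using h2[OF that] by (simp add: low_bound_def)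
  have \<kappa>pos: "0 < \<kappa>" using \<kappa>1[OF pd(3)] pos1[OF pd(3)] by linarith
  have cf: "center_family (Suc m) G"
    unfolding center_family_def
  proof (intro allI impI)
    fix i assume i: "i < Suc m"
    show "finite (G i) \<and> (\<lambda>x. 0) \<in> G i \<and> (\<forall>c\<in>G i. \<forall>x y. (\<forall>j<i. x j = y j) \<longrightarrow> c x = c y)"
    proof (cases "i < m")
      case True
      have 1: "finite (snd (h1 c) i)" "(\<lambda>x. 0) \<in> snd (h1 c) i"
        "\<And>c'. c' \<in> snd (h1 c) i \<Longrightarrow> \<forall>x y. (\<forall>j<i. x j = y j) \<longrightarrow> c' x = c' y" if "c \<in> C" for c
        using cf1[OF that] True unfolding center_family_def by blast+
      have 2: "finite (snd (h2 k) i)"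
        "\<And>c'. c' \<in> snd (h2 k) i \<Longrightarrow> \<forall>x y. (\<forall>j<i. x j = y j) \<longrightarrow> c' x = c' y" if "k \<in> ?I" for k
        using cf2[OF that] True unfolding center_family_def by blast+
      have G: "G i = (\<Union>c\<in>C. snd (h1 c) i) \<union> (\<Union>j\<in>?I. snd (h2 j) i)" using True by (simp add: G_def)
      have "finite (G i)" unfolding G using 1(1) 2(1) pd(1) finI by (intro finite_UnI finite_UN_I)
      moreover have "(\<lambda>x. 0) \<in> G i" unfolding G using 1(2)[OF pd(3)] pd(3) by blast
      moreover have "\<forall>x y. (\<forall>j<i. x j = y j) \<longrightarrow> c x = c y" if "c \<in> G i" for c
        using that unfolding G using 1(3) 2(2) by blast
      ultimately show ?thesis by blast
    next
      case False
      then have "G i = C" "i = m" using i by (auto simp: G_def)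
      then show ?thesis using pd(1-3) R_indep by blast
    qed
  qed
  have "(\<Prod>i<Suc m. real qq ^ (l - rho l (G i) x (x i))) \<le> \<kappa> * real (cls (Suc m) l P z)"
    if Px: "P x z" for x z l
  proof -
    have St: "S x (x m) z" using Px S(2) by simp
    have xint: "x i \<in> B 0" if "i < Suc m" for i using int[OF Px that] .
    have Gm: "G m = C" by (simp add: G_def)
    \<comment> \<open>More centres can only bring one of them nearer to the point and so shrink the
      polydisc. Hence the families belonging to all cells may be united.\<close>
    have lower: "(\<Prod>i<m. real qq ^ (l - rho l (G i) x (x i))) \<le> (\<Prod>i<m. real qq ^ (l - rho l (H i) x (x i)))"
      if H: "center_family m H" "\<And>i. i < m \<Longrightarrow> H i \<subseteq> G i" for H
    proof (rule prod_mono)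
      fix i assume i: "i \<in> {..<m}"
      have "rho l (H i) x (x i) \<le> rho l (G i) x (x i)"
        using H i xint[of i] by (intro rho_mono) (auto simp: center_family_def)
      then show "0 \<le> real qq ^ (l - rho l (G i) x (x i)) \<and> real qq ^ (l - rho l (G i) x (x i)) \<le> real qq ^ (l - rho l (H i) x (x i))"
        using qq_real by (auto intro!: power_increasing)
    qed
    show ?thesis
    proof (cases "\<exists>c\<in>C. x m = c x")
      case True
      then obtain c where c: "c \<in> C" "x m = c x" by blast
      have "l \<le> rho l (G m) x (x m)" using c Gm by (intro rho_ge[of l l c]) auto
      then have "(\<Prod>i<Suc m. real qq ^ (l - rho l (G i) x (x i))) = (\<Prod>i<m. real qq ^ (l - rho l (G i) x (x i)))" by simp
      also have "\<dots> \<le> (\<Prod>i<m. real qq ^ (l - rho l (snd (h1 c) i) x (x i)))"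
        by (rule lower[OF cf1[OF c(1)]]) (use c(1) in \<open>auto simp: G_def\<close>)
      also have "\<dots> \<le> fst (h1 c) * real (cls m l (?Ac c) z)"
        using h1[OF c(1)] St c(2) unfolding low_bound_def by auto
      also have "\<dots> \<le> \<kappa> * real (cls (Suc m) l P z)"
      proof (intro mult_mono \<kappa>1[OF c(1)] of_nat_mono)
        have "cls m l (?Ac c) z * 1 \<le> cls (Suc m) l P z"
          unfolding S(2)
        proof (rule cls_fiber[where S = S])
          show "\<exists>T. (\<forall>t\<in>T. S x t z) \<and> T \<noteq> {} \<and> 1 \<le> card (rep l ` T)" if "S x (c x) z" for x
            using that by (intro exI[of _ "{c x}"]) auto
        qed (use Sint Supd in auto)
        then show "cls m l (?Ac c) z \<le> cls (Suc m) l P z" by simp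
      qed (use \<kappa>pos in auto)
      finally show ?thesis .
    next
      case False
      obtain c \<xi> r where c: "c \<in> C" "\<xi> \<in> E N - B 1" "x m - c x - \<xi> * pw r \<in> B (r + int N)"
        "adm C c \<xi> x r" "x m - c x \<in> B r" "\<And>c'. c' \<in> C \<Longrightarrow> x m - c' x \<notin> B (r + 1)"
        by (rule ex_arm[of C N "x m" x]) (use pd(1,3,4) False in auto)
      have "0 \<le> r" using c(6)[OF pd(3)] xint[of m] B_mono[of "x m" 0 "r + 1"] by (cases "0 \<le> r") auto
      then obtain r' where r': "r = int r'" using nonneg_int_cases by blast
      have i: "(c, \<xi>) \<in> ?I" using c by blast
      have Sarm: "S x (c x + \<xi> * pw r) z" using prep_arm_eq[OF p c(4,3), of z] St by simp
      have "min l r' \<le> rho l (G m) x (x m)"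
        using c(1,5) Gm r' by (intro rho_ge[of _ l c]) (auto elim: B_mono)
      then have e: "l - rho l (G m) x (x m) \<le> N + (l - (r' + N))" by linarith
      have "real qq ^ (l - rho l (G m) x (x m)) \<le> real qq ^ (N + (l - (r' + N)))"
        using e qq_real by (intro power_increasing) auto
      then have last: "real qq ^ (l - rho l (G m) x (x m)) \<le> real qq ^ N * real qq ^ (l - (r' + N))" by (simp add: power_add)
      have cls: "cls m l (?A (c, \<xi>)) (case_nat r z) * qq ^ (l - (r' + N)) \<le> cls (Suc m) l P z"
        unfolding S(2)
      proof (rule cls_fiber[where S = S])
        fix x assume "?A (c, \<xi>) x (case_nat r z)"
        then have A: "adm C c \<xi> x r" "S x (c x + \<xi> * pw r) z" by auto
        let ?u = "c x + \<xi> * pw r"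
        let ?T = "{t \<in> B 0. t - ?u \<in> B (int (r' + N))}"
        have u: "?u \<in> B 0" using Sint(1)[OF A(2)] .
        have "S x t z" if "t \<in> ?T" for t
          using prep_arm_eq[OF p A(1), of t z] that A(2) r' by (simp add: algebra_simps)
        moreover have ne: "?u \<in> ?T" using u by simp
        moreover have "qq ^ (l - (r' + N)) \<le> card (rep l ` ?T)"
        proof -
          have fin: "finite (rep l ` ?T)" by (rule finite_subset[of _ "E l"]) (auto intro: rep)
          show ?thesis
          proof (cases "r' + N \<le> l")
            case True
            have "{e \<in> E l. e - ?u \<in> B (int (r' + N))} \<subseteq> rep l ` ?T"
            proof
              fix e assume e: "e \<in> {e \<in> E l. e - ?u \<in> B (int (r' + N))}"
              then have "e \<in> ?T" "rep l e = e" using E_sub by auto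
              then show "e \<in> rep l ` ?T" by force
            qed
            then have "card {e \<in> E l. e - ?u \<in> B (int (r' + N))} \<le> card (rep l ` ?T)" by (rule card_mono[OF fin])
            then show ?thesis using card_E_ball[OF u True] by simp
          next
            case False
            have "rep l ` ?T \<noteq> {}" using ne by blast
            then have "1 \<le> card (rep l ` ?T)" using fin by (simp add: Suc_le_eq card_gt_0_iff)
            then show ?thesis using False by simp
          qed
        qed
        ultimately show "\<exists>T. (\<forall>t\<in>T. S x t z) \<and> T \<noteq> {} \<and> qq ^ (l - (r' + N)) \<le> card (rep l ` T)" by blast
      qed (use Sint Supd in auto)
      have "(\<Prod>i<Suc m. real qq ^ (l - rho l (G i) x (x i))) =
         (\<Prod>i<m. real qq ^ (l - rho l (G i) x (x i))) * real qq ^ (l - rho l (G m) x (x m))" by simp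
      also have "\<dots> \<le> (fst (h2 (c, \<xi>)) * real (cls m l (?A (c, \<xi>)) (case_nat r z))) * (real qq ^ N * real qq ^ (l - (r' + N)))"
      proof (rule mult_mono[OF _ last])
        have "(\<Prod>i<m. real qq ^ (l - rho l (G i) x (x i))) \<le> (\<Prod>i<m. real qq ^ (l - rho l (snd (h2 (c, \<xi>)) i) x (x i)))"
          by (rule lower[OF cf2[OF i]]) (use i in \<open>auto simp: G_def\<close>)
        also have "\<dots> \<le> fst (h2 (c, \<xi>)) * real (cls m l (?A (c, \<xi>)) (case_nat r z))"
        proof -
          have "?A (c, \<xi>) x (case_nat r z)" using c(4) Sarm by simp
          then show ?thesis using h2[OF i] unfolding low_bound_def by blast
        qed
        finally show "(\<Prod>i<m. real qq ^ (l - rho l (G i) x (x i))) \<le> fst (h2 (c, \<xi>)) * real (cls m l (?A (c, \<xi>)) (case_nat r z))" .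
      qed (use pos2[OF i] in auto)
      also have "\<dots> = (fst (h2 (c, \<xi>)) * real qq ^ N) * real (cls m l (?A (c, \<xi>)) (case_nat r z) * qq ^ (l - (r' + N)))"
        by (simp add: mult_ac)
      also have "\<dots> \<le> \<kappa> * real (cls (Suc m) l P z)"
        by (intro mult_mono \<kappa>2[OF i] of_nat_mono cls) (use \<kappa>pos in auto)
      finally show ?thesis .
    qed
  qed
  then show ?thesis unfolding low_bound_def using \<kappa>pos cf by blast
qed

end

section \<open>The tower of levels over Presburger arithmetic\<close>

locale chain = local_field v
  for v :: "'k::field_char_0 \<Rightarrow> int" +
  fixes DD :: "nat \<Rightarrow> ((nat \<Rightarrow> 'k) \<Rightarrow> (nat \<Rightarrow> int) \<Rightarrow> bool) set" and RR :: "nat \<Rightarrow> ((nat \<Rightarrow> 'k) \<Rightarrow> 'k) set"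
  assumes lev: "level v (DD m) (RR m) m"
    and base: "DD 0 = {\<lambda>x z. Q z | Q. Q \<in> QQ}"
    and step: "DD (Suc m) = level.next_D v (DD m) (RR m) m"
    and RR_mono: "RR m \<subseteq> RR (Suc m)" and RR_coord: "(\<lambda>x. x m) \<in> RR (Suc m)"

text \<open>Dependent choice is called for because each ring comes from Zorn's lemma and has to
  contain the ring chosen before it. The clause about index 0 in the invariant pins down the base
  level.\<close>

lemma (in local_field) ex_chain: "\<exists>DD RR. chain v DD RR"
proof -
  let ?D0 = "{\<lambda>(x :: nat \<Rightarrow> 'k) z. Q z | Q. Q \<in> QQ}"
  have fs: "field_structure v ?D0"
    by (intro field_structure.intro local_field_axioms QQ_structure)
  then interpret b: field_structure v ?D0 .
  obtain R where R: "b.max_ring R" using b.ex_max_ring[OF b.def_ring_consts] by blast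
  have "level v ?D0 R 0"
    by (intro level.intro ring_structure.intro fs ring_structure_axioms.intro R level_axioms.intro) auto
  then have "\<exists>p. level v (fst p) (snd p) 0 \<and> ((0 :: nat) = 0 \<longrightarrow> fst p = ?D0)"
    by (intro exI[of _ "(?D0, R)"]) auto
  moreover have "\<exists>p'. (level v (fst p') (snd p') (Suc m) \<and> (Suc m = 0 \<longrightarrow> fst p' = ?D0)) \<and>
     (fst p' = level.next_D v (fst p) (snd p) m \<and> snd p \<subseteq> snd p' \<and> (\<lambda>x. x m) \<in> snd p')"
    if "level v (fst p) (snd p) m \<and> (m = 0 \<longrightarrow> fst p = ?D0)" for p m
  proof -
    interpret l: level v "fst p" "snd p" m using that by blast
    obtain R' where "level v l.next_D R' (Suc m)" "snd p \<subseteq> R'" "(\<lambda>x. x m) \<in> R'" using l.ex_next by blast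
    then show ?thesis by (intro exI[of _ "(l.next_D, R')"]) auto
  qed
  ultimately have "\<exists>f. \<forall>n. (level v (fst (f n)) (snd (f n)) n \<and> (n = 0 \<longrightarrow> fst (f n) = ?D0)) \<and>
     (fst (f (Suc n)) = level.next_D v (fst (f n)) (snd (f n)) n \<and> snd (f n) \<subseteq> snd (f (Suc n)) \<and> (\<lambda>x. x n) \<in> snd (f (Suc n)))"
    by (intro dependent_nat_choice) simp_all
  then obtain f where f: "\<And>n. (level v (fst (f n)) (snd (f n)) n \<and> (n = 0 \<longrightarrow> fst (f n) = ?D0)) \<and>
     (fst (f (Suc n)) = level.next_D v (fst (f n)) (snd (f n)) n \<and> snd (f n) \<subseteq> snd (f (Suc n)) \<and> (\<lambda>x. x n) \<in> snd (f (Suc n)))"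
    by (elim exE) (rule that, erule spec)
  have f0: "fst (f 0) = ?D0" using f[of 0] by simp
  note f' = f[THEN conjunct1, THEN conjunct1] f0 f[THEN conjunct2, THEN conjunct1]
    f[THEN conjunct2, THEN conjunct2, THEN conjunct1] f[THEN conjunct2, THEN conjunct2, THEN conjunct2]
  have "chain v (\<lambda>n. fst (f n)) (\<lambda>n. snd (f n))"
    by (intro chain.intro local_field_axioms chain_axioms.intro f')
  then show ?thesis by blast
qed

context chain
begin

sublocale lv: level v "DD m" "RR m" m for m by (rule lev)

lemma chain_has_vol: "P \<in> DD m \<Longrightarrow> (\<And>x z i. P x z \<Longrightarrow> i < m \<Longrightarrow> x i \<in> B 0) \<Longrightarrow> \<exists>\<phi>. has_vol m P \<phi>"
proof (induction m arbitrary: P)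
  case 0
  then obtain Q where Q: "Q \<in> QQ" "P = (\<lambda>x z. Q z)" using base by auto
  have "vol 0 l P z = of_bool (Q z)" for l z
    by (simp add: vol_def cnt_def Q(2))
  then have "has_vol 0 P (\<lambda>z. of_bool (Q z))" unfolding has_vol_def using Q(1) by (auto intro: CC_ind)
  then show ?case by blast
next
  case (Suc m)
  show ?case
    by (rule lv.next_has_vol[OF Suc.IH]) (use Suc.prems step in auto)
qed

lemma chain_low_bound:
  "P \<in> DD m \<Longrightarrow> (\<And>x z i. P x z \<Longrightarrow> i < m \<Longrightarrow> x i \<in> B 0) \<Longrightarrow> \<exists>\<kappa> G. low_bound m P \<kappa> G"
proof (induction m arbitrary: P)
  case 0
  have "1 \<le> cls 0 l P z" if "P x z" for x z l
  proof -
    have "(\<lambda>x. restrict (\<lambda>i. rep l (x i)) {..<0}) ` {x. P x z} = {\<lambda>_. undefined}" using that by (auto simp: restrict_def)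
    then show ?thesis by (simp add: cls_def)
  qed
  then have "low_bound 0 P 1 (\<lambda>_. {})" unfolding low_bound_def center_family_def by fastforce
  then show ?case by blast
next
  case (Suc m)
  show ?case
    by (rule lv.next_low_bound[OF Suc.IH]) (use Suc.prems step in auto)
qed

lemma chain_project: "P \<in> DD (Suc m) \<Longrightarrow> (\<lambda>x z. \<exists>t. P (x(m := t)) z) \<in> DD m"
  unfolding step by (rule lv.next_project)

lemma RR_le: "m \<le> n \<Longrightarrow> RR m \<subseteq> RR n"
  by (induction n rule: dec_induct) (use RR_mono in auto)

lemma RR_var: "i < m \<Longrightarrow> (\<lambda>x. x i) \<in> RR m"
  using RR_le[of "Suc i" m] RR_coord by auto

end

section \<open>The two counting functions\<close>

lemma mpeval_cong:
  assumes "\<And>\<alpha>. \<alpha> \<in> Poly_Mapping.keys p \<Longrightarrow> Poly_Mapping.keys \<alpha> \<subseteq> {..<m}" "\<And>i. i < m \<Longrightarrow> x i = y i"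
  shows "mpeval p x = mpeval p y"
proof -
  have "x i = y i" if "\<alpha> \<in> Poly_Mapping.keys p" "i \<in> Poly_Mapping.keys \<alpha>" for \<alpha> i
    using assms(1)[OF that(1)] that(2) assms(2) by blast
  then show ?thesis unfolding mpeval_def by (intro sum.cong prod.cong arg_cong2[of _ _ _ _ "(*)"] refl) simp
qed

lemma card_image_eq:
  assumes "\<And>x y. x \<in> X \<Longrightarrow> y \<in> X \<Longrightarrow> f x = f y \<longleftrightarrow> g x = g y"
  shows "card (f ` X) = card (g ` X)"
proof -
  have "bij_betw (\<lambda>b. f (inv_into X g b)) (g ` X) (f ` X)"
  proof (rule bij_betw_imageI)
    show "inj_on (\<lambda>b. f (inv_into X g b)) (g ` X)"
      by (rule inj_onI) (metis assms f_inv_into_f inv_into_into)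
    have "f (inv_into X g (g x)) = f x" if "x \<in> X" for x
      using assms that by (metis f_inv_into_f imageI inv_into_into)
    then show "(\<lambda>b. f (inv_into X g b)) ` g ` X = f ` X" by (force simp: image_image)
  qed
  then show ?thesis by (simp add: bij_betw_same_card)
qed

context local_field
begin

abbreviation reduce :: "nat \<Rightarrow> nat \<Rightarrow> (nat \<Rightarrow> 'k) \<Rightarrow> nat \<Rightarrow> 'k" where
  "reduce m l x \<equiv> restrict (\<lambda>i. rep l (x i)) {..<m}"

lemma reduce_eq_iff:
  assumes "\<And>i. i < m \<Longrightarrow> x i \<in> B 0" "\<And>i. i < m \<Longrightarrow> y i \<in> B 0"
  shows "reduce m l x = reduce m l y \<longleftrightarrow> (\<forall>i<m. x i - y i \<in> B (int l))"
proof -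
  have "reduce m l x = reduce m l y \<longleftrightarrow> (\<forall>i<m. rep l (x i) = rep l (y i))"
    by (auto simp: fun_eq_iff restrict_def)
  then show ?thesis using rep_eq_iff assms by simp
qed

lemma card_quotient_cong:
  assumes "X \<subseteq> int_points v m"
  shows "card (X // cong_rel v m n) = card (reduce m n ` X)"
proof -
  have "cong_rel v m n `` {x} = cong_rel v m n `` {y} \<longleftrightarrow> reduce m n x = reduce m n y"
    if "x \<in> X" "y \<in> X" for x y
  proof -
    have int: "\<And>i. i < m \<Longrightarrow> x i \<in> B 0" "\<And>i. i < m \<Longrightarrow> y i \<in> B 0"
      using that assms by (auto simp: int_points_def val_ring_def PiE_iff subset_iff)
    have "cong_rel v m n `` {x} = cong_rel v m n `` {y} \<longleftrightarrow> (\<forall>i<m. x i - y i \<in> B (int n))"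
    proof
      assume "cong_rel v m n `` {x} = cong_rel v m n `` {y}"
      moreover have "y \<in> cong_rel v m n `` {y}" by (simp add: cong_rel_def)
      ultimately have "y \<in> cong_rel v m n `` {x}" by simp
      then show "\<forall>i<m. x i - y i \<in> B (int n)" by (simp add: cong_rel_def)
    next
      assume "\<forall>i<m. x i - y i \<in> B (int n)"
      then have "x i - u i \<in> B (int n) \<longleftrightarrow> y i - u i \<in> B (int n)" if "i < m" for u i
        using that by (intro B_eq_iff) auto
      then show "cong_rel v m n `` {x} = cong_rel v m n `` {y}" by (auto simp: cong_rel_def)
    qed
    then show ?thesis using reduce_eq_iff[OF int] by simp
  qed
  then have "card ((\<lambda>x. cong_rel v m n `` {x}) ` X) = card (reduce m n ` X)" by (rule card_image_eq)
  moreover have "X // cong_rel v m n = (\<lambda>x. cong_rel v m n `` {x}) ` X" by (auto simp: quotient_def)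
  ultimately show ?thesis by simp
qed

text \<open>Common interface of the two counting functions. Invariance under congruence makes the
  solution set at n a union of full residue classes, so that its volume records the count
  exactly.\<close>

definition counted :: "nat \<Rightarrow> ((nat \<Rightarrow> 'k) \<Rightarrow> (nat \<Rightarrow> int) \<Rightarrow> bool) \<Rightarrow> (nat \<Rightarrow> nat) \<Rightarrow> bool" where
  "counted m P N \<longleftrightarrow> (\<forall>x z i. P x z \<longrightarrow> i < m \<longrightarrow> x i \<in> B 0) \<and>
     (\<forall>n z. N n = cls m n P (case_nat (int n) z)) \<and>
     (\<forall>n x y z. P x (case_nat (int n) z) \<longrightarrow> (\<forall>i<m. y i \<in> B 0 \<and> x i - y i \<in> B (int n)) \<longrightarrow> P y (case_nat (int n) z))"

text \<open>By the invariance, each solution class modulo the n-th power consists of a complete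
  block of the finer grid. The normalized count is thus constant for \<open>n \<le> l\<close>, and
  the limit volume is attained at \<open>l = n\<close>.\<close>

lemma counted_cnt:
  assumes c: "counted m P N" and l: "n \<le> l"
  shows "cnt m l P (case_nat (int n) z) = N n * qq ^ ((l - n) * m)"
proof -
  let ?z = "case_nat (int n) z"
  let ?X = "\<lambda>l. {x \<in> PiE {..<m} (\<lambda>_. E l). P x ?z}"
  have int: "x i \<in> B 0" if "P x ?z" "i < m" for x i using c that by (auto simp: counted_def)
  have st: "P y ?z" if "P x ?z" "\<And>i. i < m \<Longrightarrow> y i \<in> B 0" "\<And>i. i < m \<Longrightarrow> x i - y i \<in> B (int n)" for x y
    using c that unfolding counted_def by blast
  have red: "P (reduce m n x) ?z" if "P x ?z" for x
    by (rule st[OF that]) (use rep[OF int[OF that]] E_sub[of n] in auto)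
  have X: "reduce m n ` {x. P x ?z} = ?X n"
  proof (intro equalityI subsetI)
    fix y assume "y \<in> reduce m n ` {x. P x ?z}"
    then obtain x where x: "P x ?z" "y = reduce m n x" by blast
    have "y \<in> PiE {..<m} (\<lambda>_. E n)" unfolding x(2) using rep(1)[OF int[OF x(1)]] by auto
    then show "y \<in> ?X n" using red[OF x(1)] x(2) by simp
  next
    fix y assume y: "y \<in> ?X n"
    have "reduce m n y = y"
    proof
      fix i show "reduce m n y i = y i" using y rep_E by (cases "i < m") (auto simp: PiE_iff extensional_def)
    qed
    then show "y \<in> reduce m n ` {x. P x ?z}" using y by (metis (no_types, lifting) imageI mem_Collect_eq)
  qed
  have N: "N n = card (?X n)"
  proof -
    have "N n = cls m n P ?z" using c by (simp add: counted_def)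
    then show ?thesis by (simp add: cls_def X)
  qed
  have fib: "{x \<in> ?X l. reduce m n x = e} = PiE {..<m} (\<lambda>i. {t \<in> E l. t - e i \<in> B (int n)})" if e: "e \<in> ?X n" for e
  proof -
    have eE: "e i \<in> E n" if "i < m" for i using e that by auto
    have ext: "e \<in> extensional {..<m}" using e by (simp add: PiE_iff)
    show ?thesis
    proof (intro equalityI subsetI)
      fix x assume x: "x \<in> {x \<in> ?X l. reduce m n x = e}"
      have "x i - e i \<in> B (int n)" if "i < m" for i
      proof -
        have "e = reduce m n x" using x by simp
        then have "e i = rep n (x i)" using that by simp
        then show ?thesis using rep(2)[of "x i" n] int[of x i] x that by simp
      qed
      then show "x \<in> PiE {..<m} (\<lambda>i. {t \<in> E l. t - e i \<in> B (int n)})" using x by (auto simp: PiE_iff)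
    next
      fix x assume x: "x \<in> PiE {..<m} (\<lambda>i. {t \<in> E l. t - e i \<in> B (int n)})"
      have xi: "x i \<in> E l" "x i \<in> B 0" "x i - e i \<in> B (int n)" if "i < m" for i
        using x that E_sub[of l] by (auto simp: PiE_iff)
      have "P x ?z"
        by (rule st[of e]) (use e xi in \<open>auto simp: B_minus_commute[of "e _"]\<close>)
      moreover have "reduce m n x = e"
      proof
        fix i show "reduce m n x i = e i"
          using rep_eqI[OF xi(2) eE xi(3)] ext by (cases "i < m") (simp_all add: extensional_def)
      qed
      ultimately show "x \<in> {x \<in> ?X l. reduce m n x = e}" using x by (auto simp: PiE_iff)
    qed
  qed
  have card_fib: "card {x \<in> ?X l. reduce m n x = e} = qq ^ ((l - n) * m)" if e: "e \<in> ?X n" for e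
  proof -
    have "card {t \<in> E l. t - e i \<in> B (int n)} = qq ^ (l - n)" if "i < m" for i
      using e that E_sub[of n] l by (intro card_E_ball) auto
    then show ?thesis unfolding fib[OF e] by (simp add: card_PiE power_mult)
  qed
  have "cnt m l P ?z = (\<Sum>x\<in>?X l. 1)" by (simp add: cnt_def)
  also have "\<dots> = (\<Sum>e\<in>?X n. \<Sum>x\<in>{x \<in> ?X l. reduce m n x = e}. 1)"
  proof (rule sum.group[symmetric])
    show "reduce m n ` ?X l \<subseteq> ?X n" unfolding X[symmetric] by blast
  qed simp_all
  also have "\<dots> = (\<Sum>e\<in>?X n. qq ^ ((l - n) * m))" using card_fib by (intro sum.cong refl) simp
  also have "\<dots> = N n * qq ^ ((l - n) * m)" by (simp add: N)
  finally show ?thesis .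
qed

lemma counted_vol:
  assumes c: "counted m P N" and v: "has_vol m P \<phi>"
  shows "\<phi> (case_nat (int n) z) = real (N n) / real qq ^ (n * m)"
proof -
  have q: "real qq > 0" using qq_real by simp
  have "vol m l P (case_nat (int n) z) = real (N n) / real qq ^ (n * m)" if "n \<le> l" for l
  proof -
    have "l * m = (l - n) * m + n * m" using that by (simp flip: add_mult_distrib)
    then show ?thesis using q by (simp add: vol_def counted_cnt[OF c that] power_add)
  qed
  then have "(\<lambda>l. vol m l P (case_nat (int n) z)) \<longlonglongrightarrow> real (N n) / real qq ^ (n * m)"
    by (intro tendsto_eventually) (auto simp: eventually_sequentially)
  moreover have "(\<lambda>l. vol m l P (case_nat (int n) z)) \<longlonglongrightarrow> \<phi> (case_nat (int n) z)"
    using v by (simp add: has_vol_def)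
  ultimately show ?thesis by (rule LIMSEQ_unique[symmetric])
qed

lemma counted_rational:
  assumes c: "counted m P N" and v: "has_vol m P \<phi>"
  shows "rational (Abs_fps (\<lambda>n. of_nat (N n) / of_nat qq ^ (n * m)))"
    and "rational (Abs_fps (\<lambda>n. of_nat (N n) / of_nat qq ^ (n * (m + 1))))"
proof -
  note phi = counted_vol[OF c v]
  have CC: "\<phi> \<in> CC" using v by (simp add: has_vol_def)
  let ?z = "\<lambda>_ :: nat. 0 :: int"
  have "complex_of_real (\<phi> (case_nat (int n) ?z)) = of_nat (N n) / of_nat qq ^ (n * m)" for n
    by (simp add: phi)
  then show "rational (Abs_fps (\<lambda>n. of_nat (N n) / of_nat qq ^ (n * m)))"
    using CC_rational[OF CC, of ?z] by simp
  \<comment> \<open>The Serre-Poincare normalization has one additional factor \<open>1 / qq\<close>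
    for each unit of n, an exponential in variable 0.\<close>
  define F where "F z = \<phi> z * (1 / real qq) powi (z 0)" for z
  have "F \<in> CC" unfolding F_def using qq_real by (intro CC_mult CC CC_exp TT_var) auto
  moreover have "complex_of_real (F (case_nat (int n) ?z)) = of_nat (N n) / of_nat qq ^ (n * (m + 1))" for n
    using qq_real by (simp add: F_def phi power_add power_divide)
  ultimately show "rational (Abs_fps (\<lambda>n. of_nat (N n) / of_nat qq ^ (n * (m + 1))))"
    using CC_rational[of F ?z] by simp
qed

definition tilde_pred :: "nat \<Rightarrow> 'k mpoly list \<Rightarrow> (nat \<Rightarrow> 'k) \<Rightarrow> (nat \<Rightarrow> int) \<Rightarrow> bool" where
  "tilde_pred m fs x z \<longleftrightarrow> (\<forall>i<m. x i \<in> B 0) \<and> (\<forall>f\<in>set fs. mpeval f x \<in> B (z 0))"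

text \<open>A neighbourhood of the zero set instead of the zero set itself: it meets the same
  residue classes modulo the n-th power, but it is invariant under congruence, as
  \<open>counted\<close> demands.\<close>

definition lift_pred :: "nat \<Rightarrow> 'k mpoly list \<Rightarrow> (nat \<Rightarrow> 'k) \<Rightarrow> (nat \<Rightarrow> int) \<Rightarrow> bool" where
  "lift_pred m fs x z \<longleftrightarrow> (\<forall>i<m. x i \<in> B 0) \<and>
     (\<exists>y. (\<forall>i<m. y i \<in> B 0 \<and> x i - y i \<in> B (z 0)) \<and> (\<forall>f\<in>set fs. mpeval f y = 0))"

lemma mpeval_diff:
  assumes f: "integral_poly v m f" and x: "\<And>i. i < m \<Longrightarrow> x i \<in> B 0" and y: "\<And>i. i < m \<Longrightarrow> y i \<in> B 0"
    and xy: "\<And>i. i < m \<Longrightarrow> x i - y i \<in> B (int n)"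
  shows "mpeval f x - mpeval f y \<in> B (int n)"
proof -
  define c where "c a b \<longleftrightarrow> a \<in> B 0 \<and> b \<in> B 0 \<and> a - b \<in> B (int n)" for a b
  have mult: "c (a * a') (b * b')" if "c a b" "c a' b'" for a b a' b'
  proof -
    have "a * a' - b * b' = a * (a' - b') + (a - b) * b'" by (simp add: algebra_simps)
    moreover have "a * (a' - b') \<in> B (int n)" "(a - b) * b' \<in> B (int n)" "a * a' \<in> B 0" "b * b' \<in> B 0"
      using that B_mult[of a 0 "a' - b'" "int n"] B_mult[of "a - b" "int n" b' 0] B_mult[of a 0 a' 0] B_mult[of b 0 b' 0]
      by (simp_all add: c_def)
    ultimately show ?thesis by (simp add: c_def B_add)
  qed
  have one: "c 1 1" by (simp add: c_def)
  have power: "c (a ^ k) (b ^ k)" if "c a b" for a b k using that by (induction k) (auto intro: mult one)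
  have prod: "c (prod g A) (prod h A)" if "\<And>i. i \<in> A \<Longrightarrow> c (g i) (h i)" for A and g h :: "nat \<Rightarrow> 'k"
    using that by (induction A rule: infinite_finite_induct) (auto intro: mult one)
  have "c (x i) (y i)" if "\<alpha> \<in> Poly_Mapping.keys f" "i \<in> Poly_Mapping.keys \<alpha>" for \<alpha> i
  proof -
    have "i < m" using f that unfolding integral_poly_def by blast
    then show ?thesis using x y xy by (simp add: c_def)
  qed
  moreover have "c (Poly_Mapping.lookup f \<alpha>) (Poly_Mapping.lookup f \<alpha>)" for \<alpha>
    using f by (simp add: integral_poly_def val_ring_def c_def)
  ultimately have "c (Poly_Mapping.lookup f \<alpha> * (\<Prod>i\<in>Poly_Mapping.keys \<alpha>. x i ^ Poly_Mapping.lookup \<alpha> i))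
      (Poly_Mapping.lookup f \<alpha> * (\<Prod>i\<in>Poly_Mapping.keys \<alpha>. y i ^ Poly_Mapping.lookup \<alpha> i))"
    if "\<alpha> \<in> Poly_Mapping.keys f" for \<alpha>
    using that by (intro mult prod power) auto
  then show ?thesis
    unfolding mpeval_def sum_subtractf[symmetric] by (intro B_sum) (simp add: c_def)
qed

lemma cls_eq:
  assumes "\<And>x. P x z \<Longrightarrow> \<exists>y\<in>X. reduce m n x = reduce m n y" "\<And>y. y \<in> X \<Longrightarrow> P y z"
  shows "cls m n P z = card (reduce m n ` X)"
proof -
  have "reduce m n ` {x. P x z} = reduce m n ` X"
  proof (intro equalityI subsetI)
    fix w assume "w \<in> reduce m n ` {x. P x z}"
    then obtain x where x: "P x z" "w = reduce m n x" by blast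
    then obtain y where "y \<in> X" "reduce m n x = reduce m n y" using assms(1) by blast
    then show "w \<in> reduce m n ` X" using x(2) by simp
  qed (use assms(2) in blast)
  then show ?thesis by (simp only: cls_def)
qed

lemma int_points_restrict: "(\<And>i. i < m \<Longrightarrow> x i \<in> B 0) \<Longrightarrow> restrict x {..<m} \<in> int_points v m"
  by (auto simp: int_points_def val_ring_def)

lemma tilde_counted:
  assumes fs: "\<And>f. f \<in> set fs \<Longrightarrow> integral_poly v m f"
  shows "counted m (tilde_pred m fs) (Ntilde v m fs)"
  unfolding counted_def
proof (intro conjI allI impI)
  show "x i \<in> B 0" if "tilde_pred m fs x z" "i < m" for x z i using that by (simp add: tilde_pred_def)
next
  fix n z
  let ?X = "{x \<in> int_points v m. \<forall>f\<in>set fs. mpeval f x \<in> val_ball v (int n)}"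
  have keys: "Poly_Mapping.keys \<alpha> \<subseteq> {..<m}" if "f \<in> set fs" "\<alpha> \<in> Poly_Mapping.keys f" for f \<alpha>
    using fs[OF that(1)] that(2) by (simp add: integral_poly_def)
  have "cls m n (tilde_pred m fs) (case_nat (int n) z) = card (reduce m n ` ?X)"
  proof (rule cls_eq)
    fix x assume x: "tilde_pred m fs x (case_nat (int n) z)"
    have "mpeval f (restrict x {..<m}) = mpeval f x" if "f \<in> set fs" for f
      by (rule mpeval_cong[OF keys[OF that]]) auto
    then have "restrict x {..<m} \<in> ?X" using x int_points_restrict[of m x] by (simp add: tilde_pred_def)
    then show "\<exists>y\<in>?X. reduce m n x = reduce m n y" by (rule rev_bexI) (auto simp: fun_eq_iff)
  next
    fix y assume "y \<in> ?X"
    then have "\<forall>i<m. y i \<in> B 0" by (auto simp: int_points_def val_ring_def)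
    then show "tilde_pred m fs y (case_nat (int n) z)" using \<open>y \<in> ?X\<close> by (simp add: tilde_pred_def)
  qed
  moreover have "card (?X // cong_rel v m n) = card (reduce m n ` ?X)" by (rule card_quotient_cong) blast
  ultimately show "Ntilde v m fs n = cls m n (tilde_pred m fs) (case_nat (int n) z)" by (simp add: Ntilde_def)
next
  fix n x y z
  assume x: "tilde_pred m fs x (case_nat (int n) z)" and y: "\<forall>i<m. y i \<in> B 0 \<and> x i - y i \<in> B (int n)"
  have "mpeval f y \<in> B (int n)" if "f \<in> set fs" for f
  proof -
    have "mpeval f x - mpeval f y \<in> B (int n)"
      by (rule mpeval_diff[OF fs[OF that]]) (use x y in \<open>auto simp: tilde_pred_def\<close>)
    moreover have "mpeval f x \<in> B (int n)" using x that by (simp add: tilde_pred_def)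
    ultimately show ?thesis using B_eq_iff by blast
  qed
  then show "tilde_pred m fs y (case_nat (int n) z)" using y by (simp add: tilde_pred_def)
qed

lemma lift_counted:
  assumes fs: "\<And>f. f \<in> set fs \<Longrightarrow> integral_poly v m f"
  shows "counted m (lift_pred m fs) (Nlift v m fs)"
  unfolding counted_def
proof (intro conjI allI impI)
  show "x i \<in> B 0" if "lift_pred m fs x z" "i < m" for x z i using that by (simp add: lift_pred_def)
next
  fix n z
  let ?X = "{x \<in> int_points v m. \<forall>f\<in>set fs. mpeval f x = 0}"
  have keys: "Poly_Mapping.keys \<alpha> \<subseteq> {..<m}" if "f \<in> set fs" "\<alpha> \<in> Poly_Mapping.keys f" for f \<alpha>
    using fs[OF that(1)] that(2) by (simp add: integral_poly_def)
  have "cls m n (lift_pred m fs) (case_nat (int n) z) = card (reduce m n ` ?X)"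
  proof (rule cls_eq)
    fix x assume x: "lift_pred m fs x (case_nat (int n) z)"
    then obtain y where y: "\<And>i. i < m \<Longrightarrow> y i \<in> B 0" "\<And>i. i < m \<Longrightarrow> x i - y i \<in> B (int n)"
      "\<And>f. f \<in> set fs \<Longrightarrow> mpeval f y = 0" by (auto simp: lift_pred_def)
    have "mpeval f (restrict y {..<m}) = mpeval f y" if "f \<in> set fs" for f
      by (rule mpeval_cong[OF keys[OF that]]) auto
    then have "restrict y {..<m} \<in> ?X" using y int_points_restrict[of m y] by simp
    moreover have "reduce m n x = reduce m n (restrict y {..<m})"
      using x y by (subst reduce_eq_iff) (auto simp: lift_pred_def)
    ultimately show "\<exists>y\<in>?X. reduce m n x = reduce m n y" by blast
  next
    fix y assume y: "y \<in> ?X"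
    then have "y i \<in> B 0" if "i < m" for i using that by (auto simp: int_points_def val_ring_def PiE_iff)
    then show "lift_pred m fs y (case_nat (int n) z)"
      unfolding lift_pred_def using y by (intro conjI allI impI exI[of _ y]) auto
  qed
  moreover have "card (?X // cong_rel v m n) = card (reduce m n ` ?X)" by (rule card_quotient_cong) blast
  ultimately show "Nlift v m fs n = cls m n (lift_pred m fs) (case_nat (int n) z)" by (simp add: Nlift_def)
next
  fix n x y z
  assume x: "lift_pred m fs x (case_nat (int n) z)" and y: "\<forall>i<m. y i \<in> B 0 \<and> x i - y i \<in> B (int n)"
  obtain w where w: "\<And>i. i < m \<Longrightarrow> w i \<in> B 0" "\<And>i. i < m \<Longrightarrow> x i - w i \<in> B (int n)"
      "\<And>f. f \<in> set fs \<Longrightarrow> mpeval f w = 0" using x by (auto simp: lift_pred_def)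
  have "y i - w i \<in> B (int n)" if "i < m" for i
    using y w(2)[OF that] that B_trans[of "y i" "x i" "int n" "w i"] B_minus_commute by blast
  then show "lift_pred m fs y (case_nat (int n) z)" unfolding lift_pred_def using w y by (intro conjI exI[of _ w]) auto
qed

end

context chain
begin

lemma chain_projects:
  "P \<in> DD (m + k) \<Longrightarrow> (\<lambda>x z. \<exists>y. P (\<lambda>i. if i < m then x i else y i) z) \<in> DD m"
proof (induction k arbitrary: P)
  case 0
  have "P (\<lambda>i. if i < m then x i else y i) z = P x z" for x y z
    by (rule lv.indep[of P m]) (use 0 in auto)
  then show ?case using 0 by simp
next
  case (Suc k)
  have "(\<lambda>x z. \<exists>t. P (x(m + k := t)) z) \<in> DD (m + k)" using chain_project[of P "m + k"] Suc.prems by simp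
  from Suc.IH[OF this]
  have "(\<lambda>x z. \<exists>y t. P ((\<lambda>i. if i < m then x i else y i)(m + k := t)) z) \<in> DD m" .
  moreover have "(\<exists>y t. P ((\<lambda>i. if i < m then x i else y i)(m + k := t)) z) \<longleftrightarrow>
     (\<exists>y. P (\<lambda>i. if i < m then x i else y i) z)" for x z
  proof -
    have 1: "(\<lambda>i. if i < m then x i else y i)(m + k := t) = (\<lambda>i. if i < m then x i else (y(m + k := t)) i)" for y t
      by (auto simp: fun_eq_iff)
    show ?thesis unfolding 1
    proof
      assume "\<exists>y. P (\<lambda>i. if i < m then x i else y i) z"
      then obtain y where "P (\<lambda>i. if i < m then x i else y i) z" by blast
      then show "\<exists>y t. P (\<lambda>i. if i < m then x i else (y(m + k := t)) i) z"
        by (intro exI[of _ y] exI[of _ "y (m + k)"]) (simp only: fun_upd_triv)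
    qed blast
  qed
  ultimately show ?case by simp
qed

lemma RR_mpeval:
  assumes keys: "\<And>\<alpha>. \<alpha> \<in> Poly_Mapping.keys p \<Longrightarrow> Poly_Mapping.keys \<alpha> \<subseteq> {..<n}"
    and g: "\<And>i. i < n \<Longrightarrow> (\<lambda>x. g x i) \<in> RR m"
  shows "(\<lambda>x. mpeval p (g x)) \<in> RR m"
proof -
  have prod: "(\<lambda>x. \<Prod>i\<in>A. f i x) \<in> RR m" if "\<And>i. i \<in> A \<Longrightarrow> (\<lambda>x. f i x) \<in> RR m" for A and f :: "nat \<Rightarrow> (nat \<Rightarrow> 'k) \<Rightarrow> 'k"
    using that by (induction A rule: infinite_finite_induct) (auto intro: lv.R_const lv.R_mult)
  have "(\<lambda>x. g x i) \<in> RR m" if "\<alpha> \<in> Poly_Mapping.keys p" "i \<in> Poly_Mapping.keys \<alpha>" for \<alpha> i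
    using keys[OF that(1)] that(2) g by blast
  then have "(\<lambda>x. \<Sum>\<alpha>\<in>Poly_Mapping.keys p. Poly_Mapping.lookup p \<alpha> *
      (\<Prod>i\<in>Poly_Mapping.keys \<alpha>. g x i ^ Poly_Mapping.lookup \<alpha> i)) \<in> RR m"
    by (intro lv.R_sum lv.R_mult lv.R_const prod lv.R_power)
  then show ?thesis by (simp add: mpeval_def[abs_def])
qed

lemma D_all_less:
  fixes n :: nat
  assumes "\<And>i. i < n \<Longrightarrow> (\<lambda>x z. Q i x z) \<in> DD m"
  shows "(\<lambda>x z. \<forall>i<n. Q i x z) \<in> DD m"
proof -
  have "(\<lambda>x z. \<forall>i\<in>{..<n}. Q i x z) \<in> DD m"
    by (rule lv.D_ball[OF finite_lessThan]) (use assms in simp)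
  then show ?thesis by (simp add: Ball_def)
qed

lemma tilde_definable:
  assumes "\<And>f. f \<in> set fs \<Longrightarrow> integral_poly v m f"
  shows "tilde_pred m fs \<in> DD m"
proof -
  have "(\<lambda>x z. (\<forall>i<m. x i \<in> B 0) \<and> (\<forall>f\<in>set fs. mpeval f x \<in> B (z 0))) \<in> DD m"
    using assms unfolding integral_poly_def
    by (intro lv.D_conj D_all_less lv.D_ball lv.D_fn_B lv.R_def RR_var RR_mpeval[where n = m] lv.tm_intros) auto
  then show ?thesis by (simp add: tilde_pred_def[abs_def])
qed

text \<open>The exact solution is stored in the coordinates m to 2m - 1, where all conditions are
  polynomial, and these coordinates are then projected away.\<close>

lemma lift_definable:
  assumes "\<And>f. f \<in> set fs \<Longrightarrow> integral_poly v m f"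
  shows "lift_pred m fs \<in> DD m"
proof -
  let ?P = "\<lambda>x z. (\<forall>i<m. x i \<in> B 0) \<and> (\<forall>i<m. x (m + i) \<in> B 0 \<and> x i - x (m + i) \<in> B (z 0)) \<and>
    (\<forall>f\<in>set fs. mpeval f (\<lambda>i. x (m + i)) = 0)"
  have "?P \<in> DD (m + m)"
    using assms unfolding integral_poly_def
    by (intro lv.D_conj D_all_less lv.D_ball lv.D_fn_B lv.D_fn_zero lv.R_def lv.R_diff RR_var RR_mpeval[where n = m] lv.tm_intros) auto
  from chain_projects[OF this]
  have "(\<lambda>x z. \<exists>y. ?P (\<lambda>i. if i < m then x i else y i) z) \<in> DD m" .
  moreover have "(\<exists>y. ?P (\<lambda>i. if i < m then x i else y i) z) \<longleftrightarrow> lift_pred m fs x z" for x z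
  proof
    assume "\<exists>y. ?P (\<lambda>i. if i < m then x i else y i) z"
    then obtain y where y: "?P (\<lambda>i. if i < m then x i else y i) z" by blast
    show "lift_pred m fs x z"
      unfolding lift_pred_def by (intro conjI exI[of _ "\<lambda>i. y (m + i)"]) (use y in auto)
  next
    assume "lift_pred m fs x z"
    then obtain y where y: "\<forall>i<m. x i \<in> B 0" "\<forall>i<m. y i \<in> B 0 \<and> x i - y i \<in> B (z 0)" "\<forall>f\<in>set fs. mpeval f y = 0"
      by (auto simp: lift_pred_def)
    show "\<exists>y. ?P (\<lambda>i. if i < m then x i else y i) z"
      by (rule exI[of _ "\<lambda>i. y (i - m)"]) (use y in simp)
  qed
  ultimately show ?thesis by simp
qed

end

section \<open>Comparison under a field extension\<close>

text \<open>The condition on coordinate i involves only the earlier coordinates, so the coordinates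
  can be chosen one after the other with at most \<open>b i\<close> possibilities each.\<close>

lemma card_dependent_product:
  fixes ok :: "nat \<Rightarrow> (nat \<Rightarrow> 'a) \<Rightarrow> 'a \<Rightarrow> bool"
  assumes T: "finite T" and dep: "\<And>i x y t. i < m \<Longrightarrow> (\<And>j. j < i \<Longrightarrow> x j = y j) \<Longrightarrow> ok i x t = ok i y t"
    and b: "\<And>i x. i < m \<Longrightarrow> card {t \<in> T. ok i x t} \<le> b i"
  shows "card {x \<in> PiE {..<m} (\<lambda>_. T). \<forall>i<m. ok i x (x i)} \<le> (\<Prod>i<m. b i)"
  using dep b
proof (induction m)
  case 0
  then show ?case by simp
next
  case (Suc m)
  let ?W = "\<lambda>m. {x \<in> PiE {..<m :: nat} (\<lambda>_. T). \<forall>i<m. ok i x (x i)}"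
  let ?S = "SIGMA w:?W m. {t \<in> T. ok m w t}"
  have finW: "finite (?W m)" using T by (intro finite_subset[OF _ finite_PiE[of "{..<m}" "\<lambda>_. T"]]) auto
  have "inj_on (\<lambda>x. (restrict x {..<m}, x m)) (?W (Suc m))"
  proof (rule inj_onI)
    fix x y assume x: "x \<in> ?W (Suc m)" "y \<in> ?W (Suc m)" "(restrict x {..<m}, x m) = (restrict y {..<m}, y m)"
    have r: "restrict x {..<m} = restrict y {..<m}" and m: "x m = y m" using x(3) by auto
    have "x i = y i" if "i < Suc m" for i
      using fun_cong[OF r, of i] m that by (cases "i = m") auto
    then show "x = y" using x(1,2) by (intro PiE_ext[of x "{..<Suc m}" "\<lambda>_. T" y]) auto
  qed
  moreover have "(\<lambda>x. (restrict x {..<m}, x m)) ` ?W (Suc m) \<subseteq> ?S"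
  proof
    fix p assume "p \<in> (\<lambda>x. (restrict x {..<m}, x m)) ` ?W (Suc m)"
    then obtain x where p: "p = (restrict x {..<m}, x m)" and x: "x \<in> ?W (Suc m)" by blast
    have ok: "ok i x t = ok i (restrict x {..<m}) t" if "i < Suc m" for i t
      by (rule Suc.prems(1)[OF that]) (use that in auto)
    have T: "restrict x {..<m} \<in> PiE {..<m} (\<lambda>_. T)" "x m \<in> T" using x by auto
    have ok1: "ok i (restrict x {..<m}) (restrict x {..<m} i)" if "i < m" for i
      using x ok[of i "x i"] that by simp
    have ok2: "ok m (restrict x {..<m}) (x m)" using x ok[of m "x m"] by simp
    have "restrict x {..<m} \<in> ?W m" using T(1) ok1 by blast
    moreover have "x m \<in> {t \<in> T. ok m (restrict x {..<m}) t}" using T(2) ok2 by blast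
    ultimately show "p \<in> ?S" unfolding p mem_Sigma_iff by (rule conjI)
  qed
  moreover have "finite ?S" using finW T by auto
  ultimately have "card (?W (Suc m)) \<le> card ?S" by (rule card_inj_on_le)
  also have "\<dots> = (\<Sum>w\<in>?W m. card {t \<in> T. ok m w t})" using finW T by (simp add: card_SigmaI)
  also have "\<dots> \<le> (\<Sum>w\<in>?W m. b m)" by (intro sum_mono Suc.prems(2)) simp
  also have "\<dots> = card (?W m) * b m" by simp
  also have "\<dots> \<le> (\<Prod>i<m. b i) * b m"
  proof (rule mult_right_mono)
    show "card (?W m) \<le> (\<Prod>i<m. b i)"
    proof (rule Suc.IH)
      show "ok i x t = ok i y t" if "i < m" "\<And>j. j < i \<Longrightarrow> x j = y j" for i x y t
        by (rule Suc.prems(1)) (use that in simp_all)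
      show "card {t \<in> T. ok i x t} \<le> b i" if "i < m" for i x
        by (rule Suc.prems(2)) (use that in simp)
    qed
  qed simp
  finally show ?case by simp
qed

locale extension = K: local_field vK + L: local_field vL
  for vK :: "'k::field_char_0 \<Rightarrow> int" and vL :: "'l::field_char_0 \<Rightarrow> int" +
  fixes \<iota> :: "'k \<Rightarrow> 'l" and e :: nat
  assumes \<iota>_add: "\<iota> (x + y) = \<iota> x + \<iota> y" and \<iota>_mult: "\<iota> (x * y) = \<iota> x * \<iota> y" and \<iota>_one: "\<iota> 1 = 1"
    and e_pos: "0 < e" and \<iota>_val: "x \<noteq> 0 \<Longrightarrow> vL (\<iota> x) = int e * vK x"
begin

lemma \<iota>_zero: "\<iota> 0 = 0" using \<iota>_add[of 0 0] by simp

lemma \<iota>_diff: "\<iota> (x - y) = \<iota> x - \<iota> y" using \<iota>_add[of "x - y" y] by simp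

lemma \<iota>_eq_0_iff: "\<iota> x = 0 \<longleftrightarrow> x = 0"
proof
  show "x = 0" if "\<iota> x = 0" using \<iota>_mult[of x "inverse x"] \<iota>_one that by (cases "x = 0") auto
qed (simp add: \<iota>_zero)

lemma \<iota>_sum: "\<iota> (sum f A) = (\<Sum>i\<in>A. \<iota> (f i))"
  by (induction A rule: infinite_finite_induct) (simp_all add: \<iota>_zero \<iota>_add)

lemma \<iota>_prod: "\<iota> (prod f A) = (\<Prod>i\<in>A. \<iota> (f i))"
  by (induction A rule: infinite_finite_induct) (simp_all add: \<iota>_one \<iota>_mult)

lemma \<iota>_power: "\<iota> (x ^ n) = \<iota> x ^ n"
  by (induction n) (simp_all add: \<iota>_one \<iota>_mult)

lemma \<iota>_ball: "x \<in> K.B z \<Longrightarrow> \<iota> x \<in> L.B (int e * z)"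
  using e_pos by (cases "x = 0") (auto simp: K.B_iff L.B_iff \<iota>_val \<iota>_zero \<iota>_eq_0_iff)

lemma \<iota>_ball_0: "x \<in> K.B 0 \<Longrightarrow> \<iota> x \<in> L.B 0"
  using \<iota>_ball[of x 0] by simp

text \<open>Elements of K have valuations divisible by e in L, so a ball of L traces a ball of K
  with radius divided by e. Rounding down is precise enough, at the price paid in
  \<open>qq_power_le\<close>.\<close>

lemma \<iota>_ball_div:
  assumes "\<iota> x \<in> L.B (int j)" shows "x \<in> K.B (int (j div e))"
proof (cases "x = 0")
  case False
  then have "int j \<le> int e * vK x" using assms by (simp add: L.B_iff \<iota>_eq_0_iff \<iota>_val)
  moreover have "int e * int (j div e) \<le> int j" by (metis of_nat_le_iff of_nat_mult times_div_less_eq_dividend)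
  ultimately have "int e * int (j div e) \<le> int e * vK x" by linarith
  then show ?thesis using False e_pos by (simp add: K.B_iff)
qed simp

lemma lookup_base_change: "Poly_Mapping.lookup (base_change \<iota> f) \<alpha> = \<iota> (Poly_Mapping.lookup f \<alpha>)"
  by (simp add: base_change_def map.rep_eq when_def \<iota>_zero)

lemma keys_base_change: "Poly_Mapping.keys (base_change \<iota> f) = Poly_Mapping.keys f"
  by (auto simp: in_keys_iff lookup_base_change \<iota>_eq_0_iff)

lemma mpeval_base_change: "mpeval (base_change \<iota> f) (\<lambda>i. \<iota> (x i)) = \<iota> (mpeval f x)"
  unfolding mpeval_def by (simp add: keys_base_change lookup_base_change \<iota>_sum \<iota>_mult \<iota>_prod \<iota>_power)

lemma integral_base_change: "integral_poly vK m f \<Longrightarrow> integral_poly vL m (base_change \<iota> f)"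
  by (auto simp: integral_poly_def keys_base_change lookup_base_change val_ring_def \<iota>_ball_0)

text \<open>Equal to 1 / (e f) for the residue degree f, as \<open>L.qq\<close> is the f-th power of
  \<open>K.qq\<close>. It enters the estimates through \<open>powr_H\<close>.\<close>

definition H :: real where "H = ln (real K.qq) / (real e * ln (real L.qq))"

lemma H_pos: "0 < H"
  using K.qq_real L.qq_real e_pos by (simp add: H_def)

lemma powr_H: "real L.qq powr (a * H) = real K.qq powr (a / real e)"
  using K.qq_real L.qq_real e_pos by (simp add: powr_def H_def)

text \<open>Grid points over K near one centre are near each other, hence lie in a common ball of K,
  although the centre itself lives in L.\<close>

lemma fiber_bound:
  assumes "finite C" "j \<le> e * n"
  shows "card {t \<in> K.E n. \<exists>c\<in>C. \<iota> t - c \<in> L.B (int j)} \<le> card C * K.qq ^ (n - j div e)"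
proof -
  have jn: "j div e \<le> n" using assms(2) e_pos by (metis div_le_mono nonzero_mult_div_cancel_left not_gr_zero)
  have "card {t \<in> K.E n. \<iota> t - c \<in> L.B (int j)} \<le> K.qq ^ (n - j div e)" for c
  proof (cases "{t \<in> K.E n. \<iota> t - c \<in> L.B (int j)} = {}")
    case False
    then obtain t0 where t0: "\<iota> t0 - c \<in> L.B (int j)" by blast
    have "t - t0 \<in> K.B (int (j div e))" if "\<iota> t - c \<in> L.B (int j)" for t
      using L.B_diff[OF that t0] by (intro \<iota>_ball_div) (simp add: \<iota>_diff)
    then have "card {t \<in> K.E n. \<iota> t - c \<in> L.B (int j)} \<le> card {t \<in> K.E n. t - t0 \<in> K.B (int (j div e))}"
      by (intro card_mono) auto
    also have "\<dots> \<le> K.qq ^ (n - j div e)" by (rule K.card_E_ball_le[OF jn])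
    finally show ?thesis .
  qed (simp only: card.empty)
  then have "(\<Sum>c\<in>C. card {t \<in> K.E n. \<iota> t - c \<in> L.B (int j)}) \<le> (\<Sum>c\<in>C. K.qq ^ (n - j div e))" by (intro sum_mono)
  moreover have "card (\<Union>c\<in>C. {t \<in> K.E n. \<iota> t - c \<in> L.B (int j)}) \<le> (\<Sum>c\<in>C. card {t \<in> K.E n. \<iota> t - c \<in> L.B (int j)})"
    by (rule card_UN_le[OF assms(1)])
  moreover have "{t \<in> K.E n. \<exists>c\<in>C. \<iota> t - c \<in> L.B (int j)} = (\<Union>c\<in>C. {t \<in> K.E n. \<iota> t - c \<in> L.B (int j)})" by blast
  ultimately show ?thesis by simp
qed

text \<open>The factor \<open>K.qq\<close> pays for rounding j / e down.\<close>

lemma qq_power_le: "j \<le> e * n \<Longrightarrow> real K.qq ^ (n - j div e) \<le> real K.qq * (real L.qq ^ (e * n - j)) powr H"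
proof -
  assume j: "j \<le> e * n"
  have jn: "j div e \<le> n" using j e_pos by (metis div_le_mono nonzero_mult_div_cancel_left not_gr_zero)
  have "j \<le> e * (j div e) + e" using e_pos by (metis add.commute add_le_cancel_left div_mult_mod_eq less_imp_le mod_less_divisor mult.commute)
  then have "real j \<le> real e * real (j div e) + real e" by (metis of_nat_add of_nat_le_iff of_nat_mult)
  then have "real n - real (j div e) \<le> 1 + (real e * real n - real j) / real e"
    using e_pos by (simp add: field_simps)
  then have le: "real (n - j div e) \<le> 1 + real (e * n - j) / real e" using j jn by (simp add: of_nat_diff)
  have "real K.qq ^ (n - j div e) = real K.qq powr real (n - j div e)"
    using K.qq_real by (simp add: powr_realpow)
  also have "\<dots> \<le> real K.qq powr (1 + real (e * n - j) / real e)" using K.qq_real le by (intro powr_mono) auto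
  also have "\<dots> = real K.qq * real L.qq powr (real (e * n - j) * H)"
    using K.qq_real by (simp add: powr_add powr_H)
  also have "real L.qq powr (real (e * n - j) * H) = (real L.qq ^ (e * n - j)) powr H"
    using L.qq_real by (simp add: powr_powr flip: powr_realpow)
  finally show ?thesis .
qed

text \<open>The distances to the centres form a profile with at most \<open>e * n + 1\<close> values
  in each coordinate. Points with a common profile are counted coordinate by coordinate, and the
  product is bounded by a constant times the H-th power of the polydisc size at any one of them,
  which \<open>low_bound\<close> controls.\<close>

lemma comparison:
  assumes low: "L.low_bound m P \<kappa> G"
    and X: "X \<subseteq> PiE {..<m} (\<lambda>_. K.E n)" "\<And>x. x \<in> X \<Longrightarrow> P (\<lambda>i. \<iota> (x i)) z"
  shows "real (card X) \<le> (real (e * n) + 1) ^ m * ((\<Prod>i<m. real (card (G i))) * real K.qq ^ m) *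
     (\<kappa> * real (L.cls m (e * n) P z)) powr H"
proof -
  let ?l = "e * n" and ?I = "\<lambda>x i. \<iota> (x i)"
  let ?bound = "((\<Prod>i<m. real (card (G i))) * real K.qq ^ m) * (\<kappa> * real (L.cls m ?l P z)) powr H"
  have cf: "finite (G i)" "(\<lambda>x. 0) \<in> G i" "\<And>c x y. c \<in> G i \<Longrightarrow> (\<And>j. j < i \<Longrightarrow> x j = y j) \<Longrightarrow> c x = c y" if "i < m" for i
    using low that unfolding L.low_bound_def L.center_family_def by blast+
  have \<kappa>: "0 < \<kappa>" using low by (simp add: L.low_bound_def)
  have finX: "finite X" using X(1) by (rule finite_subset) simp
  define prof where "prof x = restrict (\<lambda>i. L.rho ?l (G i) (?I x) (\<iota> (x i))) {..<m}" for x
  have xB: "\<iota> (x i) \<in> L.B 0" if "x \<in> X" "i < m" for x i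
  proof -
    have "x i \<in> K.E n" using X(1) that by auto
    then show ?thesis using K.E_sub by (intro \<iota>_ball_0) blast
  qed
  have rho: "L.rho ?l (G i) (?I x) (\<iota> (x i)) \<le> ?l"
    "\<exists>c\<in>G i. \<iota> (x i) - c (?I x) \<in> L.B (int (L.rho ?l (G i) (?I x) (\<iota> (x i))))" if "x \<in> X" "i < m" for x i
    using L.rho_mem[OF cf(2)[OF that(2)] xB[OF that]] .
  have prof_in: "prof ` X \<subseteq> PiE {..<m} (\<lambda>_. {..?l})" using rho(1) unfolding prof_def by (intro image_subsetI restrict_PiE_iff[THEN iffD2]) simp
  have each: "real (card {x \<in> X. prof x = j}) \<le> ?bound" if j: "j \<in> PiE {..<m} (\<lambda>_. {..?l})" for j
  proof (cases "{x \<in> X. prof x = j} = {}")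
    case True
    then show ?thesis by (simp only: card.empty) (simp add: prod_nonneg)
  next
    case False
    then obtain x0 where x0: "x0 \<in> X" "prof x0 = j" by blast
    have jl: "j i \<le> ?l" if "i < m" for i using j that by auto
    define ok where "ok i x t \<longleftrightarrow> (\<exists>c\<in>G i. \<iota> t - c (?I x) \<in> L.B (int (j i)))" for i x t
    have "{x \<in> X. prof x = j} \<subseteq> {x \<in> PiE {..<m} (\<lambda>_. K.E n). \<forall>i<m. ok i x (x i)}"
    proof
      fix x assume x: "x \<in> {x \<in> X. prof x = j}"
      have "ok i x (x i)" if "i < m" for i
      proof -
        have "j i = L.rho ?l (G i) (?I x) (\<iota> (x i))" using x that by (auto simp: prof_def)
        then show ?thesis using rho(2)[of x i] x that by (simp add: ok_def)
      qed
      then show "x \<in> {x \<in> PiE {..<m} (\<lambda>_. K.E n). \<forall>i<m. ok i x (x i)}" using x X(1) by blast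
    qed
    then have "card {x \<in> X. prof x = j} \<le> card {x \<in> PiE {..<m} (\<lambda>_. K.E n). \<forall>i<m. ok i x (x i)}"
      by (rule card_mono[rotated]) simp
    also have "\<dots> \<le> (\<Prod>i<m. card (G i) * K.qq ^ (n - j i div e))"
    proof (rule card_dependent_product)
      fix i x assume i: "i < m"
      show "card {t \<in> K.E n. ok i x t} \<le> card (G i) * K.qq ^ (n - j i div e)"
      proof -
        have "card {t \<in> K.E n. \<exists>c\<in>(\<lambda>c. c (?I x)) ` G i. \<iota> t - c \<in> L.B (int (j i))} \<le>
          card ((\<lambda>c. c (?I x)) ` G i) * K.qq ^ (n - j i div e)"
          by (rule fiber_bound) (use cf(1)[OF i] jl[OF i] in auto)
        also have "\<dots> \<le> card (G i) * K.qq ^ (n - j i div e)"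
          by (intro mult_right_mono card_image_le cf(1) i) simp
        finally show ?thesis by (simp add: ok_def)
      qed
    next
      fix i t and x y :: "nat \<Rightarrow> 'k"
      assume i: "i < m" and xy: "\<And>j. j < i \<Longrightarrow> x j = y j"
      have "\<iota> t - c (?I x) = \<iota> t - c (?I y)" if "c \<in> G i" for c
        by (rule arg_cong[of _ _ "\<lambda>u. \<iota> t - u"], rule cf(3)[OF i that]) (simp add: xy)
      then show "ok i x t = ok i y t" unfolding ok_def by (intro bex_cong refl arg_cong[of _ _ "\<lambda>u. u \<in> L.B (int (j i))"])
    qed simp
    finally have "real (card {x \<in> X. prof x = j}) \<le> real (\<Prod>i<m. card (G i) * K.qq ^ (n - j i div e))" by (rule of_nat_mono)
    also have "\<dots> = (\<Prod>i<m. real (card (G i)) * real K.qq ^ (n - j i div e))" by simp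
    also have "\<dots> \<le> (\<Prod>i<m. real (card (G i)) * (real K.qq * (real L.qq ^ (?l - j i)) powr H))"
      by (intro prod_mono conjI mult_left_mono qq_power_le jl) auto
    also have "\<dots> = ((\<Prod>i<m. real (card (G i))) * real K.qq ^ m) * (\<Prod>i<m. (real L.qq ^ (?l - j i)) powr H)"
      by (simp add: prod.distrib)
    also have "(\<Prod>i<m. (real L.qq ^ (?l - j i)) powr H) = (\<Prod>i<m. real L.qq ^ (?l - j i)) powr H"
      by (rule prod_powr_distrib[symmetric])
    also have "(\<Prod>i<m. real L.qq ^ (?l - j i)) powr H \<le> (\<kappa> * real (L.cls m ?l P z)) powr H"
    proof (rule powr_mono2)
      have "(\<Prod>i<m. real L.qq ^ (?l - j i)) = (\<Prod>i<m. real L.qq ^ (?l - L.rho ?l (G i) (?I x0) (?I x0 i)))"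
        using x0(2) by (intro prod.cong refl) (auto simp: prof_def)
      also have "\<dots> \<le> \<kappa> * real (L.cls m ?l P z)"
        using low X(2)[OF x0(1)] unfolding L.low_bound_def by blast
      finally show "(\<Prod>i<m. real L.qq ^ (?l - j i)) \<le> \<kappa> * real (L.cls m ?l P z)" .
    qed (use H_pos in \<open>auto intro: prod_nonneg\<close>)
    finally show ?thesis by (simp add: mult_left_mono prod_nonneg)
  qed
  have "real (card X) = real (\<Sum>j\<in>PiE {..<m} (\<lambda>_. {..?l}). card {x \<in> X. prof x = j})"
    using sum.group[OF finX _ prof_in, of "\<lambda>_. 1 :: nat"] by (simp add: finite_PiE)
  also have "\<dots> = (\<Sum>j\<in>PiE {..<m} (\<lambda>_. {..?l}). real (card {x \<in> X. prof x = j}))" by simp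
  also have "\<dots> \<le> (\<Sum>j\<in>PiE {..<m} (\<lambda>_. {..?l}). ?bound)" by (intro sum_mono each)
  also have "\<dots> = (real ?l + 1) ^ m * ?bound" by (simp add: card_PiE add.commute)
  finally show ?thesis by (simp only: mult.assoc)
qed

lemma counted_comparison:
  assumes P: "K.counted m P NK" and Q: "L.counted m Q NL" and low: "L.low_bound m Q \<kappa> G"
    and PQ: "\<And>x n z. P x (case_nat (int n) z) \<Longrightarrow> Q (\<lambda>i. \<iota> (x i)) (case_nat (int (e * n)) z)"
  obtains C where "0 \<le> C" "\<And>n. real (NK n) \<le> C * (real (e * n) + 1) ^ m * real (NL (e * n)) powr H"
proof
  define C where "C = (\<Prod>i<m. real (card (G i))) * real K.qq ^ m * \<kappa> powr H"
  show "0 \<le> C" by (simp add: C_def prod_nonneg)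
  fix n
  let ?z = "\<lambda>_ :: nat. 0 :: int"
  have \<kappa>: "0 < \<kappa>" using low by (simp add: L.low_bound_def)
  have "real (NK n) = real (card {x \<in> PiE {..<m} (\<lambda>_. K.E n). P x (case_nat (int n) ?z)})"
    using K.counted_cnt[OF P, of n n ?z] by (simp add: K.cnt_def)
  also have "\<dots> \<le> (real (e * n) + 1) ^ m * ((\<Prod>i<m. real (card (G i))) * real K.qq ^ m) *
     (\<kappa> * real (L.cls m (e * n) Q (case_nat (int (e * n)) ?z))) powr H"
    by (rule comparison[OF low]) (use PQ in auto)
  also have "L.cls m (e * n) Q (case_nat (int (e * n)) ?z) = NL (e * n)"
    using Q unfolding L.counted_def by metis
  finally show "real (NK n) \<le> C * (real (e * n) + 1) ^ m * real (NL (e * n)) powr H"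
    using \<kappa> by (simp add: C_def powr_mult mult_ac)
qed

lemma tilde_transfer:
  "K.tilde_pred m fs x (case_nat (int n) z) \<Longrightarrow>
    L.tilde_pred m (map (base_change \<iota>) fs) (\<lambda>i. \<iota> (x i)) (case_nat (int (e * n)) z)"
  using \<iota>_ball[of _ "int n"] by (auto simp: K.tilde_pred_def L.tilde_pred_def mpeval_base_change \<iota>_ball_0)

lemma lift_transfer:
  assumes "K.lift_pred m fs x (case_nat (int n) z)"
  shows "L.lift_pred m (map (base_change \<iota>) fs) (\<lambda>i. \<iota> (x i)) (case_nat (int (e * n)) z)"
proof -
  obtain y where y: "\<And>i. i < m \<Longrightarrow> y i \<in> K.B 0" "\<And>i. i < m \<Longrightarrow> x i - y i \<in> K.B (int n)"
      "\<And>f. f \<in> set fs \<Longrightarrow> mpeval f y = 0" using assms by (auto simp: K.lift_pred_def)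
  have "\<iota> (x i) - \<iota> (y i) \<in> L.B (int (e * n))" if "i < m" for i
    using \<iota>_ball[OF y(2)[OF that]] by (simp add: \<iota>_diff)
  moreover have "mpeval (base_change \<iota> f) (\<lambda>i. \<iota> (y i)) = 0" if "f \<in> set fs" for f
    using y(3)[OF that] by (simp add: mpeval_base_change \<iota>_zero)
  ultimately show ?thesis
    unfolding L.lift_pred_def using assms y(1)
    by (intro conjI exI[of _ "\<lambda>i. \<iota> (y i)"]) (auto simp: K.lift_pred_def \<iota>_ball_0)
qed

end

section \<open>Poles and radii of convergence\<close>

lemma fps_eq_divide_iff:
  fixes F :: "complex fps"
  assumes "poly b 0 \<noteq> 0"
  shows "F = fps_of_poly a / fps_of_poly b \<longleftrightarrow> F * fps_of_poly b = fps_of_poly a"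
proof -
  have b: "fps_nth (fps_of_poly b) 0 \<noteq> 0" using assms by (simp add: poly_0_coeff_0)
  then have nz: "fps_of_poly b \<noteq> 0" by auto
  have "fps_of_poly a / fps_of_poly b * fps_of_poly b = fps_of_poly a"
    by (simp only: fps_divide_unit[OF b] mult.assoc inverse_mult_eq_1[OF b] mult_1_right)
  then show ?thesis using nz mult_right_cancel by metis
qed

text \<open>The selected fraction may have common factors; all that is known is that it represents
  the series. The selection is the same for every q.\<close>

lemma rat_fps_at_qs_cases:
  assumes "rational F"
  obtains a b where "poly b 0 \<noteq> 0" "F * fps_of_poly b = fps_of_poly a"
    "\<forall>q. rat_fps_at_qs F q = (\<lambda>s. poly a (of_nat q powr (- s)) / poly b (of_nat q powr (- s)))"
proof -
  let ?Q = "\<lambda>p. poly (snd p) 0 \<noteq> 0 \<and> F = fps_of_poly (fst p) / fps_of_poly (snd p)"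
  obtain a0 b0 where "poly b0 0 \<noteq> 0" "F * fps_of_poly b0 = fps_of_poly a0"
    using assms unfolding rational_def by blast
  then have "?Q (a0, b0)" by (simp add: fps_eq_divide_iff)
  then have Q: "?Q (Eps ?Q)" by (rule someI)
  have "rat_fps_at_qs F q = (\<lambda>s. poly (fst (Eps ?Q)) (of_nat q powr (- s)) / poly (snd (Eps ?Q)) (of_nat q powr (- s)))" for q
    unfolding rat_fps_at_qs_def by (simp add: case_prod_unfold Let_def)
  then have "\<forall>q. rat_fps_at_qs F q = (\<lambda>s. poly (fst (Eps ?Q)) (of_nat q powr (- s)) / poly (snd (Eps ?Q)) (of_nat q powr (- s)))" by blast
  then show ?thesis by (rule that[OF Q[THEN conjunct1] fps_eq_divide_iff[OF Q[THEN conjunct1], THEN iffD1, OF Q[THEN conjunct2]]])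
qed

text \<open>A denominator of least degree shares no root with its numerator, since a common linear
  factor could be cancelled. This fraction reveals the poles.\<close>

lemma rational_reduced:
  assumes "rational F"
  obtains a b where "poly b 0 \<noteq> 0" "F * fps_of_poly b = fps_of_poly a" "\<forall>t. poly b t = 0 \<longrightarrow> poly a t \<noteq> 0"
proof -
  let ?P = "\<lambda>p. poly (snd p) 0 \<noteq> 0 \<and> F * fps_of_poly (snd p) = fps_of_poly (fst p)"
  obtain a0 b0 where "?P (a0, b0)" using assms unfolding rational_def by auto
  then obtain p where p: "?P p" "\<And>p'. ?P p' \<Longrightarrow> degree (snd p) \<le> degree (snd p')"
    using ex_has_least_nat[of ?P "(a0, b0)" "\<lambda>p. degree (snd p)"] by blast
  have "poly (fst p) t \<noteq> 0" if t: "poly (snd p) t = 0" for t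
  proof
    assume "poly (fst p) t = 0"
    then obtain a b where ab: "fst p = [:- t, 1:] * a" "snd p = [:- t, 1:] * b"
      using t by (auto simp: poly_eq_0_iff_dvd elim!: dvdE)
    have nz: "poly b 0 \<noteq> 0" using p(1) ab(2) by auto
    have "fps_of_poly [:- t, 1:] * (F * fps_of_poly b) = fps_of_poly [:- t, 1:] * fps_of_poly a"
      using p(1) unfolding ab fps_of_poly_mult by (simp add: mult_ac)
    moreover have "fps_of_poly [:- t, 1:] \<noteq> 0"
      by (subst fps_of_poly_eq_iff[of _ 0, unfolded fps_of_poly_0]) simp
    ultimately have "F * fps_of_poly b = fps_of_poly a" by simp
    then have "degree (snd p) \<le> degree b" using p(2)[of "(a, b)"] nz by simp
    moreover have "degree (snd p) = Suc (degree b)"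
      unfolding ab(2) using nz by (subst degree_mult_eq) auto
    ultimately show False by simp
  qed
  then show ?thesis using p(1) that by blast
qed

lemma norm_nat_powr: "0 < q \<Longrightarrow> norm (of_nat q powr s :: complex) = real q powr Re s"
  using norm_powr_real_powr[of "of_nat q" s] by simp

lemma nat_powr_exp: "0 < q \<Longrightarrow> (of_nat q :: complex) powr s = exp (s * of_real (ln (real q)))"
  by (simp add: powr_def Ln_of_nat)

text \<open>Where the power series converges, its values bound the function nearby, which excludes a
  pole.\<close>

lemma pole_outside_disc:
  assumes F: "rational F" and q: "1 < q" and pole: "is_pole (rat_fps_at_qs F q) s"
  shows "fps_conv_radius F \<le> ereal (real q powr (- Re s))"
proof (rule ccontr)
  assume "\<not> ?thesis"
  then have rad: "ereal (real q powr (- Re s)) < fps_conv_radius F" by simp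
  obtain a b where ab: "poly b 0 \<noteq> 0" "F * fps_of_poly b = fps_of_poly a"
    "\<forall>q. rat_fps_at_qs F q = (\<lambda>s. poly a (of_nat q powr (- s)) / poly b (of_nat q powr (- s)))"
    by (rule rat_fps_at_qs_cases[OF F])
  let ?T = "\<lambda>s. of_nat q powr (- s) :: complex"
  let ?f = "\<lambda>s. poly a (?T s) / poly b (?T s)"
  let ?h = "\<lambda>s. eval_fps F (?T s)"
  have q0: "0 < q" using q by simp
  have T: "isCont ?T s" unfolding nat_powr_exp[OF q0] by (intro continuous_intros)
  have norm_T: "norm (?T s) = real q powr (- Re s)" for s using q by (simp add: norm_nat_powr)
  have "isCont ?h s"
    by (rule isCont_o2[OF T], rule continuous_eval_fps) (use rad in \<open>simp add: norm_T\<close>)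
  then have "(?h \<longlongrightarrow> ?h s) (at s)" by (simp add: isCont_def)
  then have "eventually (\<lambda>s'. norm (?h s') < norm (?h s) + 1) (at s)"
    by (intro order_tendstoD(2)[OF tendsto_norm]) auto
  moreover have "eventually (\<lambda>s'. norm (?f s') \<ge> norm (?h s) + 1) (at s)"
  proof -
    have "0 < norm (?h s) + 1" by (simp add: add_nonneg_pos)
    then show ?thesis using pole filterlim_at_infinity[of 0 ?f "at s"] by (simp add: is_pole_def ab(3)[rule_format])
  qed
  moreover have "eventually (\<lambda>s'. norm (?f s') \<le> norm (?h s')) (at s)"
  proof -
    have "((\<lambda>s. ereal (norm (?T s))) \<longlongrightarrow> ereal (norm (?T s))) (at s)"
      using T unfolding isCont_def by (intro tendsto_ereal tendsto_norm)
    then have "eventually (\<lambda>s'. ereal (norm (?T s')) < fps_conv_radius F) (at s)"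
      using rad by (intro order_tendstoD(2)) (simp_all only: norm_T)
    then show ?thesis
    proof eventually_elim
      case (elim s')
      have "eval_fps (F * fps_of_poly b) (?T s') = ?h s' * poly b (?T s')"
        using elim by (subst eval_fps_mult) auto
      then have "?h s' * poly b (?T s') = poly a (?T s')" by (simp add: ab(2))
      \<comment> \<open>Where the selected denominator vanishes the quotient is 0 by convention;
        only an inequality is claimed, and it holds there as well.\<close>
      then show ?case by (cases "poly b (?T s') = 0") (auto simp: eq_divide_imp[symmetric])
    qed
  qed
  ultimately have "eventually (\<lambda>s'. False) (at s)" by eventually_elim linarith
  then show False by simp
qed

text \<open>The map from s to q^(-s) has period 2 pi i / ln q and is injective near
  \<open>s0\<close>, while a nonzero polynomial has finitely many roots. Hence the zeros in s are
  isolated.\<close>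

lemma eventually_poly_nat_powr:
  assumes q: "1 < q" and p: "p \<noteq> (0 :: complex poly)"
  shows "eventually (\<lambda>s. poly p (of_nat q powr (- s)) \<noteq> 0) (at s0)"
proof -
  let ?T = "\<lambda>s. of_nat q powr (- s) :: complex"
  let ?L = "ln (real q)"
  have q0: "0 < q" and L: "0 < ?L" using q by simp_all
  have T: "isCont ?T s0" unfolding nat_powr_exp[OF q0] by (intro continuous_intros)
  have "eventually (\<lambda>s. norm (s - s0) < 2 * pi / ?L) (at s0)"
    using L by (intro eventually_at_ball'[THEN eventually_mono, of "2 * pi / ?L"]) (auto simp: dist_norm norm_minus_commute)
  moreover have "eventually (\<lambda>s. s \<noteq> s0) (at s0)" by (simp add: eventually_at_filter)
  ultimately have "eventually (\<lambda>s. ?T s \<noteq> ?T s0) (at s0)"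
  proof eventually_elim
    case (elim s)
    show ?case
    proof
      assume eq: "?T s = ?T s0"
      have "\<bar>Im (- s * of_real ?L) - Im (- s0 * of_real ?L)\<bar> = \<bar>Im (s - s0)\<bar> * ?L"
      proof -
        have "Im (- s * of_real ?L) - Im (- s0 * of_real ?L) = - (Im (s - s0) * ?L)" by (simp add: algebra_simps)
        then show ?thesis using L by (simp only: abs_minus_cancel abs_mult abs_of_pos)
      qed
      also have "\<dots> \<le> norm (s - s0) * ?L" using L abs_Im_le_cmod[of "s - s0"] by (intro mult_right_mono) auto
      also have "\<dots> < 2 * pi" using elim(1) L by (simp add: field_simps)
      finally have "\<bar>Im (- s * of_real ?L) - Im (- s0 * of_real ?L)\<bar> < 2 * pi" .
      moreover have "exp (- s * of_real ?L) = exp (- s0 * of_real ?L :: complex)"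
        using eq by (simp only: nat_powr_exp[OF q0])
      ultimately have "- s * of_real ?L = - s0 * of_real ?L" by (rule exp_complex_eqI)
      then show False using elim(2) L by simp
    qed
  qed
  then have "filterlim ?T (at (?T s0)) (at s0)"
    using T by (simp add: filterlim_at isCont_def)
  moreover have "eventually (\<lambda>t. poly p t \<noteq> 0) (at (?T s0))"
  proof -
    have fin: "finite ({t. poly p t = 0} - {?T s0})" using poly_roots_finite[OF p] by simp
    have "eventually (\<lambda>t. t \<in> - ({t. poly p t = 0} - {?T s0})) (at (?T s0))"
      using finite_imp_closed[OF fin] by (intro eventually_at_in_open' open_Compl) auto
    moreover have "eventually (\<lambda>t. t \<noteq> ?T s0) (at (?T s0))" by (simp add: eventually_at_filter)
    ultimately show ?thesis by eventually_elim auto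
  qed
  ultimately show ?thesis unfolding filterlim_iff by blast
qed

text \<open>A root of the reduced denominator is nonzero, hence of the form q^(-s), and this s is a
  pole because the numerator does not vanish there. The bound on the real parts thus excludes roots
  from the disc, on which the quotient then has a convergent expansion.\<close>

lemma conv_radius_ge_of_poles:
  assumes F: "rational F" and q: "1 < q" and poles: "\<And>s. is_pole (rat_fps_at_qs F q) s \<Longrightarrow> Re s < \<sigma>"
  shows "ereal (real q powr (- \<sigma>)) \<le> fps_conv_radius F"
proof -
  obtain a b where ab: "poly b 0 \<noteq> 0" "F * fps_of_poly b = fps_of_poly a"
    "\<forall>q. rat_fps_at_qs F q = (\<lambda>s. poly a (of_nat q powr (- s)) / poly b (of_nat q powr (- s)))"
    by (rule rat_fps_at_qs_cases[OF F])
  obtain a' b' where d: "poly b' 0 \<noteq> 0" "F * fps_of_poly b' = fps_of_poly a'" "\<forall>t. poly b' t = 0 \<longrightarrow> poly a' t \<noteq> 0"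
    by (rule rational_reduced[OF F])
  let ?T = "\<lambda>s. of_nat q powr (- s) :: complex"
  let ?L = "ln (real q)"
  have q0: "0 < q" and L: "0 < ?L" using q by simp_all
  have nz: "b \<noteq> 0" "b' \<noteq> 0" using ab(1) d(1) by auto
  have "fps_of_poly (a * b') = fps_of_poly (a' * b)"
    by (simp add: fps_of_poly_mult mult_ac flip: ab(2) d(2))
  then have cross: "a * b' = a' * b" by (simp only: fps_of_poly_eq_iff)
  have eq: "poly a t / poly b t = poly a' t / poly b' t" if "poly b t \<noteq> 0" "poly b' t \<noteq> 0" for t
    using that arg_cong[OF cross, of "\<lambda>p. poly p t"] by (simp add: frac_eq_eq)
  have root: "poly b' t \<noteq> 0" if t: "norm t < real q powr (- \<sigma>)" for t
  proof
    assume 0: "poly b' t = 0"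
    then have "t \<noteq> 0" using d(1) by auto
    define s where "s = - Ln t / of_real ?L"
    have Ts: "?T s = t" unfolding nat_powr_exp[OF q0] s_def using L \<open>t \<noteq> 0\<close> by simp
    have "real q powr (- Re s) < real q powr (- \<sigma>)" using t norm_nat_powr[OF q0, of "- s"] by (simp add: Ts)
    then have "\<sigma> < Re s" using q by (simp add: powr_less_cancel_iff)
    have cont: "isCont (\<lambda>s. poly p (?T s)) s" for p
      unfolding nat_powr_exp[OF q0] by (intro continuous_intros)
    have "filterlim (\<lambda>s. poly b' (?T s)) (at 0) (at s)"
      using cont[of b'] eventually_poly_nat_powr[OF q nz(2), of s] by (simp add: filterlim_at isCont_def Ts 0)
    then have "is_pole (\<lambda>s. poly a' (?T s) / poly b' (?T s)) s"
      by (intro is_pole_divide cont) (simp_all add: Ts d(3)[rule_format, OF 0])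
    moreover have "eventually (\<lambda>s. poly a' (?T s) / poly b' (?T s) = rat_fps_at_qs F q s) (at s)"
      using eventually_poly_nat_powr[OF q nz(1)] eventually_poly_nat_powr[OF q nz(2)]
      by eventually_elim (simp add: ab(3)[rule_format] eq)
    ultimately have "is_pole (rat_fps_at_qs F q) s" by (rule is_pole_transform) simp
    then show False using poles \<open>\<sigma> < Re s\<close> by fastforce
  qed
  have "Min {ereal (real q powr (- \<sigma>)), fps_conv_radius (fps_of_poly a'), fps_conv_radius (fps_of_poly b')}
     \<le> fps_conv_radius (fps_of_poly a' / fps_of_poly b')"
    by (rule fps_conv_radius_divide') (use root q in auto)
  moreover have "F = fps_of_poly a' / fps_of_poly b'" using d(1,2) by (simp add: fps_eq_divide_iff)
  ultimately show ?thesis by simp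
qed

lemma summable_poly_geometric:
  fixes w :: real
  assumes "0 < w" "w < 1"
  shows "summable (\<lambda>n. (real (e * n) + 1) ^ m * w ^ n)"
proof (rule summable_comparison_test)
  have "summable (\<lambda>n. of_nat n ^ m * w ^ n)" using assms by (intro summable_power_times_geometric) auto
  then show "summable (\<lambda>n. (real e + 1) ^ m * (of_nat n ^ m * w ^ n))" by (rule summable_mult)
  show "\<exists>N. \<forall>n\<ge>N. norm ((real (e * n) + 1) ^ m * w ^ n) \<le> (real e + 1) ^ m * (of_nat n ^ m * w ^ n)"
  proof (intro exI[of _ 1] allI impI)
    fix n :: nat assume "1 \<le> n"
    then have "real (e * n) + 1 \<le> (real e + 1) * real n" by (simp add: algebra_simps)
    then have "(real (e * n) + 1) ^ m \<le> ((real e + 1) * real n) ^ m" by (intro power_mono) auto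
    then have "(real (e * n) + 1) ^ m * w ^ n \<le> ((real e + 1) * real n) ^ m * w ^ n"
      using assms by (intro mult_right_mono) auto
    then show "norm ((real (e * n) + 1) ^ m * w ^ n) \<le> (real e + 1) ^ m * (of_nat n ^ m * w ^ n)"
      using assms by (simp add: power_mult_distrib mult.assoc)
  qed
qed

text \<open>Convergence at r bounds b_n by a constant times r^(-n), so a_n is bounded by a
  polynomial in n times the n-th power of \<open>r powr (- (e * h))\<close>. The room left between
  \<open>r0\<close> and r absorbs the polynomial factor.\<close>

lemma conv_radius_transfer:
  fixes a b :: "nat \<Rightarrow> real"
  assumes nonneg: "\<And>n. 0 \<le> a n" "\<And>n. 0 \<le> b n" and C: "0 \<le> C" and h: "0 < h" and e: "0 < e"
    and le: "\<And>n. a n \<le> C * (real (e * n) + 1) ^ m * b (e * n) powr h"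
    and \<rho>: "0 < \<rho>" and rad: "ereal \<rho> \<le> fps_conv_radius (Abs_fps (\<lambda>n. complex_of_real (b n)))"
  shows "ereal (\<rho> powr (real e * h)) \<le> fps_conv_radius (Abs_fps (\<lambda>n. complex_of_real (a n)))"
  unfolding fps_conv_radius_def
proof (rule conv_radius_geI_ex')
  fix r' :: real assume r': "0 < r'" "ereal r' < ereal (\<rho> powr (real e * h))"
  let ?k = "real e * h"
  have k: "0 < ?k" using e h by simp
  define r0 where "r0 = r' powr (1 / ?k)"
  have r0: "0 < r0" "r0 powr ?k = r'" using r' e h by (simp_all add: r0_def powr_powr)
  have "r0 < \<rho>"
  proof (rule ccontr)
    assume "\<not> r0 < \<rho>"
    then have "\<rho> powr ?k \<le> r0 powr ?k" using \<rho> k by (intro powr_mono2) auto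
    then show False using r' r0 by simp
  qed
  define r where "r = (r0 + \<rho>) / 2"
  have r: "0 < r" "r0 < r" "r < \<rho>" using \<open>r0 < \<rho>\<close> r0 by (simp_all add: r_def)
  define w where "w = r' / r powr ?k"
  have "r0 powr ?k < r powr ?k" using r r0 k by (intro powr_less_mono2) auto
  then have w: "0 < w" "w < 1" using r' r0 r by (simp_all add: w_def)
  have "norm (complex_of_real r) < fps_conv_radius (Abs_fps (\<lambda>n. complex_of_real (b n)))"
    using r rad by (simp add: less_le_trans[of _ "ereal \<rho>"])
  then have "summable (\<lambda>n. complex_of_real (b n) * of_real r ^ n)"
    using summable_fps by fastforce
  then have "Bseq (\<lambda>n. complex_of_real (b n) * of_real r ^ n)"
    by (intro convergent_imp_Bseq) (auto dest: summable_LIMSEQ_zero simp: convergent_def)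
  then obtain M where M: "0 < M" "\<And>n. norm (complex_of_real (b n) * of_real r ^ n) \<le> M" by (auto simp: Bseq_def)
  have bM: "b n * r ^ n \<le> M" for n using M(2)[of n] nonneg(2)[of n] r by (simp add: norm_mult norm_power)
  show "summable (\<lambda>n. fps_nth (Abs_fps (\<lambda>n. complex_of_real (a n))) n * of_real r' ^ n)"
  proof (rule summable_comparison_test)
    show "summable (\<lambda>n. C * M powr h * ((real (e * n) + 1) ^ m * w ^ n))"
      by (intro summable_mult summable_poly_geometric w)
    show "\<exists>N. \<forall>n\<ge>N. norm (fps_nth (Abs_fps (\<lambda>n. complex_of_real (a n))) n * of_real r' ^ n) \<le>
       C * M powr h * ((real (e * n) + 1) ^ m * w ^ n)"
    proof (intro exI allI impI)
      fix n
      have "b (e * n) \<le> M / r ^ (e * n)" using bM[of "e * n"] r by (simp add: field_simps)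
      then have "b (e * n) powr h \<le> (M / r ^ (e * n)) powr h" using nonneg h by (intro powr_mono2) auto
      also have "\<dots> = M powr h / (r powr ?k) ^ n"
      proof -
        have "(r ^ (e * n)) powr h = (r powr ?k) ^ n"
          using r by (simp add: powr_powr mult_ac flip: powr_realpow)
        then show ?thesis using M r by (simp add: powr_divide)
      qed
      finally have b: "b (e * n) powr h \<le> M powr h / (r powr ?k) ^ n" .
      have "norm (fps_nth (Abs_fps (\<lambda>n. complex_of_real (a n))) n * of_real r' ^ n) = a n * r' ^ n"
        using nonneg r' by (simp add: norm_mult norm_power)
      also have "\<dots> \<le> (C * (real (e * n) + 1) ^ m * b (e * n) powr h) * r' ^ n"
        using r' by (intro mult_right_mono le) auto
      also have "\<dots> \<le> (C * (real (e * n) + 1) ^ m * (M powr h / (r powr ?k) ^ n)) * r' ^ n"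
        using r' C by (intro mult_right_mono mult_left_mono b) auto
      also have "\<dots> = C * M powr h * ((real (e * n) + 1) ^ m * w ^ n)"
        by (simp add: w_def power_divide)
      finally show "norm (fps_nth (Abs_fps (\<lambda>n. complex_of_real (a n))) n * of_real r' ^ n) \<le>
       C * M powr h * ((real (e * n) + 1) ^ m * w ^ n)" .
    qed
  qed
qed

lemma pole_lambda_le:
  fixes a b :: "nat \<Rightarrow> real"
  defines "F \<equiv> Abs_fps (\<lambda>n. complex_of_real (a n))" and "G \<equiv> Abs_fps (\<lambda>n. complex_of_real (b n))"
  assumes rat: "rational F" "rational G" and nonneg: "\<And>n. 0 \<le> a n" "\<And>n. 0 \<le> b n"
    and C: "0 \<le> C" and h: "0 < h" and e: "0 < e"
    and le: "\<And>n. a n \<le> C * (real (e * n) + 1) ^ m * b (e * n) powr h"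
    and q: "1 < q" "1 < q'" "\<And>x. real q' powr (x * h) = real q powr (x / real e)"
  shows "pole_lambda (rat_fps_at_qs G q') \<le> pole_lambda (rat_fps_at_qs F q)"
proof -
  let ?PF = "{s. is_pole (rat_fps_at_qs F q) s}" and ?PG = "{s. is_pole (rat_fps_at_qs G q') s}"
  \<comment> \<open>Without a pole of G of real part at least \<open>\<sigma>\<close> the series G
    converges on the corresponding disc, the estimate carries a disc over to F, and s cannot be a
    pole. Values \<open>\<sigma>\<close> strictly below \<open>Re s\<close> suffice to compare
    suprema, and any one of them shows that G has a pole at all.\<close>
  have key: "\<exists>s'\<in>?PG. \<sigma> \<le> Re s'" if s: "s \<in> ?PF" and \<sigma>: "\<sigma> < Re s" for s \<sigma>
  proof (rule ccontr)
    assume "\<not> (\<exists>s'\<in>?PG. \<sigma> \<le> Re s')"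
    then have "ereal (real q' powr (- \<sigma>)) \<le> fps_conv_radius G"
      by (intro conv_radius_ge_of_poles rat q) auto
    then have "ereal ((real q' powr (- \<sigma>)) powr (real e * h)) \<le> fps_conv_radius F"
      unfolding F_def G_def by (intro conv_radius_transfer[OF nonneg C h e le]) (use q in auto)
    also have "(real q' powr (- \<sigma>)) powr (real e * h) = real q powr (- \<sigma>)"
      using q(3)[of "- \<sigma> * real e"] e by (simp add: powr_powr mult_ac)
    also have "fps_conv_radius F \<le> ereal (real q powr (- Re s))"
      using s by (intro pole_outside_disc rat q) simp
    finally show False using \<sigma> q(1) by simp
  qed
  show ?thesis
  proof (cases "?PF = {}")
    case True
    then show ?thesis by (simp add: pole_lambda_def)
  next
    case False
    then obtain s where s: "s \<in> ?PF" by blast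
    have PG: "?PG \<noteq> {}" using key[OF s, of "Re s - 1"] by auto
    have "(SUP s\<in>?PF. ereal (Re s)) \<le> (SUP s\<in>?PG. ereal (Re s))"
    proof (rule SUP_least)
      fix s assume s: "s \<in> ?PF"
      show "ereal (Re s) \<le> (SUP s\<in>?PG. ereal (Re s))"
      proof (rule ereal_le_real)
        fix x :: real assume x: "(SUP s\<in>?PG. ereal (Re s)) \<le> ereal x"
        show "ereal (Re s) \<le> ereal x"
        proof (rule ccontr)
          assume "\<not> ?thesis"
          then have "(x + Re s) / 2 < Re s" "x < (x + Re s) / 2" by simp_all
          then obtain s' where s': "s' \<in> ?PG" "x < Re s'" using key[OF s, of "(x + Re s) / 2"] by fastforce
          then have "ereal (Re s') \<le> (SUP s\<in>?PG. ereal (Re s))" by (intro SUP_upper)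
          then show False using x s'(2) order_trans by fastforce
        qed
      qed
    qed
    then show ?thesis unfolding pole_lambda_def by (simp only: False PG if_False ereal_minus_le_minus)
  qed
qed

section \<open>The inequality for both series\<close>

context extension
begin

text \<open>The normalizations match exactly, because the H-th power of
  \<open>L.qq ^ (e * n * \<mu>)\<close> is \<open>K.qq ^ (n * \<mu>)\<close>. The comparison of
  counts is therefore one of coefficients, for both values of \<open>\<mu>\<close>.\<close>

lemma pole_lambda_counted:
  assumes P: "K.counted m P NK" and Q: "L.counted m Q NL"
    and vol: "K.has_vol m P \<phi>" "L.has_vol m Q \<psi>" and low: "L.low_bound m Q \<kappa> G"
    and PQ: "\<And>x n z. P x (case_nat (int n) z) \<Longrightarrow> Q (\<lambda>i. \<iota> (x i)) (case_nat (int (e * n)) z)"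
    and \<mu>: "\<mu> = m \<or> \<mu> = m + 1"
  shows "pole_lambda (rat_fps_at_qs (Abs_fps (\<lambda>n. of_nat (NL n) / of_nat L.qq ^ (n * \<mu>))) L.qq)
    \<le> pole_lambda (rat_fps_at_qs (Abs_fps (\<lambda>n. of_nat (NK n) / of_nat K.qq ^ (n * \<mu>))) K.qq)"
proof -
  obtain C where C: "0 \<le> C" "\<And>n. real (NK n) \<le> C * (real (e * n) + 1) ^ m * real (NL (e * n)) powr H"
    using counted_comparison[OF P Q low PQ] by blast
  let ?a = "\<lambda>n. real (NK n) / real K.qq ^ (n * \<mu>)" and ?b = "\<lambda>n. real (NL n) / real L.qq ^ (n * \<mu>)"
  have K: "Abs_fps (\<lambda>n. of_nat (NK n) / of_nat K.qq ^ (n * \<mu>)) = Abs_fps (\<lambda>n. complex_of_real (?a n))"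
    and L: "Abs_fps (\<lambda>n. of_nat (NL n) / of_nat L.qq ^ (n * \<mu>)) = Abs_fps (\<lambda>n. complex_of_real (?b n))" by simp_all
  have rat: "rational (Abs_fps (\<lambda>n. complex_of_real (?a n)))" "rational (Abs_fps (\<lambda>n. complex_of_real (?b n)))"
    unfolding K[symmetric] L[symmetric]
    using \<mu> K.counted_rational[OF P vol(1)] L.counted_rational[OF Q vol(2)] by auto
  have le: "?a n \<le> C * (real (e * n) + 1) ^ m * ?b (e * n) powr H" for n
  proof -
    have "(real L.qq ^ (e * n * \<mu>)) powr H = real L.qq powr (real (e * n * \<mu>) * H)"
      using L.qq_real by (simp add: powr_powr flip: powr_realpow)
    also have "\<dots> = real K.qq powr real (n * \<mu>)" unfolding powr_H using e_pos by simp
    also have "\<dots> = real K.qq ^ (n * \<mu>)" using K.qq_real by (intro powr_realpow) simp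
    finally have "?b (e * n) powr H = real (NL (e * n)) powr H / real K.qq ^ (n * \<mu>)"
      using L.qq_real by (simp add: powr_divide)
    then show ?thesis using C(2)[of n] by (simp add: divide_right_mono)
  qed
  show ?thesis unfolding K L
    by (rule pole_lambda_le[OF rat _ _ C(1) H_pos e_pos le])
      (use K.qq_ge_2 L.qq_ge_2 powr_H in auto)
qed

lemma lambda_le:
  assumes fs: "\<And>f. f \<in> set fs \<Longrightarrow> integral_poly vK m f"
  shows "lambda_serre vL m (map (base_change \<iota>) fs) \<le> lambda_serre vK m fs"
    and "lambda_tilde vL m (map (base_change \<iota>) fs) \<le> lambda_tilde vK m fs"
proof -
  let ?gs = "map (base_change \<iota>) fs"
  have gs: "\<And>g. g \<in> set ?gs \<Longrightarrow> integral_poly vL m g" using fs integral_base_change by auto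
  obtain DK RK where "chain vK DK RK" using K.ex_chain by blast
  then interpret CK: chain vK DK RK .
  obtain DL RL where "chain vL DL RL" using L.ex_chain by blast
  then interpret CL: chain vL DL RL .
  have int: "\<And>x z i. K.lift_pred m fs x z \<Longrightarrow> i < m \<Longrightarrow> x i \<in> K.B 0"
    "\<And>x z i. L.lift_pred m ?gs x z \<Longrightarrow> i < m \<Longrightarrow> x i \<in> L.B 0"
    "\<And>x z i. K.tilde_pred m fs x z \<Longrightarrow> i < m \<Longrightarrow> x i \<in> K.B 0"
    "\<And>x z i. L.tilde_pred m ?gs x z \<Longrightarrow> i < m \<Longrightarrow> x i \<in> L.B 0"
    by (simp_all add: K.lift_pred_def L.lift_pred_def K.tilde_pred_def L.tilde_pred_def)
  have D1: "K.lift_pred m fs \<in> DK m" "L.lift_pred m ?gs \<in> DL m"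
    by (rule CK.lift_definable, rule fs, assumption) (rule CL.lift_definable, rule gs)
  have "\<exists>\<phi>. K.has_vol m (K.lift_pred m fs) \<phi>" by (rule CK.chain_has_vol[OF D1(1)], erule (1) int(1))
  then obtain \<phi>1 where vK1: "K.has_vol m (K.lift_pred m fs) \<phi>1" ..
  have "\<exists>\<phi>. L.has_vol m (L.lift_pred m ?gs) \<phi>" by (rule CL.chain_has_vol[OF D1(2)], erule (1) int(2))
  then obtain \<psi>1 where vL1: "L.has_vol m (L.lift_pred m ?gs) \<psi>1" ..
  have "\<exists>\<kappa> G. L.low_bound m (L.lift_pred m ?gs) \<kappa> G" by (rule CL.chain_low_bound[OF D1(2)], erule (1) int(2))
  then obtain \<kappa>1 G1 where low1: "L.low_bound m (L.lift_pred m ?gs) \<kappa>1 G1" by (elim exE)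
  have D2: "K.tilde_pred m fs \<in> DK m" "L.tilde_pred m ?gs \<in> DL m"
    by (rule CK.tilde_definable, rule fs, assumption) (rule CL.tilde_definable, rule gs)
  have "\<exists>\<phi>. K.has_vol m (K.tilde_pred m fs) \<phi>" by (rule CK.chain_has_vol[OF D2(1)], erule (1) int(3))
  then obtain \<phi>2 where vK2: "K.has_vol m (K.tilde_pred m fs) \<phi>2" ..
  have "\<exists>\<phi>. L.has_vol m (L.tilde_pred m ?gs) \<phi>" by (rule CL.chain_has_vol[OF D2(2)], erule (1) int(4))
  then obtain \<psi>2 where vL2: "L.has_vol m (L.tilde_pred m ?gs) \<psi>2" ..
  have "\<exists>\<kappa> G. L.low_bound m (L.tilde_pred m ?gs) \<kappa> G" by (rule CL.chain_low_bound[OF D2(2)], erule (1) int(4))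
  then obtain \<kappa>2 G2 where low2: "L.low_bound m (L.tilde_pred m ?gs) \<kappa>2 G2" by (elim exE)
  have counted: "K.counted m (K.lift_pred m fs) (Nlift vK m fs)" "L.counted m (L.lift_pred m ?gs) (Nlift vL m ?gs)"
    "K.counted m (K.tilde_pred m fs) (Ntilde vK m fs)" "L.counted m (L.tilde_pred m ?gs) (Ntilde vL m ?gs)"
    using fs gs by (blast intro: K.lift_counted L.lift_counted K.tilde_counted L.tilde_counted)+
  show "lambda_serre vL m ?gs \<le> lambda_serre vK m fs"
    unfolding lambda_serre_def serre_poincare_def
    by (rule pole_lambda_counted[OF counted(1,2) vK1 vL1 low1]) (rule lift_transfer, simp_all)
  show "lambda_tilde vL m ?gs \<le> lambda_tilde vK m fs"
    unfolding lambda_tilde_def poincare_tilde_def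
    by (rule pole_lambda_counted[OF counted(3,4) vK2 vL2 low2]) (rule tilde_transfer, simp_all)
qed

end

lemma finite_ext_extension:
  assumes "local_field_char0 vK" "local_field_char0 vL" "finite_ext vK vL \<iota>"
  shows "\<exists>e. extension vK vL \<iota> e"
proof -
  obtain e :: int where e: "0 < e" "\<And>x. x \<noteq> 0 \<Longrightarrow> vL (\<iota> x) = e * vK x"
    using assms(3) by (auto simp: finite_ext_def)
  have "extension vK vL \<iota> (nat e)"
    by unfold_locales (use assms e in \<open>auto simp: finite_ext_def\<close>)
  then show ?thesis by blast
qed

theorem theorem7p13:
  fixes v0 :: "'a::field_char_0 \<Rightarrow> int" and vK :: "'b::field_char_0 \<Rightarrow> int"
    and vL :: "'c::field_char_0 \<Rightarrow> int"
    and \<iota>K :: "'a \<Rightarrow> 'b" and \<iota>L :: "'b \<Rightarrow> 'c"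
    and m :: nat and fs :: "'a mpoly list"
  assumes "local_field_char0 v0" and "local_field_char0 vK" and "local_field_char0 vL"
    and "finite_ext v0 vK \<iota>K" and "finite_ext vK vL \<iota>L"
    and "\<forall>f\<in>set fs. integral_poly v0 m f"
  shows "lambda_serre vL m (map (base_change \<iota>L \<circ> base_change \<iota>K) fs)
           \<le> lambda_serre vK m (map (base_change \<iota>K) fs)
       \<and> lambda_tilde vL m (map (base_change \<iota>L \<circ> base_change \<iota>K) fs)
           \<le> lambda_tilde vK m (map (base_change \<iota>K) fs)"
proof -
  obtain e0 e where "extension v0 vK \<iota>K e0" "extension vK vL \<iota>L e"
    using finite_ext_extension assms by meson
  then interpret E0: extension v0 vK \<iota>K e0 + E: extension vK vL \<iota>L e by simp_all
  \<comment> \<open>The extension from the base field to K makes the polynomials integral over K;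
    the comparison itself takes place between K and L.\<close>
  have "integral_poly vK m f" if "f \<in> set (map (base_change \<iota>K) fs)" for f
    using that assms(6) E0.integral_base_change by auto
  note fs = this
  show ?thesis
    unfolding map_map[symmetric] by (rule conjI; rule E.lambda_le, rule fs)
qed

end
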